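(* Let $\mathscr C$ be an $E_\infty$ operad in simplicial sets and let $X$ be a cosimplicial $\mathscr C$-space. Then for all $s,s'\ge0$ the multiplication $\mu$ on $H(\operatorname{Tot}X)$ is compatible with the filtration in the sense that $$\mu(F^{-s}\otimes F^{-s'})\subseteq F^{-s-s'}.$$ Furthermore, $\mu$ descends to the filtration quotients, and $$\iota\circ\mu=\mu\circ(\iota\otimes\iota):\ (F^{-s}/F^{-s-1})H\operatorname{Tot}X\otimes(F^{-s'}/F^{-s'-1})H\operatorname{Tot}X\longrightarrow E^\infty_{-s-s'}(S_*(X)),$$ where on the left $\mu$ is the induced map to $(F^{-s-s'}/F^{-s-s'-1})H\operatorname{Tot}X$ and on the right $\mu:E^\infty_{-s}(S_*(X))\otimes E^\infty_{-s'}(S_*(X))\to E^\infty_{-s-s'}(S_*(X))$ is the multiplication in the spectral sequence.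
   Context: **Basics.** Work over $\mathbb K=\mathbb Z/2$, $\otimes=\otimes_{\mathbb K}$. "Space" means simplicial set. $\mathbb KZ$ is the (levelwise) free $\mathbb K$-module on a space $Z$. For a simplicial $\mathbb K$-module $A$, $N(A)$ is the normalized complex. $S_*(Z)=N(\mathbb KZ)$ and $H_*(Z)=H(S_*(Z))$. $\nabla:N(A)\otimes N(B)\to N(A\otimes B)$ is the shuffle map. **Spectral sequence.** For a cosimplicial chain complex $Y$, the conormalization is the second-quadrant bicomplex $C(Y)_{-p,q}=\operatorname{coker}(\bigoplus_{k=1}^p d^k:\bigoplus Y_q^{p-1}\to Y_q^p)$, horizontal differential induced by $d^0$. For a bicomplex $B$, $TB_m=\prod_jB_{j,m-j}$, $F^kTB_m=\prod_{j\le k}B_{j,m-j}$, $T_\ell B=TB/F^{-(\ell+1)}TB$. $E^r(Y)$ is the spectral sequence of the filtered complex $TC(Y)$; $E^\infty_{-s,t}(Y)$ is represented by cycles in $F^{-s}TC(Y)$ of total degree $t-s$, modulo cycles in $F^{-s-1}$ and boundaries lying in $F^{-s}$. $E^\infty_{-s}$ denotes the column $E^\infty_{-s,*}$. **Tot and abutment.** $\operatorname{Tot}X=\operatorname{map}(\Delta^\bullet,X)$: a $q$-simplex is a cosimplicial map $f:\Delta^\bullet\times\Delta^q\to X$; likewise for cosimplicial simplicial $\mathbb K$-modules. $f\mapsto\mathbb Kf$ defines $\mathbb K\operatorname{Tot}X\to\operatorname{Tot}\mathbb KX$. The quasi-isomorphism $\phi_\infty:N\operatorname{Tot}V\to TCNV$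 sends $f\in(\operatorname{Tot}V)_q$ to $\prod_kf^k(\nabla(\imath_k\otimes\imath_q))$, $\imath_k$ the fundamental simplex of $\Delta^k$. The filtration is $F^{-s}H(\operatorname{Tot}X)=\ker(H(\operatorname{Tot}X)\to H(TCN\mathbb KX)\to H(T_{s-1}CN\mathbb KX))$, where the first map is induced by $N\mathbb K\operatorname{Tot}X\to N\operatorname{Tot}\mathbb KX\xrightarrow{\phi_\infty}TCN\mathbb KX$. The abutment map $\iota:(F^{-s}/F^{-s-1})H\operatorname{Tot}X\hookrightarrow E^\infty_{-s}(S_*(X))$ sends a class to the $E^\infty$-class of a cycle in $F^{-s}TCN\mathbb KX$ representing its image in $H(TCN\mathbb KX)$. **Multiplications.** A cosimplicial $\mathscr C$-space is a cosimplicial object in $\mathscr C$-algebras in simplicial sets; $\operatorname{Tot}X$ is a $\mathscr C$-space via $\mathscr C(n)\times(\operatorname{Tot}X)^{\times n}\cong\operatorname{Tot}(c\,\mathscr C(n)\times X^{\times n})\to\operatorname{Tot}X$, where $c\,\mathscr C(n)$ is the constant cosimplicial space. Fix a vertex of $\mathscr C(2)$; since $\mathscr C(2)$ is contractible the multiplications below do not depend on the choice. The vertex gives a binary product $X\times X\to X$ of cosimplicial spaces and a binary product $\operatorname{Tot}X\times\operatorname{Tot}X\cong\operatorname{Tot}(X\times X)\to\operatorname{Tot}X$. The multiplication $\mu$ on $H\operatorname{Tot}X$ is the homology cross product followed by this binary product. The multiplication $\mu$ on $E^\infty$ is the external product $E^\infty_{-s}(S_*(X))\otimes E^\infty_{-s'}(S_*(X))\to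 E^\infty_{-s-s'}(S_*(X\times X))$ followed by the map induced by $X\times X\to X$. The external product is induced by the filtered chain maps $$TCN\mathbb KX\otimes TCN\mathbb KX\to T(CN\mathbb KX\otimes CN\mathbb KX)\xrightarrow{AW}TC(N\mathbb KX\otimes N\mathbb KX)\xrightarrow{\nabla}TCN(\mathbb KX\otimes\mathbb KX)=TCS_*(X\times X),$$ where $AW$ is the cosimplicial Alexander–Whitney map $AW(y^p\otimes z^q)=d^{p+q}\cdots d^{p+1}y^p\otimes d^{p-1}\cdots d^0z^q$ and tensor products of cosimplicial objects are levelwise.
   Formalization: The displayed Alexander–Whitney formula is not well defined on the cokernel description of C(Y); the external product on E^∞ is therefore evaluated on the representatives annihilated by all codegeneracies (one in each cokernel class). *)

theory Defs
  imports
    "HOL-Homology.Simplices"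
    "HOL-Library.Poly_Mapping"
    "HOL-Library.Function_Algebras"
    "HOL-Library.Set_Algebras"
    "HOL-Library.Z2"
    "HOL-Combinatorics.Permutations"
begin

section \<open>Simplicial sets and cosimplicial spaces\<close>

text \<open>
  A morphism \<open>\<theta> : [m] \<rightarrow> [n]\<close> of the simplex category is the list
  \<open>[\<theta> 0, \<dots>, \<theta> m]\<close>; the composite \<open>\<theta> \<circ> \<phi>\<close> is \<open>map ((!) \<theta>) \<phi>\<close>.
  A list determines its source but not its target, and the carriers of a simplicial set may
  overlap, so the actions below carry the degrees they need: for \<open>\<theta> : [m] \<rightarrow> [n]\<close>,
  \<open>sop X n \<theta> : X\<^sub>n \<rightarrow> X\<^sub>m\<close>, and for a cosimplicial space
  \<open>cop X n \<theta> q : X\<^sup>m\<^sub>q \<rightarrow> X\<^sup>n\<^sub>q\<close>.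
  Values of these functions outside the stated carriers are irrelevant.
\<close>

definition simplex_op :: "nat \<Rightarrow> nat \<Rightarrow> nat list \<Rightarrow> bool" where
  "simplex_op m n \<theta> \<longleftrightarrow> length \<theta> = Suc m \<and> sorted \<theta> \<and> set \<theta> \<subseteq> {..n}"

definition id_op :: "nat \<Rightarrow> nat list" where
  "id_op n = [0..<Suc n]"

text \<open>\<open>coface n i : [n - 1] \<rightarrow> [n]\<close> omits \<open>i\<close>; \<open>codegen n i : [n + 1] \<rightarrow> [n]\<close> repeats \<open>i\<close>.\<close>

definition coface :: "nat \<Rightarrow> nat \<Rightarrow> nat list" where
  "coface n i = [0..<i] @ [Suc i..<Suc n]"

definition codegen :: "nat \<Rightarrow> nat \<Rightarrow> nat list" where
  "codegen n i = [0..<Suc i] @ [i..<Suc n]"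

record 'a sset =
  smp :: "nat \<Rightarrow> 'a set"
  sop :: "nat \<Rightarrow> nat list \<Rightarrow> 'a \<Rightarrow> 'a"

definition simplicial_set :: "'a sset \<Rightarrow> bool" where
  "simplicial_set X \<longleftrightarrow>
     (\<forall>m n \<theta>. simplex_op m n \<theta> \<longrightarrow> sop X n \<theta> ` smp X n \<subseteq> smp X m) \<and>
     (\<forall>n. \<forall>x\<in>smp X n. sop X n (id_op n) x = x) \<and>
     (\<forall>l m n \<theta> \<phi>. simplex_op m n \<theta> \<and> simplex_op l m \<phi> \<longrightarrow>
        (\<forall>x\<in>smp X n. sop X n (map ((!) \<theta>) \<phi>) x = sop X m \<phi> (sop X n \<theta> x)))"

definition sprod :: "'a sset \<Rightarrow> 'b sset \<Rightarrow> ('a \<times> 'b) sset" where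
  "sprod X Y = \<lparr>smp = (\<lambda>q. smp X q \<times> smp Y q), sop = (\<lambda>n \<theta>. map_prod (sop X n \<theta>) (sop Y n \<theta>))\<rparr>"

definition std :: "nat \<Rightarrow> nat list sset" where
  "std n = \<lparr>smp = (\<lambda>m. {a. simplex_op m n a}), sop = (\<lambda>_ \<theta> a. map ((!) a) \<theta>)\<rparr>"

text \<open>The degeneracy in degree \<open>q\<close> of a vertex.\<close>

definition degen_vertex :: "'a sset \<Rightarrow> nat \<Rightarrow> 'a \<Rightarrow> 'a" where
  "degen_vertex X q v = sop X 0 (replicate (Suc q) 0) v"

record 'a csset =
  lev :: "nat \<Rightarrow> 'a sset"
  cop :: "nat \<Rightarrow> nat list \<Rightarrow> nat \<Rightarrow> 'a \<Rightarrow> 'a"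

definition cosimplicial_space :: "'a csset \<Rightarrow> bool" where
  "cosimplicial_space X \<longleftrightarrow>
     (\<forall>p. simplicial_set (lev X p)) \<and>
     (\<forall>m n \<theta> q. simplex_op m n \<theta> \<longrightarrow>
        cop X n \<theta> q ` smp (lev X m) q \<subseteq> smp (lev X n) q) \<and>
     (\<forall>m n \<theta> q r \<phi>. simplex_op m n \<theta> \<and> simplex_op r q \<phi> \<longrightarrow>
        (\<forall>x\<in>smp (lev X m) q.
           cop X n \<theta> r (sop (lev X m) q \<phi> x) = sop (lev X n) q \<phi> (cop X n \<theta> q x))) \<and>
     (\<forall>n q. \<forall>x\<in>smp (lev X n) q. cop X n (id_op n) q x = x) \<and>
     (\<forall>l m n \<theta> \<phi> q. simplex_op m n \<theta> \<and> simplex_op l m \<phi> \<longrightarrow>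
        (\<forall>x\<in>smp (lev X l) q. cop X n (map ((!) \<theta>) \<phi>) q x = cop X n \<theta> q (cop X m \<phi> q x)))"

definition csprod :: "'a csset \<Rightarrow> 'b csset \<Rightarrow> ('a \<times> 'b) csset" where
  "csprod X Y = \<lparr>lev = (\<lambda>p. sprod (lev X p) (lev Y p)),
                cop = (\<lambda>n \<theta> q. map_prod (cop X n \<theta> q) (cop Y n \<theta> q))\<rparr>"

definition csconst :: "'a sset \<Rightarrow> 'a csset" where
  "csconst Z = \<lparr>lev = (\<lambda>_. Z), cop = (\<lambda>_ _ _ z. z)\<rparr>"

definition csstd :: "nat list csset" where
  "csstd = \<lparr>lev = std, cop = (\<lambda>_ \<theta> _ a. map ((!) \<theta>) a)\<rparr>"

text \<open>A cosimplicial map \<open>Y \<rightarrow> X\<close>: \<open>f p q : Y\<^sup>p\<^sub>q \<rightarrow> X\<^sup>p\<^sub>q\<close>.\<close>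

definition cosimplicial_map :: "'b csset \<Rightarrow> 'a csset \<Rightarrow> (nat \<Rightarrow> nat \<Rightarrow> 'b \<Rightarrow> 'a) \<Rightarrow> bool" where
  "cosimplicial_map Y X f \<longleftrightarrow>
     (\<forall>p q. f p q ` smp (lev Y p) q \<subseteq> smp (lev X p) q) \<and>
     (\<forall>p q r \<phi>. simplex_op r q \<phi> \<longrightarrow>
        (\<forall>y\<in>smp (lev Y p) q. f p r (sop (lev Y p) q \<phi> y) = sop (lev X p) q \<phi> (f p q y))) \<and>
     (\<forall>m n q \<theta>. simplex_op m n \<theta> \<longrightarrow>
        (\<forall>y\<in>smp (lev Y m) q. f n q (cop Y n \<theta> q y) = cop X n \<theta> q (f m q y)))"

text \<open>
  \<open>prism k q\<close> is the set of all simplices, of all dimensions, of \<open>\<Delta>\<^sup>k \<times> \<Delta>\<^sup>q\<close>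
  (the dimension can be read off the lists).  A \<open>q\<close>-simplex of \<open>Tot X\<close> is a cosimplicial map
  \<open>\<Delta>\<^sup>\<bullet> \<times> \<Delta>\<^sup>q \<rightarrow> X\<close>; to be determined by the map it encodes, the representing function takes a
  fixed value \<open>u\<close> off the prisms: \<open>undefined\<close> for spaces, and \<open>0\<close> for simplicial modules,
  so that pointwise addition is the addition of \<open>Tot V\<close>.
\<close>

definition prism :: "nat \<Rightarrow> nat \<Rightarrow> (nat list \<times> nat list) set" where
  "prism k q = (\<Union>r. smp (sprod (std k) (std q)) r)"

type_synonym 'a tot = "nat \<Rightarrow> nat list \<times> nat list \<Rightarrow> 'a"

definition Tot_with :: "'a \<Rightarrow> 'a csset \<Rightarrow> 'a tot sset" where
  "Tot_with u X =
     \<lparr>smp = (\<lambda>q. {f. cosimplicial_map (csprod csstd (csconst (std q))) X (\<lambda>k _. f k) \<and>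
                     (\<forall>k z. z \<notin> prism k q \<longrightarrow> f k z = u)}),
      sop = (\<lambda>n \<theta> f k z. if z \<in> prism k (length \<theta> - 1)
                          then f k (fst z, map ((!) \<theta>) (snd z)) else u)\<rparr>"

abbreviation Tot :: "'a csset \<Rightarrow> 'a tot sset" where
  "Tot \<equiv> Tot_with undefined"

abbreviation Tot_mod :: "'a::zero csset \<Rightarrow> 'a tot sset" where
  "Tot_mod \<equiv> Tot_with 0"


section \<open>Geometric realization and contractibility\<close>

text \<open>
  \<open>|X|\<close> is the quotient of the disjoint union of the \<open>X\<^sub>n \<times> |\<Delta>\<^sup>n|\<close>, whose points are triples
  \<open>(n, x, t)\<close>, by \<open>(X(\<theta>) x, t) \<sim> (x, \<theta>\<^sub>* t)\<close>, with the quotient topology.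
\<close>

definition push_simplex :: "nat list \<Rightarrow> (nat \<Rightarrow> real) \<Rightarrow> nat \<Rightarrow> real" where
  "push_simplex \<theta> t j = (\<Sum>i | i < length \<theta> \<and> \<theta> ! i = j. t i)"

definition cells :: "'a sset \<Rightarrow> (nat \<times> 'a \<times> (nat \<Rightarrow> real)) set" where
  "cells X = {(n, x, t). x \<in> smp X n \<and> t \<in> standard_simplex n}"

definition glue :: "'a sset \<Rightarrow> (nat \<times> 'a \<times> (nat \<Rightarrow> real)) rel" where
  "glue X = {((m, sop X n \<theta> x, t), (n, x, push_simplex \<theta> t)) | m n \<theta> x t.
               simplex_op m n \<theta> \<and> x \<in> smp X n \<and> t \<in> standard_simplex m}"

definition glue_eq :: "'a sset \<Rightarrow> (nat \<times> 'a \<times> (nat \<Rightarrow> real)) rel" where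
  "glue_eq X = (glue X \<union> (glue X)\<inverse>)\<^sup>*"

definition realization_open :: "'a sset \<Rightarrow> (nat \<times> 'a \<times> (nat \<Rightarrow> real)) set set \<Rightarrow> bool" where
  "realization_open X U \<longleftrightarrow> U \<subseteq> cells X // glue_eq X \<and>
     (\<forall>n. \<forall>x\<in>smp X n. openin (subtopology (powertop_real UNIV) (standard_simplex n))
        {t \<in> standard_simplex n. glue_eq X `` {(n, x, t)} \<in> U})"

lemma istopology_realization_open: "istopology (realization_open X)"
proof -
  let ?T = "\<lambda>n. subtopology (powertop_real UNIV) (standard_simplex n)"
  let ?P = "\<lambda>n x U. {t \<in> standard_simplex n. glue_eq X `` {(n, x, t)} \<in> U}"
  have int: "?P n x (U \<inter> V) = ?P n x U \<inter> ?P n x V" for n x U V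
    by auto
  have un: "?P n x (\<Union>\<U>) = (\<Union>U\<in>\<U>. ?P n x U)" for n x \<U>
    by auto
  show ?thesis
    unfolding istopology_def realization_open_def int un
    by (auto intro!: openin_Int openin_Union)
qed

definition realization :: "'a sset \<Rightarrow> (nat \<times> 'a \<times> (nat \<Rightarrow> real)) set topology" where
  "realization X = topology (realization_open X)"

text \<open>The library regards the empty space as contractible, hence the first conjunct.\<close>

definition contractible_sset :: "'a sset \<Rightarrow> bool" where
  "contractible_sset X \<longleftrightarrow>
     topspace (realization X) \<noteq> {} \<and> contractible_space (realization X)"


section \<open>Operads in simplicial sets, algebras\<close>

text \<open>
  Symmetric operads in simplicial sets in May's form.
  \<open>oact C n q \<sigma>\<close> is the right action of \<open>\<sigma> \<in> \<Sigma>\<^sub>n\<close> on \<open>C(n)\<^sub>q\<close>, and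
  \<open>ocomp C q c [(j\<^sub>1, d\<^sub>1), \<dots>, (j\<^sub>k, d\<^sub>k)]\<close> is \<open>\<gamma>(c; d\<^sub>1, \<dots>, d\<^sub>k)\<close> for \<open>c \<in> C(k)\<^sub>q\<close> and
  \<open>d\<^sub>i \<in> C(j\<^sub>i)\<^sub>q\<close>.  With \<open>\<sigma> \<cdot> (y\<^sub>1, \<dots>, y\<^sub>k) = (y\<^bsub>\<sigma>\<^sup>-\<^sup>1(1)\<^esub>, \<dots>, y\<^bsub>\<sigma>\<^sup>-\<^sup>1(k)\<^esub>)\<close>, which is
  \<open>permute_list (\<sigma>\<^sup>-\<^sup>1)\<close>, the conventions are those for which \<open>(f \<sigma>)(y) = f(\<sigma> \<cdot> y)\<close> in the
  endomorphism operad.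
\<close>

record 'o operad =
  osp :: "nat \<Rightarrow> 'o sset"
  ounit :: 'o
  oact :: "nat \<Rightarrow> nat \<Rightarrow> (nat \<Rightarrow> nat) \<Rightarrow> 'o \<Rightarrow> 'o"
  ocomp :: "nat \<Rightarrow> 'o \<Rightarrow> (nat \<times> 'o) list \<Rightarrow> 'o"

definition act_list :: "(nat \<Rightarrow> nat) \<Rightarrow> 'a list \<Rightarrow> 'a list" where
  "act_list \<sigma> ys = permute_list (inv_into UNIV \<sigma>) ys"

definition block_start :: "nat list \<Rightarrow> nat \<Rightarrow> nat" where
  "block_start js i = sum_list (take i js)"

definition block_index :: "nat list \<Rightarrow> nat \<Rightarrow> nat" where
  "block_index js x = (LEAST i. x < block_start js (Suc i))"

text \<open>\<open>\<sigma>(j\<^sub>1, \<dots>, j\<^sub>k)\<close> permutes blocks of lengths \<open>j\<^sub>1, \<dots>, j\<^sub>k\<close> as \<open>\<sigma>\<close> permutes \<open>k\<close> letters: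
  the \<open>i\<close>-th block is moved to place \<open>\<sigma> i\<close>.\<close>

definition block_perm :: "(nat \<Rightarrow> nat) \<Rightarrow> nat list \<Rightarrow> nat \<Rightarrow> nat" where
  "block_perm \<sigma> js x =
     (if x < sum_list js
      then block_start (act_list \<sigma> js) (\<sigma> (block_index js x)) + (x - block_start js (block_index js x))
      else x)"

text \<open>\<open>\<tau>\<^sub>1 \<oplus> \<dots> \<oplus> \<tau>\<^sub>k\<close>\<close>

definition sum_perm :: "(nat \<Rightarrow> nat) list \<Rightarrow> nat list \<Rightarrow> nat \<Rightarrow> nat" where
  "sum_perm \<tau>s js x =
     (if x < sum_list js
      then block_start js (block_index js x) + (\<tau>s ! block_index js x) (x - block_start js (block_index js x))
      else x)"

definition oelems :: "'o operad \<Rightarrow> nat \<Rightarrow> (nat \<times> 'o) list set" where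
  "oelems C q = {ds. \<forall>(j, d)\<in>set ds. d \<in> smp (osp C j) q}"

definition simplicial_operad :: "'o operad \<Rightarrow> bool" where
  "simplicial_operad C \<longleftrightarrow>
    (\<forall>n. simplicial_set (osp C n)) \<and>
    ounit C \<in> smp (osp C 1) 0 \<and>
    \<comment> \<open>the symmetric group actions are simplicial right actions\<close>
    (\<forall>n q \<sigma>. \<sigma> permutes {..<n} \<longrightarrow> oact C n q \<sigma> ` smp (osp C n) q \<subseteq> smp (osp C n) q) \<and>
    (\<forall>n q r \<sigma> \<phi>. \<sigma> permutes {..<n} \<and> simplex_op r q \<phi> \<longrightarrow>
       (\<forall>c\<in>smp (osp C n) q.
          oact C n r \<sigma> (sop (osp C n) q \<phi> c) = sop (osp C n) q \<phi> (oact C n q \<sigma> c))) \<and>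
    (\<forall>n q. \<forall>c\<in>smp (osp C n) q. oact C n q id c = c) \<and>
    (\<forall>n q \<sigma> \<tau>. \<sigma> permutes {..<n} \<and> \<tau> permutes {..<n} \<longrightarrow>
       (\<forall>c\<in>smp (osp C n) q. oact C n q (\<sigma> \<circ> \<tau>) c = oact C n q \<tau> (oact C n q \<sigma> c))) \<and>
    \<comment> \<open>composition is a simplicial map\<close>
    (\<forall>q. \<forall>ds\<in>oelems C q. \<forall>c\<in>smp (osp C (length ds)) q.
       ocomp C q c ds \<in> smp (osp C (sum_list (map fst ds))) q) \<and>
    (\<forall>q r \<phi>. simplex_op r q \<phi> \<longrightarrow> (\<forall>ds\<in>oelems C q. \<forall>c\<in>smp (osp C (length ds)) q.
       sop (osp C (sum_list (map fst ds))) q \<phi> (ocomp C q c ds) =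
       ocomp C r (sop (osp C (length ds)) q \<phi> c)
         (map (\<lambda>(j, d). (j, sop (osp C j) q \<phi> d)) ds))) \<and>
    \<comment> \<open>unit laws\<close>
    (\<forall>n q. \<forall>c\<in>smp (osp C n) q.
       ocomp C q (degen_vertex (osp C 1) q (ounit C)) [(n, c)] = c \<and>
       ocomp C q c (replicate n (1, degen_vertex (osp C 1) q (ounit C))) = c) \<and>
    \<comment> \<open>associativity; \<open>dss\<close> lists the pairs \<open>((j\<^sub>i, d\<^sub>i), es\<^sub>i)\<close> with \<open>es\<^sub>i\<close> the inputs of \<open>d\<^sub>i\<close>\<close>
    (\<forall>q dss. \<forall>c\<in>smp (osp C (length dss)) q.
       (\<forall>((j, d), es)\<in>set dss. length es = j \<and> d \<in> smp (osp C j) q \<and> es \<in> oelems C q) \<longrightarrow>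
       ocomp C q (ocomp C q c (map fst dss)) (concat (map snd dss)) =
       ocomp C q c (map (\<lambda>((j, d), es). (sum_list (map fst es), ocomp C q d es)) dss)) \<and>
    \<comment> \<open>equivariance\<close>
    (\<forall>q \<sigma>. \<forall>ds\<in>oelems C q. \<forall>c\<in>smp (osp C (length ds)) q. \<sigma> permutes {..<length ds} \<longrightarrow>
       ocomp C q (oact C (length ds) q \<sigma> c) ds =
       oact C (sum_list (map fst ds)) q (block_perm \<sigma> (map fst ds))
         (ocomp C q c (act_list \<sigma> ds))) \<and>
    (\<forall>q \<tau>s. \<forall>ds\<in>oelems C q. \<forall>c\<in>smp (osp C (length ds)) q.
       length \<tau>s = length ds \<and> (\<forall>i<length ds. (\<tau>s ! i) permutes {..<fst (ds ! i)}) \<longrightarrow>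
       ocomp C q c (map2 (\<lambda>\<tau> (j, d). (j, oact C j q \<tau> d)) \<tau>s ds) =
       oact C (sum_list (map fst ds)) q (sum_perm \<tau>s (map fst ds)) (ocomp C q c ds))"

definition E_infinity_operad :: "'o operad \<Rightarrow> bool" where
  "E_infinity_operad C \<longleftrightarrow> simplicial_operad C \<and>
     (\<forall>n. contractible_sset (osp C n)) \<and>
     (\<forall>n q \<sigma>. \<sigma> permutes {..<n} \<longrightarrow>
        (\<forall>c\<in>smp (osp C n) q. oact C n q \<sigma> c = c \<longrightarrow> \<sigma> = id))"

text \<open>\<open>A q c [x\<^sub>1, \<dots>, x\<^sub>n]\<close> is the action of \<open>c \<in> C(n)\<^sub>q\<close> on \<open>x\<^sub>1, \<dots>, x\<^sub>n \<in> Z\<^sub>q\<close>.\<close>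

definition operad_algebra :: "'o operad \<Rightarrow> 'a sset \<Rightarrow> (nat \<Rightarrow> 'o \<Rightarrow> 'a list \<Rightarrow> 'a) \<Rightarrow> bool" where
  "operad_algebra C Z A \<longleftrightarrow>
    simplicial_set Z \<and>
    (\<forall>q. \<forall>xs\<in>lists (smp Z q). \<forall>c\<in>smp (osp C (length xs)) q. A q c xs \<in> smp Z q) \<and>
    (\<forall>q r \<phi>. simplex_op r q \<phi> \<longrightarrow> (\<forall>xs\<in>lists (smp Z q). \<forall>c\<in>smp (osp C (length xs)) q.
       sop Z q \<phi> (A q c xs) = A r (sop (osp C (length xs)) q \<phi> c) (map (sop Z q \<phi>) xs))) \<and>
    (\<forall>q. \<forall>x\<in>smp Z q. A q (degen_vertex (osp C 1) q (ounit C)) [x] = x) \<and>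
    (\<forall>q dxs. \<forall>c\<in>smp (osp C (length dxs)) q.
       (\<forall>((j, d), xs)\<in>set dxs. length xs = j \<and> d \<in> smp (osp C j) q \<and> xs \<in> lists (smp Z q)) \<longrightarrow>
       A q (ocomp C q c (map fst dxs)) (concat (map snd dxs)) =
       A q c (map (\<lambda>((j, d), xs). A q d xs) dxs)) \<and>
    (\<forall>q \<sigma>. \<forall>xs\<in>lists (smp Z q). \<forall>c\<in>smp (osp C (length xs)) q. \<sigma> permutes {..<length xs} \<longrightarrow>
       A q (oact C (length xs) q \<sigma> c) xs = A q c (act_list \<sigma> xs))"

text \<open>A cosimplicial object in \<open>C\<close>-algebras; \<open>A p\<close> is the \<open>C\<close>-algebra structure of \<open>X\<^sup>p\<close>.\<close>

definition cosimplicial_operad_space ::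
  "'o operad \<Rightarrow> 'a csset \<Rightarrow> (nat \<Rightarrow> nat \<Rightarrow> 'o \<Rightarrow> 'a list \<Rightarrow> 'a) \<Rightarrow> bool" where
  "cosimplicial_operad_space C X A \<longleftrightarrow>
     cosimplicial_space X \<and>
     (\<forall>p. operad_algebra C (lev X p) (A p)) \<and>
     (\<forall>m n \<theta> q. simplex_op m n \<theta> \<longrightarrow>
        (\<forall>xs\<in>lists (smp (lev X m) q). \<forall>c\<in>smp (osp C (length xs)) q.
           cop X n \<theta> q (A m q c xs) = A n q c (map (cop X n \<theta> q) xs)))"

text \<open>
  The action of \<open>c \<in> C(n)\<^sub>q\<close> on \<open>n\<close> simplices of \<open>(Tot X)\<^sub>q\<close>: \<open>c\<close> corresponds to the \<open>q\<close>-simplex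
  \<open>(a, b) \<mapsto> C(n)(b) c\<close> of \<open>Tot\<close> of the constant cosimplicial space on \<open>C(n)\<close>.
\<close>

definition Tot_act ::
  "'o operad \<Rightarrow> (nat \<Rightarrow> nat \<Rightarrow> 'o \<Rightarrow> 'a list \<Rightarrow> 'a) \<Rightarrow> nat \<Rightarrow> 'o \<Rightarrow> 'a tot list \<Rightarrow> 'a tot" where
  "Tot_act C A q c fs = (\<lambda>k z. if z \<in> prism k q
     then A k (length (fst z) - 1) (sop (osp C (length fs)) q (snd z) c) (map (\<lambda>f. f k z) fs)
     else undefined)"

text \<open>The binary products on \<open>X\<close> and on \<open>Tot X\<close> determined by a vertex \<open>v\<close> of \<open>C(2)\<close>.\<close>

definition binary ::
  "'o operad \<Rightarrow> (nat \<Rightarrow> nat \<Rightarrow> 'o \<Rightarrow> 'a list \<Rightarrow> 'a) \<Rightarrow> 'o \<Rightarrow> nat \<Rightarrow> nat \<Rightarrow> 'a \<times> 'a \<Rightarrow> 'a" where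
  "binary C A v p q = (\<lambda>(x, y). A p q (degen_vertex (osp C 2) q v) [x, y])"

definition Tot_binary ::
  "'o operad \<Rightarrow> (nat \<Rightarrow> nat \<Rightarrow> 'o \<Rightarrow> 'a list \<Rightarrow> 'a) \<Rightarrow> 'o \<Rightarrow> nat \<Rightarrow> 'a tot \<times> 'a tot \<Rightarrow> 'a tot" where
  "Tot_binary C A v q = (\<lambda>(f, g). Tot_act C A q (degen_vertex (osp C 2) q v) [f, g])"


section \<open>Modules over the field with two elements, chain complexes\<close>

text \<open>
  The free module on a set \<open>Z\<close> consists of the finitely supported \<open>c :: 'a \<Rightarrow>\<^sub>0 bit\<close> with
  \<open>keys c \<subseteq> Z\<close>.  \<open>kext g\<close> is the linear extension of \<open>g\<close>: all nonzero coefficients are \<open>1\<close>.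
\<close>

definition kext :: "('a \<Rightarrow> 'b::comm_monoid_add) \<Rightarrow> ('a \<Rightarrow>\<^sub>0 bit) \<Rightarrow> 'b" where
  "kext g c = (\<Sum>x\<in>Poly_Mapping.keys c. g x)"

abbreviation kgen :: "'a \<Rightarrow> 'a \<Rightarrow>\<^sub>0 bit" where
  "kgen x \<equiv> Poly_Mapping.single x 1"

definition kmap :: "('a \<Rightarrow> 'b) \<Rightarrow> ('a \<Rightarrow>\<^sub>0 bit) \<Rightarrow> 'b \<Rightarrow>\<^sub>0 bit" where
  "kmap g = kext (\<lambda>x. kgen (g x))"

text \<open>\<open>x \<otimes> y\<close> under the identification of the tensor product of the free modules on two sets with
  the free module on their product.\<close>

definition ktensor :: "('a \<Rightarrow>\<^sub>0 bit) \<Rightarrow> ('b \<Rightarrow>\<^sub>0 bit) \<Rightarrow> ('a \<times> 'b) \<Rightarrow>\<^sub>0 bit" where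
  "ktensor c d = kext (\<lambda>x. kext (\<lambda>y. kgen (x, y)) d) c"

definition kfree :: "'a sset \<Rightarrow> ('a \<Rightarrow>\<^sub>0 bit) sset" where
  "kfree Z = \<lparr>smp = (\<lambda>q. {c. Poly_Mapping.keys c \<subseteq> smp Z q}), sop = (\<lambda>n \<theta>. kmap (sop Z n \<theta>))\<rparr>"

definition cskfree :: "'a csset \<Rightarrow> ('a \<Rightarrow>\<^sub>0 bit) csset" where
  "cskfree X = \<lparr>lev = (\<lambda>p. kfree (lev X p)), cop = (\<lambda>n \<theta> q. kmap (cop X n \<theta> q))\<rparr>"

text \<open>
  A chain complex of modules (graded by the integers) is presented by subgroups
  \<open>nulls m \<subseteq> chains m\<close> of an ambient abelian group: the module in degree \<open>m\<close> is the quotient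
  \<open>chains m / nulls m\<close>, and the differential is given on representatives.  In this way a quotient
  of a quotient again is a quotient of subgroups of the ambient group.  There are no signs because
  the characteristic is \<open>2\<close>.
\<close>

record 'a chcx =
  chains :: "int \<Rightarrow> 'a set"
  nulls :: "int \<Rightarrow> 'a set"
  bdry :: "int \<Rightarrow> 'a \<Rightarrow> 'a"

definition cycles :: "'a::ab_group_add chcx \<Rightarrow> int \<Rightarrow> 'a set" where
  "cycles D m = {x \<in> chains D m. bdry D m x \<in> nulls D (m - 1)}"

definition bounds :: "'a::ab_group_add chcx \<Rightarrow> int \<Rightarrow> 'a set" where
  "bounds D m = bdry D (m + 1) ` chains D (m + 1) + nulls D m"

text \<open>The quotient \<open>V / W\<close> as a set of cosets.\<close>

definition quot :: "'a::plus set \<Rightarrow> 'a set \<Rightarrow> 'a set set" where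
  "quot V W = (\<lambda>x. x +o W) ` V"

definition homology :: "'a::ab_group_add chcx \<Rightarrow> int \<Rightarrow> 'a set set" where
  "homology D m = quot (cycles D m) (bounds D m)"

text \<open>
  The maps into \<open>V / W\<close> induced on cosets by a map, resp. a bilinear map, given on representatives.
  (A map respects the quotients if and only if all cosets in the union coincide.)  Linear maps out
  of tensor products are treated as bilinear maps throughout.
\<close>

definition induced :: "'b::plus set \<Rightarrow> ('a \<Rightarrow> 'b) \<Rightarrow> 'a set \<Rightarrow> 'b set" where
  "induced W f \<xi> = (\<Union>x\<in>\<xi>. f x +o W)"

definition induced2 :: "'c::plus set \<Rightarrow> ('a \<Rightarrow> 'b \<Rightarrow> 'c) \<Rightarrow> 'a set \<Rightarrow> 'b set \<Rightarrow> 'c set" where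
  "induced2 W f \<xi> \<eta> = (\<Union>x\<in>\<xi>. \<Union>y\<in>\<eta>. f x y +o W)"

text \<open>The normalized complex of a simplicial module: the quotient by the degenerate elements, with
  the alternating sum of the faces as differential.\<close>

definition normalized :: "'a::ab_group_add sset \<Rightarrow> 'a chcx" where
  "normalized A =
     \<lparr>chains = (\<lambda>q. if q < 0 then {0} else smp A (nat q)),
      nulls = (\<lambda>q. {\<Sum>i<nat q. sop A (nat q - 1) (codegen (nat q - 1) i) (a i) | a.
                     \<forall>i<nat q. a i \<in> smp A (nat q - 1)}),
      bdry = (\<lambda>q x. if q \<le> 0 then 0 else \<Sum>i\<le>nat q. sop A (nat q) (coface (nat q) i) x)\<rparr>"

abbreviation S_chains :: "'a sset \<Rightarrow> ('a \<Rightarrow>\<^sub>0 bit) chcx" where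
  "S_chains Z \<equiv> normalized (kfree Z)"

text \<open>
  The shuffle map.  An \<open>(a, b)\<close>-shuffle \<open>(\<mu>, \<nu>)\<close> is given by the \<open>a\<close>-element subset \<open>\<mu>\<close> of
  \<open>{..<a + b}\<close>, \<open>\<nu>\<close> being the complement; the iterated degeneracy
  \<open>s\<^bsub>\<nu>\<^sub>b\<^esub> \<dots> s\<^bsub>\<nu>\<^sub>1\<^esub>\<close> is the action of the map \<open>[a + b] \<rightarrow> [a]\<close> that increases exactly at
  the steps in \<open>\<mu>\<close>.
\<close>

definition step_op :: "nat \<Rightarrow> nat set \<Rightarrow> nat list" where
  "step_op n \<mu> = map (\<lambda>i. card {k \<in> \<mu>. k < i}) [0..<Suc n]"

definition shuffle ::
  "'a sset \<Rightarrow> 'b sset \<Rightarrow> nat \<Rightarrow> nat \<Rightarrow> ('a \<Rightarrow>\<^sub>0 bit) \<Rightarrow> ('b \<Rightarrow>\<^sub>0 bit) \<Rightarrow> ('a \<times> 'b) \<Rightarrow>\<^sub>0 bit" where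
  "shuffle X Y a b x y =
     (\<Sum>\<mu> | \<mu> \<subseteq> {..<a + b} \<and> card \<mu> = a.
        ktensor (sop (kfree X) a (step_op (a + b) \<mu>) x)
                (sop (kfree Y) b (step_op (a + b) ({..<a + b} - \<mu>)) y))"


section \<open>The spectral sequence of a cosimplicial chain complex\<close>

record 'a cchcx =
  clev :: "nat \<Rightarrow> 'a chcx"
  ccop :: "nat \<Rightarrow> nat list \<Rightarrow> int \<Rightarrow> 'a \<Rightarrow> 'a"

definition csnormalized :: "'a::ab_group_add csset \<Rightarrow> 'a cchcx" where
  "csnormalized V = \<lparr>clev = (\<lambda>p. normalized (lev V p)), ccop = (\<lambda>n \<theta> q. cop V n \<theta> (nat q))\<rparr>"

abbreviation csS_chains :: "'a csset \<Rightarrow> ('a \<Rightarrow>\<^sub>0 bit) cchcx" where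
  "csS_chains X \<equiv> csnormalized (cskfree X)"

text \<open>
  Second-quadrant bicomplexes: \<open>bchains B p q / bnulls B p q\<close> is the module in bidegree \<open>(-p, q)\<close>,
  \<open>bhor B p q\<close> maps it to bidegree \<open>(-(p + 1), q)\<close> and \<open>bver B p q\<close> to bidegree \<open>(-p, q - 1)\<close>.
\<close>

record 'a bicx =
  bchains :: "nat \<Rightarrow> int \<Rightarrow> 'a set"
  bnulls :: "nat \<Rightarrow> int \<Rightarrow> 'a set"
  bhor :: "nat \<Rightarrow> int \<Rightarrow> 'a \<Rightarrow> 'a"
  bver :: "nat \<Rightarrow> int \<Rightarrow> 'a \<Rightarrow> 'a"

definition conormalization :: "'a::ab_group_add cchcx \<Rightarrow> 'a bicx" where
  "conormalization Y =
     \<lparr>bchains = (\<lambda>p q. chains (clev Y p) q),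
      bnulls = (\<lambda>p q. {\<Sum>k=1..p. ccop Y p (coface p k) q (y k) | y.
                        \<forall>k\<in>{1..p}. y k \<in> chains (clev Y (p - 1)) q} + nulls (clev Y p) q),
      bhor = (\<lambda>p q. ccop Y (Suc p) (coface (Suc p) 0) q),
      bver = (\<lambda>p q. bdry (clev Y p) q)\<rparr>"

text \<open>An element of total degree \<open>m\<close> is a family \<open>x\<close> with \<open>x p\<close> in bidegree \<open>(-p, m + p)\<close>.\<close>

definition total :: "'a::ab_group_add bicx \<Rightarrow> (nat \<Rightarrow> 'a) chcx" where
  "total B =
     \<lparr>chains = (\<lambda>m. {x. \<forall>p. x p \<in> bchains B p (m + int p)}),
      nulls = (\<lambda>m. {x. \<forall>p. x p \<in> bnulls B p (m + int p)}),
      bdry = (\<lambda>m x p. bver B p (m + int p) (x p) +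
                       (if p = 0 then 0 else bhor B (p - 1) (m + int (p - 1)) (x (p - 1))))\<rparr>"

text \<open>\<open>F\<^sup>k TB\<^sub>m\<close>: the components in the columns \<open>j > k\<close> vanish.\<close>

definition fil :: "'a::ab_group_add bicx \<Rightarrow> int \<Rightarrow> int \<Rightarrow> (nat \<Rightarrow> 'a) set" where
  "fil B k m = {x \<in> chains (total B) m. \<forall>p. - int p > k \<longrightarrow> x p \<in> bnulls B p (m + int p)}"

text \<open>\<open>T\<^sub>l B = TB / F\<^bsup>-(l+1)\<^esup> TB\<close>\<close>

definition total_trunc :: "int \<Rightarrow> 'a::ab_group_add bicx \<Rightarrow> (nat \<Rightarrow> 'a) chcx" where
  "total_trunc l B = (total B)\<lparr>nulls := (\<lambda>m. fil B (- (l + 1)) m)\<rparr>"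

text \<open>\<open>E\<^sup>\<infinity>\<^bsub>-s,t\<^esub> = E_cycles s t / E_nulls s t\<close>\<close>

definition E_cycles :: "'a::ab_group_add cchcx \<Rightarrow> nat \<Rightarrow> int \<Rightarrow> (nat \<Rightarrow> 'a) set" where
  "E_cycles Y s t = (let B = conormalization Y; m = t - int s
     in cycles (total B) m \<inter> fil B (- int s) m)"

definition E_nulls :: "'a::ab_group_add cchcx \<Rightarrow> nat \<Rightarrow> int \<Rightarrow> (nat \<Rightarrow> 'a) set" where
  "E_nulls Y s t = (let B = conormalization Y; m = t - int s
     in (cycles (total B) m \<inter> fil B (- int s - 1) m) + (bounds (total B) m \<inter> fil B (- int s) m))"

definition E_infinity :: "'a::ab_group_add cchcx \<Rightarrow> nat \<Rightarrow> int \<Rightarrow> (nat \<Rightarrow> 'a) set set" where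
  "E_infinity Y s t = quot (E_cycles Y s t) (E_nulls Y s t)"


section \<open>The abutment\<close>

abbreviation TC :: "'a csset \<Rightarrow> (nat \<Rightarrow> 'a \<Rightarrow>\<^sub>0 bit) chcx" where
  "TC X \<equiv> total (conormalization (csS_chains X))"

abbreviation H_Tot :: "'a csset \<Rightarrow> int \<Rightarrow> ('a tot \<Rightarrow>\<^sub>0 bit) set set" where
  "H_Tot X n \<equiv> homology (S_chains (Tot X)) n"

text \<open>On generators in degree \<open>q\<close>, the map \<open>kfree (Tot X) \<rightarrow> Tot_mod (cskfree X)\<close>.\<close>

definition Tot_free :: "nat \<Rightarrow> 'a tot \<Rightarrow> ('a \<Rightarrow>\<^sub>0 bit) tot" where
  "Tot_free q f = (\<lambda>k z. if z \<in> prism k q then kgen (f k z) else 0)"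

text \<open>\<open>\<phi>\<^sub>\<infinity>\<close> on elements of degree \<open>q\<close> of \<open>Tot_mod V\<close>: \<open>id_op k\<close> is the fundamental simplex \<open>\<iota>\<^sub>k\<close> of \<open>std k\<close>,
  and \<open>f k\<close> is extended linearly to chains on \<open>\<Delta>\<^sup>k \<times> \<Delta>\<^sup>q\<close>.\<close>

definition phi_infinity :: "nat \<Rightarrow> 'a::ab_group_add tot \<Rightarrow> nat \<Rightarrow> 'a" where
  "phi_infinity q f = (\<lambda>k. kext (f k) (shuffle (std k) (std q) k q (kgen (id_op k)) (kgen (id_op q))))"

definition comparison :: "int \<Rightarrow> ('a tot \<Rightarrow>\<^sub>0 bit) \<Rightarrow> nat \<Rightarrow> 'a \<Rightarrow>\<^sub>0 bit" where
  "comparison n c = phi_infinity (nat n) (kext (Tot_free (nat n)) c)"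

text \<open>\<open>H(Tot X) \<rightarrow> H(T C N \<K>X)\<close>; a homology class is the set of the cycles representing it.\<close>

definition H_comparison ::
  "'a csset \<Rightarrow> int \<Rightarrow> ('a tot \<Rightarrow>\<^sub>0 bit) set \<Rightarrow> (nat \<Rightarrow> 'a \<Rightarrow>\<^sub>0 bit) set" where
  "H_comparison X n = induced (bounds (TC X) n) (comparison n)"

text \<open>\<open>F\<^bsup>-s\<^esup> H\<^sub>n(Tot X)\<close> and its filtration quotients; \<open>bounds\<close> is the zero class in homology.\<close>

definition H_fil :: "'a csset \<Rightarrow> nat \<Rightarrow> int \<Rightarrow> ('a tot \<Rightarrow>\<^sub>0 bit) set set" where
  "H_fil X s n = (let T = total_trunc (int s - 1) (conormalization (csS_chains X))
     in {h \<in> H_Tot X n. induced (bounds T n) (\<lambda>z. z) (H_comparison X n h) = bounds T n})"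

definition H_gr :: "'a csset \<Rightarrow> nat \<Rightarrow> int \<Rightarrow> ('a tot \<Rightarrow>\<^sub>0 bit) set set set" where
  "H_gr X s n = quot (H_fil X s n) (H_fil X (Suc s) n)"

text \<open>The abutment map \<open>(F\<^bsup>-s\<^esup> / F\<^bsup>-s-1\<^esup>) H\<^sub>n(Tot X) \<rightarrow> E\<^sup>\<infinity>\<^bsub>-s,n+s\<^esub>\<close>.\<close>

definition iota ::
  "'a csset \<Rightarrow> nat \<Rightarrow> int \<Rightarrow> ('a tot \<Rightarrow>\<^sub>0 bit) set set \<Rightarrow> (nat \<Rightarrow> 'a \<Rightarrow>\<^sub>0 bit) set" where
  "iota X s n \<xi> =
     (\<Union>h\<in>\<xi>. \<Union>z\<in>H_comparison X n h \<inter> fil (conormalization (csS_chains X)) (- int s) n.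
        z +o E_nulls (csS_chains X) s (n + int s))"


section \<open>The multiplications\<close>

text \<open>The homology cross product \<open>H\<^sub>m(Z) \<otimes> H\<^sub>n(Z') \<rightarrow> H\<^bsub>m+n\<^esub>(Z \<times> Z')\<close>.\<close>

definition cross ::
  "'a sset \<Rightarrow> 'b sset \<Rightarrow> int \<Rightarrow> int \<Rightarrow> ('a \<Rightarrow>\<^sub>0 bit) set \<Rightarrow> ('b \<Rightarrow>\<^sub>0 bit) set \<Rightarrow> ('a \<times> 'b \<Rightarrow>\<^sub>0 bit) set" where
  "cross Z Z' m n =
     induced2 (bounds (S_chains (sprod Z Z')) (m + n)) (shuffle Z Z' (nat m) (nat n))"

definition mu_H ::
  "'o operad \<Rightarrow> 'a csset \<Rightarrow> (nat \<Rightarrow> nat \<Rightarrow> 'o \<Rightarrow> 'a list \<Rightarrow> 'a) \<Rightarrow> 'o \<Rightarrow> int \<Rightarrow> int \<Rightarrow>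
   ('a tot \<Rightarrow>\<^sub>0 bit) set \<Rightarrow> ('a tot \<Rightarrow>\<^sub>0 bit) set \<Rightarrow> ('a tot \<Rightarrow>\<^sub>0 bit) set" where
  "mu_H C X A v m n g h =
     induced (bounds (S_chains (Tot X)) (m + n)) (kmap (Tot_binary C A v (nat (m + n))))
       (cross (Tot X) (Tot X) m n g h)"

text \<open>The map induced by \<open>mu_H\<close> on filtration quotients.\<close>

definition mu_gr ::
  "'o operad \<Rightarrow> 'a csset \<Rightarrow> (nat \<Rightarrow> nat \<Rightarrow> 'o \<Rightarrow> 'a list \<Rightarrow> 'a) \<Rightarrow> 'o \<Rightarrow> nat \<Rightarrow> int \<Rightarrow> nat \<Rightarrow> int \<Rightarrow>
   ('a tot \<Rightarrow>\<^sub>0 bit) set set \<Rightarrow> ('a tot \<Rightarrow>\<^sub>0 bit) set set \<Rightarrow> ('a tot \<Rightarrow>\<^sub>0 bit) set set" where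
  "mu_gr C X A v s m s' n = induced2 (H_fil X (Suc (s + s')) (m + n)) (mu_H C X A v m n)"

text \<open>
  The two factors of the Alexander--Whitney map
  \<open>y \<otimes> z \<mapsto> d\<^bsup>p+q\<^esup> \<dots> d\<^bsup>p+1\<^esup> y \<otimes> d\<^bsup>p-1\<^esup> \<dots> d\<^sup>0 z\<close>, for \<open>y\<close> in cosimplicial degree \<open>p\<close> and \<open>z\<close> in
  cosimplicial degree \<open>q\<close>; \<open>t\<close> is the chain degree.

  Pitfall: this formula does not respect the relation \<open>d\<^sup>p y' = 0\<close> in the cokernel defining the
  conormalization (for \<open>p = 1\<close>, \<open>q = 0\<close> it sends \<open>d\<^sup>1 y' \<otimes> z\<close> to \<open>d\<^sup>1 y' \<otimes> d\<^sup>0 z\<close>, which need not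
  lie in the image of \<open>d\<^sup>1\<close>).  As usual, it is to be applied to the representatives annihilated by
  all codegeneracies: every class of the cokernel has exactly one of these.  The set
  \<open>conormal Y m\<close> consists of the families of such representatives, in total degree \<open>m\<close>.
\<close>

definition conormal :: "'a cchcx \<Rightarrow> int \<Rightarrow> (nat \<Rightarrow> 'a) set" where
  "conormal Y m = {x. \<forall>p. \<forall>i<p.
     ccop Y (p - 1) (codegen (p - 1) i) (m + int p) (x p) \<in> nulls (clev Y (p - 1)) (m + int p)}"

definition AW_front :: "'a cchcx \<Rightarrow> nat \<Rightarrow> nat \<Rightarrow> int \<Rightarrow> 'a \<Rightarrow> 'a" where
  "AW_front Y p q t y = fold (\<lambda>k. ccop Y k (coface k k) t) [Suc p..<Suc (p + q)] y"

definition AW_back :: "'a cchcx \<Rightarrow> nat \<Rightarrow> nat \<Rightarrow> int \<Rightarrow> 'a \<Rightarrow> 'a" where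
  "AW_back Y p q t z = fold (\<lambda>k. ccop Y (Suc (q + k)) (coface (Suc (q + k)) k) t) [0..<p] z"

text \<open>
  The composite of Alexander--Whitney and shuffle map on elements \<open>x\<close>, \<open>y\<close> of total degrees
  \<open>m\<close>, \<open>n\<close>; the summand for \<open>p\<close> comes from \<open>x p \<otimes> y q\<close> with \<open>p + q = j\<close>.
\<close>

definition ext_prod ::
  "'a csset \<Rightarrow> int \<Rightarrow> int \<Rightarrow> (nat \<Rightarrow> 'a \<Rightarrow>\<^sub>0 bit) \<Rightarrow> (nat \<Rightarrow> 'a \<Rightarrow>\<^sub>0 bit) \<Rightarrow> nat \<Rightarrow> ('a \<times> 'a) \<Rightarrow>\<^sub>0 bit" where
  "ext_prod X m n x y = (\<lambda>j. \<Sum>p\<le>j. let q = j - p; t = m + int p; u = n + int q in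
     shuffle (lev X j) (lev X j) (nat t) (nat u)
       (AW_front (csS_chains X) p q t (x p)) (AW_back (csS_chains X) p q u (y q)))"

text \<open>\<open>E\<^sup>\<infinity>\<^bsub>-s,t\<^esub>(S\<^sub>*(X)) \<otimes> E\<^sup>\<infinity>\<^bsub>-s',t'\<^esub>(S\<^sub>*(X)) \<rightarrow> E\<^sup>\<infinity>\<^bsub>-s-s',t+t'\<^esub>(S\<^sub>*(X \<times> X))\<close>\<close>

definition E_ext ::
  "'a csset \<Rightarrow> nat \<Rightarrow> int \<Rightarrow> nat \<Rightarrow> int \<Rightarrow>
   (nat \<Rightarrow> 'a \<Rightarrow>\<^sub>0 bit) set \<Rightarrow> (nat \<Rightarrow> 'a \<Rightarrow>\<^sub>0 bit) set \<Rightarrow> (nat \<Rightarrow> ('a \<times> 'a) \<Rightarrow>\<^sub>0 bit) set" where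
  "E_ext X s t s' t' e e' =
     induced2 (E_nulls (csS_chains (csprod X X)) (s + s') (t + t'))
       (ext_prod X (t - int s) (t' - int s'))
       (e \<inter> conormal (csS_chains X) (t - int s)) (e' \<inter> conormal (csS_chains X) (t' - int s'))"

definition mu_E ::
  "'o operad \<Rightarrow> 'a csset \<Rightarrow> (nat \<Rightarrow> nat \<Rightarrow> 'o \<Rightarrow> 'a list \<Rightarrow> 'a) \<Rightarrow> 'o \<Rightarrow> nat \<Rightarrow> int \<Rightarrow> nat \<Rightarrow> int \<Rightarrow>
   (nat \<Rightarrow> 'a \<Rightarrow>\<^sub>0 bit) set \<Rightarrow> (nat \<Rightarrow> 'a \<Rightarrow>\<^sub>0 bit) set \<Rightarrow> (nat \<Rightarrow> 'a \<Rightarrow>\<^sub>0 bit) set" where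
  "mu_E C X A v s t s' t' e e' =
     induced (E_nulls (csS_chains X) (s + s') (t + t'))
       (\<lambda>w p. kmap (binary C A v p (nat (t + t' - int (s + s') + int p))) (w p))
       (E_ext X s t s' t' e e')"

end

theory Submission
  imports Defs
begin

text \<open>
  The product of two homology classes of \<open>Tot X\<close> is given by shuffles followed by the binary product,
  and the product in the spectral sequence by Alexander--Whitney and shuffles followed by the same
  binary product.  The theorem therefore reduces to one statement on chains: the comparison map
  \<open>\<phi>\<^sub>\<infinity>\<close> carries the first product of two cycles to the second one up to a boundary
  (\<open>comparison_mult\<close>).  Granted this, let \<open>a\<close>, \<open>b\<close> be cycles for which \<open>\<phi>\<^sub>\<infinity> a + \<partial>w\<close> and
  \<open>\<phi>\<^sub>\<infinity> b + \<partial>w'\<close> lie in filtration \<open>-s\<close> and \<open>-s'\<close>.  The Alexander--Whitney product of these two lies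
  in filtration \<open>-s - s'\<close> since it adds cosimplicial degrees (\<open>bil_fil\<close>), and it differs from
  \<open>\<phi>\<^sub>\<infinity> (a b)\<close> by a boundary (\<open>tot_prod_fil\<close>).  All three claims follow by computing with cosets
  (\<open>iota_coset\<close>, \<open>mu_gr_coset\<close>, \<open>mu_E_coset\<close>).

  Two difficulties have to be removed before that.

  The first one is that the conormalization is a cokernel, whereas the Alexander--Whitney map makes
  sense only on the representatives annihilated by all codegeneracies.  The two descriptions are
  related by the product \<open>P\<close> of the idempotents \<open>1 + d\<^bsup>i+1\<^esup> s\<^sup>i\<close> (\<open>proj\<close>).  It kills the images of
  \<open>d\<^sup>1, \<dots>, d\<^sup>p\<close>, its values are annihilated by all codegeneracies, and it is the identity modulo the
  images of \<open>d\<^sup>1, \<dots>, d\<^sup>p\<close>.  Hence membership in the cokernel relations is tested by \<open>P\<close>, and under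
  \<open>P\<close> the horizontal differential \<open>d\<^sup>0\<close> becomes the sum of all cofaces (\<open>tproj_bdry\<close>).  With that sum
  as horizontal differential, the shuffle map, the Alexander--Whitney product and \<open>\<phi>\<^sub>\<infinity>\<close> are chain maps
  on the nose, before any quotient is taken (\<open>fbd_shuffle\<close>, \<open>tbd_eprod\<close>, \<open>tbd_comparison\<close>), and only
  the degenerate chains remain to be divided out.

  The second one is the homotopy between the two products.  Elements \<open>f\<close>, \<open>g\<close> of \<open>Tot X\<close> of degrees
  \<open>m\<close>, \<open>n\<close> are cosimplicial maps out of \<open>\<Delta>\<^sup>\<bullet> \<times> \<Delta>\<^sup>m\<close> and \<open>\<Delta>\<^sup>\<bullet> \<times> \<Delta>\<^sup>n\<close>.  Both products of \<open>f\<close> and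
  \<open>g\<close> are images of universal chains of degree \<open>m + n + k\<close> on
  \<open>(\<Delta>\<^sup>k \<times> \<Delta>\<^sup>m) \<times> (\<Delta>\<^sup>k \<times> \<Delta>\<^sup>n)\<close>: one of them, \<open>ushuf\<close>, consists of shuffles and the diagonal of
  \<open>\<Delta>\<^sup>k\<close>, the other one, \<open>uaw\<close>, is the Alexander--Whitney product.  The boundary of either family is the sum
  of its cofaces in the three directions \<open>k\<close>, \<open>m\<close>, \<open>n\<close>, and both agree for \<open>m = n = k = 0\<close>.
  The products of simplices being contractible by the cone over the initial vertex, a recursion over
  \<open>m + n + k\<close> gives a homotopy that is compatible with all cofaces (\<open>qbd_hty\<close>).  Codegeneracies fix the initial
  vertex and so commute with the cone; hence the homotopy maps degenerate \<open>f\<close> or \<open>g\<close> to degenerate chains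
  (\<open>tdgn_pushq_left\<close>, \<open>tdgn_pushq_right\<close>) and yields the boundary required for \<open>comparison_mult\<close>.
\<close>

section \<open>Linear extension over the field with two elements\<close>

abbreviation supp :: "('a \<Rightarrow>\<^sub>0 bit) \<Rightarrow> 'a set" where
  "supp \<equiv> Poly_Mapping.keys"

lemma chain_double [simp]: "c + c = (0 :: 'a \<Rightarrow>\<^sub>0 bit)"
  by (rule poly_mapping_eqI) (simp add: lookup_add)

lemma chain_diff [simp]: "c - d = c + (d :: 'a \<Rightarrow>\<^sub>0 bit)"
  by (simp add: diff_eq_eq add.assoc)

lemma chain_cancel [simp]: "c + (c + d) = (d :: 'a \<Rightarrow>\<^sub>0 bit)"
  by (simp add: add.assoc [symmetric])

lemma chain_add_eq_0_iff [simp]: "c + d = 0 \<longleftrightarrow> c = (d :: 'a \<Rightarrow>\<^sub>0 bit)"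
  by (metis chain_cancel chain_double add_0_right)

lemma keys_add_bit:
  "supp (c + d) = (supp c - supp d) \<union>
     (supp d - supp (c :: 'a \<Rightarrow>\<^sub>0 bit))"
proof -
  have "(Poly_Mapping.lookup c x + Poly_Mapping.lookup d x \<noteq> 0) = ((Poly_Mapping.lookup c x \<noteq> 0) \<noteq> (Poly_Mapping.lookup d x \<noteq> 0))" for x
    by (cases "Poly_Mapping.lookup c x"; cases "Poly_Mapping.lookup d x") auto
  then show ?thesis by (auto simp: in_keys_iff lookup_add)
qed

text \<open>The elements common to both supports contribute \<open>g x + g x = 0\<close>, and they disappear from the support
  of the sum.\<close>

lemma kext_add_general:
  fixes g :: "'a \<Rightarrow> 'b::comm_monoid_add"
  assumes "\<And>x. g x + g x = 0"
  shows "kext g (c + d) = kext g c + kext g d"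
proof -
  let ?C = "supp c" and ?D = "supp d"
  have "kext g (c + d) = sum g (?C - ?D) + sum g (?D - ?C)"
    unfolding kext_def keys_add_bit by (rule sum.union_disjoint) auto
  moreover have "sum g ?C = sum g (?C - ?D) + sum g (?C \<inter> ?D)"
    using sum.Int_Diff [of ?C g ?D] by (simp add: add.commute)
  moreover have "sum g ?D = sum g (?D - ?C) + sum g (?C \<inter> ?D)"
    using sum.Int_Diff [of ?D g ?C] by (simp add: add.commute Int_commute)
  moreover have "sum g (?C \<inter> ?D) + sum g (?C \<inter> ?D) = 0"
    by (simp add: sum.distrib [symmetric] assms)
  ultimately show ?thesis
    unfolding kext_def by (metis (no_types, lifting) add.assoc add.commute add_0_right)
qed

lemma kext_0 [simp]: "kext g 0 = 0"
  by (simp add: kext_def)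

lemma kext_kgen [simp]: "kext g (kgen x) = g x"
  by (simp add: kext_def)

lemma kext_add: "kext g (c + d) = kext g c + (kext g d :: 'b \<Rightarrow>\<^sub>0 bit)"
  by (rule kext_add_general) simp

lemma kext_sum: "kext g (\<Sum>i\<in>I. c i) = (\<Sum>i\<in>I. kext g (c i) :: 'b \<Rightarrow>\<^sub>0 bit)"
  by (induction I rule: infinite_finite_induct) (simp_all add: kext_add)

lemma kext_plus: "kext (\<lambda>x. f x + g x) c = kext f c + (kext g c :: 'b::comm_monoid_add)"
  by (simp add: kext_def sum.distrib)

lemma kext_zero [simp]: "kext (\<lambda>x. 0) c = 0"
  by (simp add: kext_def)

lemma kext_Sum: "kext (\<lambda>x. \<Sum>i\<in>I. f i x) c = (\<Sum>i\<in>I. kext (f i) c :: 'b::comm_monoid_add)"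
  unfolding kext_def by (rule sum.swap)

lemma kext_swap: "kext (\<lambda>x. kext (f x) d) c = (kext (\<lambda>y. kext (\<lambda>x. f x y) c) d :: 'b::comm_monoid_add)"
  unfolding kext_def by (rule sum.swap)

lemma kext_cong:
  "(\<And>x. x \<in> supp c \<Longrightarrow> f x = g x) \<Longrightarrow> kext f c = kext g c"
  by (simp add: kext_def)

lemma chain_expand: "c = (\<Sum>x\<in>supp c. kgen x :: 'a \<Rightarrow>\<^sub>0 bit)"
proof (rule poly_mapping_eqI)
  fix y
  have "Poly_Mapping.lookup (\<Sum>x\<in>supp c. kgen x :: 'a \<Rightarrow>\<^sub>0 bit) y
      = (\<Sum>x\<in>supp c. if x = y then 1 else 0)"
    by (simp add: lookup_sum lookup_single when_def)
  also have "\<dots> = (if y \<in> supp c then 1 else 0)"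
    by simp
  also have "\<dots> = Poly_Mapping.lookup c y"
    by (cases "Poly_Mapping.lookup c y") (auto simp: in_keys_iff)
  finally show "Poly_Mapping.lookup c y = Poly_Mapping.lookup (\<Sum>x\<in>supp c. kgen x :: 'a \<Rightarrow>\<^sub>0 bit) y" by simp
qed

lemma kext_kgen_id: "kext kgen c = c"
  unfolding kext_def by (rule chain_expand [symmetric])

lemma kext_kext: "kext g (kext f c) = (kext (\<lambda>x. kext g (f x)) c :: 'b \<Rightarrow>\<^sub>0 bit)"
  by (subst (2) kext_def) (simp add: kext_sum kext_def [of _ c])

lemma kmap_0 [simp]: "kmap g 0 = 0"
  by (simp add: kmap_def)

lemma kmap_kgen [simp]: "kmap g (kgen x) = kgen (g x)"
  by (simp add: kmap_def)

lemma kmap_add: "kmap g (c + d) = kmap g c + kmap g d"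
  by (simp add: kmap_def kext_add)

lemma kmap_sum: "kmap g (\<Sum>i\<in>I. c i) = (\<Sum>i\<in>I. kmap g (c i))"
  by (simp add: kmap_def kext_sum)

lemma kmap_kext: "kmap g (kext f c) = kext (\<lambda>x. kmap g (f x)) c"
  by (simp add: kmap_def kext_kext)

lemma kext_kmap: "kext g (kmap f c) = (kext (\<lambda>x. g (f x)) c :: 'b \<Rightarrow>\<^sub>0 bit)"
  by (simp add: kmap_def kext_kext)

lemma kmap_kmap: "kmap g (kmap f c) = kmap (\<lambda>x. g (f x)) c"
  by (simp add: kmap_def kext_kext)

lemma kmap_cong:
  "(\<And>x. x \<in> supp c \<Longrightarrow> f x = g x) \<Longrightarrow> kmap f c = kmap g c"
  unfolding kmap_def by (rule kext_cong) simp

lemma kmap_eq_self: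
  "(\<And>x. x \<in> supp c \<Longrightarrow> f x = x) \<Longrightarrow> kmap f c = c"
  using kmap_cong [of c f "\<lambda>x. x"] by (simp add: kmap_def kext_kgen_id)

lemma keys_plus_subset:
  "supp c \<subseteq> S \<Longrightarrow> supp d \<subseteq> S \<Longrightarrow>
   supp (c + d :: 'a \<Rightarrow>\<^sub>0 bit) \<subseteq> S"
  by (auto simp: keys_add_bit)

lemma keys_sum_subset:
  "(\<And>i. i \<in> I \<Longrightarrow> supp (c i) \<subseteq> S) \<Longrightarrow>
   supp (\<Sum>i\<in>I. c i :: 'a \<Rightarrow>\<^sub>0 bit) \<subseteq> S"
  by (induction I rule: infinite_finite_induct) (auto simp: keys_add_bit)

lemma keys_kext_subset:
  "(\<And>x. x \<in> supp c \<Longrightarrow> supp (f x :: 'b \<Rightarrow>\<^sub>0 bit) \<subseteq> S) \<Longrightarrow>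
   supp (kext f c) \<subseteq> S"
  unfolding kext_def by (rule keys_sum_subset) auto

lemma keys_kmap_subset:
  "f ` supp c \<subseteq> S \<Longrightarrow> supp (kmap f c) \<subseteq> S"
  unfolding kmap_def by (rule keys_kext_subset) auto

text \<open>Over the two-element field every double sum over pairs that come in equal couples
  vanishes; this is the one computation behind all identities \<open>\<partial>\<partial> = 0\<close>, for faces and for cofaces.\<close>

lemma double_sum_cancel:
  fixes f :: "nat \<Rightarrow> nat \<Rightarrow> 'a \<Rightarrow>\<^sub>0 bit"
  assumes "\<And>i j. i < j \<Longrightarrow> j \<le> Suc n \<Longrightarrow> f i j = f (j - 1) i"
  shows "(\<Sum>j\<le>Suc n. \<Sum>i\<le>n. f i j) = 0"
proof -
  let ?A = "{(j, i). j \<le> Suc n \<and> i \<le> n \<and> i < j}" and ?B = "{(j, i). j \<le> Suc n \<and> i \<le> n \<and> j \<le> i}"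
  have fin: "finite ({..Suc n} \<times> {..n})" by simp
  have fA: "finite ?A" and fB: "finite ?B"
    by (rule finite_subset [OF _ fin], auto)+
  have "(\<Sum>j\<le>Suc n. \<Sum>i\<le>n. f i j) = (\<Sum>(j, i)\<in>{..Suc n} \<times> {..n}. f i j)"
    by (simp add: sum.cartesian_product)
  also have "{..Suc n} \<times> {..n} = ?A \<union> ?B" by auto
  also have "(\<Sum>(j, i)\<in>?A \<union> ?B. f i j) = (\<Sum>(j, i)\<in>?A. f i j) + (\<Sum>(j, i)\<in>?B. f i j)"
    by (rule sum.union_disjoint [OF fA fB]) auto
  \<comment> \<open>\<open>(j, i)\<close> with \<open>i < j\<close> corresponds to \<open>(i, j - 1)\<close>, so the two halves of the square have equal sums.\<close>
  also have "(\<Sum>(j, i)\<in>?A. f i j) = (\<Sum>(j, i)\<in>?B. f i j)"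
    by (rule sum.reindex_bij_witness [of _ "\<lambda>(j, i). (Suc i, j)" "\<lambda>(j, i). (i, j - 1)"])
       (auto simp: assms)
  finally show ?thesis by simp
qed

section \<open>The shuffles of two fundamental simplices\<close>

definition del :: "nat \<Rightarrow> 'a list \<Rightarrow> 'a list" where
  "del t l = take t l @ drop (Suc t) l"

text \<open>The coface that misses \<open>j\<close>, as a function on all natural numbers: operators then need no bound on
  their target, and the identities between them hold without side conditions on dimensions.\<close>

definition skip :: "nat \<Rightarrow> nat \<Rightarrow> nat" where
  "skip j x = (if x < j then x else Suc x)"

abbreviation push :: "nat \<Rightarrow> nat \<Rightarrow> nat list \<times> nat list \<Rightarrow> nat list \<times> nat list" where
  "push x y \<equiv> (\<lambda>(\<alpha>, \<beta>). (\<alpha> @ [x], \<beta> @ [y]))"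

text \<open>A shuffle is a lattice path from \<open>(0, 0)\<close> to \<open>(a, b)\<close>, here the pair of its coordinate lists.  The
  recursion splits off the last step; it is better suited to computing faces than the sum over subsets
  in the definition of the shuffle map, to which \<open>shuf_eq_shufs\<close> relates it.\<close>

fun shuf :: "nat \<Rightarrow> nat \<Rightarrow> nat list \<times> nat list \<Rightarrow>\<^sub>0 bit" where
  "shuf 0 0 = kgen ([0], [0])"
| "shuf (Suc a) 0 = kmap (push (Suc a) 0) (shuf a 0)"
| "shuf 0 (Suc b) = kmap (push 0 (Suc b)) (shuf 0 b)"
| "shuf (Suc a) (Suc b) = kmap (push (Suc a) (Suc b)) (shuf a (Suc b) + shuf (Suc a) b)"

definition shufs :: "nat \<Rightarrow> nat \<Rightarrow> nat list \<times> nat list \<Rightarrow>\<^sub>0 bit" where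
  "shufs N a = (\<Sum>\<mu> | \<mu> \<subseteq> {..<N} \<and> card \<mu> = a. kgen (step_op N \<mu>, step_op N ({..<N} - \<mu>)))"

lemma step_op_Suc: "step_op (Suc N) \<mu> = step_op N \<mu> @ [card {k \<in> \<mu>. k < Suc N}]"
  by (simp add: step_op_def)

lemma step_op_cong:
  assumes "\<And>k. k < N \<Longrightarrow> k \<in> \<mu> \<longleftrightarrow> k \<in> \<nu>"
  shows "step_op N \<mu> = step_op N \<nu>"
  unfolding step_op_def
proof (rule map_cong [OF refl])
  fix i assume "i \<in> set [0..<Suc N]"
  then have "{k \<in> \<mu>. k < i} = {k \<in> \<nu>. k < i}" using assms by auto
  then show "card {k \<in> \<mu>. k < i} = card {k \<in> \<nu>. k < i}" by (rule arg_cong)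
qed

lemma shufs_0: "shufs 0 0 = kgen ([0], [0])"
proof -
  have "{\<mu> :: nat set. \<mu> \<subseteq> {..<0} \<and> card \<mu> = 0} = {{}}" by auto
  then show ?thesis by (simp add: shufs_def step_op_def)
qed

lemma shufs_large: "N < a \<Longrightarrow> shufs N a = 0"
proof -
  assume "N < a"
  then have "\<not> (\<mu> \<subseteq> {..<N} \<and> card \<mu> = a)" for \<mu>
    using card_mono [of "{..<N}" \<mu>] by auto
  then have e: "{\<mu>. \<mu> \<subseteq> {..<N} \<and> card \<mu> = a} = {}"
    by blast
  show ?thesis unfolding shufs_def e by simp
qed

text \<open>A subset that contains \<open>N\<close> is a path whose last step is in the first coordinate; removing \<open>N\<close> from the
  subset takes that step off the path.\<close>

lemma shufs_in:
  "(\<Sum>\<mu> | \<mu> \<subseteq> {..<Suc N} \<and> card \<mu> = Suc a \<and> N \<in> \<mu>.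
      kgen (step_op (Suc N) \<mu>, step_op (Suc N) ({..<Suc N} - \<mu>))) =
   kmap (push (Suc a) (N - a)) (shufs N a)"
  unfolding shufs_def kmap_sum
proof (rule sum.reindex_bij_witness [of _ "insert N" "\<lambda>\<mu>. \<mu> - {N}"], goal_cases)
  case (5 \<mu>)
  let ?\<nu> = "\<mu> - {N}"
  have fin: "finite \<mu>" using 5 finite_subset by blast
  have c: "card ?\<nu> = a" using 5 fin by simp
  have s: "?\<nu> \<subseteq> {..<N}" using 5 by auto
  have e1: "{k \<in> \<mu>. k < Suc N} = \<mu>" and e2: "{k \<in> {..<Suc N} - \<mu>. k < Suc N} = {..<N} - ?\<nu>"
    using 5 by (auto simp: less_Suc_eq)
  have e3: "card ({..<N} - ?\<nu>) = N - a" using c s card_Diff_subset [of ?\<nu> "{..<N}"] fin by simp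
  have "step_op N \<mu> = step_op N ?\<nu>" by (rule step_op_cong) auto
  moreover have "step_op N ({..<Suc N} - \<mu>) = step_op N ({..<N} - ?\<nu>)" by (rule step_op_cong) auto
  ultimately have "step_op (Suc N) ({..<Suc N} - \<mu>) = step_op N ({..<N} - ?\<nu>) @ [N - a]"
    "step_op (Suc N) \<mu> = step_op N ?\<nu> @ [Suc a]"
    using 5 by (simp_all only: step_op_Suc e1 e2 e3 mem_Collect_eq)
  then show ?case by simp
next
  case (4 \<mu>)
  then have "finite \<mu>" using finite_subset finite_lessThan by blast
  with 4 show ?case by (auto simp: card_insert_if)
next
  case (2 \<mu>)
  then have "finite \<mu>" using finite_subset finite_lessThan by blast
  with 2 show ?case by (auto simp: less_Suc_eq)
qed auto

lemma shufs_out: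
  "(\<Sum>\<mu> | \<mu> \<subseteq> {..<Suc N} \<and> card \<mu> = a \<and> N \<notin> \<mu>.
      kgen (step_op (Suc N) \<mu>, step_op (Suc N) ({..<Suc N} - \<mu>))) =
   kmap (push a (Suc N - a)) (shufs N a)"
  unfolding shufs_def kmap_sum
proof (rule sum.reindex_bij_witness [of _ "\<lambda>\<mu>. \<mu>" "\<lambda>\<mu>. \<mu>"], goal_cases)
  case (5 \<mu>)
  have s: "\<mu> \<subseteq> {..<N}" using 5 by (auto simp: less_Suc_eq)
  have e1: "{k \<in> \<mu>. k < Suc N} = \<mu>" and e2: "{k \<in> {..<Suc N} - \<mu>. k < Suc N} = {..<Suc N} - \<mu>"
    using 5 by auto
  have "finite \<mu>" using s finite_subset finite_lessThan by blast
  then have e3: "card ({..<Suc N} - \<mu>) = Suc N - a"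
    using 5 card_Diff_subset [of \<mu> "{..<Suc N}"] by simp
  have "step_op N ({..<Suc N} - \<mu>) = step_op N ({..<N} - \<mu>)" by (rule step_op_cong) auto
  then have "step_op (Suc N) ({..<Suc N} - \<mu>) = step_op N ({..<N} - \<mu>) @ [Suc N - a]"
    by (simp only: step_op_Suc e2 e3)
  moreover have "step_op (Suc N) \<mu> = step_op N \<mu> @ [a]"
    using 5 by (simp add: step_op_Suc e1)
  ultimately show ?case by simp
qed (auto simp: less_Suc_eq)

lemma shufs_split:
  "shufs N a = (\<Sum>\<mu> | \<mu> \<subseteq> {..<N} \<and> card \<mu> = a \<and> P \<mu>. kgen (step_op N \<mu>, step_op N ({..<N} - \<mu>))) +
     (\<Sum>\<mu> | \<mu> \<subseteq> {..<N} \<and> card \<mu> = a \<and> \<not> P \<mu>. kgen (step_op N \<mu>, step_op N ({..<N} - \<mu>)))"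
proof -
  have fin: "finite {\<mu>. \<mu> \<subseteq> {..<N} \<and> Q \<mu>}" for Q
    by (rule finite_subset [of _ "Pow {..<N}"]) auto
  have "{\<mu>. \<mu> \<subseteq> {..<N} \<and> card \<mu> = a} =
      {\<mu>. \<mu> \<subseteq> {..<N} \<and> card \<mu> = a \<and> P \<mu>} \<union> {\<mu>. \<mu> \<subseteq> {..<N} \<and> card \<mu> = a \<and> \<not> P \<mu>}" by auto
  then have "shufs N a = (\<Sum>\<mu> \<in> {\<mu>. \<mu> \<subseteq> {..<N} \<and> card \<mu> = a \<and> P \<mu>} \<union>
      {\<mu>. \<mu> \<subseteq> {..<N} \<and> card \<mu> = a \<and> \<not> P \<mu>}. kgen (step_op N \<mu>, step_op N ({..<N} - \<mu>)))"
    unfolding shufs_def by (rule arg_cong)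
  also note sum.union_disjoint [OF fin fin]
  finally show ?thesis by auto
qed

lemma shufs_Suc_Suc:
  "shufs (Suc N) (Suc a) = kmap (push (Suc a) (N - a)) (shufs N a + shufs N (Suc a))"
  unfolding shufs_split [where P = "\<lambda>\<mu>. N \<in> \<mu>" and N = "Suc N"]
  by (simp only: shufs_in shufs_out kmap_add diff_Suc_Suc)

lemma shufs_Suc_0: "shufs (Suc N) 0 = kmap (push 0 (Suc N)) (shufs N 0)"
proof -
  have e: "{\<mu>. \<mu> \<subseteq> {..<Suc N} \<and> card \<mu> = 0 \<and> N \<in> \<mu>} = {}"
    using finite_subset [OF _ finite_lessThan] by (auto simp: card_eq_0_iff)
  show ?thesis
    unfolding shufs_split [where P = "\<lambda>\<mu>. N \<in> \<mu>" and N = "Suc N"] e shufs_out by simp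
qed

lemma shuf_eq_shufs: "shuf a b = shufs (a + b) a"
proof (induction a b rule: shuf.induct)
  case 1
  show ?case by (simp add: shufs_0)
next
  case (2 a)
  have "shufs (Suc a) (Suc a) = kmap (push (Suc a) 0) (shufs a a)"
    using shufs_Suc_Suc [of a a] by (simp add: shufs_large)
  with 2 show ?case by simp
next
  case (3 b)
  with shufs_Suc_0 [of b] show ?case by simp
next
  case (4 a b)
  have "shufs (Suc (a + Suc b)) (Suc a) =
      kmap (push (Suc a) (Suc b)) (shufs (a + Suc b) a + shufs (a + Suc b) (Suc a))"
    using shufs_Suc_Suc [of "a + Suc b" a] by simp
  moreover have "shufs (a + Suc b) (Suc a) = shuf (Suc a) b"
    using 4(2) by simp
  moreover have "shufs (a + Suc b) a = shuf a (Suc b)"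
    using 4(1) by simp
  ultimately show ?case by simp
qed

text \<open>By the last two conclusions each coordinate passes from \<open>i\<close> to \<open>i + 1\<close> at a step that leaves the other one
  unchanged.  This is why products with a degenerate simplex are degenerate.\<close>

lemma shuf_keys:
  assumes "z \<in> supp (shuf a b)"
  obtains \<alpha> \<beta> where "z = (\<alpha>, \<beta>)" "simplex_op (a + b) a \<alpha>" "simplex_op (a + b) b \<beta>"
    "\<alpha> ! (a + b) = a" "\<beta> ! (a + b) = b"
    "\<And>i. i < a \<Longrightarrow> \<exists>t<a + b. \<alpha> ! t = i \<and> \<alpha> ! Suc t = Suc i \<and> \<beta> ! t = \<beta> ! Suc t"
    "\<And>i. i < b \<Longrightarrow> \<exists>t<a + b. \<beta> ! t = i \<and> \<beta> ! Suc t = Suc i \<and> \<alpha> ! t = \<alpha> ! Suc t"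
proof -
  define inc where "inc N \<gamma> \<delta> i \<longleftrightarrow> (\<exists>t<N. \<gamma> ! t = i \<and> \<gamma> ! Suc t = Suc i \<and> \<delta> ! t = \<delta> ! Suc t)"
    for N i and \<gamma> \<delta> :: "nat list"
  define good where "good a b z \<longleftrightarrow> (\<exists>\<alpha> \<beta>. z = (\<alpha>, \<beta>) \<and> simplex_op (a + b) a \<alpha> \<and>
     simplex_op (a + b) b \<beta> \<and> \<alpha> ! (a + b) = a \<and> \<beta> ! (a + b) = b \<and>
     (\<forall>i<a. inc (a + b) \<alpha> \<beta> i) \<and> (\<forall>i<b. inc (a + b) \<beta> \<alpha> i))"
    for a b and z :: "nat list \<times> nat list"
  have snoc: "simplex_op (Suc N) x (\<gamma> @ [x])" if "simplex_op N y \<gamma>" "y \<le> x" for N x y \<gamma>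
    using that by (auto simp: simplex_op_def sorted_append)
  have extend: "inc (Suc N) (\<gamma> @ [x]) (\<delta> @ [y]) i"
    if "inc N \<gamma> \<delta> i" "length \<gamma> = Suc N" "length \<delta> = Suc N" for N x y i \<gamma> \<delta>
  proof -
    from that(1) obtain t where t: "t < N" "\<gamma> ! t = i \<and> \<gamma> ! Suc t = Suc i \<and> \<delta> ! t = \<delta> ! Suc t"
      unfolding inc_def by blast
    then show ?thesis using that(2,3) unfolding inc_def by (intro exI [of _ t]) (simp add: nth_append)
  qed
  have new: "inc (Suc N) (\<gamma> @ [Suc i]) (\<delta> @ [y]) i"
    if "\<gamma> ! N = i" "\<delta> ! N = y" "length \<gamma> = Suc N" "length \<delta> = Suc N" for N y i \<gamma> \<delta>
    using that unfolding inc_def by (intro exI [of _ N]) (simp add: nth_append)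
  have left: "good (Suc a) b (push (Suc a) b z)" if g: "good a b z" for a b z
  proof -
    obtain \<alpha> \<beta> where z: "z = (\<alpha>, \<beta>)" and so: "simplex_op (a + b) a \<alpha>" "simplex_op (a + b) b \<beta>"
      and l: "\<alpha> ! (a + b) = a" "\<beta> ! (a + b) = b"
      and i: "\<forall>i<a. inc (a + b) \<alpha> \<beta> i" "\<forall>i<b. inc (a + b) \<beta> \<alpha> i"
      using g unfolding good_def by blast
    have len: "length \<alpha> = Suc (a + b)" "length \<beta> = Suc (a + b)"
      using so by (simp_all add: simplex_op_def)
    have "inc (Suc (a + b)) (\<alpha> @ [Suc a]) (\<beta> @ [b]) i" if "i < Suc a" for i
      using that i(1) extend [OF _ len] new [OF l len] less_Suc_eq by metis
    moreover have "inc (Suc (a + b)) (\<beta> @ [b]) (\<alpha> @ [Suc a]) i" if "i < b" for i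
      using that i(2) extend len by blast
    ultimately show ?thesis
      using z so len by (simp add: good_def snoc nth_append)
  qed
  have right: "good a (Suc b) (push a (Suc b) z)" if g: "good a b z" for a b z
  proof -
    obtain \<alpha> \<beta> where z: "z = (\<alpha>, \<beta>)" and so: "simplex_op (a + b) a \<alpha>" "simplex_op (a + b) b \<beta>"
      and l: "\<alpha> ! (a + b) = a" "\<beta> ! (a + b) = b"
      and i: "\<forall>i<a. inc (a + b) \<alpha> \<beta> i" "\<forall>i<b. inc (a + b) \<beta> \<alpha> i"
      using g unfolding good_def by blast
    have len: "length \<alpha> = Suc (a + b)" "length \<beta> = Suc (a + b)"
      using so by (simp_all add: simplex_op_def)
    have "inc (Suc (a + b)) (\<beta> @ [Suc b]) (\<alpha> @ [a]) i" if "i < Suc b" for i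
      using that i(2) extend [OF _ len(2,1)] new [OF l(2,1) len(2,1)] less_Suc_eq by metis
    moreover have "inc (Suc (a + b)) (\<alpha> @ [a]) (\<beta> @ [Suc b]) i" if "i < a" for i
      using that i(1) extend len by blast
    ultimately show ?thesis
      using z so len by (simp add: good_def snoc nth_append)
  qed
  have "\<forall>z\<in>supp (shuf a b). good a b z"
  proof (induction a b rule: shuf.induct)
    case 1
    show ?case by (simp add: good_def simplex_op_def)
  next
    case (2 a)
    have "supp (shuf (Suc a) 0) \<subseteq> {z. good (Suc a) 0 z}"
      unfolding shuf.simps by (rule keys_kmap_subset) (use 2 left in blast)
    then show ?case by blast
  next
    case (3 b)
    have "supp (shuf 0 (Suc b)) \<subseteq> {z. good 0 (Suc b) z}"
      unfolding shuf.simps by (rule keys_kmap_subset) (use 3 right in blast)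
    then show ?case by blast
  next
    case (4 a b)
    have "supp (shuf (Suc a) (Suc b)) \<subseteq> {z. good (Suc a) (Suc b) z}"
      unfolding shuf.simps kmap_add
      by (intro keys_plus_subset keys_kmap_subset) (use 4 left right in blast)+
    then show ?case by blast
  qed
  with assms have "good a b z" by blast
  then show thesis unfolding good_def inc_def using that by blast
qed

lemma del_map: "del t (map f l) = map f (del t l)"
  by (simp add: del_def take_map drop_map)

lemma del_push: "t < length l \<Longrightarrow> del t (l @ [x]) = del t l @ [x]"
  by (simp add: del_def)

definition faces2 :: "nat \<Rightarrow> (nat list \<times> nat list \<Rightarrow>\<^sub>0 bit) \<Rightarrow> nat list \<times> nat list \<Rightarrow>\<^sub>0 bit" where
  "faces2 N c = (\<Sum>t\<le>N. kmap (\<lambda>(\<alpha>, \<beta>). (del t \<alpha>, del t \<beta>)) c)"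

lemma faces2_add: "faces2 N (c + d) = faces2 N c + faces2 N d"
  by (simp add: faces2_def kmap_add sum.distrib)

text \<open>Appending a vertex is a cone, hence a contraction of the augmented complex.\<close>

lemma faces2_push:
  assumes "\<And>\<alpha> \<beta>. (\<alpha>, \<beta>) \<in> supp c \<Longrightarrow> length \<alpha> = Suc N \<and> length \<beta> = Suc N"
  shows "faces2 (Suc N) (kmap (push x y) c) = c + kmap (push x y) (faces2 N c)"
proof -
  have "kmap (\<lambda>(\<alpha>, \<beta>). (del (Suc N) \<alpha>, del (Suc N) \<beta>)) (kmap (push x y) c) = c"
    unfolding kmap_kmap
  proof (rule kmap_eq_self)
    fix z assume "z \<in> supp c"
    then show "(case push x y z of (\<alpha>, \<beta>) \<Rightarrow> (del (Suc N) \<alpha>, del (Suc N) \<beta>)) = z"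
      using assms by (cases z) (simp add: del_def)
  qed
  moreover have "kmap (\<lambda>(\<alpha>, \<beta>). (del t \<alpha>, del t \<beta>)) (kmap (push x y) c) =
      kmap (push x y) (kmap (\<lambda>(\<alpha>, \<beta>). (del t \<alpha>, del t \<beta>)) c)" if "t \<le> N" for t
    unfolding kmap_kmap
  proof (rule kmap_cong)
    fix z assume "z \<in> supp c"
    then show "(case push x y z of (\<alpha>, \<beta>) \<Rightarrow> (del t \<alpha>, del t \<beta>)) =
        push x y (case z of (\<alpha>, \<beta>) \<Rightarrow> (del t \<alpha>, del t \<beta>))"
      using assms that by (cases z) (simp add: del_push)
  qed
  ultimately show ?thesis
    by (simp add: faces2_def kmap_sum add.commute)
qed

definition cofaces_left :: "nat \<Rightarrow> (nat list \<times> nat list \<Rightarrow>\<^sub>0 bit) \<Rightarrow> nat list \<times> nat list \<Rightarrow>\<^sub>0 bit" where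
  "cofaces_left a c = (\<Sum>j\<le>a. kmap (\<lambda>(\<alpha>, \<beta>). (map (skip j) \<alpha>, \<beta>)) c)"

definition cofaces_right :: "nat \<Rightarrow> (nat list \<times> nat list \<Rightarrow>\<^sub>0 bit) \<Rightarrow> nat list \<times> nat list \<Rightarrow>\<^sub>0 bit" where
  "cofaces_right b c = (\<Sum>j\<le>b. kmap (\<lambda>(\<alpha>, \<beta>). (\<alpha>, map (skip j) \<beta>)) c)"

lemma cofaces_left_add: "cofaces_left a (c + d) = cofaces_left a c + cofaces_left a d"
  by (simp add: cofaces_left_def kmap_add sum.distrib)

lemma cofaces_right_add: "cofaces_right b (c + d) = cofaces_right b c + cofaces_right b d"
  by (simp add: cofaces_right_def kmap_add sum.distrib)

lemma cofaces_left_push: "cofaces_left a (kmap (push a y) c) = kmap (push (Suc a) y) (cofaces_left a c)"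
  by (simp add: cofaces_left_def kmap_sum kmap_kmap case_prod_beta skip_def)

lemma cofaces_right_push: "cofaces_right b (kmap (push x b) c) = kmap (push x (Suc b)) (cofaces_right b c)"
  by (simp add: cofaces_right_def kmap_sum kmap_kmap case_prod_beta skip_def)

text \<open>The additional coface \<open>d\<^bsup>a+1\<^esup>\<close> misses the vertex \<open>a + 1\<close>, which does not occur: it acts as the
  identity.\<close>

lemma cofaces_left_Suc: "cofaces_left (Suc a) (shuf a b) = cofaces_left a (shuf a b) + shuf a b"
proof -
  have "kmap (\<lambda>(\<alpha>, \<beta>). (map (skip (Suc a)) \<alpha>, \<beta>)) (shuf a b) = shuf a b"
    by (rule kmap_eq_self) (erule shuf_keys, auto simp: skip_def simplex_op_def intro!: map_idI)
  then show ?thesis by (simp add: cofaces_left_def)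
qed

lemma cofaces_right_Suc: "cofaces_right (Suc b) (shuf a b) = cofaces_right b (shuf a b) + shuf a b"
proof -
  have "kmap (\<lambda>(\<alpha>, \<beta>). (\<alpha>, map (skip (Suc b)) \<beta>)) (shuf a b) = shuf a b"
    by (rule kmap_eq_self) (erule shuf_keys, auto simp: skip_def simplex_op_def intro!: map_idI)
  then show ?thesis by (simp add: cofaces_right_def)
qed

text \<open>The universal case of the statement that the shuffle map is a chain map.  Both sides satisfy
  the same recursion; the two summands of the recursion for \<open>shuf\<close> have a common face
  \<open>shuf a b\<close> opposite to the penultimate vertex, and these two cancel.\<close>

lemma faces2_shuf:
  "faces2 (a + b) (shuf a b) =
     (if a = 0 then 0 else cofaces_left a (shuf (a - 1) b)) + (if b = 0 then 0 else cofaces_right b (shuf a (b - 1))) +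
     (if a = 0 \<and> b = 0 then kgen ([], []) else 0)"
proof (induction a b rule: shuf.induct)
  case 1
  show ?case by (simp add: faces2_def del_def)
next
  case (2 a)
  have len: "(\<alpha>, \<beta>) \<in> supp (shuf a 0) \<Longrightarrow> length \<alpha> = Suc a \<and> length \<beta> = Suc a" for \<alpha> \<beta>
    by (erule shuf_keys) (simp add: simplex_op_def)
  have "cofaces_left a (shuf a 0) = kmap (push (Suc a) 0)
      ((if a = 0 then 0 else cofaces_left a (shuf (a - 1) 0)) + (if a = 0 then kgen ([], []) else 0))"
  proof (cases a)
    case 0
    then show ?thesis by (simp add: cofaces_left_def skip_def)
  next
    case (Suc a')
    then show ?thesis using cofaces_left_push [of a 0 "shuf a' 0"] by simp
  qed
  with 2 show ?case
    by (simp add: faces2_push [OF len] cofaces_left_Suc add.commute)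
next
  case (3 b)
  have len: "(\<alpha>, \<beta>) \<in> supp (shuf 0 b) \<Longrightarrow> length \<alpha> = Suc b \<and> length \<beta> = Suc b" for \<alpha> \<beta>
    by (erule shuf_keys) (simp add: simplex_op_def)
  have "cofaces_right b (shuf 0 b) = kmap (push 0 (Suc b))
      ((if b = 0 then 0 else cofaces_right b (shuf 0 (b - 1))) + (if b = 0 then kgen ([], []) else 0))"
  proof (cases b)
    case 0
    then show ?thesis by (simp add: cofaces_right_def skip_def)
  next
    case (Suc b')
    then show ?thesis using cofaces_right_push [of b 0 "shuf 0 b'"] by simp
  qed
  with 3 show ?case
    by (simp add: faces2_push [OF len] cofaces_right_Suc add.commute)
next
  case (4 a b)
  have len: "(\<alpha>, \<beta>) \<in> supp (shuf a (Suc b) + shuf (Suc a) b) \<Longrightarrow>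
      length \<alpha> = Suc (Suc (a + b)) \<and> length \<beta> = Suc (Suc (a + b))" for \<alpha> \<beta>
    unfolding keys_add_bit by (auto elim!: shuf_keys simp: simplex_op_def)
  define A B where "A = shuf a (Suc b)" and "B = shuf (Suc a) b"
  have l: "cofaces_left a A = kmap (push (Suc a) (Suc b))
      ((if a = 0 then 0 else cofaces_left a (shuf (a - 1) (Suc b))) + cofaces_left a (shuf a b))"
  proof (cases a)
    case 0
    then show ?thesis using cofaces_left_push [of 0 "Suc b" "shuf 0 b"] by (simp add: A_def)
  next
    case (Suc a')
    then show ?thesis using cofaces_left_push [of a "Suc b" "shuf a' (Suc b) + shuf a b"]
      by (simp add: A_def cofaces_left_add)
  qed
  have r: "cofaces_right b B = kmap (push (Suc a) (Suc b))
      (cofaces_right b (shuf a b) + (if b = 0 then 0 else cofaces_right b (shuf (Suc a) (b - 1))))"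
  proof (cases b)
    case 0
    then show ?thesis using cofaces_right_push [of 0 "Suc a" "shuf a 0"] by (simp add: B_def)
  next
    case (Suc b')
    then show ?thesis using cofaces_right_push [of b "Suc a" "shuf a b + shuf (Suc a) b'"]
      by (simp add: B_def cofaces_right_add)
  qed
  \<comment> \<open>The summand \<open>shuf a b\<close> of \<open>fA\<close> and of \<open>fB\<close> is the common face mentioned above.\<close>
  have fA: "faces2 (Suc (a + b)) A = (if a = 0 then 0 else cofaces_left a (shuf (a - 1) (Suc b))) +
      (cofaces_right b (shuf a b) + shuf a b)"
    using 4(1) by (simp add: A_def cofaces_right_Suc)
  have fB: "faces2 (Suc (a + b)) B = (cofaces_left a (shuf a b) + shuf a b) +
      (if b = 0 then 0 else cofaces_right b (shuf (Suc a) (b - 1)))"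
    using 4(2) by (simp add: B_def cofaces_left_Suc)
  have AB: "shuf (Suc a) (Suc b) = kmap (push (Suc a) (Suc b)) (A + B)"
    by (simp add: A_def B_def)
  have "faces2 (Suc a + Suc b) (shuf (Suc a) (Suc b)) =
      (A + B) + kmap (push (Suc a) (Suc b)) (faces2 (Suc (a + b)) A + faces2 (Suc (a + b)) B)"
    unfolding AB using faces2_push [OF len, folded A_def B_def] by (simp add: faces2_add)
  also have "\<dots> = (cofaces_left a A + A) + (cofaces_right b B + B)"
    unfolding fA fB l r by (simp add: kmap_add ac_simps)
  also have "\<dots> = cofaces_left (Suc a) (shuf a (Suc b)) + cofaces_right (Suc b) (shuf (Suc a) b)"
    unfolding A_def B_def cofaces_left_Suc cofaces_right_Suc ..
  finally show ?case by simp
qed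

section \<open>Simplicial sets and their chains\<close>

declare One_nat_def [simp del]

text \<open>The codegeneracy that takes the value \<open>i\<close> twice, again on all natural numbers.\<close>

definition collapse :: "nat \<Rightarrow> nat \<Rightarrow> nat" where
  "collapse i x = (if x \<le> i then x else x - 1)"

lemma coface_conv: "i \<le> n \<Longrightarrow> coface n i = map (skip i) [0..<n]"
  by (rule nth_equalityI) (auto simp: coface_def skip_def nth_append)

lemma codegen_conv: "i \<le> n \<Longrightarrow> codegen n i = map (collapse i) [0..<Suc (Suc n)]"
proof (rule nth_equalityI)
  fix s assume i: "i \<le> n" and "s < length (codegen n i)"
  then have s: "s < Suc (Suc n)" by (auto simp: codegen_def)
  show "codegen n i ! s = map (collapse i) [0..<Suc (Suc n)] ! s"
  proof (cases "s \<le> i")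
    case True
    with s show ?thesis by (simp add: codegen_def collapse_def nth_append del: upt_Suc)
  next
    case False
    then obtain k where "s = Suc (i + k)" using less_imp_Suc_add [of i s] by auto
    with s i show ?thesis by (simp add: codegen_def collapse_def nth_append del: upt_Suc)
  qed
qed (simp add: codegen_def)

lemma map_nth_upt: "set \<phi> \<subseteq> {..<n} \<Longrightarrow> map ((!) (map f [0..<n])) \<phi> = map f \<phi>"
  by (rule map_cong) auto

lemma map_coface: "i \<le> n \<Longrightarrow> set \<phi> \<subseteq> {..<n} \<Longrightarrow> map ((!) (coface n i)) \<phi> = map (skip i) \<phi>"
  by (simp add: coface_conv map_nth_upt)

lemma map_codegen:
  "i \<le> n \<Longrightarrow> set \<phi> \<subseteq> {..Suc n} \<Longrightarrow> map ((!) (codegen n i)) \<phi> = map (collapse i) \<phi>"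
  unfolding codegen_conv by (rule map_nth_upt) auto

lemma simplex_op_map:
  assumes "simplex_op m n \<phi>" "mono f" "\<And>x. x \<le> n \<Longrightarrow> f x \<le> k"
  shows "simplex_op m k (map f \<phi>)"
  using assms by (auto simp: simplex_op_def sorted_wrt_map mono_def intro: sorted_wrt_mono_rel)

lemma mono_skip: "mono (skip i)" and mono_collapse: "mono (collapse i)"
  by (auto simp: mono_def skip_def collapse_def)

lemma simplex_op_id: "simplex_op n n [0..<Suc n]"
  by (auto simp: simplex_op_def simp del: upt_Suc)

lemma simplex_op_coface: "i \<le> Suc n \<Longrightarrow> simplex_op n (Suc n) (coface (Suc n) i)"
  unfolding coface_conv by (rule simplex_op_map [OF simplex_op_id mono_skip]) (auto simp: skip_def)

lemma simplex_op_coface': "i \<le> n \<Longrightarrow> 0 < n \<Longrightarrow> simplex_op (n - 1) n (coface n i)"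
  using simplex_op_coface [of i "n - 1"] by simp

lemma simplex_op_codegen: "i \<le> n \<Longrightarrow> simplex_op (Suc n) n (codegen n i)"
  unfolding codegen_conv by (rule simplex_op_map [OF simplex_op_id mono_collapse]) (auto simp: collapse_def)

lemma simplex_op_codegen': "i < n \<Longrightarrow> simplex_op n (n - 1) (codegen (n - 1) i)"
  using simplex_op_codegen [of i "n - 1"] by simp

lemma simplex_op_comp:
  assumes "simplex_op m n \<theta>" "simplex_op l m \<phi>"
  shows "simplex_op l n (map ((!) \<theta>) \<phi>)"
proof -
  have "\<theta> ! x \<le> \<theta> ! y" if "x \<in> set \<phi>" "y \<in> set \<phi>" "x \<le> y" for x y
    using assms that by (auto simp: simplex_op_def intro!: sorted_nth_mono)
  then have "sorted_wrt (\<lambda>x y. \<theta> ! x \<le> \<theta> ! y) \<phi>"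
    using assms(2) unfolding simplex_op_def by (auto intro: sorted_wrt_mono_rel)
  moreover have "\<theta> ! x \<le> n" if "x \<in> set \<phi>" for x
  proof -
    have "x < length \<theta>" using that assms by (auto simp: simplex_op_def)
    then have "\<theta> ! x \<in> set \<theta>" by (rule nth_mem)
    with assms(1) show ?thesis by (auto simp: simplex_op_def)
  qed
  ultimately show ?thesis using assms
    by (auto simp: simplex_op_def sorted_wrt_map)
qed

lemma nth_del: "i < length l - 1 \<Longrightarrow> t < length l \<Longrightarrow> del t l ! i = l ! skip t i"
  by (auto simp: del_def skip_def nth_append)

lemma length_del: "t < length l \<Longrightarrow> length (del t l) = length l - 1"
  by (simp add: del_def)

lemma map_nth_coface:
  assumes "length \<theta> = Suc q" "t \<le> q"
  shows "map ((!) \<theta>) (coface q t) = del t \<theta>"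
  using assms by (intro nth_equalityI) (auto simp: coface_conv length_del nth_del)

lemma simplex_op_del:
  assumes "simplex_op (Suc q) n \<theta>" "t \<le> Suc q"
  shows "simplex_op q n (del t \<theta>)"
proof -
  have "length \<theta> = Suc (Suc q)" using assms(1) by (simp add: simplex_op_def)
  then show ?thesis
    using simplex_op_comp [OF assms(1) simplex_op_coface [OF assms(2)]] assms(2)
    by (simp only: map_nth_coface)
qed

text \<open>An operator that repeats a value factors through the corresponding codegeneracy.\<close>

lemma degenerate_factor:
  assumes "simplex_op q n \<theta>" "t < q" "\<theta> ! t = \<theta> ! Suc t"
  shows "simplex_op (q - 1) n (del (Suc t) \<theta>)"
    and "\<theta> = map ((!) (del (Suc t) \<theta>)) (codegen (q - 1) t)"
proof -
  show "simplex_op (q - 1) n (del (Suc t) \<theta>)"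
    using simplex_op_del [of "q - 1" n \<theta> "Suc t"] assms by simp
  have len: "length \<theta> = Suc q" using assms by (simp add: simplex_op_def)
  have c: "codegen (q - 1) t = map (collapse t) [0..<Suc q]"
    using assms(2) codegen_conv [of t "q - 1"] by simp
  show "\<theta> = map ((!) (del (Suc t) \<theta>)) (codegen (q - 1) t)"
  proof (rule nth_equalityI)
    fix s assume "s < length \<theta>"
    then have s: "s \<le> q" using len by simp
    have "collapse t s < length \<theta> - 1" using s assms(2) len by (auto simp: collapse_def)
    then have "del (Suc t) \<theta> ! collapse t s = \<theta> ! skip (Suc t) (collapse t s)"
      using assms(2) len by (simp add: nth_del)
    also have "\<dots> = \<theta> ! s"
      using assms(3) by (cases "s = Suc t") (auto simp: skip_def collapse_def)
    finally show "\<theta> ! s = map ((!) (del (Suc t) \<theta>)) (codegen (q - 1) t) ! s"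
      using s unfolding c by (simp del: upt_Suc)
  qed (simp add: c len)
qed

lemma sop_in:
  "simplicial_set X \<Longrightarrow> simplex_op m n \<theta> \<Longrightarrow> x \<in> smp X n \<Longrightarrow> sop X n \<theta> x \<in> smp X m"
  unfolding simplicial_set_def by blast

lemma sop_comp:
  "simplicial_set X \<Longrightarrow> simplex_op m n \<theta> \<Longrightarrow> simplex_op l m \<phi> \<Longrightarrow> x \<in> smp X n \<Longrightarrow>
   sop X m \<phi> (sop X n \<theta> x) = sop X n (map ((!) \<theta>) \<phi>) x"
  unfolding simplicial_set_def by metis

lemma smp_std [simp]: "smp (std n) m = {\<alpha>. simplex_op m n \<alpha>}"
  and sop_std [simp]: "sop (std n) m \<theta> \<alpha> = map ((!) \<alpha>) \<theta>"
  by (simp_all add: std_def)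

lemma simplicial_set_std: "simplicial_set (std n)"
  unfolding simplicial_set_def
proof (intro conjI allI impI ballI)
  fix l m k \<theta> \<phi> x
  assume so: "simplex_op m k \<theta> \<and> simplex_op l m \<phi>"
  then have "i < length \<theta>" if "i \<in> set \<phi>" for i
    using that by (auto simp: simplex_op_def)
  then show "sop (std n) k (map ((!) \<theta>) \<phi>) x = sop (std n) m \<phi> (sop (std n) k \<theta> x)"
    by simp
next
  fix k x assume "x \<in> smp (std n) k"
  then have "length x = Suc k" by (simp add: simplex_op_def)
  then show "sop (std n) k (id_op k) x = x"
    using map_nth [of x] by (simp add: id_op_def del: upt_Suc)
next
  fix m k \<theta> assume "simplex_op m k \<theta>"
  then show "sop (std n) k \<theta> ` smp (std n) k \<subseteq> smp (std n) m"
    using simplex_op_comp by auto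
qed

lemma smp_sprod [simp]: "smp (sprod X Y) q = smp X q \<times> smp Y q"
  and sop_sprod [simp]: "sop (sprod X Y) n \<theta> = map_prod (sop X n \<theta>) (sop Y n \<theta>)"
  by (simp_all add: sprod_def)

lemma simplicial_set_sprod: "simplicial_set X \<Longrightarrow> simplicial_set Y \<Longrightarrow> simplicial_set (sprod X Y)"
  unfolding simplicial_set_def by (auto simp: map_prod_def image_subset_iff)

definition simplicial_map :: "'a sset \<Rightarrow> 'b sset \<Rightarrow> (nat \<Rightarrow> 'a \<Rightarrow> 'b) \<Rightarrow> bool" where
  "simplicial_map X Y f \<longleftrightarrow> (\<forall>q. \<forall>x\<in>smp X q. f q x \<in> smp Y q) \<and>
     (\<forall>q r \<phi>. simplex_op r q \<phi> \<longrightarrow> (\<forall>x\<in>smp X q. f r (sop X q \<phi> x) = sop Y q \<phi> (f q x)))"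

lemma simplicial_mapD:
  assumes "simplicial_map X Y f" "x \<in> smp X q"
  shows "f q x \<in> smp Y q" "simplex_op r q \<phi> \<Longrightarrow> f r (sop X q \<phi> x) = sop Y q \<phi> (f q x)"
  using assms by (auto simp: simplicial_map_def)

definition fbd :: "'a sset \<Rightarrow> nat \<Rightarrow> ('a \<Rightarrow>\<^sub>0 bit) \<Rightarrow> 'a \<Rightarrow>\<^sub>0 bit" where
  "fbd X q c = (if q = 0 then 0 else \<Sum>i\<le>q. kmap (sop X q (coface q i)) c)"

definition dgn :: "'a sset \<Rightarrow> nat \<Rightarrow> 'a set" where
  "dgn X q = {sop X (q - 1) (codegen (q - 1) i) y | i y. i < q \<and> y \<in> smp X (q - 1)}"

lemma fbd_0 [simp]: "fbd X q 0 = 0"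
  by (simp add: fbd_def)

lemma fbd_add: "fbd X q (c + d) = fbd X q c + fbd X q d"
  by (simp add: fbd_def kmap_add sum.distrib)

lemma fbd_kext: "fbd X q (kext f c) = kext (\<lambda>x. fbd X q (f x)) c"
  by (simp add: fbd_def kmap_kext kext_Sum)

lemma fbd_sum: "fbd X q (\<Sum>i\<in>I. c i) = (\<Sum>i\<in>I. fbd X q (c i))"
  by (induction I rule: infinite_finite_induct) (simp_all add: fbd_add)

lemma bdry_S_chains: "bdry (S_chains X) q c = fbd X (nat q) c"
  by (simp add: normalized_def kfree_def fbd_def)

lemma chains_S_chains:
  "c \<in> chains (S_chains X) q \<longleftrightarrow> supp c \<subseteq> smp X (nat q) \<and> (q < 0 \<longrightarrow> c = 0)"
  by (auto simp: normalized_def kfree_def)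

lemma dgn_subset: "simplicial_set X \<Longrightarrow> dgn X q \<subseteq> smp X q"
  unfolding dgn_def by (auto intro!: sop_in simplex_op_codegen')

text \<open>In a free simplicial module the degenerate elements have a basis of degenerate simplices.\<close>

lemma nulls_S_chains:
  "nulls (S_chains (X :: 'a sset)) q = {c :: 'a \<Rightarrow>\<^sub>0 bit. supp c \<subseteq> dgn X (nat q)}"
proof (rule subset_antisym; rule subsetI)
  fix c assume "c \<in> nulls (S_chains X) q"
  then obtain a where c: "c = (\<Sum>i<nat q. kmap (sop X (nat q - 1) (codegen (nat q - 1) i)) (a i))"
    and a: "\<forall>i<nat q. supp (a i) \<subseteq> smp X (nat q - 1)"
    by (auto simp: normalized_def kfree_def)
  show "c \<in> {c :: 'a \<Rightarrow>\<^sub>0 bit. supp c \<subseteq> dgn X (nat q)}"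
    unfolding c mem_Collect_eq
    by (intro keys_sum_subset keys_kmap_subset) (use a in \<open>auto simp: dgn_def\<close>)
next
  fix c assume "c \<in> {c :: 'a \<Rightarrow>\<^sub>0 bit. supp c \<subseteq> dgn X (nat q)}"
  then have "\<forall>x\<in>supp c. \<exists>i y. i < nat q \<and> y \<in> smp X (nat q - 1) \<and>
      x = sop X (nat q - 1) (codegen (nat q - 1) i) y"
    unfolding dgn_def by blast
  then obtain I Y where IY: "\<And>x. x \<in> supp c \<Longrightarrow> I x < nat q \<and> Y x \<in> smp X (nat q - 1) \<and>
      x = sop X (nat q - 1) (codegen (nat q - 1) (I x)) (Y x)"
    by metis
  define a where "a i = (\<Sum>x | x \<in> supp c \<and> I x = i. kgen (Y x) :: 'a \<Rightarrow>\<^sub>0 bit)" for i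
  have "kmap (sop X (nat q - 1) (codegen (nat q - 1) i)) (a i) =
      (\<Sum>x | x \<in> supp c \<and> I x = i. kgen x)" for i
    unfolding a_def kmap_sum kmap_kgen by (rule sum.cong) (use IY in auto)
  then have "(\<Sum>i<nat q. kmap (sop X (nat q - 1) (codegen (nat q - 1) i)) (a i)) =
      (\<Sum>i<nat q. \<Sum>x | x \<in> supp c \<and> I x = i. kgen x)"
    by simp
  also have "\<dots> = (\<Sum>x\<in>supp c. kgen x)"
    by (rule sum.group) (use IY in auto)
  also have "\<dots> = c" by (rule chain_expand [symmetric])
  finally have "c = (\<Sum>i<nat q. kmap (sop X (nat q - 1) (codegen (nat q - 1) i)) (a i))" by simp
  moreover have "supp (a i) \<subseteq> smp X (nat q - 1)" for i
    unfolding a_def by (rule keys_sum_subset) (use IY in auto)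
  ultimately show "c \<in> nulls (S_chains X) q"
    by (auto simp: normalized_def kfree_def)
qed

lemma dgn_sop:
  assumes "simplicial_set X" "x \<in> smp X n" "simplex_op q n \<theta>" "t < q" "\<theta> ! t = \<theta> ! Suc t"
  shows "sop X n \<theta> x \<in> dgn X q"
proof -
  note f = degenerate_factor [OF assms(3-5)]
  have "sop X n \<theta> x = sop X (q - 1) (codegen (q - 1) t) (sop X n (del (Suc t) \<theta>) x)"
    using sop_comp [OF assms(1) f(1) simplex_op_codegen' [OF assms(4)] assms(2)]
    unfolding f(2) [symmetric] ..
  moreover have "sop X n (del (Suc t) \<theta>) x \<in> smp X (q - 1)"
    using sop_in [OF assms(1) f(1) assms(2)] .
  ultimately show ?thesis unfolding dgn_def using assms(4) by blast
qed

lemma dgn_pair: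
  assumes "simplicial_set X" "x \<in> smp X n" "simplex_op q n \<theta>" "\<theta> ! t = \<theta> ! Suc t"
    and "simplicial_set Y" "y \<in> smp Y m" "simplex_op q m \<phi>" "\<phi> ! t = \<phi> ! Suc t" "t < q"
  shows "(sop X n \<theta> x, sop Y m \<phi> y) \<in> dgn (sprod X Y) q"
proof -
  note f = degenerate_factor [OF assms(3,9,4)] and g = degenerate_factor [OF assms(7,9,8)]
  have 1: "sop X n \<theta> x = sop X (q - 1) (codegen (q - 1) t) (sop X n (del (Suc t) \<theta>) x)"
    using sop_comp [OF assms(1) f(1) simplex_op_codegen' [OF assms(9)] assms(2)]
    unfolding f(2) [symmetric] ..
  have 2: "sop Y m \<phi> y = sop Y (q - 1) (codegen (q - 1) t) (sop Y m (del (Suc t) \<phi>) y)"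
    using sop_comp [OF assms(5) g(1) simplex_op_codegen' [OF assms(9)] assms(6)]
    unfolding g(2) [symmetric] ..
  have "sop X n (del (Suc t) \<theta>) x \<in> smp X (q - 1)" "sop Y m (del (Suc t) \<phi>) y \<in> smp Y (q - 1)"
    by (rule sop_in [OF assms(1) f(1) assms(2)], rule sop_in [OF assms(5) g(1) assms(6)])
  then show ?thesis unfolding dgn_def mem_Collect_eq
    by (intro exI [of _ t] exI [of _ "(sop X n (del (Suc t) \<theta>) x, sop Y m (del (Suc t) \<phi>) y)"])
       (use assms(9) in \<open>simp add: 1 [symmetric] 2 [symmetric]\<close>)
qed

lemma skip_skip: "i < j \<Longrightarrow> skip j (skip i x) = skip i (skip (j - 1) x)"
  by (auto simp: skip_def)

lemma coface_coface:
  assumes "i < j" "j \<le> Suc (Suc n)"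
  shows "map ((!) (coface (Suc (Suc n)) j)) (coface (Suc n) i) =
         map ((!) (coface (Suc (Suc n)) i)) (coface (Suc n) (j - 1))"
proof -
  have s: "set (coface (Suc n) k) \<subseteq> {..<Suc (Suc n)}" if "k \<le> Suc n" for k
    using simplex_op_coface [OF that] by (auto simp: simplex_op_def)
  have "map (skip j) (coface (Suc n) i) = map (skip i) (coface (Suc n) (j - 1))"
    using assms by (simp add: coface_conv skip_skip del: upt_Suc)
  then show ?thesis
    using assms by (simp add: map_coface s)
qed

lemma keys_fbd:
  assumes "simplicial_set X" "supp c \<subseteq> smp X q"
  shows "supp (fbd X q c) \<subseteq> smp X (q - 1)"
  unfolding fbd_def using assms sop_in [OF assms(1) simplex_op_coface']
  by (auto intro!: keys_sum_subset keys_kmap_subset)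

lemma fbd_fbd:
  assumes "simplicial_set X" "supp c \<subseteq> smp X q"
  shows "fbd X (q - 1) (fbd X q c) = 0"
proof (cases "q \<le> 1")
  case True
  then show ?thesis by (simp add: fbd_def)
next
  case False
  then obtain n where q: "q = Suc (Suc n)" using that [of "q - 2"] by simp
  define f where "f i j = kmap (\<lambda>x. sop X (Suc (Suc n)) (map ((!) (coface (Suc (Suc n)) j)) (coface (Suc n) i)) x) c"
    for i j
  have "kmap (sop X (Suc n) (coface (Suc n) i)) (kmap (sop X q (coface q j)) c) = f i j"
    if "i \<le> Suc n" "j \<le> Suc (Suc n)" for i j
    unfolding f_def kmap_kmap q
    by (rule kmap_cong, rule sop_comp) (use assms that simplex_op_coface q in auto)
  then have "fbd X (q - 1) (fbd X q c) = (\<Sum>i\<le>Suc n. \<Sum>j\<le>Suc (Suc n). f i j)"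
    unfolding fbd_def q by (simp add: kmap_sum del: sum.atMost_Suc)
  also have "\<dots> = (\<Sum>j\<le>Suc (Suc n). \<Sum>i\<le>Suc n. f i j)" by (rule sum.swap)
  also have "\<dots> = 0"
    by (rule double_sum_cancel) (simp only: f_def coface_coface)
  finally show ?thesis .
qed

text \<open>This makes the boundary well defined on normalized chains.\<close>

lemma fbd_dgn:
  assumes X: "simplicial_set X" and c: "supp c \<subseteq> dgn X q"
  shows "supp (fbd X q c) \<subseteq> dgn X (q - 1)"
proof -
  have gen: "supp (fbd X q (kgen x)) \<subseteq> dgn X (q - 1)" if "x \<in> dgn X q" for x
  proof -
    from that obtain i y where iy: "i < q" "y \<in> smp X (q - 1)"
      and x: "x = sop X (q - 1) (codegen (q - 1) i) y" unfolding dgn_def by blast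
    define \<theta> where "\<theta> j = map (\<lambda>s. collapse i (skip j s)) [0..<q]" for j
    have "set (coface q j) \<subseteq> {..Suc (q - 1)}" if "j \<le> q" for j
      using simplex_op_coface' [OF that] iy(1) by (auto simp: simplex_op_def)
    then have th: "\<theta> j = map ((!) (codegen (q - 1) i)) (coface q j)" if "j \<le> q" for j
      using that iy(1) by (simp add: \<theta>_def map_codegen) (simp add: coface_conv)
    then have so: "simplex_op (q - 1) (q - 1) (\<theta> j)" if "j \<le> q" for j
      using simplex_op_comp [OF simplex_op_codegen' [OF iy(1)] simplex_op_coface' [OF that]] iy(1) that by simp
    have face: "kmap (sop X q (coface q j)) (kgen x) = kgen (sop X (q - 1) (\<theta> j) y)" if "j \<le> q" for j
      unfolding x kmap_kgen th [OF that]
      by (subst sop_comp [OF X simplex_op_codegen' simplex_op_coface']) (use iy that in auto)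
    \<comment> \<open>The faces \<open>i\<close> and \<open>i + 1\<close> of \<open>s\<^sub>i y\<close> are both \<open>y\<close> and cancel; each other face repeats a vertex,
      at the position \<open>t\<close> below.\<close>
    have "\<theta> i = \<theta> (Suc i)"
      unfolding \<theta>_def by (auto simp: collapse_def skip_def)
    then have pair: "(\<Sum>j\<in>{i, Suc i}. kgen (sop X (q - 1) (\<theta> j) y) :: 'a \<Rightarrow>\<^sub>0 bit) = 0"
      by simp
    have "fbd X q (kgen x) = (\<Sum>j\<le>q. kgen (sop X (q - 1) (\<theta> j) y))"
      using face iy(1) by (simp add: fbd_def)
    also have "\<dots> = (\<Sum>j\<in>{..q} - {i, Suc i}. kgen (sop X (q - 1) (\<theta> j) y))"
      by (subst sum.subset_diff [of "{i, Suc i}"]) (use iy(1) pair in auto)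
    finally have e: "fbd X q (kgen x) = \<dots>" .
    show ?thesis unfolding e
    proof (rule keys_sum_subset)
      fix j assume j: "j \<in> {..q} - {i, Suc i}"
      define t where "t = (if j < i then i - 1 else i)"
      have t: "t < q - 1" using j iy(1) by (auto simp: t_def)
      then have "\<theta> j ! t = \<theta> j ! Suc t"
        using j unfolding \<theta>_def t_def by (auto simp: collapse_def skip_def)
      then have "sop X (q - 1) (\<theta> j) y \<in> dgn X (q - 1)"
        using dgn_sop [OF X iy(2) so t] j by simp
      then show "supp (kgen (sop X (q - 1) (\<theta> j) y)) \<subseteq> dgn X (q - 1)" by simp
    qed
  qed
  have e: "fbd X q c = kext (\<lambda>x. fbd X q (kgen x)) c"
    using fbd_kext [of X q kgen c] by (simp add: kext_kgen_id)
  show ?thesis unfolding e by (rule keys_kext_subset, rule gen) (use c in blast)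
qed

lemma keys_kmap_simplicial:
  assumes "simplicial_map X Y f" "supp c \<subseteq> smp X q"
  shows "supp (kmap (f q) c) \<subseteq> smp Y q"
  by (rule keys_kmap_subset) (use assms in \<open>auto simp: simplicial_map_def\<close>)

lemma keys_kmap_dgn:
  assumes "simplicial_map X Y f" "supp c \<subseteq> dgn X q"
  shows "supp (kmap (f q) c) \<subseteq> dgn Y q"
proof (rule keys_kmap_subset, rule subsetI)
  fix z assume "z \<in> f q ` supp c"
  then obtain i y where iy: "i < q" "y \<in> smp X (q - 1)" "z = f q (sop X (q - 1) (codegen (q - 1) i) y)"
    using assms(2) unfolding dgn_def by blast
  then have "z = sop Y (q - 1) (codegen (q - 1) i) (f (q - 1) y)" "f (q - 1) y \<in> smp Y (q - 1)"
    using simplicial_mapD [OF assms(1)] simplex_op_codegen' by auto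
  with iy(1) show "z \<in> dgn Y q" unfolding dgn_def by blast
qed

lemma kmap_fbd:
  assumes "simplicial_map X Y f" "supp c \<subseteq> smp X q"
  shows "kmap (f (q - 1)) (fbd X q c) = fbd Y q (kmap (f q) c)"
proof (cases "q = 0")
  case False
  then show ?thesis unfolding fbd_def
    by (simp add: kmap_sum kmap_kmap, intro sum.cong kmap_cong simplicial_mapD(2) [OF assms(1)])
       (use assms(2) simplex_op_coface' in auto)
qed (simp add: fbd_def)

section \<open>The shuffle map\<close>

lemma ktensor_kmap: "ktensor (kmap f x) (kmap g y) = kext (\<lambda>u. kext (\<lambda>v. kgen (f u, g v)) y) x"
  by (simp add: ktensor_def kext_kmap)

text \<open>The operators in the definition of the shuffle map are the two coordinates of the paths in
  \<open>shuf a b\<close>; in this form the shuffle map is evaluation of one universal chain.\<close>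

lemma shuffle_alt:
  "shuffle X Y a b x y =
     kext (\<lambda>u. kext (\<lambda>v. kmap (\<lambda>(\<alpha>, \<beta>). (sop X a \<alpha> u, sop Y b \<beta> v)) (shuf a b)) y) x"
  by (simp add: shuffle_def shuf_eq_shufs shufs_def kfree_def kmap_sum kext_Sum ktensor_kmap)

lemma shuffle_add_left: "shuffle X Y a b (x + x') y = shuffle X Y a b x y + shuffle X Y a b x' y"
  by (simp add: shuffle_alt kext_add)

lemma shuffle_add_right: "shuffle X Y a b x (y + y') = shuffle X Y a b x y + shuffle X Y a b x y'"
  by (simp add: shuffle_alt kext_add kext_plus)

lemma shuffle_0 [simp]: "shuffle X Y a b 0 y = 0" "shuffle X Y a b x 0 = 0"
  by (simp_all add: shuffle_alt)

lemma shuffle_sum_left: "shuffle X Y a b (\<Sum>i\<in>I. x i) y = (\<Sum>i\<in>I. shuffle X Y a b (x i) y)"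
  by (induction I rule: infinite_finite_induct) (simp_all add: shuffle_add_left)

lemma shuffle_sum_right: "shuffle X Y a b x (\<Sum>i\<in>I. y i) = (\<Sum>i\<in>I. shuffle X Y a b x (y i))"
  by (induction I rule: infinite_finite_induct) (simp_all add: shuffle_add_right)

lemma shuffle_gen:
  "shuffle X Y a b (kgen u) (kgen v) = kmap (\<lambda>(\<alpha>, \<beta>). (sop X a \<alpha> u, sop Y b \<beta> v)) (shuf a b)"
  by (simp add: shuffle_alt)

lemma shuffle_expand:
  "shuffle X Y a b x y = kext (\<lambda>u. kext (\<lambda>v. shuffle X Y a b (kgen u) (kgen v)) y) x"
  unfolding shuffle_gen by (rule shuffle_alt)

lemma shuffle_keys:
  assumes "simplicial_set X" "simplicial_set Y"
    and "supp x \<subseteq> smp X a" "supp y \<subseteq> smp Y b"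
  shows "supp (shuffle X Y a b x y) \<subseteq> smp (sprod X Y) (a + b)"
  unfolding shuffle_alt
  by (intro keys_kext_subset keys_kmap_subset)
     (use assms in \<open>auto elim!: shuf_keys intro: sop_in\<close>)

text \<open>If \<open>u = s\<^sub>i u'\<close>, then on each path the step at which the first coordinate goes from \<open>i\<close> to
  \<open>i + 1\<close> leaves the second coordinate unchanged, so that both components repeat a vertex there.\<close>

lemma shuffle_dgn_left:
  assumes X: "simplicial_set X" and Y: "simplicial_set Y"
    and x: "supp x \<subseteq> dgn X a" and y: "supp y \<subseteq> smp Y b"
  shows "supp (shuffle X Y a b x y) \<subseteq> dgn (sprod X Y) (a + b)"
  unfolding shuffle_alt
proof (intro keys_kext_subset keys_kmap_subset subsetI)
  fix u v w assume u: "u \<in> supp x" and v: "v \<in> supp y"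
    and "w \<in> (\<lambda>(\<alpha>, \<beta>). (sop X a \<alpha> u, sop Y b \<beta> v)) ` supp (shuf a b)"
  then obtain \<alpha> \<beta> where k: "(\<alpha>, \<beta>) \<in> supp (shuf a b)" and w: "w = (sop X a \<alpha> u, sop Y b \<beta> v)"
    by auto
  from u x obtain i y' where i: "i < a" "y' \<in> smp X (a - 1)" "u = sop X (a - 1) (codegen (a - 1) i) y'"
    unfolding dgn_def by blast
  from k obtain so: "simplex_op (a + b) a \<alpha>" "simplex_op (a + b) b \<beta>"
    and "\<exists>t<a + b. \<alpha> ! t = i \<and> \<alpha> ! Suc t = Suc i \<and> \<beta> ! t = \<beta> ! Suc t"
    by (rule shuf_keys) (use i(1) in blast)
  then obtain t where t: "t < a + b" "\<alpha> ! t = i" "\<alpha> ! Suc t = Suc i" "\<beta> ! t = \<beta> ! Suc t" by blast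
  let ?\<theta> = "map ((!) (codegen (a - 1) i)) \<alpha>"
  have th: "?\<theta> = map (collapse i) \<alpha>"
    by (rule map_codegen) (use i(1) so in \<open>auto simp: simplex_op_def\<close>)
  have "length \<alpha> = Suc (a + b)" using so by (simp add: simplex_op_def)
  then have eq: "?\<theta> ! t = ?\<theta> ! Suc t"
    unfolding th using t by (simp add: collapse_def)
  have "sop X a \<alpha> u = sop X (a - 1) ?\<theta> y'"
    unfolding i(3) by (rule sop_comp [OF X simplex_op_codegen']) (use i so in auto)
  then show "w \<in> dgn (sprod X Y) (a + b)"
    unfolding w using dgn_pair [OF X i(2) _ eq Y _ so(2) t(4) t(1)] v y
      simplex_op_comp [OF simplex_op_codegen' [OF i(1)]] so by auto
qed

lemma shuffle_dgn_right:
  assumes X: "simplicial_set X" and Y: "simplicial_set Y"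
    and x: "supp x \<subseteq> smp X a" and y: "supp y \<subseteq> dgn Y b"
  shows "supp (shuffle X Y a b x y) \<subseteq> dgn (sprod X Y) (a + b)"
  unfolding shuffle_alt
proof (intro keys_kext_subset keys_kmap_subset subsetI)
  fix u v w assume u: "u \<in> supp x" and v: "v \<in> supp y"
    and "w \<in> (\<lambda>(\<alpha>, \<beta>). (sop X a \<alpha> u, sop Y b \<beta> v)) ` supp (shuf a b)"
  then obtain \<alpha> \<beta> where k: "(\<alpha>, \<beta>) \<in> supp (shuf a b)" and w: "w = (sop X a \<alpha> u, sop Y b \<beta> v)"
    by auto
  from v y obtain i y' where i: "i < b" "y' \<in> smp Y (b - 1)" "v = sop Y (b - 1) (codegen (b - 1) i) y'"
    unfolding dgn_def by blast
  from k obtain so: "simplex_op (a + b) a \<alpha>" "simplex_op (a + b) b \<beta>"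
    and "\<exists>t<a + b. \<beta> ! t = i \<and> \<beta> ! Suc t = Suc i \<and> \<alpha> ! t = \<alpha> ! Suc t"
    by (rule shuf_keys) (use i(1) in blast)
  then obtain t where t: "t < a + b" "\<beta> ! t = i" "\<beta> ! Suc t = Suc i" "\<alpha> ! t = \<alpha> ! Suc t" by blast
  let ?\<theta> = "map ((!) (codegen (b - 1) i)) \<beta>"
  have th: "?\<theta> = map (collapse i) \<beta>"
    by (rule map_codegen) (use i(1) so in \<open>auto simp: simplex_op_def\<close>)
  have "length \<beta> = Suc (a + b)" using so by (simp add: simplex_op_def)
  then have eq: "?\<theta> ! t = ?\<theta> ! Suc t"
    unfolding th using t by (simp add: collapse_def)
  have "sop Y b \<beta> v = sop Y (b - 1) ?\<theta> y'"
    unfolding i(3) by (rule sop_comp [OF Y simplex_op_codegen']) (use i so in auto)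
  then show "w \<in> dgn (sprod X Y) (a + b)"
    unfolding w using dgn_pair [OF X _ so(1) t(4) Y i(2) _ eq t(1)] u x
      simplex_op_comp [OF simplex_op_codegen' [OF i(1)]] so by auto
qed

lemma shuffle_natural:
  assumes "simplicial_map X X' f" "simplicial_map Y Y' g"
    and "supp x \<subseteq> smp X a" "supp y \<subseteq> smp Y b"
  shows "kmap (map_prod (f (a + b)) (g (a + b))) (shuffle X Y a b x y) =
         shuffle X' Y' a b (kmap (f a) x) (kmap (g b) y)"
  unfolding shuffle_alt kmap_kext kext_kmap kmap_kmap
proof (intro kext_cong kmap_cong)
  fix u v z assume "u \<in> supp x" "v \<in> supp y" "z \<in> supp (shuf a b)"
  then obtain \<alpha> \<beta> where "z = (\<alpha>, \<beta>)" "simplex_op (a + b) a \<alpha>" "simplex_op (a + b) b \<beta>"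
    and "u \<in> smp X a" "v \<in> smp Y b" using assms(3,4) by (blast elim: shuf_keys)
  then show "map_prod (f (a + b)) (g (a + b)) (case z of (\<alpha>, \<beta>) \<Rightarrow> (sop X a \<alpha> u, sop Y b \<beta> v)) =
      (case z of (\<alpha>, \<beta>) \<Rightarrow> (sop X' a \<alpha> (f a u), sop Y' b \<beta> (g b v)))"
    by (simp add: simplicial_mapD(2) [OF assms(1)] simplicial_mapD(2) [OF assms(2)])
qed

text \<open>The shuffle map is a chain map on unnormalized chains, with no degenerate error terms.  By bilinearity
  this concerns a pair of simplices, where it is the image of the universal identity \<open>faces2_shuf\<close>.\<close>

lemma fbd_shuffle:
  assumes X: "simplicial_set X" and Y: "simplicial_set Y"
    and x: "supp x \<subseteq> smp X a" and y: "supp y \<subseteq> smp Y b"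
  shows "fbd (sprod X Y) (a + b) (shuffle X Y a b x y) =
         shuffle X Y (a - 1) b (fbd X a x) y + shuffle X Y a (b - 1) x (fbd Y b y)"
proof -
  have gen: "fbd (sprod X Y) (a + b) (shuffle X Y a b (kgen u) (kgen v)) =
      shuffle X Y (a - 1) b (fbd X a (kgen u)) (kgen v) + shuffle X Y a (b - 1) (kgen u) (fbd Y b (kgen v))"
    if u: "u \<in> smp X a" and v: "v \<in> smp Y b" for u v
  proof (cases "a + b = 0")
    case True
    then show ?thesis by (simp add: fbd_def)
  next
    case False
    define pt where "pt = (\<lambda>(\<alpha>, \<beta>). (sop X a \<alpha> u, sop Y b \<beta> v))"
    have "kmap (sop (sprod X Y) (a + b) (coface (a + b) t)) (kmap pt (shuf a b)) =
        kmap pt (kmap (\<lambda>(\<alpha>, \<beta>). (del t \<alpha>, del t \<beta>)) (shuf a b))" if t: "t \<le> a + b" for t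
      unfolding kmap_kmap
    proof (rule kmap_cong)
      fix z assume "z \<in> supp (shuf a b)"
      then obtain \<alpha> \<beta> where z: "z = (\<alpha>, \<beta>)" and so: "simplex_op (a + b) a \<alpha>" "simplex_op (a + b) b \<beta>"
        by (rule shuf_keys)
      have "map ((!) \<alpha>) (coface (a + b) t) = del t \<alpha>" "map ((!) \<beta>) (coface (a + b) t) = del t \<beta>"
        using so t by (auto intro!: map_nth_coface simp: simplex_op_def)
      moreover have "simplex_op (a + b - 1) (a + b) (coface (a + b) t)"
        using False t by (intro simplex_op_coface') auto
      ultimately show "sop (sprod X Y) (a + b) (coface (a + b) t) (pt z) =
          pt (case z of (\<alpha>, \<beta>) \<Rightarrow> (del t \<alpha>, del t \<beta>))"
        using sop_comp [OF X so(1) _ u] sop_comp [OF Y so(2) _ v] by (simp add: z pt_def)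
    qed
    then have "(\<Sum>t\<le>a + b. kmap (sop (sprod X Y) (a + b) (coface (a + b) t)) (kmap pt (shuf a b))) =
        kmap pt (faces2 (a + b) (shuf a b))"
      unfolding faces2_def kmap_sum by (intro sum.cong) auto
    then have "fbd (sprod X Y) (a + b) (shuffle X Y a b (kgen u) (kgen v)) = kmap pt (faces2 (a + b) (shuf a b))"
      unfolding fbd_def shuffle_gen pt_def [symmetric] using False by presburger
    also have "\<dots> = (if a = 0 then 0 else kmap pt (cofaces_left a (shuf (a - 1) b))) +
        (if b = 0 then 0 else kmap pt (cofaces_right b (shuf a (b - 1))))"
      using False by (auto simp: faces2_shuf kmap_add)
    also have "(if a = 0 then 0 else kmap pt (cofaces_left a (shuf (a - 1) b))) =
        shuffle X Y (a - 1) b (fbd X a (kgen u)) (kgen v)"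
    proof (cases "a = 0")
      case False
      have "kmap pt (kmap (\<lambda>(\<alpha>, \<beta>). (map (skip j) \<alpha>, \<beta>)) (shuf (a - 1) b)) =
          shuffle X Y (a - 1) b (kgen (sop X a (coface a j) u)) (kgen v)" if j: "j \<le> a" for j
        unfolding kmap_kmap shuffle_gen
      proof (rule kmap_cong)
        fix z assume "z \<in> supp (shuf (a - 1) b)"
        then obtain \<alpha> \<beta> where z: "z = (\<alpha>, \<beta>)" and so: "simplex_op (a - 1 + b) (a - 1) \<alpha>"
          by (rule shuf_keys)
        have "map ((!) (coface a j)) \<alpha> = map (skip j) \<alpha>"
          by (rule map_coface [OF j]) (use so False in \<open>auto simp: simplex_op_def\<close>)
        then have "sop X (a - 1) \<alpha> (sop X a (coface a j) u) = sop X a (map (skip j) \<alpha>) u"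
          using sop_comp [OF X simplex_op_coface' [OF j] so u] False by (simp only: neq0_conv)
        then show "pt (case z of (\<alpha>, \<beta>) \<Rightarrow> (map (skip j) \<alpha>, \<beta>)) =
            (case z of (\<alpha>, \<beta>) \<Rightarrow> (sop X (a - 1) \<alpha> (sop X a (coface a j) u), sop Y b \<beta> v))"
          by (simp add: z pt_def)
      qed
      then show ?thesis using False
        by (simp add: fbd_def shuffle_sum_left cofaces_left_def kmap_sum)
    qed (simp add: fbd_def)
    also have "(if b = 0 then 0 else kmap pt (cofaces_right b (shuf a (b - 1)))) =
        shuffle X Y a (b - 1) (kgen u) (fbd Y b (kgen v))"
    proof (cases "b = 0")
      case False
      have "kmap pt (kmap (\<lambda>(\<alpha>, \<beta>). (\<alpha>, map (skip j) \<beta>)) (shuf a (b - 1))) =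
          shuffle X Y a (b - 1) (kgen u) (kgen (sop Y b (coface b j) v))" if j: "j \<le> b" for j
        unfolding kmap_kmap shuffle_gen
      proof (rule kmap_cong)
        fix z assume "z \<in> supp (shuf a (b - 1))"
        then obtain \<alpha> \<beta> where z: "z = (\<alpha>, \<beta>)" and so: "simplex_op (a + (b - 1)) (b - 1) \<beta>"
          by (rule shuf_keys)
        have "map ((!) (coface b j)) \<beta> = map (skip j) \<beta>"
          by (rule map_coface [OF j]) (use so False in \<open>auto simp: simplex_op_def\<close>)
        then have "sop Y (b - 1) \<beta> (sop Y b (coface b j) v) = sop Y b (map (skip j) \<beta>) v"
          using sop_comp [OF Y simplex_op_coface' [OF j] so v] False by (simp only: neq0_conv)
        then show "pt (case z of (\<alpha>, \<beta>) \<Rightarrow> (\<alpha>, map (skip j) \<beta>)) =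
            (case z of (\<alpha>, \<beta>) \<Rightarrow> (sop X a \<alpha> u, sop Y (b - 1) \<beta> (sop Y b (coface b j) v)))"
          by (simp add: z pt_def)
      qed
      then show ?thesis using False
        by (simp add: fbd_def shuffle_sum_right cofaces_right_def kmap_sum)
    qed (simp add: fbd_def)
    finally show ?thesis .
  qed
  have fX: "fbd X a x = kext (\<lambda>u. fbd X a (kgen u)) x" and fY: "fbd Y b y = kext (\<lambda>v. fbd Y b (kgen v)) y"
    using fbd_kext [of X a kgen x] fbd_kext [of Y b kgen y] by (simp_all add: kext_kgen_id)
  have l: "shuffle X Y (a - 1) b (fbd X a x) y =
      kext (\<lambda>u. kext (\<lambda>v. shuffle X Y (a - 1) b (fbd X a (kgen u)) (kgen v)) y) x"
    unfolding fX
    by (subst (1 2) shuffle_expand) (simp add: kext_kext, rule kext_cong, rule kext_swap)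
  have r: "shuffle X Y a (b - 1) x (fbd Y b y) =
      kext (\<lambda>u. kext (\<lambda>v. shuffle X Y a (b - 1) (kgen u) (fbd Y b (kgen v))) y) x"
    unfolding fY by (subst (1 2) shuffle_expand) (simp add: kext_kext)
  have "fbd (sprod X Y) (a + b) (shuffle X Y a b x y) =
      kext (\<lambda>u. kext (\<lambda>v. fbd (sprod X Y) (a + b) (shuffle X Y a b (kgen u) (kgen v))) y) x"
    by (subst shuffle_expand) (simp add: fbd_kext)
  also have "\<dots> = kext (\<lambda>u. kext (\<lambda>v. shuffle X Y (a - 1) b (fbd X a (kgen u)) (kgen v) +
      shuffle X Y a (b - 1) (kgen u) (fbd Y b (kgen v))) y) x"
    by (intro kext_cong gen) (use x y in auto)
  finally show ?thesis unfolding l r by (simp add: kext_plus)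
qed

section \<open>Cosimplicial spaces and the conormalization\<close>

declare upt_Suc [simp del]

lemma simplicial_set_lev: "cosimplicial_space X \<Longrightarrow> simplicial_set (lev X p)"
  by (simp add: cosimplicial_space_def)

lemma cop_in:
  "cosimplicial_space X \<Longrightarrow> simplex_op m n \<theta> \<Longrightarrow> x \<in> smp (lev X m) q \<Longrightarrow>
   cop X n \<theta> q x \<in> smp (lev X n) q"
  by (simp add: cosimplicial_space_def image_subset_iff)

lemma cop_comp:
  "cosimplicial_space X \<Longrightarrow> simplex_op m n \<theta> \<Longrightarrow> simplex_op l m \<phi> \<Longrightarrow> x \<in> smp (lev X l) q \<Longrightarrow>
   cop X n \<theta> q (cop X m \<phi> q x) = cop X n (map ((!) \<theta>) \<phi>) q x"
  unfolding cosimplicial_space_def by metis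

lemma cop_id: "cosimplicial_space X \<Longrightarrow> x \<in> smp (lev X n) q \<Longrightarrow> cop X n [0..<Suc n] q x = x"
  unfolding cosimplicial_space_def id_op_def by metis

lemma simplicial_map_cop:
  "cosimplicial_space X \<Longrightarrow> simplex_op m n \<theta> \<Longrightarrow> simplicial_map (lev X m) (lev X n) (cop X n \<theta>)"
  unfolding cosimplicial_space_def simplicial_map_def by (simp add: image_subset_iff)

lemma keys_kmap_cop:
  "cosimplicial_space X \<Longrightarrow> simplex_op m n \<theta> \<Longrightarrow> supp c \<subseteq> smp (lev X m) q \<Longrightarrow>
   supp (kmap (cop X n \<theta> q) c) \<subseteq> smp (lev X n) q"
  using keys_kmap_simplicial [OF simplicial_map_cop] .

lemma keys_kmap_cop_dgn:
  "cosimplicial_space X \<Longrightarrow> simplex_op m n \<theta> \<Longrightarrow> supp c \<subseteq> dgn (lev X m) q \<Longrightarrow>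
   supp (kmap (cop X n \<theta> q) c) \<subseteq> dgn (lev X n) q"
  using keys_kmap_dgn [OF simplicial_map_cop] .

lemma kmap_cop_fbd:
  "cosimplicial_space X \<Longrightarrow> simplex_op m n \<theta> \<Longrightarrow> supp c \<subseteq> smp (lev X m) q \<Longrightarrow>
   kmap (cop X n \<theta> (q - 1)) (fbd (lev X m) q c) = fbd (lev X n) q (kmap (cop X n \<theta> q) c)"
  using kmap_fbd [OF simplicial_map_cop] .

lemma kmap_cop_comp:
  assumes "cosimplicial_space X" "simplex_op m n \<theta>" "simplex_op l m \<phi>"
    and "supp c \<subseteq> smp (lev X l) q"
  shows "kmap (cop X n \<theta> q) (kmap (cop X m \<phi> q) c) = kmap (cop X n (map ((!) \<theta>) \<phi>) q) c"
  unfolding kmap_kmap by (rule kmap_cong, rule cop_comp) (use assms in auto)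

lemma kmap_cop_id:
  assumes "cosimplicial_space X" "supp c \<subseteq> smp (lev X n) q"
  shows "kmap (cop X n [0..<Suc n] q) c = c"
  by (rule kmap_eq_self, rule cop_id) (use assms in auto)

lemma lev_csprod [simp]: "lev (csprod X Y) p = sprod (lev X p) (lev Y p)"
  and cop_csprod [simp]: "cop (csprod X Y) n \<theta> q = map_prod (cop X n \<theta> q) (cop Y n \<theta> q)"
  by (simp_all add: csprod_def)

lemma cosimplicial_space_csprod:
  assumes "cosimplicial_space X" "cosimplicial_space Y"
  shows "cosimplicial_space (csprod X Y)"
  using assms unfolding cosimplicial_space_def
  by (auto simp: image_subset_iff simplicial_set_sprod)

text \<open>Operators \<open>[0, \<dots>, n] \<rightarrow> [0, \<dots>, m]\<close> are written \<open>map f [0..<Suc n]\<close> from here on; composition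
  then is composition of functions of natural numbers.\<close>

lemma comp_op:
  assumes "\<And>x. x \<le> l \<Longrightarrow> g x \<le> m"
  shows "map ((!) (map f [0..<Suc m])) (map g [0..<Suc l]) = map (\<lambda>x. f (g x)) [0..<Suc l]"
proof -
  have "map ((!) (map f [0..<Suc m])) (map g [0..<Suc l]) = map f (map g [0..<Suc l])"
    by (rule map_nth_upt) (use assms in \<open>auto simp: less_Suc_eq_le\<close>)
  then show ?thesis by simp
qed

lemma kmap_cop_funs:
  assumes X: "cosimplicial_space X" and c: "supp c \<subseteq> smp (lev X l) q"
    and f: "mono f" "\<And>x. x \<le> m \<Longrightarrow> f x \<le> n" and g: "mono g" "\<And>x. x \<le> l \<Longrightarrow> g x \<le> m"
  shows "kmap (cop X n (map f [0..<Suc m]) q) (kmap (cop X m (map g [0..<Suc l]) q) c) =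
         kmap (cop X n (map (\<lambda>x. f (g x)) [0..<Suc l]) q) c"
proof -
  have "simplex_op m n (map f [0..<Suc m])" "simplex_op l m (map g [0..<Suc l])"
    using f g simplex_op_map simplex_op_id by blast+
  then show ?thesis using kmap_cop_comp [OF X _ _ c] comp_op [of l g m f] g(2) by metis
qed

text \<open>\<open>collapse i\<close> followed by \<open>skip (Suc i)\<close>.\<close>

definition squash :: "nat \<Rightarrow> nat \<Rightarrow> nat" where
  "squash i x = (if x = Suc i then i else x)"

lemma mono_squash: "mono (squash i)"
  by (auto simp: mono_def squash_def)

lemma squash_le: "i < p \<Longrightarrow> x \<le> p \<Longrightarrow> squash i x \<le> p"
  by (auto simp: squash_def)

lemma skip_le: "x \<le> n \<Longrightarrow> skip i x \<le> Suc n"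
  by (auto simp: skip_def)

lemma collapse_le: "i \<le> n \<Longrightarrow> x \<le> Suc n \<Longrightarrow> collapse i x \<le> n"
  by (auto simp: collapse_def)

text \<open>In \<open>squash_step\<close> the operator is \<open>d\<^bsup>i+1\<^esup> s\<^sup>i\<close>, so that \<open>proj X p q p\<close> is the product of the
  idempotents \<open>1 + d\<^bsup>i+1\<^esup> s\<^sup>i\<close>.\<close>

definition squash_step :: "'a csset \<Rightarrow> nat \<Rightarrow> nat \<Rightarrow> nat \<Rightarrow> ('a \<Rightarrow>\<^sub>0 bit) \<Rightarrow> 'a \<Rightarrow>\<^sub>0 bit" where
  "squash_step X p q i c = c + kmap (cop X p (map (squash i) [0..<Suc p]) q) c"

primrec proj :: "'a csset \<Rightarrow> nat \<Rightarrow> nat \<Rightarrow> nat \<Rightarrow> ('a \<Rightarrow>\<^sub>0 bit) \<Rightarrow> 'a \<Rightarrow>\<^sub>0 bit" where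
  "proj X p q 0 c = c"
| "proj X p q (Suc n) c = squash_step X p q n (proj X p q n c)"

abbreviation dco :: "'a csset \<Rightarrow> nat \<Rightarrow> nat \<Rightarrow> nat \<Rightarrow> ('a \<Rightarrow>\<^sub>0 bit) \<Rightarrow> 'a \<Rightarrow>\<^sub>0 bit" where
  "dco X p q i \<equiv> kmap (cop X (Suc p) (map (skip i) [0..<Suc p]) q)"

abbreviation sco :: "'a csset \<Rightarrow> nat \<Rightarrow> nat \<Rightarrow> nat \<Rightarrow> ('a \<Rightarrow>\<^sub>0 bit) \<Rightarrow> 'a \<Rightarrow>\<^sub>0 bit" where
  "sco X p q i \<equiv> kmap (cop X p (map (collapse i) [0..<Suc (Suc p)]) q)"

lemma simplex_op_skip: "simplex_op p (Suc p) (map (skip i) [0..<Suc p])"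
  using simplex_op_map [OF simplex_op_id mono_skip skip_le] .

lemma simplex_op_collapse: "i \<le> p \<Longrightarrow> simplex_op (Suc p) p (map (collapse i) [0..<Suc (Suc p)])"
  using simplex_op_map [OF simplex_op_id mono_collapse collapse_le] .

lemma simplex_op_squash: "i < p \<Longrightarrow> simplex_op p p (map (squash i) [0..<Suc p])"
  using simplex_op_map [OF simplex_op_id mono_squash squash_le] .

lemma squash_step_add: "squash_step X p q i (c + d) = squash_step X p q i c + squash_step X p q i d"
  by (simp add: squash_step_def kmap_add ac_simps)

lemma squash_step_0 [simp]: "squash_step X p q i 0 = 0"
  by (simp add: squash_step_def)

lemma proj_add: "proj X p q n (c + d) = proj X p q n c + proj X p q n d"
  by (induction n) (simp_all add: squash_step_add)

lemma proj_0 [simp]: "proj X p q n 0 = 0"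
  by (induction n) simp_all

lemma proj_sum: "proj X p q n (\<Sum>i\<in>I. c i) = (\<Sum>i\<in>I. proj X p q n (c i))"
  by (induction I rule: infinite_finite_induct) (simp_all add: proj_add)

text \<open>The sum of all cofaces; on elements annihilated by the codegeneracies it represents the
  horizontal differential.\<close>

definition cbd :: "'a csset \<Rightarrow> nat \<Rightarrow> nat \<Rightarrow> ('a \<Rightarrow>\<^sub>0 bit) \<Rightarrow> 'a \<Rightarrow>\<^sub>0 bit" where
  "cbd X p q c = (\<Sum>i\<le>Suc p. dco X p q i c)"

context
  fixes X :: "'a csset"
  assumes X: "cosimplicial_space X"
begin

lemma keys_squash_step:
  "i < p \<Longrightarrow> supp c \<subseteq> smp (lev X p) q \<Longrightarrow>
   supp (squash_step X p q i c) \<subseteq> smp (lev X p) q"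
  unfolding squash_step_def by (intro keys_plus_subset keys_kmap_cop [OF X simplex_op_squash])

lemma keys_proj:
  "n \<le> p \<Longrightarrow> supp c \<subseteq> smp (lev X p) q \<Longrightarrow>
   supp (proj X p q n c) \<subseteq> smp (lev X p) q"
  by (induction n) (simp_all add: keys_squash_step)

lemma keys_proj_dgn:
  "n \<le> p \<Longrightarrow> supp c \<subseteq> dgn (lev X p) q \<Longrightarrow>
   supp (proj X p q n c) \<subseteq> dgn (lev X p) q"
  by (induction n)
     (simp_all add: squash_step_def keys_plus_subset keys_kmap_cop_dgn [OF X simplex_op_squash])

lemma proj_fbd:
  assumes "n \<le> p" "supp c \<subseteq> smp (lev X p) q"
  shows "proj X p (q - 1) n (fbd (lev X p) q c) = fbd (lev X p) q (proj X p q n c)"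
  using assms(1)
proof (induction n)
  case (Suc n)
  then show ?case
    by (simp add: squash_step_def fbd_add kmap_cop_fbd [OF X simplex_op_squash] keys_proj assms(2))
qed simp

lemma sco_squash_step_same:
  assumes "i \<le> p" "supp c \<subseteq> smp (lev X (Suc p)) q"
  shows "sco X p q i (squash_step X (Suc p) q i c) = 0"
proof -
  have "collapse i (squash i x) = collapse i x" for x by (auto simp: collapse_def squash_def)
  then show ?thesis
    unfolding squash_step_def kmap_add using assms
    by (subst kmap_cop_funs [OF X]) (auto simp: mono_collapse mono_squash squash_le collapse_le)
qed

lemma sco_squash_step_less:
  assumes "i < j" "j \<le> p" "supp c \<subseteq> smp (lev X (Suc p)) q"
  shows "sco X p q i (squash_step X (Suc p) q j c) = squash_step X p q (j - 1) (sco X p q i c)"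
proof -
  have "collapse i (squash j x) = squash (j - 1) (collapse i x)" for x
    using assms by (auto simp: collapse_def squash_def)
  moreover have "collapse i x \<le> p" if "x \<le> Suc p" for x using that assms collapse_le by simp
  moreover have "squash j x \<le> Suc p" if "x \<le> Suc p" for x using that assms squash_le by simp
  moreover have "squash (j - 1) x \<le> p" if "x \<le> p" for x using that assms squash_le [of "j - 1" p x] by simp
  ultimately show ?thesis
    unfolding squash_step_def kmap_add using assms
    by (simp add: kmap_cop_funs [OF X] mono_collapse mono_squash)
qed

lemma sco_proj_aux:
  assumes "supp c \<subseteq> smp (lev X (Suc p)) q"
  shows "i < n \<Longrightarrow> n \<le> Suc p \<Longrightarrow> sco X p q i (proj X (Suc p) q n c) = 0"
proof (induction n)
  case (Suc n)
  have k: "supp (proj X (Suc p) q n c) \<subseteq> smp (lev X (Suc p)) q"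
    using keys_proj [OF _ assms] Suc.prems by simp
  show ?case
  proof (cases "i = n")
    case True
    then show ?thesis using sco_squash_step_same [OF _ k] Suc.prems by simp
  next
    case False
    then show ?thesis using Suc sco_squash_step_less [OF _ _ k, of i n] by simp
  qed
qed simp

text \<open>The factors of \<open>P\<close> are applied in increasing order of \<open>i\<close>.  The factor for \<open>i\<close> makes \<open>s\<^sup>i\<close>
  vanish, and \<open>s\<^sup>i\<close> passes through all later factors.\<close>

lemma sco_proj:
  assumes "supp c \<subseteq> smp (lev X (Suc p)) q" "i \<le> p"
  shows "sco X p q i (proj X (Suc p) q (Suc p) c) = 0"
  using sco_proj_aux [OF assms(1), of i "Suc p"] assms(2) by (simp del: proj.simps)

lemma squash_step_dco_less:
  assumes "Suc i < k" "k \<le> Suc p" "supp c \<subseteq> smp (lev X p) q"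
  shows "squash_step X (Suc p) q i (dco X p q k c) = dco X p q k (squash_step X p q i c)"
proof -
  have "squash i (skip k x) = skip k (squash i x)" for x
    using assms by (auto simp: skip_def squash_def)
  moreover have "squash i x \<le> p" if "x \<le> p" for x using that assms squash_le [of i p x] by simp
  moreover have "squash i x \<le> Suc p" if "x \<le> Suc p" for x using that assms squash_le [of i "Suc p" x] by simp
  ultimately show ?thesis
    unfolding squash_step_def kmap_add using assms
    by (simp add: kmap_cop_funs [OF X] mono_skip mono_squash skip_le)
qed

lemma squash_step_dco_same:
  assumes "k \<le> p" "supp c \<subseteq> smp (lev X p) q"
  shows "squash_step X (Suc p) q k (dco X p q (Suc k) c) = 0"
proof -
  have "squash k (skip (Suc k) x) = skip (Suc k) x" for x by (auto simp: skip_def squash_def)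
  moreover have "squash k x \<le> Suc p" if "x \<le> Suc p" for x using that assms squash_le [of k "Suc p" x] by simp
  ultimately show ?thesis
    unfolding squash_step_def using assms
    by (simp add: kmap_cop_funs [OF X] mono_skip mono_squash skip_le)
qed

text \<open>For \<open>k \<ge> 1\<close>, the coface \<open>d\<^sup>k\<close> passes through the factors for \<open>i < k - 1\<close> and is killed by the one
  for \<open>i = k - 1\<close>.\<close>

lemma proj_dco:
  assumes "1 \<le> k" "k \<le> Suc p" "supp c \<subseteq> smp (lev X p) q"
  shows "proj X (Suc p) q (Suc p) (dco X p q k c) = 0"
proof -
  obtain k' where k: "k = Suc k'" "k' \<le> p" using assms by (cases k) auto
  have less: "proj X (Suc p) q n (dco X p q k c) = dco X p q k (proj X p q n c)" if "n \<le> k'" for n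
    using that
  proof (induction n)
    case (Suc n)
    then show ?case
      using squash_step_dco_less [of n k p "proj X p q n c" q] keys_proj [OF _ assms(3), of n] k by simp
  qed simp
  have "proj X (Suc p) q n (dco X p q k c) = 0" if "Suc k' \<le> n" "n \<le> Suc p" for n
    using that
  proof (induction rule: dec_induct)
    case base
    then show ?case
      using less [of k'] squash_step_dco_same [of k' p "proj X p q k' c" q]
        keys_proj [OF _ assms(3), of k'] k by simp
  qed simp
  then show ?thesis using k by (simp del: proj.simps)
qed

lemma squash_step_conv:
  assumes "i \<le> p" "supp c \<subseteq> smp (lev X (Suc p)) q"
  shows "squash_step X (Suc p) q i c = c + dco X p q (Suc i) (sco X p q i c)"
proof -
  have "skip (Suc i) (collapse i x) = squash i x" for x
    by (auto simp: skip_def squash_def collapse_def)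
  then show ?thesis
    unfolding squash_step_def using assms
    by (simp add: kmap_cop_funs [OF X] mono_skip mono_collapse skip_le collapse_le)
qed

lemma proj_conormal:
  assumes "supp c \<subseteq> smp (lev X (Suc p)) q" "\<And>i. i \<le> p \<Longrightarrow> sco X p q i c = 0"
  shows "proj X (Suc p) q (Suc p) c = c"
proof -
  have "n \<le> Suc p \<Longrightarrow> proj X (Suc p) q n c = c" for n
    by (induction n) (simp_all add: squash_step_conv assms)
  then show ?thesis by (simp del: proj.simps)
qed

text \<open>The representatives on which the product in the spectral sequence is defined are annihilated by the
  codegeneracies only modulo degenerate chains, so \<open>P\<close> fixes them only modulo degenerate chains.\<close>

lemma proj_conormal_dgn:
  assumes c: "supp c \<subseteq> smp (lev X (Suc p)) q"
    and s: "\<And>i. i \<le> p \<Longrightarrow> supp (sco X p q i c) \<subseteq> dgn (lev X p) q"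
  shows "supp (c + proj X (Suc p) q (Suc p) c) \<subseteq> dgn (lev X (Suc p)) q"
proof -
  have "n \<le> Suc p \<Longrightarrow> supp (c + proj X (Suc p) q n c) \<subseteq> dgn (lev X (Suc p)) q" for n
  proof (induction n)
    case (Suc n)
    define \<nu> where "\<nu> = c + proj X (Suc p) q n c"
    have \<nu>: "supp \<nu> \<subseteq> dgn (lev X (Suc p)) q" using Suc \<nu>_def by simp
    have "proj X (Suc p) q n c = c + \<nu>" by (simp add: \<nu>_def)
    then have "c + proj X (Suc p) q (Suc n) c = squash_step X (Suc p) q n \<nu> + dco X p q (Suc n) (sco X p q n c)"
      using Suc.prems by (simp add: squash_step_add squash_step_conv [OF _ c] ac_simps)
    moreover have "supp (squash_step X (Suc p) q n \<nu>) \<subseteq> dgn (lev X (Suc p)) q"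
      unfolding squash_step_def
      by (intro keys_plus_subset \<nu> keys_kmap_cop_dgn [OF X simplex_op_squash]) (use Suc.prems in simp)
    moreover have "supp (dco X p q (Suc n) (sco X p q n c)) \<subseteq> dgn (lev X (Suc p)) q"
      by (rule keys_kmap_cop_dgn [OF X simplex_op_skip s]) (use Suc.prems in simp)
    ultimately show ?case by (simp add: keys_plus_subset del: proj.simps)
  qed simp
  then show ?thesis by (simp del: proj.simps)
qed

end

section \<open>The total complex of the conormalization\<close>

text \<open>The last condition is not implied by the first one: \<open>nat\<close> sends negative chain degrees to \<open>0\<close>, where
  there may well be simplices.\<close>

definition tchain :: "'a csset \<Rightarrow> int \<Rightarrow> (nat \<Rightarrow> 'a \<Rightarrow>\<^sub>0 bit) \<Rightarrow> bool" where
  "tchain X m x \<longleftrightarrow> (\<forall>p. supp (x p) \<subseteq> smp (lev X p) (nat (m + int p)) \<and>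
     (m + int p < 0 \<longrightarrow> x p = 0))"

definition tdgn :: "'a csset \<Rightarrow> int \<Rightarrow> (nat \<Rightarrow> 'a \<Rightarrow>\<^sub>0 bit) \<Rightarrow> bool" where
  "tdgn X m x \<longleftrightarrow> (\<forall>p. supp (x p) \<subseteq> dgn (lev X p) (nat (m + int p)))"

definition tproj :: "'a csset \<Rightarrow> int \<Rightarrow> (nat \<Rightarrow> 'a \<Rightarrow>\<^sub>0 bit) \<Rightarrow> nat \<Rightarrow> 'a \<Rightarrow>\<^sub>0 bit" where
  "tproj X m x = (\<lambda>p. proj X p (nat (m + int p)) p (x p))"

text \<open>The differential of the total complex with the sum of all cofaces in place of \<open>d\<^sup>0\<close>.\<close>

definition tbd :: "'a csset \<Rightarrow> int \<Rightarrow> (nat \<Rightarrow> 'a \<Rightarrow>\<^sub>0 bit) \<Rightarrow> nat \<Rightarrow> 'a \<Rightarrow>\<^sub>0 bit" where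
  "tbd X m x = (\<lambda>p. fbd (lev X p) (nat (m + int p)) (x p) +
     (case p of 0 \<Rightarrow> 0 | Suc p' \<Rightarrow> cbd X p' (nat (m + int p')) (x p')))"

abbreviation CN :: "'a csset \<Rightarrow> ('a \<Rightarrow>\<^sub>0 bit) bicx" where
  "CN X \<equiv> conormalization (csS_chains X)"

lemma fun_double [simp]: "x + x = (0 :: nat \<Rightarrow> 'a \<Rightarrow>\<^sub>0 bit)"
  by (rule ext) simp

lemma fun_diff [simp]: "x - y = x + (y :: nat \<Rightarrow> 'a \<Rightarrow>\<^sub>0 bit)"
  by (rule ext) simp

lemma fun_cancel [simp]: "x + (x + y) = (y :: nat \<Rightarrow> 'a \<Rightarrow>\<^sub>0 bit)"
  by (rule ext) simp

lemma dgn_0 [simp]: "dgn X 0 = {}"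
  by (simp add: dgn_def)

lemma cbd_add: "cbd X p q (c + d) = cbd X p q c + cbd X p q d"
  by (simp add: cbd_def kmap_add sum.distrib)

lemma cbd_0 [simp]: "cbd X p q 0 = 0"
  by (simp add: cbd_def)

lemma cbd_sum: "cbd X p q (\<Sum>i\<in>I. c i) = (\<Sum>i\<in>I. cbd X p q (c i))"
  by (induction I rule: infinite_finite_induct) (simp_all add: cbd_add)

lemma tproj_add: "tproj X m (x + y) = tproj X m x + tproj X m y"
  by (rule ext) (simp add: tproj_def proj_add)

lemma tchain_add: "tchain X m x \<Longrightarrow> tchain X m y \<Longrightarrow> tchain X m (x + y)"
  by (simp add: tchain_def keys_plus_subset)

lemma tdgn_add: "tdgn X m x \<Longrightarrow> tdgn X m y \<Longrightarrow> tdgn X m (x + y)"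
  by (simp add: tdgn_def keys_plus_subset)

lemma tchain_0: "tchain X m 0"
  by (simp add: tchain_def)

lemma tdgn_0: "tdgn X m 0"
  by (simp add: tdgn_def)

lemma lev_cskfree [simp]: "lev (cskfree X) p = kfree (lev X p)"
  and cop_cskfree [simp]: "cop (cskfree X) n \<theta> q = kmap (cop X n \<theta> q)"
  by (simp_all add: cskfree_def)

lemma clev_csnormalized [simp]: "clev (csnormalized V) p = normalized (lev V p)"
  and ccop_csnormalized [simp]: "ccop (csnormalized V) n \<theta> t = cop V n \<theta> (nat t)"
  by (simp_all add: csnormalized_def)

lemma bchains_CN:
  "c \<in> bchains (CN X) p t \<longleftrightarrow> supp c \<subseteq> smp (lev X p) (nat t) \<and> (t < 0 \<longrightarrow> c = 0)"
  by (simp add: conormalization_def chains_S_chains)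

lemma chains_TC: "x \<in> chains (TC X) m \<longleftrightarrow> tchain X m x"
  by (simp add: total_def tchain_def bchains_CN)

lemma bdry_TC:
  "bdry (TC X) m x p = fbd (lev X p) (nat (m + int p)) (x p) +
     (case p of 0 \<Rightarrow> 0 | Suc p' \<Rightarrow> dco X p' (nat (m + int p')) 0 (x p'))"
  by (cases p) (simp_all add: total_def conormalization_def bdry_S_chains coface_conv)

lemma bdry_TC_add: "bdry (TC X) m (x + y) = bdry (TC X) m x + bdry (TC X) m y"
  by (rule ext) (simp add: bdry_TC fbd_add kmap_add ac_simps split: nat.split)

text \<open>The relations of the cokernel that defines the conormalization.\<close>

definition cospan :: "'a csset \<Rightarrow> nat \<Rightarrow> nat \<Rightarrow> ('a \<Rightarrow>\<^sub>0 bit) set" where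
  "cospan X p q = {\<Sum>k=1..p. dco X (p - 1) q k (y k) | y.
     \<forall>k\<in>{1..p}. supp (y k) \<subseteq> smp (lev X (p - 1)) q}"

lemma cospan_0: "0 \<in> cospan X p q"
  unfolding cospan_def by (intro CollectI exI [of _ "\<lambda>_. 0"]) simp

lemma cospan_add:
  assumes "c \<in> cospan X p q" "d \<in> cospan X p q"
  shows "c + d \<in> cospan X p q"
proof -
  from assms obtain y z where y: "c = (\<Sum>k=1..p. dco X (p - 1) q k (y k))"
      "\<forall>k\<in>{1..p}. supp (y k) \<subseteq> smp (lev X (p - 1)) q"
    and z: "d = (\<Sum>k=1..p. dco X (p - 1) q k (z k))"
      "\<forall>k\<in>{1..p}. supp (z k) \<subseteq> smp (lev X (p - 1)) q"
    unfolding cospan_def by blast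
  have "c + d = (\<Sum>k=1..p. dco X (p - 1) q k (y k + z k))"
    unfolding y z by (simp only: kmap_add sum.distrib)
  then show ?thesis unfolding cospan_def using y(2) z(2)
    by (intro CollectI exI [of _ "\<lambda>k. y k + z k"]) (simp add: keys_plus_subset)
qed

lemma dco_in_cospan:
  assumes "1 \<le> k" "k \<le> Suc p" "supp c \<subseteq> smp (lev X p) q"
  shows "dco X p q k c \<in> cospan X (Suc p) q"
proof -
  have "(\<Sum>i=1..Suc p. dco X p q i (if i = k then c else 0)) = (\<Sum>i=1..Suc p. if i = k then dco X p q k c else 0)"
    by (rule sum.cong) auto
  also have "\<dots> = dco X p q k c"
    using assms(1,2) by simp
  finally show ?thesis
    unfolding cospan_def using assms(3) 
    by (intro CollectI exI [of _ "\<lambda>i. if i = k then c else 0"]) simp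
qed

lemma cospan_keys:
  assumes "cosimplicial_space X" "c \<in> cospan X p q"
  shows "supp c \<subseteq> smp (lev X p) q"
proof (cases p)
  case 0
  then show ?thesis using assms(2) by (simp add: cospan_def)
next
  case (Suc p')
  then obtain y where y: "c = (\<Sum>k=1..p. dco X p' q k (y k))"
      "\<forall>k\<in>{1..p}. supp (y k) \<subseteq> smp (lev X p') q"
    using assms(2) unfolding cospan_def by auto
  show ?thesis unfolding y(1) Suc
    by (rule keys_sum_subset, rule keys_kmap_cop [OF assms(1) simplex_op_skip]) (use y(2) Suc in auto)
qed

context
  fixes X :: "'a csset"
  assumes X: "cosimplicial_space X"
begin

lemma proj_cospan:
  assumes "c \<in> cospan X p q"
  shows "proj X p q p c = 0"
proof (cases p)
  case 0
  then show ?thesis using assms by (simp add: cospan_def)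
next
  case (Suc p')
  then obtain y where y: "c = (\<Sum>k=1..Suc p'. dco X p' q k (y k))"
      "\<forall>k\<in>{1..Suc p'}. supp (y k) \<subseteq> smp (lev X p') q"
    using assms unfolding cospan_def by auto
  show ?thesis unfolding Suc y(1) proj_sum
    by (rule sum.neutral) (use y(2) proj_dco [OF X] in \<open>simp del: proj.simps\<close>)
qed

text \<open>Each factor \<open>1 + d\<^bsup>i+1\<^esup> s\<^sup>i\<close> changes its argument by an element of the image of \<open>d\<^bsup>i+1\<^esup>\<close>.\<close>

lemma proj_cospan_diff:
  assumes c: "supp c \<subseteq> smp (lev X p) q"
  shows "c + proj X p q p c \<in> cospan X p q"
proof (cases p)
  case 0
  then show ?thesis by (simp add: cospan_0)
next
  case (Suc p')
  have c': "supp c \<subseteq> smp (lev X (Suc p')) q" using c Suc by simp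
  have "n \<le> Suc p' \<Longrightarrow> c + proj X (Suc p') q n c \<in> cospan X (Suc p') q" for n
  proof (induction n)
    case 0
    then show ?case by (simp add: cospan_0)
  next
    case (Suc n)
    define d where "d = proj X (Suc p') q n c"
    have d: "supp d \<subseteq> smp (lev X (Suc p')) q"
      unfolding d_def using keys_proj [OF X _ c'] Suc.prems by simp
    have "supp (sco X p' q n d) \<subseteq> smp (lev X p') q"
      by (rule keys_kmap_cop [OF X simplex_op_collapse d]) (use Suc.prems in simp)
    then have "dco X p' q (Suc n) (sco X p' q n d) \<in> cospan X (Suc p') q"
      by (rule dco_in_cospan [rotated 2]) (use Suc.prems in auto)
    moreover have "c + d \<in> cospan X (Suc p') q" using Suc by (simp add: d_def)
    ultimately have "(c + d) + dco X p' q (Suc n) (sco X p' q n d) \<in> cospan X (Suc p') q"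
      by (rule cospan_add [rotated])
    then show ?case
      using squash_step_conv [OF X _ d, of n] Suc.prems by (simp add: d_def [symmetric] add.assoc)
  qed
  then show ?thesis using Suc by (simp del: proj.simps)
qed

text \<open>The zero elements of the conormalized normalized complex are the sums of an element of \<open>cospan\<close> and a
  degenerate chain.  As \<open>P\<close> kills the former and preserves the latter, and \<open>1 + P\<close> maps into
  \<open>cospan\<close>, they are recognized by \<open>P\<close>.\<close>

lemma bnulls_CN:
  "c \<in> bnulls (CN X) p t \<longleftrightarrow> c \<in> bchains (CN X) p t \<and>
     supp (proj X p (nat t) p c) \<subseteq> dgn (lev X p) (nat t)"
proof -
  let ?Y = "\<lambda>y. \<forall>k\<in>{1..p}. y k \<in> chains (S_chains (lev X (p - 1))) t"
  have "(\<Sum>k=1..p. kmap (cop X p (coface p k) (nat t)) (y k)) = (\<Sum>k=1..p. dco X (p - 1) (nat t) k (y k))" for y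
    by (rule sum.cong) (auto simp: coface_conv)
  then have B: "bnulls (CN X) p t = {\<Sum>k=1..p. dco X (p - 1) (nat t) k (y k) | y. ?Y y} +
      {c. supp c \<subseteq> dgn (lev X p) (nat t)}"
    by (simp add: conormalization_def nulls_S_chains)
  show ?thesis
  proof (cases "t < 0")
    case True
    \<comment> \<open>In negative chain degrees all modules are zero, although \<open>nat t = 0\<close>.\<close>
    define S where "S = {\<Sum>k=1..p. dco X (p - 1) (nat t) k (y k) | y. ?Y y}"
    have "z = 0" if z: "z \<in> S" for z
    proof -
      obtain y where "?Y y" and "z = (\<Sum>k=1..p. dco X (p - 1) (nat t) k (y k))"
        using z unfolding S_def by blast
      moreover from this(1) have "y k = 0" if "k \<in> {1..p}" for k
        using that True by (simp only: chains_S_chains)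
      ultimately show ?thesis by simp
    qed
    moreover have "0 \<in> S"
      unfolding S_def by (intro CollectI exI [of _ "\<lambda>_. 0"]) (simp add: chains_S_chains)
    ultimately have "S = {0}" by blast
    moreover have "{c :: 'a \<Rightarrow>\<^sub>0 bit. supp c \<subseteq> dgn (lev X p) (nat t)} = {0}"
      using True by simp
    ultimately have "bnulls (CN X) p t = {0}"
      unfolding B S_def by (simp add: set_plus_def)
    then show ?thesis using True by (cases "c = 0") (simp_all only: bchains_CN singleton_iff
        proj_0 keys_zero empty_subsetI simp_thms)
  next
    case False
    then have C: "{\<Sum>k=1..p. dco X (p - 1) (nat t) k (y k) | y. ?Y y} = cospan X p (nat t)"
      unfolding cospan_def by (simp add: chains_S_chains)
    show ?thesis unfolding B C
    proof
      assume "c \<in> cospan X p (nat t) + {c. supp c \<subseteq> dgn (lev X p) (nat t)}"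
      then obtain l \<nu> where c: "c = l + \<nu>" "l \<in> cospan X p (nat t)" "supp \<nu> \<subseteq> dgn (lev X p) (nat t)"
        by (auto simp: set_plus_def)
      have "supp \<nu> \<subseteq> smp (lev X p) (nat t)"
        using c(3) dgn_subset [OF simplicial_set_lev [OF X]] by blast
      then have "supp c \<subseteq> smp (lev X p) (nat t)"
        unfolding c(1) by (rule keys_plus_subset [OF cospan_keys [OF X c(2)]])
      moreover have "proj X p (nat t) p c = proj X p (nat t) p \<nu>"
        unfolding c(1) by (simp add: proj_add proj_cospan [OF c(2)])
      ultimately show "c \<in> bchains (CN X) p t \<and> supp (proj X p (nat t) p c) \<subseteq> dgn (lev X p) (nat t)"
        using False keys_proj_dgn [OF X _ c(3), of p] by (simp add: bchains_CN)
    next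
      assume a: "c \<in> bchains (CN X) p t \<and> supp (proj X p (nat t) p c) \<subseteq> dgn (lev X p) (nat t)"
      then have "c + proj X p (nat t) p c \<in> cospan X p (nat t)"
        by (intro proj_cospan_diff) (simp add: bchains_CN)
      then have "(c + proj X p (nat t) p c) + proj X p (nat t) p c \<in>
          cospan X p (nat t) + {c. supp c \<subseteq> dgn (lev X p) (nat t)}"
        by (rule set_plus_intro) (use a in simp)
      then show "c \<in> cospan X p (nat t) + {c. supp c \<subseteq> dgn (lev X p) (nat t)}"
        by (simp add: add.assoc)
    qed
  qed
qed

lemma tchain_of_tdgn: "tdgn X m x \<Longrightarrow> tchain X m x"
  unfolding tdgn_def tchain_def
proof (intro allI conjI impI)
  fix p assume a: "\<forall>p. supp (x p) \<subseteq> dgn (lev X p) (nat (m + int p))"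
  then show "supp (x p) \<subseteq> smp (lev X p) (nat (m + int p))"
    using dgn_subset [OF simplicial_set_lev [OF X]] by blast
  assume "m + int p < 0"
  then show "x p = 0" using a [rule_format, of p] by simp
qed

lemma nulls_TC: "x \<in> nulls (TC X) m \<longleftrightarrow> tchain X m x \<and> tdgn X m (tproj X m x)"
proof -
  have "x \<in> nulls (TC X) m \<longleftrightarrow> (\<forall>p. x p \<in> bnulls (CN X) p (m + int p))"
    by (simp add: total_def)
  then show ?thesis unfolding tchain_def tdgn_def tproj_def
    by (auto simp: bnulls_CN bchains_CN)
qed

lemma fil_TC:
  "x \<in> fil (CN X) (- int s) m \<longleftrightarrow> tchain X m x \<and>
     (\<forall>p<s. supp (tproj X m x p) \<subseteq> dgn (lev X p) (nat (m + int p)))"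
  unfolding fil_def by (auto simp: chains_TC bnulls_CN tproj_def tchain_def bchains_CN)

lemma tchain_tproj: "tchain X m x \<Longrightarrow> tchain X m (tproj X m x)"
  unfolding tchain_def tproj_def by (simp add: keys_proj [OF X])

lemma tdgn_tproj: "tdgn X m x \<Longrightarrow> tdgn X m (tproj X m x)"
  unfolding tdgn_def tproj_def by (simp add: keys_proj_dgn [OF X])

lemma sco_dco_same:
  assumes "j \<le> p" "i = j \<or> i = Suc j" "supp c \<subseteq> smp (lev X p) q"
  shows "sco X p q j (dco X p q i c) = c"
proof -
  have "collapse j (skip i x) = x" for x
    using assms(2) by (auto simp: skip_def collapse_def)
  then show ?thesis using assms(1,3)
    by (simp add: kmap_cop_funs [OF X] mono_skip mono_collapse skip_le collapse_le kmap_cop_id [OF X])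
qed

lemma sco_dco:
  assumes "j \<le> Suc p" "i \<le> Suc (Suc p)" "supp c \<subseteq> smp (lev X (Suc p)) q"
  shows "sco X (Suc p) q j (dco X (Suc p) q i c) =
     (if i < j then dco X p q i (sco X p q (j - 1) c)
      else if i = j \<or> i = Suc j then c
      else dco X p q (i - 1) (sco X p q j c))"
proof -
  consider "i < j" | "i = j \<or> i = Suc j" | "Suc j < i" by linarith
  then show ?thesis
  proof cases
    case 1
    then have "collapse j (skip i x) = skip i (collapse (j - 1) x)" for x
      by (auto simp: skip_def collapse_def)
    moreover have "collapse (j - 1) x \<le> p" if "x \<le> Suc p" for x
      using that 1 assms(1) by (auto simp: collapse_def)
    ultimately show ?thesis using 1 assms
      by (simp add: kmap_cop_funs [OF X] mono_skip mono_collapse skip_le collapse_le)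
  next
    case 2
    then have "\<not> i < j" by auto
    with 2 show ?thesis using sco_dco_same [OF _ 2 assms(3)] assms(1) by simp
  next
    case 3
    then have "collapse j (skip i x) = skip (i - 1) (collapse j x)" for x
      by (auto simp: skip_def collapse_def)
    moreover have "j \<le> p" using 3 assms(2) by simp
    ultimately show ?thesis using 3 assms
      by (simp add: kmap_cop_funs [OF X] mono_skip mono_collapse skip_le collapse_le)
  qed
qed

lemma dco_dco:
  assumes "i < j" "supp c \<subseteq> smp (lev X p) q"
  shows "dco X (Suc p) q j (dco X p q i c) = dco X (Suc p) q i (dco X p q (j - 1) c)"
  using assms skip_skip [OF assms(1)]
  by (simp add: kmap_cop_funs [OF X] mono_skip skip_le)

lemma cbd_cbd:
  assumes "supp c \<subseteq> smp (lev X p) q"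
  shows "cbd X (Suc p) q (cbd X p q c) = 0"
  unfolding cbd_def kmap_sum
  by (rule double_sum_cancel) (rule dco_dco [OF _ assms])

lemma keys_cbd:
  "supp c \<subseteq> smp (lev X p) q \<Longrightarrow> supp (cbd X p q c) \<subseteq> smp (lev X (Suc p)) q"
  unfolding cbd_def by (intro keys_sum_subset keys_kmap_cop [OF X simplex_op_skip])

lemma keys_cbd_dgn:
  "supp c \<subseteq> dgn (lev X p) q \<Longrightarrow> supp (cbd X p q c) \<subseteq> dgn (lev X (Suc p)) q"
  unfolding cbd_def by (intro keys_sum_subset keys_kmap_cop_dgn [OF X simplex_op_skip])

lemma cbd_fbd:
  "supp c \<subseteq> smp (lev X p) q \<Longrightarrow>
   cbd X p (q - 1) (fbd (lev X p) q c) = fbd (lev X (Suc p)) q (cbd X p q c)"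
  unfolding cbd_def fbd_sum by (intro sum.cong refl kmap_cop_fbd [OF X simplex_op_skip])

text \<open>In \<open>s\<^sup>j \<Sum> d\<^sup>i\<close> the terms for \<open>i = j\<close> and \<open>i = j + 1\<close> are identities and cancel; the others contain a
  codegeneracy applied to \<open>c\<close>.\<close>

lemma sco_cbd:
  assumes j: "j \<le> p" and c: "supp c \<subseteq> smp (lev X p) q"
    and s: "\<And>i. i < p \<Longrightarrow> sco X (p - 1) q i c = 0"
  shows "sco X p q j (cbd X p q c) = 0"
proof (cases p)
  case 0
  have "sco X p q 0 (dco X p q i c) = c" if "i \<le> Suc 0" for i
    by (rule sco_dco_same [OF _ _ c]) (use that in auto)
  then show ?thesis using j 0 by (simp add: cbd_def kmap_add)
next
  case (Suc p')
  have c': "supp c \<subseteq> smp (lev X (Suc p')) q" using c Suc by simp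
  have z: "sco X (Suc p') q j (dco X (Suc p') q i c) = (if i = j \<or> i = Suc j then c else 0)"
    if "i \<le> Suc (Suc p')" for i
    using that j s Suc sco_dco [OF _ that c', of j] by (auto)
  have "sco X (Suc p') q j (cbd X (Suc p') q c) = (\<Sum>i\<le>Suc (Suc p'). if i = j \<or> i = Suc j then c else 0)"
    unfolding cbd_def kmap_sum by (intro sum.cong refl z) simp
  also have "\<dots> = (\<Sum>i\<in>{j, Suc j}. c)"
    by (rule sum.mono_neutral_cong_right) (use j Suc in auto)
  also have "\<dots> = 0" by simp
  finally show ?thesis using Suc by simp
qed

lemma tchain_tbd:
  assumes "tchain X m x" shows "tchain X (m - 1) (tbd X m x)"
  unfolding tchain_def
proof (intro allI conjI impI)
  fix p
  have n: "nat (m - 1 + int p) = nat (m + int p) - 1" by simp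
  have f: "supp (fbd (lev X p) (nat (m + int p)) (x p)) \<subseteq> smp (lev X p) (nat (m - 1 + int p))"
    unfolding n using keys_fbd [OF simplicial_set_lev [OF X]] assms by (simp add: tchain_def)
  have c: "supp (cbd X p' (nat (m + int p')) (x p')) \<subseteq> smp (lev X p) (nat (m - 1 + int p))"
    if "p = Suc p'" for p'
    using keys_cbd assms that by (simp add: tchain_def)
  show "supp (tbd X m x p) \<subseteq> smp (lev X p) (nat (m - 1 + int p))"
    unfolding tbd_def by (rule keys_plus_subset [OF f]) (use c in \<open>auto split: nat.split\<close>)
  assume "m - 1 + int p < 0"
  then show "tbd X m x p = 0"
    using assms by (auto simp: tbd_def tchain_def fbd_def split: nat.split)
qed

lemma tdgn_tbd:
  assumes "tdgn X m x" shows "tdgn X (m - 1) (tbd X m x)"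
  unfolding tdgn_def
proof
  fix p
  have n: "nat (m - 1 + int p) = nat (m + int p) - 1" by simp
  have f: "supp (fbd (lev X p) (nat (m + int p)) (x p)) \<subseteq> dgn (lev X p) (nat (m - 1 + int p))"
    unfolding n using fbd_dgn [OF simplicial_set_lev [OF X]] assms by (simp add: tdgn_def)
  have c: "supp (cbd X p' (nat (m + int p')) (x p')) \<subseteq> dgn (lev X p) (nat (m - 1 + int p))"
    if "p = Suc p'" for p'
    using keys_cbd_dgn assms that by (simp add: tdgn_def)
  show "supp (tbd X m x p) \<subseteq> dgn (lev X p) (nat (m - 1 + int p))"
    unfolding tbd_def by (rule keys_plus_subset [OF f]) (use c in \<open>auto split: nat.split\<close>)
qed

lemma tbd_tbd:
  assumes "tchain X m x" shows "tbd X (m - 1) (tbd X m x) = 0"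
proof
  fix p
  have k: "supp (x p) \<subseteq> smp (lev X p) (nat (m + int p))" for p
    using assms by (simp add: tchain_def)
  have n: "nat (m - 1 + int p) = nat (m + int p) - 1" for p by simp
  have ff: "fbd (lev X p) (nat (m - 1 + int p)) (fbd (lev X p) (nat (m + int p)) (x p)) = 0" for p
    unfolding n using fbd_fbd [OF simplicial_set_lev [OF X] k] .
  show "tbd X (m - 1) (tbd X m x) p = 0 p"
  proof (cases p)
    case 0
    then show ?thesis using ff [of 0] by (simp add: tbd_def)
  next
    case (Suc p')
    have fc: "cbd X p' (nat (m - 1 + int p')) (fbd (lev X p') (nat (m + int p')) (x p')) =
        fbd (lev X p) (nat (m - 1 + int p)) (cbd X p' (nat (m + int p')) (x p'))"
      unfolding n [of p'] Suc using cbd_fbd [OF k] by simp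
    have cc: "cbd X p' (nat (m - 1 + int p')) (case p' of 0 \<Rightarrow> 0 | Suc p'' \<Rightarrow> cbd X p'' (nat (m + int p'')) (x p'')) = 0"
      using cbd_cbd [OF k] by (auto split: nat.split)
    show ?thesis
      using ff [of p] fc cc Suc by (simp add: tbd_def fbd_add cbd_add)
  qed
qed

text \<open>On the projections the differential of the conormalization becomes the sum of all faces and
  all cofaces.\<close>

lemma tproj_bdry:
  assumes x: "tchain X m x" shows "tproj X (m - 1) (bdry (TC X) m x) = tbd X m (tproj X m x)"
proof
  fix p
  have k: "supp (x p) \<subseteq> smp (lev X p) (nat (m + int p))" for p
    using x by (simp add: tchain_def)
  have n: "nat (m - 1 + int p) = nat (m + int p) - 1" by simp
  have f: "proj X p (nat (m - 1 + int p)) p (fbd (lev X p) (nat (m + int p)) (x p)) =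
      fbd (lev X p) (nat (m + int p)) (tproj X m x p)"
    unfolding n tproj_def by (rule proj_fbd [OF X _ k]) simp
  show "tproj X (m - 1) (bdry (TC X) m x) p = tbd X m (tproj X m x) p"
  proof (cases p)
    case 0
    then show ?thesis using f by (simp add: tproj_def tbd_def bdry_TC proj_add)
  next
    case (Suc p')
    define q where "q = nat (m + int p')"
    define z where "z = tproj X m x p'"
    have q: "nat (m - 1 + int p) = q" by (simp add: q_def Suc)
    have kz: "supp z \<subseteq> smp (lev X p') q"
      unfolding z_def tproj_def q_def by (rule keys_proj [OF X _ k]) simp
    have "x p' + z \<in> cospan X p' q"
      unfolding z_def tproj_def q_def by (rule proj_cospan_diff [OF k])
    \<comment> \<open>\<open>d\<^sup>0 d\<^sup>k = d\<^bsup>k+1\<^esup> d\<^sup>0\<close>, so \<open>d\<^sup>0\<close> maps \<open>cospan\<close> to \<open>cospan\<close>, which \<open>P\<close> kills.\<close>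
    then have "proj X p q p (dco X p' q 0 (x p' + z)) = 0"
    proof (cases p')
      case 0
      then show ?thesis using \<open>x p' + z \<in> cospan X p' q\<close> by (simp add: cospan_def)
    next
      case (Suc r)
      then obtain y where y: "x p' + z = (\<Sum>k=1..p'. dco X r q k (y k))"
          "\<forall>k\<in>{1..p'}. supp (y k) \<subseteq> smp (lev X r) q"
        using \<open>x p' + z \<in> cospan X p' q\<close> unfolding cospan_def by auto
      have "proj X p q p (dco X p' q 0 (dco X r q k (y k))) = 0" if k: "k \<in> {1..p'}" for k
      proof -
        have "dco X p' q 0 (dco X r q k (y k)) = dco X p' q (Suc k) (dco X r q 0 (y k))"
          using dco_dco [of 0 "Suc k" "y k" r q] y(2) k Suc by simp
        moreover have "supp (dco X r q 0 (y k)) \<subseteq> smp (lev X p') q"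
          unfolding Suc by (rule keys_kmap_cop [OF X simplex_op_skip]) (use y(2) k in auto)
        ultimately show ?thesis
          using proj_dco [OF X, of "Suc k" p'] k \<open>p = Suc p'\<close> by (simp del: proj.simps)
      qed
      then show ?thesis unfolding y(1) kmap_sum proj_sum by (rule sum.neutral [OF ballI])
    qed
    then have e1: "proj X p q p (dco X p' q 0 (x p')) = proj X p q p (dco X p' q 0 z)"
      by (simp only: kmap_add proj_add chain_add_eq_0_iff)
    have "cbd X p' q z = dco X p' q 0 z + (\<Sum>k=1..Suc p'. dco X p' q k z)"
      unfolding cbd_def by (simp add: atMost_atLeast0 sum.atLeast_Suc_atMost [of 0] One_nat_def del: sum.cl_ivl_Suc)
    moreover have "proj X p q p (\<Sum>k=1..Suc p'. dco X p' q k z) = 0"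
      unfolding proj_sum Suc by (rule sum.neutral, rule ballI, rule proj_dco [OF X _ _ kz]) auto
    ultimately have e2: "proj X p q p (cbd X p' q z) = proj X p q p (dco X p' q 0 z)"
      by (simp add: proj_add)
    have "sco X (p' - 1) q i z = 0" if i: "i < p'" for i
    proof -
      obtain r where r: "p' = Suc r" using i by (cases p') auto
      show ?thesis unfolding z_def tproj_def q_def r
        using sco_proj [OF X, of "x p'" r q i] k [of p'] i by (simp add: r q_def del: proj.simps)
    qed
    then have e3: "proj X p q p (cbd X p' q z) = cbd X p' q z"
      unfolding Suc by (intro proj_conormal [OF X keys_cbd [OF kz]] sco_cbd [OF _ kz])
    have "proj X p q p (dco X p' q 0 (x p')) = cbd X p' q z"
      using e1 e2 e3 by simp
    then show ?thesis
      using f Suc q by (simp add: tproj_def tbd_def bdry_TC proj_add z_def q_def del: proj.simps)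
  qed
qed

lemma tchain_bdry:
  assumes "tchain X m x" shows "tchain X (m - 1) (bdry (TC X) m x)"
  unfolding tchain_def
proof (intro allI conjI impI)
  fix p
  have n: "nat (m - 1 + int p) = nat (m + int p) - 1" by simp
  have f: "supp (fbd (lev X p) (nat (m + int p)) (x p)) \<subseteq> smp (lev X p) (nat (m - 1 + int p))"
    unfolding n using keys_fbd [OF simplicial_set_lev [OF X]] assms by (simp add: tchain_def)
  have c: "supp (dco X p' (nat (m + int p')) 0 (x p')) \<subseteq> smp (lev X p) (nat (m - 1 + int p))"
    if "p = Suc p'" for p'
    using keys_kmap_cop [OF X simplex_op_skip] assms that by (simp add: tchain_def)
  show "supp (bdry (TC X) m x p) \<subseteq> smp (lev X p) (nat (m - 1 + int p))"
    unfolding bdry_TC by (rule keys_plus_subset [OF f]) (use c in \<open>auto split: nat.split\<close>)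
  assume "m - 1 + int p < 0"
  then show "bdry (TC X) m x p = 0"
    using assms by (auto simp: bdry_TC tchain_def fbd_def split: nat.split)
qed

end

section \<open>The Alexander--Whitney product\<close>

text \<open>One summand of the composite of Alexander--Whitney and shuffle map, for \<open>x\<close> in cosimplicial
  degree \<open>p\<close> and \<open>y\<close> in cosimplicial degree \<open>j - p\<close>.\<close>

definition aw :: "'a csset \<Rightarrow> 'b csset \<Rightarrow> nat \<Rightarrow> nat \<Rightarrow> nat \<Rightarrow> nat \<Rightarrow>
    ('a \<Rightarrow>\<^sub>0 bit) \<Rightarrow> ('b \<Rightarrow>\<^sub>0 bit) \<Rightarrow> 'a \<times> 'b \<Rightarrow>\<^sub>0 bit" where
  "aw X Y j p t u x y = shuffle (lev X j) (lev Y j) t u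
     (kmap (cop X j (map (\<lambda>i. i) [0..<Suc p]) t) x)
     (kmap (cop Y j (map ((+) p) [0..<Suc (j - p)]) u) y)"

text \<open>The external product, for two cosimplicial spaces because the two universal elements live on
  different ones.\<close>

definition eprod :: "'a csset \<Rightarrow> 'b csset \<Rightarrow> int \<Rightarrow> int \<Rightarrow>
    (nat \<Rightarrow> 'a \<Rightarrow>\<^sub>0 bit) \<Rightarrow> (nat \<Rightarrow> 'b \<Rightarrow>\<^sub>0 bit) \<Rightarrow> nat \<Rightarrow> 'a \<times> 'b \<Rightarrow>\<^sub>0 bit" where
  "eprod X Y m n x y = (\<lambda>j. \<Sum>p\<le>j. aw X Y j p (nat (m + int p)) (nat (n + int (j - p))) (x p) (y (j - p)))"

lemma aw_add: "aw X Y j p t u (x + x') y = aw X Y j p t u x y + aw X Y j p t u x' y"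
  "aw X Y j p t u x (y + y') = aw X Y j p t u x y + aw X Y j p t u x y'"
  by (simp_all add: aw_def kmap_add shuffle_add_left shuffle_add_right)

lemma aw_0 [simp]: "aw X Y j p t u 0 y = 0" "aw X Y j p t u x 0 = 0"
  by (simp_all add: aw_def)

lemma aw_sum: "aw X Y j p t u (\<Sum>i\<in>I. f i) y = (\<Sum>i\<in>I. aw X Y j p t u (f i) y)"
  "aw X Y j p t u x (\<Sum>i\<in>I. g i) = (\<Sum>i\<in>I. aw X Y j p t u x (g i))"
  by (induction I rule: infinite_finite_induct) (simp_all add: aw_add)

lemma eprod_add:
  "eprod X Y m n (x + x') y = eprod X Y m n x y + eprod X Y m n x' y"
  "eprod X Y m n x (y + y') = eprod X Y m n x y + eprod X Y m n x y'"
  by (rule ext, simp add: eprod_def aw_add sum.distrib)+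

lemma mono_add: "mono ((+) (p :: nat))"
  by (simp add: mono_def)

lemma mono_self: "mono (\<lambda>i :: nat. i)"
  by (simp add: mono_def)

lemma simplex_op_front: "p \<le> j \<Longrightarrow> simplex_op p j (map (\<lambda>i. i) [0..<Suc p])"
  by (rule simplex_op_map [OF simplex_op_id mono_self]) simp

lemma simplex_op_back: "p \<le> j \<Longrightarrow> simplex_op (j - p) j (map ((+) p) [0..<Suc (j - p)])"
  by (rule simplex_op_map [OF simplex_op_id mono_add]) simp

lemma AW_front_eq:
  assumes X: "cosimplicial_space X" and c: "supp c \<subseteq> smp (lev X p) (nat t)"
  shows "AW_front (csS_chains X) p q t c = kmap (cop X (p + q) (map (\<lambda>i. i) [0..<Suc p]) (nat t)) c"
proof (induction q)
  case 0
  show ?case using kmap_cop_id [OF X c] by (simp add: AW_front_def)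
next
  case (Suc q)
  have "[Suc p..<Suc (p + Suc q)] = [Suc p..<Suc (p + q)] @ [Suc (p + q)]"
    by (simp add: upt_Suc)
  then have "AW_front (csS_chains X) p (Suc q) t c =
      kmap (cop X (Suc (p + q)) (coface (Suc (p + q)) (Suc (p + q))) (nat t)) (AW_front (csS_chains X) p q t c)"
    by (simp add: AW_front_def)
  also have "\<dots> = dco X (p + q) (nat t) (Suc (p + q)) (kmap (cop X (p + q) (map (\<lambda>i. i) [0..<Suc p]) (nat t)) c)"
    by (simp add: Suc coface_conv del: map_ident)
  also have "\<dots> = kmap (cop X (Suc (p + q)) (map (\<lambda>i. skip (Suc (p + q)) i) [0..<Suc p]) (nat t)) c"
    by (rule kmap_cop_funs [OF X c mono_skip _ mono_self]) (auto simp: skip_le)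
  also have "map (\<lambda>i. skip (Suc (p + q)) i) [0..<Suc p] = map (\<lambda>i. i) [0..<Suc p]"
    by (rule map_cong) (auto simp: skip_def)
  finally show ?case by simp
qed

lemma AW_back_eq:
  assumes X: "cosimplicial_space X" and c: "supp c \<subseteq> smp (lev X q) (nat t)"
  shows "AW_back (csS_chains X) p q t c = kmap (cop X (p + q) (map ((+) p) [0..<Suc q]) (nat t)) c"
proof (induction p)
  case 0
  show ?case using kmap_cop_id [OF X c] by (simp add: AW_back_def)
next
  case (Suc p)
  have "AW_back (csS_chains X) (Suc p) q t c =
      kmap (cop X (Suc (q + p)) (coface (Suc (q + p)) p) (nat t)) (AW_back (csS_chains X) p q t c)"
    by (simp add: AW_back_def upt_Suc)
  also have "\<dots> = dco X (p + q) (nat t) p (kmap (cop X (p + q) (map ((+) p) [0..<Suc q]) (nat t)) c)"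
    by (simp add: Suc coface_conv add.commute [of q p])
  also have "\<dots> = kmap (cop X (Suc (p + q)) (map (\<lambda>i. skip p (p + i)) [0..<Suc q]) (nat t)) c"
    by (rule kmap_cop_funs [OF X c mono_skip _ mono_add]) (auto simp: skip_le)
  also have "map (\<lambda>i. skip p (p + i)) [0..<Suc q] = map ((+) (Suc p)) [0..<Suc q]"
    by (rule map_cong) (auto simp: skip_def)
  finally show ?case by (subst add_Suc [of p q])
qed

text \<open>The iterated cofaces in the Alexander--Whitney map are the inclusions of \<open>[p]\<close> as the first and of
  \<open>[j - p]\<close> as the last vertices of \<open>[j]\<close>.\<close>

lemma ext_prod_eprod:
  assumes X: "cosimplicial_space X" and "tchain X m x" "tchain X n y"
  shows "ext_prod X m n x y = eprod X X m n x y"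
proof
  fix j
  have "supp (x p) \<subseteq> smp (lev X p) (nat (m + int p))"
    "supp (y p) \<subseteq> smp (lev X p) (nat (n + int p))" for p
    using assms by (auto simp: tchain_def)
  then show "ext_prod X m n x y j = eprod X X m n x y j"
    unfolding ext_prod_def eprod_def aw_def Let_def
    by (intro sum.cong) (simp_all add: AW_front_eq [OF X] AW_back_eq [OF X] del: of_nat_diff)
qed

context
  fixes X :: "'a csset" and Y :: "'b csset"
  assumes X: "cosimplicial_space X" and Y: "cosimplicial_space Y"
begin

lemma keys_aw:
  assumes "p \<le> j" "supp x \<subseteq> smp (lev X p) t" "supp y \<subseteq> smp (lev Y (j - p)) u"
  shows "supp (aw X Y j p t u x y) \<subseteq> smp (sprod (lev X j) (lev Y j)) (t + u)"
  unfolding aw_def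
  by (intro shuffle_keys simplicial_set_lev X Y keys_kmap_cop [OF X simplex_op_front] keys_kmap_cop [OF Y simplex_op_back] assms)

lemma aw_dgn_left:
  assumes "p \<le> j" "supp x \<subseteq> dgn (lev X p) t" "supp y \<subseteq> smp (lev Y (j - p)) u"
  shows "supp (aw X Y j p t u x y) \<subseteq> dgn (sprod (lev X j) (lev Y j)) (t + u)"
  unfolding aw_def
  by (intro shuffle_dgn_left simplicial_set_lev X Y keys_kmap_cop_dgn [OF X simplex_op_front] keys_kmap_cop [OF Y simplex_op_back] assms)

lemma aw_dgn_right:
  assumes "p \<le> j" "supp x \<subseteq> smp (lev X p) t" "supp y \<subseteq> dgn (lev Y (j - p)) u"
  shows "supp (aw X Y j p t u x y) \<subseteq> dgn (sprod (lev X j) (lev Y j)) (t + u)"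
  unfolding aw_def
  by (intro shuffle_dgn_right simplicial_set_lev X Y keys_kmap_cop [OF X simplex_op_front] keys_kmap_cop_dgn [OF Y simplex_op_back] assms)

lemma fbd_aw:
  assumes p: "p \<le> j" and x: "supp x \<subseteq> smp (lev X p) t"
    and y: "supp y \<subseteq> smp (lev Y (j - p)) u"
  shows "fbd (sprod (lev X j) (lev Y j)) (t + u) (aw X Y j p t u x y) =
     aw X Y j p (t - 1) u (fbd (lev X p) t x) y + aw X Y j p t (u - 1) x (fbd (lev Y (j - p)) u y)"
  unfolding aw_def kmap_cop_fbd [OF X simplex_op_front [OF p] x] kmap_cop_fbd [OF Y simplex_op_back [OF p] y]
  by (intro fbd_shuffle simplicial_set_lev X Y keys_kmap_cop [OF X simplex_op_front] keys_kmap_cop [OF Y simplex_op_back] p x y)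

lemma dco_aw:
  assumes p: "p \<le> j" and x: "supp x \<subseteq> smp (lev X p) t"
    and y: "supp y \<subseteq> smp (lev Y (j - p)) u"
  shows "dco (csprod X Y) j (t + u) i (aw X Y j p t u x y) = shuffle (lev X (Suc j)) (lev Y (Suc j)) t u
     (kmap (cop X (Suc j) (map (\<lambda>a. skip i a) [0..<Suc p]) t) x)
     (kmap (cop Y (Suc j) (map (\<lambda>a. skip i (p + a)) [0..<Suc (j - p)]) u) y)"
proof -
  have "dco X j t i (kmap (cop X j (map (\<lambda>i. i) [0..<Suc p]) t) x) =
      kmap (cop X (Suc j) (map (\<lambda>a. skip i a) [0..<Suc p]) t) x"
    by (rule kmap_cop_funs [OF X x mono_skip skip_le mono_self]) (use p in auto)
  moreover have "dco Y j u i (kmap (cop Y j (map ((+) p) [0..<Suc (j - p)]) u) y) =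
      kmap (cop Y (Suc j) (map (\<lambda>a. skip i (p + a)) [0..<Suc (j - p)]) u) y"
    by (rule kmap_cop_funs [OF Y y mono_skip skip_le mono_add]) (use p in auto)
  moreover have "dco (csprod X Y) j (t + u) i (aw X Y j p t u x y) = shuffle (lev X (Suc j)) (lev Y (Suc j)) t u
      (dco X j t i (kmap (cop X j (map (\<lambda>i. i) [0..<Suc p]) t) x))
      (dco Y j u i (kmap (cop Y j (map ((+) p) [0..<Suc (j - p)]) u) y))"
    unfolding aw_def cop_csprod
    by (rule shuffle_natural [OF simplicial_map_cop [OF X simplex_op_skip] simplicial_map_cop [OF Y simplex_op_skip]])
       (intro keys_kmap_cop [OF X simplex_op_front] keys_kmap_cop [OF Y simplex_op_back] p x y)+
  ultimately show ?thesis by simp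
qed

lemma dco_aw_low:
  assumes p: "p \<le> j" and x: "supp x \<subseteq> smp (lev X p) t"
    and y: "supp y \<subseteq> smp (lev Y (j - p)) u" and i: "i \<le> p"
  shows "dco (csprod X Y) j (t + u) i (aw X Y j p t u x y) = aw X Y (Suc j) (Suc p) t u (dco X p t i x) y"
proof -
  have "kmap (cop X (Suc j) (map (\<lambda>i. i) [0..<Suc (Suc p)]) t) (dco X p t i x) =
      kmap (cop X (Suc j) (map (\<lambda>a. skip i a) [0..<Suc p]) t) x"
    by (rule kmap_cop_funs [OF X x mono_self _ mono_skip skip_le]) (use p in auto)
  moreover have "skip i (p + a) = Suc p + a" for a using i by (simp add: skip_def)
  then have "(\<lambda>a. skip i (p + a)) = (+) (Suc p)" by auto
  ultimately show ?thesis
    unfolding dco_aw [OF p x y] unfolding aw_def by (simp only: diff_Suc_Suc)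
qed

lemma dco_aw_high:
  assumes p: "p \<le> j" and x: "supp x \<subseteq> smp (lev X p) t"
    and y: "supp y \<subseteq> smp (lev Y (j - p)) u" and i: "p < i"
  shows "dco (csprod X Y) j (t + u) i (aw X Y j p t u x y) = aw X Y (Suc j) p t u x (dco Y (j - p) u (i - p) y)"
proof -
  have "kmap (cop Y (Suc j) (map ((+) p) [0..<Suc (Suc (j - p))]) u) (dco Y (j - p) u (i - p) y) =
      kmap (cop Y (Suc j) (map (\<lambda>a. p + skip (i - p) a) [0..<Suc (j - p)]) u) y"
    by (rule kmap_cop_funs [OF Y y mono_add _ mono_skip skip_le]) (use p in auto)
  moreover have "p + skip (i - p) a = skip i (p + a)" for a using i by (auto simp: skip_def)
  moreover have "map (\<lambda>a. skip i a) [0..<Suc p] = map (\<lambda>i. i) [0..<Suc p]"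
    by (rule map_cong) (use i in \<open>auto simp: skip_def\<close>)
  ultimately show ?thesis
    unfolding dco_aw [OF p x y] unfolding aw_def by (simp only: Suc_diff_le [OF p])
qed

text \<open>Both operators send \<open>[p]\<close> to the first \<open>p + 1\<close> vertices and \<open>[j - p]\<close> to the last \<open>j - p + 1\<close> vertices of
  \<open>[j + 1]\<close>.\<close>

lemma aw_middle:
  assumes p: "p \<le> j" and x: "supp x \<subseteq> smp (lev X p) t"
    and y: "supp y \<subseteq> smp (lev Y (j - p)) u"
  shows "aw X Y (Suc j) (Suc p) t u (dco X p t (Suc p) x) y = aw X Y (Suc j) p t u x (dco Y (j - p) u 0 y)"
proof -
  have "kmap (cop Y (Suc j) (map ((+) p) [0..<Suc (Suc (j - p))]) u) (dco Y (j - p) u 0 y) =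
      kmap (cop Y (Suc j) (map (\<lambda>a. p + skip 0 a) [0..<Suc (j - p)]) u) y"
    by (rule kmap_cop_funs [OF Y y mono_add _ mono_skip skip_le]) (use p in auto)
  moreover have "(\<lambda>a. p + skip 0 a) = (+) (Suc p)" by (auto simp: skip_def)
  moreover have "kmap (cop X (Suc j) (map (\<lambda>i. i) [0..<Suc (Suc p)]) t) (dco X p t (Suc p) x) =
      kmap (cop X (Suc j) (map (\<lambda>a. skip (Suc p) a) [0..<Suc p]) t) x"
    by (rule kmap_cop_funs [OF X x mono_self _ mono_skip skip_le]) (use p in auto)
  moreover have "map (\<lambda>a. skip (Suc p) a) [0..<Suc p] = map (\<lambda>i. i) [0..<Suc p]"
    by (rule map_cong) (auto simp: skip_def)
  ultimately show ?thesis
    unfolding aw_def by (simp only: Suc_diff_le [OF p] diff_Suc_Suc)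
qed

text \<open>The cofaces \<open>d\<^sup>i\<close> with \<open>i \<le> p\<close> act on the first factor and those with \<open>i > p\<close> on the second one.  On
  the right the terms \<open>d\<^bsup>p+1\<^esup> x \<otimes> y\<close> and \<open>x \<otimes> d\<^sup>0 y\<close> are in excess; they agree by \<open>aw_middle\<close> and cancel.\<close>

lemma cbd_aw:
  assumes p: "p \<le> j" and x: "supp x \<subseteq> smp (lev X p) t"
    and y: "supp y \<subseteq> smp (lev Y (j - p)) u"
  shows "cbd (csprod X Y) j (t + u) (aw X Y j p t u x y) =
     aw X Y (Suc j) (Suc p) t u (cbd X p t x) y + aw X Y (Suc j) p t u x (cbd Y (j - p) u y)"
proof -
  let ?A = "\<lambda>i. aw X Y (Suc j) (Suc p) t u (dco X p t i x) y"
  let ?B = "\<lambda>i. aw X Y (Suc j) p t u x (dco Y (j - p) u i y)"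
  have "cbd (csprod X Y) j (t + u) (aw X Y j p t u x y) = (\<Sum>i\<le>Suc j. if i \<le> p then ?A i else ?B (i - p))"
    unfolding cbd_def by (intro sum.cong refl) (use dco_aw_low [OF p x y] dco_aw_high [OF p x y] in auto)
  also have "{..Suc j} = {..p} \<union> {Suc p..Suc j}" using p by auto
  also have "(\<Sum>i\<in>{..p} \<union> {Suc p..Suc j}. if i \<le> p then ?A i else ?B (i - p)) =
      (\<Sum>i\<le>p. ?A i) + (\<Sum>i=Suc p..Suc j. ?B (i - p))"
    by (subst sum.union_disjoint) (auto intro!: arg_cong2 [where f = "(+)"] sum.cong)
  also have "(\<Sum>i=Suc p..Suc j. ?B (i - p)) = (\<Sum>i=1..Suc (j - p). ?B i)"
    by (rule sum.reindex_bij_witness [of _ "\<lambda>i. i + p" "\<lambda>i. i - p"]) (use p in auto)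
  also have "(\<Sum>i\<le>p. ?A i) + (\<Sum>i=1..Suc (j - p). ?B i) =
      ((\<Sum>i\<le>p. ?A i) + ?A (Suc p)) + (?B 0 + (\<Sum>i=1..Suc (j - p). ?B i))"
    unfolding aw_middle [OF p x y] by (simp add: add.assoc)
  also have "?B 0 + (\<Sum>i=1..Suc (j - p). ?B i) = (\<Sum>i\<le>Suc (j - p). ?B i)"
    by (simp add: atMost_atLeast0 sum.atLeast_Suc_atMost [of 0] One_nat_def del: sum.cl_ivl_Suc)
  finally show ?thesis unfolding cbd_def aw_sum by simp
qed

lemma tchain_eprod:
  assumes x: "tchain X m x" and y: "tchain Y n y"
  shows "tchain (csprod X Y) (m + n) (eprod X Y m n x y)"
  unfolding tchain_def
proof (intro allI conjI impI)
  fix j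
  have z: "aw X Y j p (nat (m + int p)) (nat (n + int (j - p))) (x p) (y (j - p)) = 0"
    if "m + int p < 0 \<or> n + int (j - p) < 0" for p
    using that x y unfolding tchain_def by (metis aw_0)
  show "supp (eprod X Y m n x y j) \<subseteq> smp (lev (csprod X Y) j) (nat (m + n + int j))"
    unfolding eprod_def
  proof (rule keys_sum_subset)
    fix p assume p: "p \<in> {..j}"
    show "supp (aw X Y j p (nat (m + int p)) (nat (n + int (j - p))) (x p) (y (j - p)))
        \<subseteq> smp (lev (csprod X Y) j) (nat (m + n + int j))"
    proof (cases "m + int p < 0 \<or> n + int (j - p) < 0")
      case True
      then show ?thesis by (simp add: z)
    next
      case False
      then have "nat (m + n + int j) = nat (m + int p) + nat (n + int (j - p))" using p by auto
      then show ?thesis using keys_aw [of p j] x y p by (simp add: tchain_def del: smp_sprod of_nat_diff)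
    qed
  qed
  assume "m + n + int j < 0"
  then show "eprod X Y m n x y j = 0"
    unfolding eprod_def by (intro sum.neutral ballI z) auto
qed

text \<open>Stated for a fixed cosimplicial degree \<open>j\<close>, so as to apply to filtrations as well as to null elements.\<close>

lemma eprod_dgn:
  assumes x: "tchain X m x" and y: "tchain Y n y"
    and d: "\<And>p. p \<le> j \<Longrightarrow> supp (x p) \<subseteq> dgn (lev X p) (nat (m + int p)) \<or>
       supp (y (j - p)) \<subseteq> dgn (lev Y (j - p)) (nat (n + int (j - p)))"
  shows "supp (eprod X Y m n x y j) \<subseteq> dgn (lev (csprod X Y) j) (nat (m + n + int j))"
  unfolding eprod_def
proof (rule keys_sum_subset)
  fix p assume p: "p \<in> {..j}"
  show "supp (aw X Y j p (nat (m + int p)) (nat (n + int (j - p))) (x p) (y (j - p)))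
      \<subseteq> dgn (lev (csprod X Y) j) (nat (m + n + int j))"
  proof (cases "m + int p < 0 \<or> n + int (j - p) < 0")
    case True
    then have "aw X Y j p (nat (m + int p)) (nat (n + int (j - p))) (x p) (y (j - p)) = 0"
      using x y unfolding tchain_def by (metis aw_0)
    then show ?thesis by simp
  next
    case False
    then have "nat (m + n + int j) = nat (m + int p) + nat (n + int (j - p))" using p by auto
    moreover have "supp (x p) \<subseteq> smp (lev X p) (nat (m + int p))"
      "supp (y (j - p)) \<subseteq> smp (lev Y (j - p)) (nat (n + int (j - p)))"
      using x y unfolding tchain_def by blast+
    moreover have "p \<le> j" using p by simp
    ultimately show ?thesis unfolding lev_csprod
      using aw_dgn_left [of p j] aw_dgn_right [of p j] d [of p] by metis
  qed
qed

text \<open>The product is a chain map strictly, not only modulo degenerate chains, provided that the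
  horizontal differential is the sum of all cofaces.\<close>

lemma tbd_eprod:
  assumes x: "tchain X m x" and y: "tchain Y n y"
  shows "tbd (csprod X Y) (m + n) (eprod X Y m n x y) =
    eprod X Y (m - 1) n (tbd X m x) y + eprod X Y m (n - 1) x (tbd Y n y)"
proof
  fix j
  let ?t = "\<lambda>p. nat (m + int p)" and ?u = "\<lambda>q. nat (n + int q)"
  have kx: "supp (x p) \<subseteq> smp (lev X p) (?t p)"
    and ky: "supp (y p) \<subseteq> smp (lev Y p) (?u p)" for p
    using x y by (auto simp: tchain_def)
  \<comment> \<open>The truncations by \<open>nat\<close> do no harm: in a negative degree one of the factors vanishes.\<close>
  have neg: "x p = 0 \<or> y (j - p) = 0" if "\<not> (0 \<le> m + int p \<and> 0 \<le> n + int (j - p))" for p j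
    using that x y unfolding tchain_def by (meson not_le)
  have tu: "nat (m + n + int j) = ?t p + ?u (j - p)" if "0 \<le> m + int p \<and> 0 \<le> n + int (j - p)" "p \<le> j" for p j
    using that by auto
  have n1: "nat (m - 1 + int p) = ?t p - 1" "nat (n - 1 + int p) = ?u p - 1" for p by auto
  have vert: "fbd (lev (csprod X Y) j) (nat (m + n + int j)) (eprod X Y m n x y j) =
      (\<Sum>p\<le>j. aw X Y j p (?t p - 1) (?u (j - p)) (fbd (lev X p) (?t p) (x p)) (y (j - p))) +
      (\<Sum>p\<le>j. aw X Y j p (?t p) (?u (j - p) - 1) (x p) (fbd (lev Y (j - p)) (?u (j - p)) (y (j - p))))"
    unfolding eprod_def fbd_sum sum.distrib [symmetric]
  proof (rule sum.cong [OF refl])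
    fix p assume p: "p \<in> {..j}"
    show "fbd (lev (csprod X Y) j) (nat (m + n + int j)) (aw X Y j p (?t p) (?u (j - p)) (x p) (y (j - p))) =
        aw X Y j p (?t p - 1) (?u (j - p)) (fbd (lev X p) (?t p) (x p)) (y (j - p)) +
        aw X Y j p (?t p) (?u (j - p) - 1) (x p) (fbd (lev Y (j - p)) (?u (j - p)) (y (j - p)))"
    proof (cases "0 \<le> m + int p \<and> 0 \<le> n + int (j - p)")
      case True
      then show ?thesis using fbd_aw [OF _ kx ky, of p j] tu [OF True] p by simp
    next
      case False
      then show ?thesis using neg [of p j] by auto
    qed
  qed
  have hor: "(case j of 0 \<Rightarrow> 0 | Suc j' \<Rightarrow> cbd (csprod X Y) j' (nat (m + n + int j')) (eprod X Y m n x y j')) =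
      (\<Sum>p\<le>j. aw X Y j p (?t p - 1) (?u (j - p)) (case p of 0 \<Rightarrow> 0 | Suc p' \<Rightarrow> cbd X p' (?t p') (x p')) (y (j - p))) +
      (\<Sum>p\<le>j. aw X Y j p (?t p) (?u (j - p) - 1) (x p) (case j - p of 0 \<Rightarrow> 0 | Suc q \<Rightarrow> cbd Y q (?u q) (y q)))"
  proof (cases j)
    case 0
    then show ?thesis by simp
  next
    case (Suc j')
    have "cbd (csprod X Y) j' (nat (m + n + int j')) (eprod X Y m n x y j') =
        (\<Sum>p\<le>j'. aw X Y (Suc j') (Suc p) (?t p) (?u (j' - p)) (cbd X p (?t p) (x p)) (y (j' - p))) +
        (\<Sum>p\<le>j'. aw X Y (Suc j') p (?t p) (?u (j' - p)) (x p) (cbd Y (j' - p) (?u (j' - p)) (y (j' - p))))"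
      unfolding eprod_def cbd_sum sum.distrib [symmetric]
    proof (rule sum.cong [OF refl])
      fix p assume p: "p \<in> {..j'}"
      show "cbd (csprod X Y) j' (nat (m + n + int j')) (aw X Y j' p (?t p) (?u (j' - p)) (x p) (y (j' - p))) =
          aw X Y (Suc j') (Suc p) (?t p) (?u (j' - p)) (cbd X p (?t p) (x p)) (y (j' - p)) +
          aw X Y (Suc j') p (?t p) (?u (j' - p)) (x p) (cbd Y (j' - p) (?u (j' - p)) (y (j' - p)))"
      proof (cases "0 \<le> m + int p \<and> 0 \<le> n + int (j' - p)")
        case True
        then show ?thesis using cbd_aw [OF _ kx ky, of p j'] tu [OF True] p by simp
      next
        case False
        then show ?thesis using neg [of p j'] by auto
      qed
    qed
    moreover have "(\<Sum>p\<le>j. aw X Y j p (?t p - 1) (?u (j - p)) (case p of 0 \<Rightarrow> 0 | Suc p' \<Rightarrow> cbd X p' (?t p') (x p')) (y (j - p))) =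
        (\<Sum>p\<le>j'. aw X Y (Suc j') (Suc p) (?t p) (?u (j' - p)) (cbd X p (?t p) (x p)) (y (j' - p)))"
    proof -
      have "?t (Suc p) - 1 = ?t p" if "x p \<noteq> 0" for p
        proof -
        have "0 \<le> m + int p" using that x unfolding tchain_def by (meson not_le)
        then show ?thesis by simp
      qed
      then have "aw X Y (Suc j') (Suc p) (?t (Suc p) - 1) u (cbd X p (?t p) (x p)) z =
          aw X Y (Suc j') (Suc p) (?t p) u (cbd X p (?t p) (x p)) z" for p u z
        by (cases "x p = 0") simp_all
      then show ?thesis unfolding Suc by (simp add: sum.atMost_Suc_shift del: sum.atMost_Suc)
    qed
    moreover have "(\<Sum>p\<le>j. aw X Y j p (?t p) (?u (j - p) - 1) (x p) (case j - p of 0 \<Rightarrow> 0 | Suc q \<Rightarrow> cbd Y q (?u q) (y q))) =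
        (\<Sum>p\<le>j'. aw X Y (Suc j') p (?t p) (?u (j' - p)) (x p) (cbd Y (j' - p) (?u (j' - p)) (y (j' - p))))"
    proof -
      have "?u (Suc p) - 1 = ?u p" if "y p \<noteq> 0" for p
        proof -
        have "0 \<le> n + int p" using that y unfolding tchain_def by (meson not_le)
        then show ?thesis by simp
      qed
      then have "aw X Y (Suc j') p t (?u (Suc q) - 1) z (cbd Y q (?u q) (y q)) =
          aw X Y (Suc j') p t (?u q) z (cbd Y q (?u q) (y q))" for p q t z
        by (cases "y q = 0") simp_all
      then show ?thesis unfolding Suc by (simp add: Suc_diff_le del: of_nat_diff of_nat_Suc)
    qed
    ultimately show ?thesis by (simp add: Suc)
  qed
  show "tbd (csprod X Y) (m + n) (eprod X Y m n x y) j =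
      (eprod X Y (m - 1) n (tbd X m x) y + eprod X Y m (n - 1) x (tbd Y n y)) j"
    unfolding tbd_def plus_fun_apply vert hor
    unfolding eprod_def n1 aw_add sum.distrib
    by (simp only: ac_simps)
qed

end

lemma cosimplicial_mapD:
  assumes "cosimplicial_map Y X f"
  shows "simplicial_map (lev Y p) (lev X p) (f p)"
    and "simplex_op m n \<theta> \<Longrightarrow> y \<in> smp (lev Y m) q \<Longrightarrow> f n q (cop Y n \<theta> q y) = cop X n \<theta> q (f m q y)"
  using assms unfolding cosimplicial_map_def simplicial_map_def by (simp_all add: image_subset_iff)

definition tmap :: "int \<Rightarrow> (nat \<Rightarrow> nat \<Rightarrow> 'b \<Rightarrow> 'a) \<Rightarrow> (nat \<Rightarrow> 'b \<Rightarrow>\<^sub>0 bit) \<Rightarrow> nat \<Rightarrow> 'a \<Rightarrow>\<^sub>0 bit" where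
  "tmap m f x = (\<lambda>p. kmap (f p (nat (m + int p))) (x p))"

lemma tmap_add: "tmap m f (x + y) = tmap m f x + tmap m f y"
  by (rule ext) (simp add: tmap_def kmap_add)

context
  fixes Y :: "'b csset" and X :: "'a csset" and f :: "nat \<Rightarrow> nat \<Rightarrow> 'b \<Rightarrow> 'a"
  assumes X: "cosimplicial_space X" and Y: "cosimplicial_space Y" and f: "cosimplicial_map Y X f"
begin

lemma tchain_tmap: "tchain Y m x \<Longrightarrow> tchain X m (tmap m f x)"
  unfolding tchain_def tmap_def using keys_kmap_simplicial [OF cosimplicial_mapD(1) [OF f]] by simp

lemma tdgn_tmap: "tdgn Y m x \<Longrightarrow> tdgn X m (tmap m f x)"
  unfolding tdgn_def tmap_def using keys_kmap_dgn [OF cosimplicial_mapD(1) [OF f]] by simp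

lemma kmap_cosimplicial:
  assumes "simplex_op m n \<theta>" "supp c \<subseteq> smp (lev Y m) q"
  shows "kmap (f n q) (kmap (cop Y n \<theta> q) c) = kmap (cop X n \<theta> q) (kmap (f m q) c)"
  unfolding kmap_kmap by (rule kmap_cong, rule cosimplicial_mapD(2) [OF f]) (use assms in auto)

lemma kmap_cbd:
  assumes "supp c \<subseteq> smp (lev Y p) q"
  shows "kmap (f (Suc p) q) (cbd Y p q c) = cbd X p q (kmap (f p q) c)"
  unfolding cbd_def kmap_sum by (intro sum.cong refl kmap_cosimplicial simplex_op_skip assms)

lemma kmap_proj:
  assumes "supp c \<subseteq> smp (lev Y p) q" "n \<le> p"
  shows "kmap (f p q) (proj Y p q n c) = proj X p q n (kmap (f p q) c)"
  using assms(2)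
proof (induction n)
  case (Suc n)
  then show ?case
    using kmap_cosimplicial [OF simplex_op_squash keys_proj [OF Y _ assms(1)], of n n]
    by (simp add: squash_step_def kmap_add)
qed simp

lemma tproj_tmap: "tchain Y m x \<Longrightarrow> tproj X m (tmap m f x) = tmap m f (tproj Y m x)"
  unfolding tproj_def tmap_def tchain_def by (simp add: kmap_proj)

lemma tmap_tbd:
  assumes "tchain Y m x" shows "tmap (m - 1) f (tbd Y m x) = tbd X m (tmap m f x)"
proof
  fix p
  have k: "supp (x p) \<subseteq> smp (lev Y p) (nat (m + int p))" for p
    using assms by (simp add: tchain_def)
  have n: "nat (m - 1 + int p) = nat (m + int p) - 1" by simp
  have "kmap (f p (nat (m - 1 + int p))) (fbd (lev Y p) (nat (m + int p)) (x p)) =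
      fbd (lev X p) (nat (m + int p)) (kmap (f p (nat (m + int p))) (x p))"
    unfolding n by (rule kmap_fbd [OF cosimplicial_mapD(1) [OF f] k])
  then show "tmap (m - 1) f (tbd Y m x) p = tbd X m (tmap m f x) p"
    unfolding tmap_def tbd_def kmap_add
    by (cases p) (simp_all add: kmap_cbd [OF k])
qed

lemma tmap_bdry:
  assumes "tchain Y m x" shows "tmap (m - 1) f (bdry (TC Y) m x) = bdry (TC X) m (tmap m f x)"
proof
  fix p
  have k: "supp (x p) \<subseteq> smp (lev Y p) (nat (m + int p))" for p
    using assms by (simp add: tchain_def)
  have n: "nat (m - 1 + int p) = nat (m + int p) - 1" by simp
  have "kmap (f p (nat (m - 1 + int p))) (fbd (lev Y p) (nat (m + int p)) (x p)) =
      fbd (lev X p) (nat (m + int p)) (kmap (f p (nat (m + int p))) (x p))"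
    unfolding n by (rule kmap_fbd [OF cosimplicial_mapD(1) [OF f] k])
  then show "tmap (m - 1) f (bdry (TC Y) m x) p = bdry (TC X) m (tmap m f x) p"
    unfolding tmap_def bdry_TC kmap_add
    by (cases p) (simp_all add: kmap_cosimplicial [OF simplex_op_skip k])
qed

lemma nulls_tmap: "x \<in> nulls (TC Y) m \<Longrightarrow> tmap m f x \<in> nulls (TC X) m"
  by (simp add: nulls_TC [OF X] nulls_TC [OF Y] tproj_tmap tchain_tmap tdgn_tmap)

lemma fil_tmap: "x \<in> fil (CN Y) (- int s) m \<Longrightarrow> tmap m f x \<in> fil (CN X) (- int s) m"
  unfolding fil_TC [OF X] fil_TC [OF Y]
proof (intro conjI allI impI)
  fix p assume a: "tchain Y m x \<and>
      (\<forall>p<s. supp (tproj Y m x p) \<subseteq> dgn (lev Y p) (nat (m + int p)))"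
  then show "tchain X m (tmap m f x)" by (simp add: tchain_tmap)
  assume "p < s"
  then show "supp (tproj X m (tmap m f x) p) \<subseteq> dgn (lev X p) (nat (m + int p))"
    using a keys_kmap_dgn [OF cosimplicial_mapD(1) [OF f]] by (simp add: tproj_tmap) (simp add: tmap_def)
qed

end

section \<open>A universal homotopy by coning\<close>

text \<open>Simplices of \<open>(\<Delta>\<^sup>k \<times> \<Delta>\<^sup>m) \<times> (\<Delta>\<^sup>k \<times> \<Delta>\<^sup>n)\<close>, given by their lists of vertices.\<close>

type_synonym quad = "(nat list \<times> nat list) \<times> (nat list \<times> nat list)"

text \<open>The operator \<open>f\<close> acts on both copies of \<open>\<Delta>\<^sup>k\<close>, since these come from the same cosimplicial direction.\<close>

definition qmap :: "(nat \<Rightarrow> nat) \<Rightarrow> (nat \<Rightarrow> nat) \<Rightarrow> (nat \<Rightarrow> nat) \<Rightarrow> quad \<Rightarrow> quad" where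
  "qmap f g h = (\<lambda>((a, b), (c, d)). ((map f a, map g b), (map f c, map h d)))"

definition qdel :: "nat \<Rightarrow> quad \<Rightarrow> quad" where
  "qdel t = (\<lambda>((a, b), (c, d)). ((del t a, del t b), (del t c, del t d)))"

definition qcone :: "quad \<Rightarrow> quad" where
  "qcone = (\<lambda>((a, b), (c, d)). ((0 # a, 0 # b), (0 # c, 0 # d)))"

definition qbd :: "nat \<Rightarrow> (quad \<Rightarrow>\<^sub>0 bit) \<Rightarrow> quad \<Rightarrow>\<^sub>0 bit" where
  "qbd N c = (\<Sum>t\<le>N. kmap (qdel t) c)"

lemma qmap_qmap: "qmap f g h (qmap f' g' h' z) = qmap (f \<circ> f') (g \<circ> g') (h \<circ> h') z"
  by (cases z rule: prod.exhaust, rename_tac u w, case_tac u, case_tac w) (simp add: qmap_def)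

lemma qdel_qmap: "qdel t (qmap f g h z) = qmap f g h (qdel t z)"
  by (cases z rule: prod.exhaust, rename_tac u w, case_tac u, case_tac w) (simp add: qmap_def qdel_def del_map)

lemma qcone_qmap: "f 0 = 0 \<Longrightarrow> g 0 = 0 \<Longrightarrow> h 0 = 0 \<Longrightarrow> qmap f g h (qcone z) = qcone (qmap f g h z)"
  by (cases z rule: prod.exhaust, rename_tac u w, case_tac u, case_tac w) (simp add: qmap_def qcone_def)

lemma qdel_0_qcone: "qdel 0 (qcone z) = z"
  by (cases z rule: prod.exhaust, rename_tac u w, case_tac u, case_tac w) (simp add: qdel_def qcone_def del_def)

lemma qdel_Suc_qcone: "qdel (Suc t) (qcone z) = qcone (qdel t z)"
  by (cases z rule: prod.exhaust, rename_tac u w, case_tac u, case_tac w) (simp add: qdel_def qcone_def del_def)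

lemma qbd_add: "qbd N (c + d) = qbd N c + qbd N d"
  by (simp add: qbd_def kmap_add sum.distrib)

lemma qbd_0 [simp]: "qbd N 0 = 0"
  by (simp add: qbd_def)

lemma qbd_sum: "qbd N (\<Sum>i\<in>I. c i) = (\<Sum>i\<in>I. qbd N (c i))"
  by (induction I rule: infinite_finite_induct) (simp_all add: qbd_add)

lemma qbd_qmap: "qbd N (kmap (qmap f g h) c) = kmap (qmap f g h) (qbd N c)"
  by (simp add: qbd_def kmap_sum kmap_kmap qdel_qmap)

text \<open>The cone is a contraction of the augmented complex; with \<open>N = 0\<close> the second summand accounts for the
  empty simplex.\<close>

lemma qbd_qcone: "qbd (Suc N) (kmap qcone c) = c + kmap qcone (qbd N c)"
proof -
  have "kmap (\<lambda>z. z) c = c" by (rule kmap_eq_self) simp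
  then show ?thesis
    by (simp add: qbd_def kmap_sum kmap_kmap sum.atMost_Suc_shift qdel_0_qcone qdel_Suc_qcone del: sum.atMost_Suc)
qed

text \<open>Families indexed by three cosimplicial degrees, and the sums of the cofaces in each of these.\<close>

type_synonym qfam = "nat \<Rightarrow> nat \<Rightarrow> nat \<Rightarrow> quad \<Rightarrow>\<^sub>0 bit"

definition qdK :: "qfam \<Rightarrow> qfam" where
  "qdK A m n k = (case k of 0 \<Rightarrow> 0 | Suc k' \<Rightarrow> \<Sum>j\<le>k. kmap (qmap (skip j) id id) (A m n k'))"

definition qdM :: "qfam \<Rightarrow> qfam" where
  "qdM A m n k = (case m of 0 \<Rightarrow> 0 | Suc m' \<Rightarrow> \<Sum>j\<le>m. kmap (qmap id (skip j) id) (A m' n k))"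

definition qdN :: "qfam \<Rightarrow> qfam" where
  "qdN A m n k = (case n of 0 \<Rightarrow> 0 | Suc n' \<Rightarrow> \<Sum>j\<le>n. kmap (qmap id id (skip j)) (A m n' k))"

definition qd :: "qfam \<Rightarrow> qfam" where
  "qd A m n k = qdK A m n k + qdM A m n k + qdN A m n k"

lemma skip_comp: "i < j \<Longrightarrow> skip j \<circ> skip i = skip i \<circ> skip (j - 1)"
  using skip_skip by auto

lemma qdK_qdK: "qdK (qdK A) m n k = 0"
proof (cases k)
  case (Suc k1)
  show ?thesis
  proof (cases k1)
    case Suc2: (Suc k2)
    have "(\<Sum>j\<le>Suc k1. \<Sum>i\<le>k1. kmap (qmap (skip j) id id) (kmap (qmap (skip i) id id) (A m n k2))) = 0"
      by (rule double_sum_cancel) (simp only: kmap_kmap qmap_qmap skip_comp)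
    then show ?thesis using Suc Suc2 by (simp add: qdK_def kmap_sum del: sum.atMost_Suc)
  qed (use Suc in \<open>simp add: qdK_def\<close>)
qed (simp add: qdK_def)

lemma qdM_qdM: "qdM (qdM A) m n k = 0"
proof (cases m)
  case (Suc m1)
  show ?thesis
  proof (cases m1)
    case Suc2: (Suc m2)
    have "(\<Sum>j\<le>Suc m1. \<Sum>i\<le>m1. kmap (qmap id (skip j) id) (kmap (qmap id (skip i) id) (A m2 n k))) = 0"
      by (rule double_sum_cancel) (simp only: kmap_kmap qmap_qmap skip_comp)
    then show ?thesis using Suc Suc2 by (simp add: qdM_def kmap_sum del: sum.atMost_Suc)
  qed (use Suc in \<open>simp add: qdM_def\<close>)
qed (simp add: qdM_def)

lemma qdN_qdN: "qdN (qdN A) m n k = 0"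
proof (cases n)
  case (Suc n1)
  show ?thesis
  proof (cases n1)
    case Suc2: (Suc n2)
    have "(\<Sum>j\<le>Suc n1. \<Sum>i\<le>n1. kmap (qmap id id (skip j)) (kmap (qmap id id (skip i)) (A m n2 k))) = 0"
      by (rule double_sum_cancel) (simp only: kmap_kmap qmap_qmap skip_comp)
    then show ?thesis using Suc Suc2 by (simp add: qdN_def kmap_sum del: sum.atMost_Suc)
  qed (use Suc in \<open>simp add: qdN_def\<close>)
qed (simp add: qdN_def)

lemma qdK_qdM: "qdK (qdM A) m n k = qdM (qdK A) m n k"
  by (cases k; cases m) (simp_all add: qdK_def qdM_def kmap_sum kmap_kmap qmap_qmap del: sum.atMost_Suc, rule sum.swap)

lemma qdK_qdN: "qdK (qdN A) m n k = qdN (qdK A) m n k"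
  by (cases k; cases n) (simp_all add: qdK_def qdN_def kmap_sum kmap_kmap qmap_qmap del: sum.atMost_Suc, rule sum.swap)

lemma qdM_qdN: "qdM (qdN A) m n k = qdN (qdM A) m n k"
  by (cases m; cases n) (simp_all add: qdM_def qdN_def kmap_sum kmap_kmap qmap_qmap del: sum.atMost_Suc, rule sum.swap)

lemma qdK_add: "qdK (\<lambda>m n k. A m n k + B m n k) m n k = qdK A m n k + qdK B m n k"
  by (simp add: qdK_def kmap_add sum.distrib split: nat.split)

lemma qdM_add: "qdM (\<lambda>m n k. A m n k + B m n k) m n k = qdM A m n k + qdM B m n k"
  by (simp add: qdM_def kmap_add sum.distrib split: nat.split)

lemma qdN_add: "qdN (\<lambda>m n k. A m n k + B m n k) m n k = qdN A m n k + qdN B m n k"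
  by (simp add: qdN_def kmap_add sum.distrib split: nat.split)

lemma qd_add: "qd (\<lambda>m n k. A m n k + B m n k) m n k = qd A m n k + qd B m n k"
  by (simp add: qd_def qdK_add qdM_add qdN_add ac_simps)

lemma qd_qd: "qd (qd A) m n k = 0"
proof -
  have e: "qd A = (\<lambda>m n k. qdK A m n k + qdM A m n k + qdN A m n k)"
    by (intro ext) (simp add: qd_def)
  show ?thesis
    unfolding qd_def [of "qd A"] unfolding e qdK_add qdM_add qdN_add
    unfolding qdK_qdK qdM_qdM qdN_qdN qdK_qdM [symmetric] qdK_qdN [symmetric] qdM_qdN [symmetric]
    by (simp add: ac_simps)
qed

lemma qbd_qd: "qbd (m + n + k) (qd A m n k) = qd (\<lambda>m n k. qbd (Suc (m + n + k)) (A m n k)) m n k"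
  unfolding qd_def qbd_add
  by (simp add: qdK_def qdM_def qdN_def qbd_sum qbd_qmap del: sum.atMost_Suc split: nat.split)

lemma qd_cong:
  assumes "\<And>m' n' k'. m' + n' + k' < m + n + k \<Longrightarrow> A m' n' k' = B m' n' k'"
  shows "qd A m n k = qd B m n k"
  unfolding qd_def qdK_def qdM_def qdN_def using assms by (simp split: nat.split del: sum.atMost_Suc)

text \<open>The cone over the initial vertex contracts the universal chains, and the recursion makes the
  homotopy compatible with all cofaces.\<close>

function hty :: "qfam \<Rightarrow> qfam" where
  "hty W m n k = kmap qcone (W m n k +
     ((case k of 0 \<Rightarrow> 0 | Suc k' \<Rightarrow> \<Sum>j\<le>k. kmap (qmap (skip j) id id) (hty W m n k')) +
      (case m of 0 \<Rightarrow> 0 | Suc m' \<Rightarrow> \<Sum>j\<le>m. kmap (qmap id (skip j) id) (hty W m' n k)) +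
      (case n of 0 \<Rightarrow> 0 | Suc n' \<Rightarrow> \<Sum>j\<le>n. kmap (qmap id id (skip j)) (hty W m n' k))))"
  by auto
termination
  by (relation "measure (\<lambda>(W, m, n, k). m + n + k)") auto

declare hty.simps [simp del]

lemma hty_eq: "hty W m n k = kmap qcone (W m n k + qd (hty W) m n k)"
  by (subst hty.simps) (simp only: qd_def qdK_def qdM_def qdN_def)

text \<open>In the recursion the cone is applied to \<open>W + qd (hty W)\<close>.  This is a cycle, by induction and because of
  \<open>qd_qd\<close> and the hypothesis, so its cone bounds it.\<close>

lemma qbd_hty:
  assumes W: "\<And>m n k. qbd (m + n + k) (W m n k) = qd W m n k"
  shows "qbd (Suc (m + n + k)) (hty W m n k) = W m n k + qd (hty W) m n k"
proof (induction "m + n + k" arbitrary: m n k rule: less_induct)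
  case less
  have "qbd (m + n + k) (qd (hty W) m n k) = qd (\<lambda>m n k. W m n k + qd (hty W) m n k) m n k"
    unfolding qbd_qd by (rule qd_cong) (rule less, simp)
  also have "\<dots> = qd W m n k"
    by (simp add: qd_add qd_qd)
  finally show ?case
    by (subst hty_eq) (simp add: qbd_qcone qbd_add W)
qed

abbreviation cubes :: "nat \<Rightarrow> nat \<Rightarrow> nat \<Rightarrow> quad sset" where
  "cubes m n k \<equiv> sprod (sprod (std k) (std m)) (sprod (std k) (std n))"

lemma simplex_op_cone: "simplex_op r k a \<Longrightarrow> simplex_op (Suc r) k (0 # a)"
  by (auto simp: simplex_op_def)

lemma simplex_op_skip_map: "simplex_op r k a \<Longrightarrow> simplex_op r (Suc k) (map (skip j) a)"
  by (rule simplex_op_map [OF _ mono_skip skip_le])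

lemma keys_qd:
  assumes "\<And>m' n' k'. Suc (m' + n' + k') = m + n + k \<Longrightarrow>
    supp (A m' n' k') \<subseteq> smp (cubes m' n' k') r"
  shows "supp (qd A m n k) \<subseteq> smp (cubes m n k) r"
proof -
  have K: "supp (kmap (qmap (skip j) id id) (A m n k')) \<subseteq> smp (cubes m n k) r" if "k = Suc k'" for j k'
    by (rule keys_kmap_subset)
       (use assms [of m n k'] that in \<open>auto simp: qmap_def simplex_op_skip_map\<close>)
  have M: "supp (kmap (qmap id (skip j) id) (A m' n k)) \<subseteq> smp (cubes m n k) r" if "m = Suc m'" for j m'
    by (rule keys_kmap_subset)
       (use assms [of m' n k] that in \<open>auto simp: qmap_def simplex_op_skip_map\<close>)
  have N: "supp (kmap (qmap id id (skip j)) (A m n' k)) \<subseteq> smp (cubes m n k) r" if "n = Suc n'" for j n'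
    by (rule keys_kmap_subset)
       (use assms [of m n' k] that in \<open>auto simp: qmap_def simplex_op_skip_map\<close>)
  have "supp (qdK A m n k) \<subseteq> smp (cubes m n k) r"
    unfolding qdK_def using K by (cases k) (simp_all add: keys_sum_subset del: sum.atMost_Suc smp_sprod)
  moreover have "supp (qdM A m n k) \<subseteq> smp (cubes m n k) r"
    unfolding qdM_def using M by (cases m) (simp_all add: keys_sum_subset del: sum.atMost_Suc smp_sprod)
  moreover have "supp (qdN A m n k) \<subseteq> smp (cubes m n k) r"
    unfolding qdN_def using N by (cases n) (simp_all add: keys_sum_subset del: sum.atMost_Suc smp_sprod)
  ultimately show ?thesis unfolding qd_def by (intro keys_plus_subset)
qed

lemma keys_hty:
  assumes W: "\<And>m n k. supp (W m n k) \<subseteq> smp (cubes m n k) (m + n + k)"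
  shows "supp (hty W m n k) \<subseteq> smp (cubes m n k) (Suc (m + n + k))"
proof (induction "m + n + k" arbitrary: m n k rule: less_induct)
  case less
  have "supp (qd (hty W) m n k) \<subseteq> smp (cubes m n k) (m + n + k)"
  proof (rule keys_qd)
    fix m' n' k' assume e: "Suc (m' + n' + k') = m + n + k"
    then have "m' + n' + k' < m + n + k" by simp
    from less [OF this] show "supp (hty W m' n' k') \<subseteq> smp (cubes m' n' k') (m + n + k)"
      unfolding e .
  qed
  then have k: "supp (W m n k + qd (hty W) m n k) \<subseteq> smp (cubes m n k) (m + n + k)"
    by (intro keys_plus_subset W)
  show ?case
  proof (subst hty_eq, rule keys_kmap_subset, rule subsetI)
    fix z assume "z \<in> qcone ` supp (W m n k + qd (hty W) m n k)"
    then obtain a b c d where "z = qcone ((a, b), (c, d))" "((a, b), (c, d)) \<in> smp (cubes m n k) (m + n + k)"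
      using k by fastforce
    then show "z \<in> smp (cubes m n k) (Suc (m + n + k))"
      by (simp add: qcone_def simplex_op_cone)
  qed
qed

text \<open>Degenerate quadruples, without bounds on the vertices: the condition then is preserved by all operators
  at once.\<close>

definition qdgn :: "nat \<Rightarrow> quad set" where
  "qdgn r = {((a, b), (c, d)) | a b c d. length a = Suc r \<and> length b = Suc r \<and> length c = Suc r \<and> length d = Suc r \<and>
     (\<exists>t<r. a ! t = a ! Suc t \<and> b ! t = b ! Suc t \<and> c ! t = c ! Suc t \<and> d ! t = d ! Suc t)}"

lemma qdgn_qcone: "z \<in> qdgn r \<Longrightarrow> qcone z \<in> qdgn (Suc r)"
  unfolding qdgn_def qcone_def by fastforce

lemma qdgn_qmap: "z \<in> qdgn r \<Longrightarrow> qmap f g h z \<in> qdgn r"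
proof -
  assume "z \<in> qdgn r"
  then obtain a b c d t where "z = ((a, b), (c, d))" "length a = Suc r" "length b = Suc r"
    "length c = Suc r" "length d = Suc r" "t < r"
    "a ! t = a ! Suc t" "b ! t = b ! Suc t" "c ! t = c ! Suc t" "d ! t = d ! Suc t"
    unfolding qdgn_def by blast
  then show ?thesis by (auto simp: qdgn_def qmap_def intro!: exI [of _ t])
qed

lemma keys_qmap_qdgn:
  "supp c \<subseteq> qdgn r \<Longrightarrow> supp (kmap (qmap f g h) c) \<subseteq> qdgn r"
  by (rule keys_kmap_subset) (use qdgn_qmap in blast)

lemma keys_qcone_qdgn:
  "supp c \<subseteq> qdgn r \<Longrightarrow> supp (kmap qcone c) \<subseteq> qdgn (Suc r)"
  by (rule keys_kmap_subset) (use qdgn_qcone in blast)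

text \<open>A codegeneracy moves past all cofaces but the two of which it is a left inverse, and the
  contributions of those cancel.\<close>

lemma codegeneracy_sum:
  fixes A :: "quad \<Rightarrow>\<^sub>0 bit"
  assumes q: "\<And>f g z. q f (q g z) = q (f \<circ> g) z" and q1: "\<And>z. q id z = z"
    and i: "i \<le> m" and D: "\<And>i'. i' < m \<Longrightarrow> supp (kmap (q (collapse i')) A) \<subseteq> D"
    and qD: "\<And>f c. supp c \<subseteq> D \<Longrightarrow> supp (kmap (q f) c) \<subseteq> D"
  shows "supp (\<Sum>j\<le>Suc m. kmap (q (collapse i)) (kmap (q (skip j)) A)) \<subseteq> D"
proof -
  have same: "collapse i \<circ> skip j = id" if "j = i \<or> j = Suc i" for j
    using that by (auto simp: collapse_def skip_def fun_eq_iff)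
  have e: "kmap (q (collapse i)) (kmap (q (skip j)) A) = A" if "j = i \<or> j = Suc i" for j
    by (simp add: kmap_kmap q same [OF that] q1 kmap_eq_self)
  have "(\<Sum>j\<le>Suc m. kmap (q (collapse i)) (kmap (q (skip j)) A)) =
      (\<Sum>j\<in>{..Suc m} - {i, Suc i}. kmap (q (collapse i)) (kmap (q (skip j)) A)) +
      (\<Sum>j\<in>{i, Suc i}. kmap (q (collapse i)) (kmap (q (skip j)) A))"
    by (rule sum.subset_diff) (use i in auto)
  also have "(\<Sum>j\<in>{i, Suc i}. kmap (q (collapse i)) (kmap (q (skip j)) A)) = 0"
    by (simp add: e)
  finally have s: "(\<Sum>j\<le>Suc m. kmap (q (collapse i)) (kmap (q (skip j)) A)) =
      (\<Sum>j\<in>{..Suc m} - {i, Suc i}. kmap (q (collapse i)) (kmap (q (skip j)) A))" by simp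
  show ?thesis unfolding s
  proof (rule keys_sum_subset)
    fix j assume j: "j \<in> {..Suc m} - {i, Suc i}"
    show "supp (kmap (q (collapse i)) (kmap (q (skip j)) A)) \<subseteq> D"
    proof (cases "j < i")
      case True
      then have "collapse i \<circ> skip j = skip j \<circ> collapse (i - 1)"
        by (auto simp: collapse_def skip_def fun_eq_iff)
      then have "kmap (q (collapse i)) (kmap (q (skip j)) A) = kmap (q (skip j)) (kmap (q (collapse (i - 1))) A)"
        by (simp add: kmap_kmap q)
      then show ?thesis using qD [OF D [of "i - 1"]] True i by simp
    next
      case False
      then have "collapse i \<circ> skip j = skip (j - 1) \<circ> collapse i"
        using j by (auto simp: collapse_def skip_def fun_eq_iff)
      then have "kmap (q (collapse i)) (kmap (q (skip j)) A) = kmap (q (skip (j - 1))) (kmap (q (collapse i)) A)"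
        by (simp add: kmap_kmap q)
      then show ?thesis using qD [OF D [of i]] False j by simp
    qed
  qed
qed

text \<open>The codegeneracy commutes with the cone since it fixes the vertex \<open>0\<close>, passes through the cofaces in the
  two other directions, and \<open>codegeneracy_sum\<close> takes care of the cofaces in its own direction.\<close>

lemma hty_codegeneracy_M:
  assumes W: "\<And>m n k i. i < m \<Longrightarrow> supp (kmap (qmap id (collapse i) id) (W m n k)) \<subseteq> qdgn (m + n + k)"
  shows "i < m \<Longrightarrow> supp (kmap (qmap id (collapse i) id) (hty W m n k)) \<subseteq> qdgn (Suc (m + n + k))"
proof (induction "m + n + k" arbitrary: m n k i rule: less_induct)
  case less
  let ?s = "qmap id (collapse i) id"
  have IH: "supp (kmap (qmap id (collapse i') id) (hty W m' n' k')) \<subseteq> qdgn (m + n + k)"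
    if "Suc (m' + n' + k') = m + n + k" "i' < m'" for m' n' k' i'
    using less.hyps [of m' n' k' i'] that by simp
  have K: "supp (kmap ?s (qdK (hty W) m n k)) \<subseteq> qdgn (m + n + k)"
  proof (cases k)
    case (Suc k')
    have "kmap ?s (kmap (qmap (skip j) id id) c) = kmap (qmap (skip j) id id) (kmap ?s c)" for j c
      by (simp add: kmap_kmap qmap_qmap)
    then show ?thesis using Suc IH [of m n k' i] less.prems
      by (simp add: qdK_def kmap_sum keys_sum_subset keys_qmap_qdgn del: sum.atMost_Suc)
  qed (simp add: qdK_def)
  have N: "supp (kmap ?s (qdN (hty W) m n k)) \<subseteq> qdgn (m + n + k)"
  proof (cases n)
    case (Suc n')
    have "kmap ?s (kmap (qmap id id (skip j)) c) = kmap (qmap id id (skip j)) (kmap ?s c)" for j c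
      by (simp add: kmap_kmap qmap_qmap)
    then show ?thesis using Suc IH [of m n' k i] less.prems
      by (simp add: qdN_def kmap_sum keys_sum_subset keys_qmap_qdgn del: sum.atMost_Suc)
  qed (simp add: qdN_def)
  have M: "supp (kmap ?s (qdM (hty W) m n k)) \<subseteq> qdgn (m + n + k)"
  proof (cases m)
    case (Suc m')
    have "supp (\<Sum>j\<le>Suc m'. kmap ?s (kmap (qmap id (skip j) id) (hty W m' n k))) \<subseteq> qdgn (m + n + k)"
    proof (rule codegeneracy_sum [where q = "\<lambda>f. qmap id f id"])
      show "qmap id id id z = z" for z
        by (cases z rule: prod.exhaust, rename_tac u w, case_tac u, case_tac w) (simp add: qmap_def)
    qed (use Suc IH less.prems in \<open>auto simp: qmap_qmap intro!: keys_qmap_qdgn\<close>)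
    then show ?thesis using Suc by (simp add: qdM_def kmap_sum del: sum.atMost_Suc)
  qed (use less.prems in simp)
  have "kmap ?s (hty W m n k) = kmap qcone (kmap ?s (W m n k + qd (hty W) m n k))"
    by (subst hty_eq) (simp add: kmap_kmap qcone_qmap collapse_def)
  moreover have "supp (kmap ?s (W m n k + qd (hty W) m n k)) \<subseteq> qdgn (m + n + k)"
    unfolding kmap_add qd_def by (intro keys_plus_subset W less.prems K M N)
  ultimately show ?case by (simp add: keys_qcone_qdgn)
qed

lemma hty_codegeneracy_N:
  assumes W: "\<And>m n k i. i < n \<Longrightarrow> supp (kmap (qmap id id (collapse i)) (W m n k)) \<subseteq> qdgn (m + n + k)"
  shows "i < n \<Longrightarrow> supp (kmap (qmap id id (collapse i)) (hty W m n k)) \<subseteq> qdgn (Suc (m + n + k))"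
proof (induction "m + n + k" arbitrary: m n k i rule: less_induct)
  case less
  let ?s = "qmap id id (collapse i)"
  have IH: "supp (kmap (qmap id id (collapse i')) (hty W m' n' k')) \<subseteq> qdgn (m + n + k)"
    if "Suc (m' + n' + k') = m + n + k" "i' < n'" for m' n' k' i'
    using less.hyps [of m' n' k' i'] that by simp
  have K: "supp (kmap ?s (qdK (hty W) m n k)) \<subseteq> qdgn (m + n + k)"
  proof (cases k)
    case (Suc k')
    have "kmap ?s (kmap (qmap (skip j) id id) c) = kmap (qmap (skip j) id id) (kmap ?s c)" for j c
      by (simp add: kmap_kmap qmap_qmap)
    then show ?thesis using Suc IH [of m n k' i] less.prems
      by (simp add: qdK_def kmap_sum keys_sum_subset keys_qmap_qdgn del: sum.atMost_Suc)
  qed (simp add: qdK_def)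
  have M: "supp (kmap ?s (qdM (hty W) m n k)) \<subseteq> qdgn (m + n + k)"
  proof (cases m)
    case (Suc m')
    have "kmap ?s (kmap (qmap id (skip j) id) c) = kmap (qmap id (skip j) id) (kmap ?s c)" for j c
      by (simp add: kmap_kmap qmap_qmap)
    then show ?thesis using Suc IH [of m' n k i] less.prems
      by (simp add: qdM_def kmap_sum keys_sum_subset keys_qmap_qdgn del: sum.atMost_Suc)
  qed (simp add: qdM_def)
  have N: "supp (kmap ?s (qdN (hty W) m n k)) \<subseteq> qdgn (m + n + k)"
  proof (cases n)
    case (Suc n')
    have "supp (\<Sum>j\<le>Suc n'. kmap ?s (kmap (qmap id id (skip j)) (hty W m n' k))) \<subseteq> qdgn (m + n + k)"
    proof (rule codegeneracy_sum [where q = "\<lambda>f. qmap id id f"])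
      show "qmap id id id z = z" for z
        by (cases z rule: prod.exhaust, rename_tac u w, case_tac u, case_tac w) (simp add: qmap_def)
    qed (use Suc IH less.prems in \<open>auto simp: qmap_qmap intro!: keys_qmap_qdgn\<close>)
    then show ?thesis using Suc by (simp add: qdN_def kmap_sum del: sum.atMost_Suc)
  qed (use less.prems in simp)
  have "kmap ?s (hty W m n k) = kmap qcone (kmap ?s (W m n k + qd (hty W) m n k))"
    by (subst hty_eq) (simp add: kmap_kmap qcone_qmap collapse_def)
  moreover have "supp (kmap ?s (W m n k + qd (hty W) m n k)) \<subseteq> qdgn (m + n + k)"
    unfolding kmap_add qd_def by (intro keys_plus_subset W less.prems K M N)
  ultimately show ?case by (simp add: keys_qcone_qdgn)
qed

section \<open>Totalization\<close>

lemma fun_sum_apply: "(\<Sum>i\<in>I. g i) x = (\<Sum>i\<in>I. g i x)"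
  by (induction I rule: infinite_finite_induct) simp_all

lemma map_nth_map:
  "(\<And>i. i \<in> set \<phi> \<Longrightarrow> i < length x) \<Longrightarrow> map ((!) (map f x)) \<phi> = map f (map ((!) x) \<phi>)"
  by simp

lemma simplex_op_nth: "simplex_op m n \<theta> \<Longrightarrow> simplex_op l m \<phi> \<Longrightarrow> i \<in> set \<phi> \<Longrightarrow> i < length \<theta>"
  by (auto simp: simplex_op_def)

lemma cosimplicial_space_csstd: "cosimplicial_space csstd"
  unfolding cosimplicial_space_def
proof (intro conjI allI impI ballI)
  fix m n q r :: nat and \<theta> \<phi> x
  assume a: "simplex_op m n \<theta> \<and> simplex_op r q \<phi>" "x \<in> smp (lev csstd m) q"
  then have "simplex_op q m x" by (simp add: csstd_def)
  with a have "i < length x" if "i \<in> set \<phi>" for i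
    using that simplex_op_nth by blast
  then show "cop csstd n \<theta> r (sop (lev csstd m) q \<phi> x) = sop (lev csstd n) q \<phi> (cop csstd n \<theta> q x)"
    by (simp add: csstd_def)
next
  fix n q x assume "x \<in> smp (lev csstd n) q"
  then have "\<And>i. i \<in> set x \<Longrightarrow> i < Suc n" by (auto simp: csstd_def simplex_op_def)
  then show "cop csstd n (id_op n) q x = x"
    by (simp add: csstd_def id_op_def map_idI)
next
  fix l m n :: nat and \<theta> \<phi> q x
  assume "simplex_op m n \<theta> \<and> simplex_op l m \<phi>" "x \<in> smp (lev csstd l) q"
  then have "\<And>i. i \<in> set x \<Longrightarrow> i < length \<phi>"
    by (auto simp: csstd_def simplex_op_def)
  then show "cop csstd n (map ((!) \<theta>) \<phi>) q x = cop csstd n \<theta> q (cop csstd m \<phi> q x)"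
    by (simp add: csstd_def)
qed (auto simp: csstd_def simplicial_set_std intro: simplex_op_comp)

lemma cosimplicial_space_csconst: "simplicial_set Z \<Longrightarrow> cosimplicial_space (csconst Z)"
  by (simp add: cosimplicial_space_def csconst_def)

text \<open>The cosimplicial space \<open>\<Delta>\<^sup>\<bullet> \<times> \<Delta>\<^sup>m\<close>: elements of \<open>Tot X\<close> of degree \<open>m\<close> are the cosimplicial maps from it
  to \<open>X\<close>.\<close>

definition cube :: "nat \<Rightarrow> (nat list \<times> nat list) csset" where
  "cube m = csprod csstd (csconst (std m))"

lemma lev_cube [simp]: "lev (cube m) k = sprod (std k) (std m)"
  and cop_cube: "cop (cube m) n \<theta> q = map_prod (map ((!) \<theta>)) (\<lambda>b. b)"
  by (simp_all add: cube_def csstd_def csconst_def)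

lemma cosimplicial_space_cube: "cosimplicial_space (cube m)"
  unfolding cube_def
  by (intro cosimplicial_space_csprod cosimplicial_space_csstd cosimplicial_space_csconst simplicial_set_std)

lemma simplicial_map_std:
  assumes "mono f" "\<And>x. x \<le> k \<Longrightarrow> f x \<le> l"
  shows "simplicial_map (std k) (std l) (\<lambda>_. map f)"
  unfolding simplicial_map_def
proof (intro conjI allI ballI impI)
  fix q x assume "x \<in> smp (std k) q"
  then show "map f x \<in> smp (std l) q" using simplex_op_map assms by simp
next
  fix q r \<phi> x assume "simplex_op r q \<phi>" "x \<in> smp (std k) q"
  then show "map f (sop (std k) q \<phi> x) = sop (std l) q \<phi> (map f x)"
    using map_nth_map [of \<phi> x f] by (simp add: simplex_op_nth)
qed

lemma simplicial_map_same: "simplicial_map X X (\<lambda>_ x. x)"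
  by (simp add: simplicial_map_def)

lemma simplicial_map_prod:
  "simplicial_map X Y f \<Longrightarrow> simplicial_map X' Y' g \<Longrightarrow>
   simplicial_map (sprod X X') (sprod Y Y') (\<lambda>q. map_prod (f q) (g q))"
  by (simp add: simplicial_map_def)

lemma cosimplicial_map_cube:
  assumes "mono f" "\<And>x. x \<le> m \<Longrightarrow> f x \<le> m'"
  shows "cosimplicial_map (cube m) (cube m') (\<lambda>_ _. map_prod (\<lambda>a. a) (map f))"
proof -
  have s: "simplicial_map (sprod (std k) (std m)) (sprod (std k) (std m')) (\<lambda>_. map_prod (\<lambda>a. a) (map f))" for k
    using simplicial_map_prod [OF simplicial_map_same simplicial_map_std [OF assms]] .
  show ?thesis
    unfolding cosimplicial_map_def lev_cube
  proof (intro conjI allI impI ballI)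
    fix k q
    show "map_prod (\<lambda>a. a) (map f) ` smp (sprod (std k) (std m)) q \<subseteq> smp (sprod (std k) (std m')) q"
      by (rule image_subsetI) (rule simplicial_mapD(1) [OF s])
  next
    fix k q r \<phi> y assume "simplex_op r q \<phi>" "y \<in> smp (sprod (std k) (std m)) q"
    then show "map_prod (\<lambda>a. a) (map f) (sop (sprod (std k) (std m)) q \<phi> y) =
        sop (sprod (std k) (std m')) q \<phi> (map_prod (\<lambda>a. a) (map f) y)"
      using simplicial_mapD(2) [OF s] by blast
  qed (auto simp: cop_cube)
qed

text \<open>The universal element of degree \<open>m\<close>: the value of \<open>phi_infinity\<close> at the identity of
  \<open>\<Delta>\<^sup>\<bullet> \<times> \<Delta>\<^sup>m\<close>.\<close>

definition usimp :: "nat \<Rightarrow> nat \<Rightarrow> nat list \<times> nat list \<Rightarrow>\<^sub>0 bit" where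
  "usimp m k = shuffle (std k) (std m) k m (kgen [0..<Suc k]) (kgen [0..<Suc m])"

lemma shuffle_std_gen: "shuffle (std k) (std m) k m (kgen [0..<Suc k]) (kgen [0..<Suc m]) = shuf k m"
  unfolding shuffle_gen
proof (rule kmap_eq_self)
  fix z assume "z \<in> supp (shuf k m)"
  then obtain \<alpha> \<beta> where z: "z = (\<alpha>, \<beta>)" "simplex_op (k + m) k \<alpha>" "simplex_op (k + m) m \<beta>"
    by (rule shuf_keys)
  then have "\<And>i. i \<in> set \<alpha> \<Longrightarrow> i < Suc k" "\<And>i. i \<in> set \<beta> \<Longrightarrow> i < Suc m"
    by (auto simp: simplex_op_def)
  then show "(case z of (\<alpha>, \<beta>) \<Rightarrow> (sop (std k) k \<alpha> [0..<Suc k], sop (std m) m \<beta> [0..<Suc m])) = z"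
    by (simp add: z map_idI)
qed

lemma keys_gen_std: "supp (kgen [0..<Suc k]) \<subseteq> smp (std k) k"
  by (simp add: simplex_op_id)

lemma keys_usimp: "supp (usimp m k) \<subseteq> smp (sprod (std k) (std m)) (k + m)"
  unfolding usimp_def by (intro shuffle_keys simplicial_set_std keys_gen_std)

lemma tchain_usimp: "tchain (cube m) (int m) (usimp m)"
proof -
  have "nat (int m + int k) = k + m" for k by simp
  then show ?thesis unfolding tchain_def lev_cube using keys_usimp by simp
qed

lemma fbd_std_gen:
  "fbd (std k) k (kgen [0..<Suc k]) =
     (case k of 0 \<Rightarrow> 0 | Suc k' \<Rightarrow> \<Sum>j\<le>k. kmap (map (skip j)) (kgen [0..<Suc k']))"
proof (cases k)
  case (Suc k')
  have "map ((!) [0..<Suc k]) (coface k j) = map (skip j) [0..<Suc k']" if "j \<le> k" for j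
  proof -
    have "map ((!) [0..<Suc k]) (coface k j) = coface k j"
      by (rule map_idI) (use simplex_op_coface [of j k'] that Suc in \<open>auto simp: simplex_op_def\<close>)
    then show ?thesis using that Suc by (simp add: coface_conv)
  qed
  then show ?thesis using Suc by (simp add: fbd_def del: sum.atMost_Suc)
qed (simp add: fbd_def)

text \<open>The chain map property of shuffles, since the faces of a fundamental simplex are the cofaces of the
  fundamental simplices of lower dimension.\<close>

lemma fbd_usimp:
  "fbd (sprod (std k) (std m)) (k + m) (usimp m k) =
     (case k of 0 \<Rightarrow> 0 | Suc k' \<Rightarrow> \<Sum>j\<le>k. kmap (map_prod (map (skip j)) (\<lambda>b. b)) (usimp m k')) +
     (case m of 0 \<Rightarrow> 0 | Suc m' \<Rightarrow> \<Sum>j\<le>m. kmap (map_prod (\<lambda>a. a) (map (skip j))) (usimp m' k))"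
proof -
  have l: "shuffle (std k) (std m) (k - 1) m (fbd (std k) k (kgen [0..<Suc k])) (kgen [0..<Suc m]) =
      (case k of 0 \<Rightarrow> 0 | Suc k' \<Rightarrow> \<Sum>j\<le>k. kmap (map_prod (map (skip j)) (\<lambda>b. b)) (usimp m k'))"
  proof (cases k)
    case (Suc k')
    have "kmap (map_prod (map (skip j)) (\<lambda>b. b)) (usimp m k') =
        shuffle (std k) (std m) k' m (kmap (map (skip j)) (kgen [0..<Suc k'])) (kmap (\<lambda>b. b) (kgen [0..<Suc m]))" for j
      unfolding usimp_def Suc
      by (rule shuffle_natural [OF simplicial_map_std [OF mono_skip skip_le] simplicial_map_same])
         (simp_all add: simplex_op_id)
    then show ?thesis unfolding fbd_std_gen using Suc by (simp add: shuffle_sum_left del: sum.atMost_Suc)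
  qed (simp add: fbd_def)
  have r: "shuffle (std k) (std m) k (m - 1) (kgen [0..<Suc k]) (fbd (std m) m (kgen [0..<Suc m])) =
      (case m of 0 \<Rightarrow> 0 | Suc m' \<Rightarrow> \<Sum>j\<le>m. kmap (map_prod (\<lambda>a. a) (map (skip j))) (usimp m' k))"
  proof (cases m)
    case (Suc m')
    have "kmap (map_prod (\<lambda>a. a) (map (skip j))) (usimp m' k) =
        shuffle (std k) (std m) k m' (kmap (\<lambda>b. b) (kgen [0..<Suc k])) (kmap (map (skip j)) (kgen [0..<Suc m']))" for j
      unfolding usimp_def Suc
      by (rule shuffle_natural [OF simplicial_map_same simplicial_map_std [OF mono_skip skip_le]])
         (simp_all add: simplex_op_id)
    then show ?thesis unfolding fbd_std_gen using Suc by (simp add: shuffle_sum_right del: sum.atMost_Suc)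
  qed (simp add: fbd_def)
  show ?thesis
    unfolding usimp_def [of m k]
    by (subst fbd_shuffle [OF simplicial_set_std simplicial_set_std keys_gen_std keys_gen_std]) (simp only: l r)
qed

lemma cbd_cube:
  assumes "supp c \<subseteq> smp (sprod (std k) (std m)) q"
  shows "cbd (cube m) k q c = (\<Sum>j\<le>Suc k. kmap (map_prod (map (skip j)) (\<lambda>b. b)) c)"
  unfolding cbd_def cop_cube
proof (intro sum.cong refl kmap_cong)
  fix j z assume "z \<in> supp c"
  then obtain a b where "z = (a, b)" "simplex_op q k a" using assms by (cases z) auto
  then show "map_prod (map ((!) (map (skip j) [0..<Suc k]))) (\<lambda>b. b) z = map_prod (map (skip j)) (\<lambda>b. b) z"
    by (auto simp: simplex_op_def intro!: map_nth_upt)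
qed

text \<open>The part of the boundary on the faces of \<open>\<Delta>\<^sup>k\<close> cancels against the horizontal differential.\<close>

lemma tbd_usimp:
  "tbd (cube m) (int m) (usimp m) = (case m of 0 \<Rightarrow> 0 | Suc m' \<Rightarrow>
     \<Sum>j\<le>m. tmap (int m') (\<lambda>_ _. map_prod (\<lambda>a. a) (map (skip j))) (usimp m'))"
proof
  fix k
  have n: "nat (int m + int k) = k + m" for k by simp
  have c: "cbd (cube m) k' (k' + m) (usimp m k') = (\<Sum>j\<le>Suc k'. kmap (map_prod (map (skip j)) (\<lambda>b. b)) (usimp m k'))" for k'
    by (rule cbd_cube [OF keys_usimp])
  show "tbd (cube m) (int m) (usimp m) k = (case m of 0 \<Rightarrow> 0 | Suc m' \<Rightarrow>
     \<Sum>j\<le>m. tmap (int m') (\<lambda>_ _. map_prod (\<lambda>a. a) (map (skip j))) (usimp m')) k"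
    unfolding tbd_def n lev_cube fbd_usimp
    using c by (cases k; cases m) (simp_all add: tmap_def fun_sum_apply del: sum.atMost_Suc)
qed

lemma dgn_std_gen:
  assumes "i \<le> m" shows "map (collapse i) [0..<Suc (Suc m)] \<in> dgn (std m) (Suc m)"
proof -
  have "map ((!) [0..<Suc m]) (codegen m i) = map (collapse i) [0..<Suc (Suc m)]"
    using assms by (subst map_idI) (auto simp: codegen_conv collapse_def)
  then show ?thesis unfolding dgn_def using assms simplex_op_id [of m]
    by (intro CollectI exI [of _ i] exI [of _ "[0..<Suc m]"]) simp
qed

lemma usimp_codegeneracy_left:
  assumes "i \<le> k"
  shows "supp (kmap (map_prod (map (collapse i)) (\<lambda>b. b)) (usimp m (Suc k))) \<subseteq>
     dgn (sprod (std k) (std m)) (Suc k + m)"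
proof -
  have "kmap (map_prod (map (collapse i)) (\<lambda>b. b)) (usimp m (Suc k)) =
      shuffle (std k) (std m) (Suc k) m (kmap (map (collapse i)) (kgen [0..<Suc (Suc k)])) (kmap (\<lambda>b. b) (kgen [0..<Suc m]))"
    unfolding usimp_def
    by (rule shuffle_natural [OF simplicial_map_std [OF mono_collapse collapse_le [OF assms]] simplicial_map_same])
       (simp_all add: simplex_op_id)
  then show ?thesis
    using shuffle_dgn_left [OF simplicial_set_std simplicial_set_std, of "kgen (map (collapse i) [0..<Suc (Suc k)])" k "Suc k"]
      dgn_std_gen [OF assms] keys_gen_std by simp
qed

lemma usimp_codegeneracy_right:
  assumes "i \<le> m"
  shows "supp (kmap (map_prod (\<lambda>a. a) (map (collapse i))) (usimp (Suc m) k)) \<subseteq>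
     dgn (sprod (std k) (std m)) (k + Suc m)"
proof -
  have "kmap (map_prod (\<lambda>a. a) (map (collapse i))) (usimp (Suc m) k) =
      shuffle (std k) (std m) k (Suc m) (kmap (\<lambda>b. b) (kgen [0..<Suc k])) (kmap (map (collapse i)) (kgen [0..<Suc (Suc m)]))"
    unfolding usimp_def
    by (rule shuffle_natural [OF simplicial_map_same simplicial_map_std [OF mono_collapse collapse_le [OF assms]]])
       (simp_all add: simplex_op_id)
  then show ?thesis
    using shuffle_dgn_right [OF simplicial_set_std simplicial_set_std _ , of _ k k "kgen (map (collapse i) [0..<Suc (Suc m)])" m "Suc m"]
      dgn_std_gen [OF assms] keys_gen_std by simp
qed

lemma prism_iff: "(a, b) \<in> prism k q \<longleftrightarrow> (\<exists>r. simplex_op r k a \<and> simplex_op r q b)"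
  by (simp add: prism_def)

text \<open>Outside of \<open>prism k q\<close> an element of \<open>Tot X\<close> takes a default value, which makes equality of elements
  extensional on simplices.\<close>

lemma Tot_iff:
  "f \<in> smp (Tot X) q \<longleftrightarrow> cosimplicial_map (cube q) X (\<lambda>k _. f k) \<and> (\<forall>k z. z \<notin> prism k q \<longrightarrow> f k z = undefined)"
  by (simp add: Tot_with_def cube_def)

lemma Tot_map: "f \<in> smp (Tot X) q \<Longrightarrow> cosimplicial_map (cube q) X (\<lambda>k _. f k)"
  by (simp add: Tot_iff)

lemma Tot_simplicial_map:
  "f \<in> smp (Tot X) q \<Longrightarrow> simplicial_map (sprod (std k) (std q)) (lev X k) (\<lambda>_. f k)"
  using cosimplicial_mapD(1) [OF Tot_map] by simp

lemma sop_Tot: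
  assumes "simplex_op r k a" "simplex_op r q b" "length \<theta> = Suc q"
  shows "sop (Tot X) n \<theta> f k (a, b) = f k (a, map ((!) \<theta>) b)"
  using assms by (auto simp: Tot_with_def prism_iff)

lemma cosimplicial_map_cong:
  assumes f: "cosimplicial_map Y X f" and Y: "cosimplicial_space Y"
    and e: "\<And>p q y. y \<in> smp (lev Y p) q \<Longrightarrow> f p q y = g p q y"
  shows "cosimplicial_map Y X g"
  unfolding cosimplicial_map_def
proof (intro conjI allI impI ballI)
  fix p q show "g p q ` smp (lev Y p) q \<subseteq> smp (lev X p) q"
    using f e by (auto simp: cosimplicial_map_def image_subset_iff)
next
  fix p q r \<phi> y assume "simplex_op r q \<phi>" "y \<in> smp (lev Y p) q"
  then show "g p r (sop (lev Y p) q \<phi> y) = sop (lev X p) q \<phi> (g p q y)"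
    using simplicial_mapD(2) [OF cosimplicial_mapD(1) [OF f]] e sop_in [OF simplicial_set_lev [OF Y]] by metis
next
  fix m n q \<theta> y assume "simplex_op m n \<theta>" "y \<in> smp (lev Y m) q"
  then show "g n q (cop Y n \<theta> q y) = cop X n \<theta> q (g m q y)"
    using cosimplicial_mapD(2) [OF f] e cop_in [OF Y] by metis
qed

lemma cosimplicial_map_comp:
  assumes f: "cosimplicial_map Z Y f" and g: "cosimplicial_map Y X g"
  shows "cosimplicial_map Z X (\<lambda>p q z. g p q (f p q z))"
  using f g unfolding cosimplicial_map_def by (simp add: image_subset_iff)

lemma cosimplicial_map_pair:
  assumes f: "cosimplicial_map Z X f" and g: "cosimplicial_map Z Y g"
  shows "cosimplicial_map Z (csprod X Y) (\<lambda>p q z. (f p q z, g p q z))"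
  using f g unfolding cosimplicial_map_def by (simp add: image_subset_iff)

lemma cosimplicial_map_prod:
  assumes f: "cosimplicial_map Y X f" and g: "cosimplicial_map Y' X' g"
  shows "cosimplicial_map (csprod Y Y') (csprod X X') (\<lambda>p q. map_prod (f p q) (g p q))"
  using f g unfolding cosimplicial_map_def by (simp add: image_subset_iff)

lemma cosimplicial_map_cube_op:
  assumes t: "simplex_op m n \<theta>"
  shows "cosimplicial_map (cube m) (cube n) (\<lambda>_ _. map_prod (\<lambda>a. a) (map ((!) \<theta>)))"
proof -
  define h where "h x = \<theta> ! min x m" for x
  have "h x \<in> set \<theta>" for x
    unfolding h_def by (rule nth_mem) (use t in \<open>simp add: simplex_op_def\<close>)
  then have "h x \<le> n" for x using t by (auto simp: simplex_op_def)
  moreover have "mono h"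
    unfolding h_def mono_def using t by (auto simp: simplex_op_def intro!: sorted_nth_mono)
  ultimately have "cosimplicial_map (cube m) (cube n) (\<lambda>_ _. map_prod (\<lambda>a. a) (map h))"
    by (intro cosimplicial_map_cube)
  then show ?thesis
  proof (rule cosimplicial_map_cong [OF _ cosimplicial_space_cube])
    fix p q y assume "y \<in> smp (lev (cube m) p) q"
    then show "map_prod (\<lambda>a. a) (map h) y = map_prod (\<lambda>a. a) (map ((!) \<theta>)) y"
      by (cases y) (auto simp: h_def simplex_op_def min_absorb1 subset_eq)
  qed
qed

lemma sop_Tot_in:
  assumes t: "simplex_op m n \<theta>" and f: "f \<in> smp (Tot X) n"
  shows "sop (Tot X) n \<theta> f \<in> smp (Tot X) m"
  unfolding Tot_iff
proof
  have l: "length \<theta> = Suc m" using t by (simp add: simplex_op_def)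
  show "cosimplicial_map (cube m) X (\<lambda>k _. sop (Tot X) n \<theta> f k)"
  proof (rule cosimplicial_map_cong [OF cosimplicial_map_comp [OF cosimplicial_map_cube_op [OF t] Tot_map [OF f]] cosimplicial_space_cube])
    fix k q y assume "y \<in> smp (lev (cube m) k) q"
    then show "f k (map_prod (\<lambda>a. a) (map ((!) \<theta>)) y) = sop (Tot X) n \<theta> f k y"
      using sop_Tot [of q k _ m _ \<theta> X n f] l by (cases y) auto
  qed
  show "\<forall>k z. z \<notin> prism k m \<longrightarrow> sop (Tot X) n \<theta> f k z = undefined"
    using l by (simp add: Tot_with_def)
qed

lemma Tot_eqI:
  assumes "f \<in> smp (Tot X) q" "g \<in> smp (Tot X) q"
    and "\<And>k r a b. simplex_op r k a \<Longrightarrow> simplex_op r q b \<Longrightarrow> f k (a, b) = g k (a, b)"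
  shows "f = g"
proof (intro ext)
  fix k and z :: "nat list \<times> nat list"
  show "f k z = g k z"
    by (cases z; cases "z \<in> prism k q") (use assms in \<open>auto simp: Tot_iff prism_iff\<close>)
qed

lemma simplicial_set_Tot: "simplicial_set (Tot X)"
  unfolding simplicial_set_def
proof (intro conjI allI impI ballI)
  fix m n \<theta> assume "simplex_op m n \<theta>"
  then show "sop (Tot X) n \<theta> ` smp (Tot X) n \<subseteq> smp (Tot X) m" using sop_Tot_in by blast
next
  fix n f assume f: "f \<in> smp (Tot X) n"
  have "simplex_op n n (id_op n)" unfolding id_op_def by (rule simplex_op_id)
  from sop_Tot_in [OF this f] show "sop (Tot X) n (id_op n) f = f"
  proof (rule Tot_eqI [OF _ f])
    fix k r a b assume ab: "simplex_op r k a" "simplex_op r n b"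
    then have "map ((!) [0..<Suc n]) b = b" by (intro map_idI) (auto simp: simplex_op_def)
    then show "sop (Tot X) n (id_op n) f k (a, b) = f k (a, b)"
      using sop_Tot [OF ab, of "id_op n" X n f] by (simp add: id_op_def)
  qed
next
  fix l m n \<theta> \<phi> f assume so: "simplex_op m n \<theta> \<and> simplex_op l m \<phi>" and f: "f \<in> smp (Tot X) n"
  then have in1: "sop (Tot X) n (map ((!) \<theta>) \<phi>) f \<in> smp (Tot X) l"
    using sop_Tot_in [OF simplex_op_comp] by blast
  have in2: "sop (Tot X) m \<phi> (sop (Tot X) n \<theta> f) \<in> smp (Tot X) l"
    using so f sop_Tot_in by blast
  from in1 in2 show "sop (Tot X) n (map ((!) \<theta>) \<phi>) f = sop (Tot X) m \<phi> (sop (Tot X) n \<theta> f)"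
  proof (rule Tot_eqI)
    fix k r a b assume ab: "simplex_op r k a" "simplex_op r l b"
    have lt: "length \<theta> = Suc m" and lp: "length \<phi> = Suc l" using so by (auto simp: simplex_op_def)
    have b': "simplex_op r m (map ((!) \<phi>) b)" using simplex_op_comp so ab by blast
    have "map ((!) (map ((!) \<theta>) \<phi>)) b = map ((!) \<theta>) (map ((!) \<phi>) b)"
      by (rule map_nth_map) (use ab lp in \<open>auto simp: simplex_op_def\<close>)
    then show "sop (Tot X) n (map ((!) \<theta>) \<phi>) f k (a, b) = sop (Tot X) m \<phi> (sop (Tot X) n \<theta> f) k (a, b)"
      using sop_Tot [OF ab, of "map ((!) \<theta>) \<phi>" X n f] sop_Tot [OF ab lp, of X m "sop (Tot X) n \<theta> f"]
        sop_Tot [OF ab(1) b' lt, of X n f] lp by (simp only: length_map)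
  qed
qed

lemma Tot_face:
  assumes "simplex_op r k a" "simplex_op r m b" "j \<le> Suc m"
  shows "sop (Tot X) (Suc m) (coface (Suc m) j) f k (a, b) = f k (a, map (skip j) b)"
proof -
  have "map ((!) (coface (Suc m) j)) b = map (skip j) b"
    by (rule map_coface [OF assms(3)]) (use assms(2) in \<open>auto simp: simplex_op_def\<close>)
  moreover have "length (coface (Suc m) j) = Suc m"
    using simplex_op_coface [OF assms(3)] by (simp add: simplex_op_def)
  ultimately show ?thesis
    using sop_Tot [OF assms(1,2), of "coface (Suc m) j" X "Suc m" f] by (simp only:)
qed

lemma Tot_degeneracy:
  assumes "simplex_op r k a" "simplex_op r (Suc m) b" "i \<le> m"
  shows "sop (Tot X) m (codegen m i) f k (a, b) = f k (a, map (collapse i) b)"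
proof -
  have "map ((!) (codegen m i)) b = map (collapse i) b"
    by (rule map_codegen [OF assms(3)]) (use assms(2) in \<open>auto simp: simplex_op_def\<close>)
  moreover have "length (codegen m i) = Suc (Suc m)"
    using simplex_op_codegen [OF assms(3)] by (simp add: simplex_op_def)
  ultimately show ?thesis
    using sop_Tot [OF assms(1,2), of "codegen m i" X m f] by (simp only:)
qed

section \<open>The comparison map on chains\<close>

text \<open>\<open>\<phi>\<^sub>\<infinity>\<close> evaluates an element of \<open>Tot X\<close> on the universal chains, so its properties are inherited from
  these by naturality.\<close>

lemma comparison_eq:
  "comparison (int m) c k = kext (\<lambda>f. kmap (f k) (usimp m k)) c"
proof -
  have p: "z \<in> prism k m" if "z \<in> supp (usimp m k)" for z
    using subsetD [OF keys_usimp that] by (cases z) (auto simp: prism_iff)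
  have "kext (Tot_free m) c k z = kext (\<lambda>f. kgen (f k z)) c" if "z \<in> supp (usimp m k)" for z
    using p [OF that] by (simp add: kext_def fun_sum_apply Tot_free_def)
  then have "kext (kext (Tot_free m) c k) (usimp m k) = kext (\<lambda>z. kext (\<lambda>f. kgen (f k z)) c) (usimp m k)"
    by (rule kext_cong)
  also have "\<dots> = kext (\<lambda>f. kmap (f k) (usimp m k)) c"
    unfolding kmap_def by (rule kext_swap)
  finally show ?thesis
    by (simp add: comparison_def phi_infinity_def usimp_def id_op_def)
qed

lemma comparison_0 [simp]: "comparison m 0 = 0"
  by (rule ext) (simp add: comparison_def phi_infinity_def, simp add: kext_def)

lemma comparison_add: "comparison (int m) (c + d) = comparison (int m) c + comparison (int m) d"
  by (rule ext) (simp add: comparison_eq kext_add)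

context
  fixes X :: "'a csset"
  assumes X: "cosimplicial_space X"
begin

lemma tchain_comparison:
  assumes "supp c \<subseteq> smp (Tot X) m"
  shows "tchain X (int m) (comparison (int m) c)"
  unfolding tchain_def
proof (intro allI conjI impI)
  fix k
  have n: "nat (int m + int k) = k + m" by simp
  show "supp (comparison (int m) c k) \<subseteq> smp (lev X k) (nat (int m + int k))"
    unfolding comparison_eq n
    by (rule keys_kext_subset, rule keys_kmap_simplicial [OF Tot_simplicial_map keys_usimp]) (use assms in auto)
qed simp

lemma tbd_comparison:
  assumes c: "supp c \<subseteq> smp (Tot X) m"
  shows "tbd X (int m) (comparison (int m) c) = comparison (int m - 1) (fbd (Tot X) m c)"
proof
  fix k
  have n: "nat (int m + int k) = k + m" for k by simp
  have gen: "fbd (lev X k) (k + m) (kmap (f k) (usimp m k)) +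
      (case k of 0 \<Rightarrow> 0 | Suc k' \<Rightarrow> cbd X k' (k' + m) (kmap (f k') (usimp m k'))) =
      (case m of 0 \<Rightarrow> 0 | Suc m' \<Rightarrow> \<Sum>j\<le>m. kmap (sop (Tot X) m (coface m j) f k) (usimp m' k))"
    if "f \<in> supp c" for f
  proof -
    have f: "f \<in> smp (Tot X) m" using that c by blast
    note fm = Tot_map [OF f]
    have "tbd X (int m) (tmap (int m) (\<lambda>k _. f k) (usimp m)) = tmap (int m - 1) (\<lambda>k _. f k) (tbd (cube m) (int m) (usimp m))"
      using tmap_tbd [OF X cosimplicial_space_cube fm tchain_usimp] by simp
    then have "tbd X (int m) (tmap (int m) (\<lambda>k _. f k) (usimp m)) k = tmap (int m - 1) (\<lambda>k _. f k) (tbd (cube m) (int m) (usimp m)) k"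
      by simp
    moreover have "tmap (int m - 1) (\<lambda>k _. f k) (tbd (cube m) (int m) (usimp m)) k =
        (case m of 0 \<Rightarrow> 0 | Suc m' \<Rightarrow> \<Sum>j\<le>m. kmap (sop (Tot X) m (coface m j) f k) (usimp m' k))"
    proof (cases m)
      case (Suc m')
      have "kmap (\<lambda>z. f k (map_prod (\<lambda>a. a) (map (skip j)) z)) (usimp m' k) =
          kmap (sop (Tot X) m (coface m j) f k) (usimp m' k)" if "j \<le> m" for j
      proof (rule kmap_cong)
        fix z assume "z \<in> supp (usimp m' k)"
        then obtain a b where "z = (a, b)" "simplex_op (k + m') k a" "simplex_op (k + m') m' b"
          using keys_usimp [of m' k] by (cases z) auto
        then show "f k (map_prod (\<lambda>a. a) (map (skip j)) z) = sop (Tot X) m (coface m j) f k z"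
          using Tot_face [of "k + m'" k a m' b j X f] that Suc by simp
      qed
      then show ?thesis unfolding tbd_usimp using Suc
        by (simp add: tmap_def fun_sum_apply kmap_sum kmap_kmap del: sum.atMost_Suc)
    next
      case 0
      then show ?thesis unfolding tbd_usimp by (simp add: tmap_def)
    qed
    ultimately have "tbd X (int m) (tmap (int m) (\<lambda>k _. f k) (usimp m)) k =
        (case m of 0 \<Rightarrow> 0 | Suc m' \<Rightarrow> \<Sum>j\<le>m. kmap (sop (Tot X) m (coface m j) f k) (usimp m' k))"
      by (rule trans)
    then show ?thesis unfolding tbd_def tmap_def n .
  qed
  have "tbd X (int m) (comparison (int m) c) k =
      kext (\<lambda>f. fbd (lev X k) (k + m) (kmap (f k) (usimp m k)) +
        (case k of 0 \<Rightarrow> 0 | Suc k' \<Rightarrow> cbd X k' (k' + m) (kmap (f k') (usimp m k')))) c"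
    unfolding tbd_def comparison_eq n
    by (cases k) (simp_all add: fbd_kext kext_plus cbd_def kmap_kext kext_Sum del: sum.atMost_Suc)
  also have "\<dots> = kext (\<lambda>f. case m of 0 \<Rightarrow> 0 | Suc m' \<Rightarrow> \<Sum>j\<le>m. kmap (sop (Tot X) m (coface m j) f k) (usimp m' k)) c"
    by (rule kext_cong) (rule gen)
  also have "\<dots> = comparison (int m - 1) (fbd (Tot X) m c) k"
  proof (cases m)
    case 0
    then show ?thesis by (simp add: fbd_def)
  next
    case (Suc m')
    then show ?thesis
      by (simp add: comparison_eq fbd_def kext_sum kext_kmap kext_Sum del: sum.atMost_Suc)
  qed
  finally show "tbd X (int m) (comparison (int m) c) k = comparison (int m - 1) (fbd (Tot X) m c) k" .
qed

lemma tdgn_comparison: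
  assumes c: "supp c \<subseteq> dgn (Tot X) m"
  shows "tdgn X (int m) (comparison (int m) c)"
  unfolding tdgn_def
proof
  fix k
  have n: "nat (int m + int k) = k + m" by simp
  show "supp (comparison (int m) c k) \<subseteq> dgn (lev X k) (nat (int m + int k))"
    unfolding comparison_eq n
  proof (rule keys_kext_subset)
    fix f assume "f \<in> supp c"
    then obtain i g where i: "i < m" "g \<in> smp (Tot X) (m - 1)" "f = sop (Tot X) (m - 1) (codegen (m - 1) i) g"
      using c unfolding dgn_def by blast
    obtain m' where m: "m = Suc m'" using i(1) by (cases m) auto
    have "kmap (f k) (usimp m k) = kmap (g k) (kmap (map_prod (\<lambda>a. a) (map (collapse i))) (usimp m k))"
      unfolding kmap_kmap
    proof (rule kmap_cong)
      fix z assume "z \<in> supp (usimp m k)"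
      then obtain a b where "z = (a, b)" "simplex_op (k + m) k a" "simplex_op (k + m) m b"
        using keys_usimp [of m k] by (cases z) auto
      then show "f k z = g k (map_prod (\<lambda>a. a) (map (collapse i)) z)"
        using Tot_degeneracy [of "k + m" k a m' b i X g] i m by simp
    qed
    then show "supp (kmap (f k) (usimp m k)) \<subseteq> dgn (lev X k) (k + m)"
      using keys_kmap_dgn [OF Tot_simplicial_map usimp_codegeneracy_right, of g X m' i k] i m by simp
  qed
qed

text \<open>A codegeneracy of \<open>\<Delta>\<^sup>k\<close> makes the fundamental chain of \<open>\<Delta>\<^sup>k \<times> \<Delta>\<^sup>m\<close> degenerate.  So \<open>\<phi>\<^sub>\<infinity>\<close> takes values in the
  representatives on which the Alexander--Whitney product is defined, up to degenerate chains.\<close>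

lemma comparison_conormal:
  assumes c: "supp c \<subseteq> smp (Tot X) m"
  shows "tdgn X (int m) (comparison (int m) c + tproj X (int m) (comparison (int m) c))"
  unfolding tdgn_def
proof
  fix p
  show "supp ((comparison (int m) c + tproj X (int m) (comparison (int m) c)) p)
      \<subseteq> dgn (lev X p) (nat (int m + int p))"
  proof (cases p)
    case 0
    then show ?thesis by (simp add: tproj_def)
  next
    case (Suc k)
    have n: "nat (int m + int (Suc k)) = Suc k + m" by simp
    have "supp (comparison (int m) c (Suc k)) \<subseteq> smp (lev X (Suc k)) (Suc k + m)"
      using tchain_comparison [OF c] unfolding tchain_def n [symmetric] by blast
    moreover have "supp (sco X k (Suc k + m) i (comparison (int m) c (Suc k))) \<subseteq> dgn (lev X k) (Suc k + m)"
      if i: "i \<le> k" for i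
      unfolding comparison_eq kmap_kext
    proof (rule keys_kext_subset)
      fix f assume "f \<in> supp c"
      then have f: "f \<in> smp (Tot X) m" using c by blast
      have "sco X k (Suc k + m) i (kmap (f (Suc k)) (usimp m (Suc k))) =
          kmap (f k) (kmap (cop (cube m) k (map (collapse i) [0..<Suc (Suc k)]) (Suc k + m)) (usimp m (Suc k)))"
        by (rule kmap_cosimplicial [OF X cosimplicial_space_cube Tot_map [OF f] simplex_op_collapse [OF i], symmetric])
           (simp only: lev_cube keys_usimp)
      also have "kmap (cop (cube m) k (map (collapse i) [0..<Suc (Suc k)]) (Suc k + m)) (usimp m (Suc k)) =
          kmap (map_prod (map (collapse i)) (\<lambda>b. b)) (usimp m (Suc k))"
        unfolding cop_cube
      proof (rule kmap_cong)
        fix z assume "z \<in> supp (usimp m (Suc k))"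
        then obtain a b where "z = (a, b)" "simplex_op (Suc k + m) (Suc k) a"
          using keys_usimp [of m "Suc k"] by (cases z) auto
        then show "map_prod (map ((!) (map (collapse i) [0..<Suc (Suc k)]))) (\<lambda>b. b) z =
            map_prod (map (collapse i)) (\<lambda>b. b) z"
          by (auto simp: simplex_op_def intro!: map_nth_upt)
      qed
      finally show "supp (sco X k (Suc k + m) i (kmap (f (Suc k)) (usimp m (Suc k)))) \<subseteq> dgn (lev X k) (Suc k + m)"
        using keys_kmap_dgn [OF Tot_simplicial_map [OF f] usimp_codegeneracy_left [OF i]] by simp
    qed
    ultimately have "supp (comparison (int m) c (Suc k) + proj X (Suc k) (Suc k + m) (Suc k) (comparison (int m) c (Suc k)))
        \<subseteq> dgn (lev X (Suc k)) (Suc k + m)"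
      by (rule proj_conormal_dgn [OF X])
    then show ?thesis unfolding Suc plus_fun_apply tproj_def n .
  qed
qed

end

section \<open>The two universal products and the homotopy between them\<close>

lemma eprod_0 [simp]: "eprod X Y m n 0 y = 0" "eprod X Y m n x 0 = 0"
  by (rule ext, simp add: eprod_def)+

lemma eprod_sum_left: "eprod X Y m n (\<Sum>i\<in>I. x i) y = (\<Sum>i\<in>I. eprod X Y m n (x i) y)"
  by (induction I rule: infinite_finite_induct)
     (simp_all only: sum.infinite sum.empty sum.insert not_False_eq_True eprod_add eprod_0)

lemma eprod_sum_right: "eprod X Y m n x (\<Sum>i\<in>I. y i) = (\<Sum>i\<in>I. eprod X Y m n x (y i))"
  by (induction I rule: infinite_finite_induct)
     (simp_all only: sum.infinite sum.empty sum.insert not_False_eq_True eprod_add eprod_0)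

text \<open>Naturality in both arguments carries identities for the universal elements over to arbitrary ones.\<close>

lemma eprod_natural:
  assumes X: "cosimplicial_space X" "cosimplicial_space X'" and Y: "cosimplicial_space Y" "cosimplicial_space Y'"
    and f: "cosimplicial_map Y X f" and g: "cosimplicial_map Y' X' g"
    and x: "tchain Y m x" and y: "tchain Y' n y"
  shows "eprod X X' m n (tmap m f x) (tmap n g y) = tmap (m + n) (\<lambda>p q. map_prod (f p q) (g p q)) (eprod Y Y' m n x y)"
proof
  fix j
  have kx: "supp (x p) \<subseteq> smp (lev Y p) (nat (m + int p))"
    and ky: "supp (y p) \<subseteq> smp (lev Y' p) (nat (n + int p))" for p
    using x y by (auto simp: tchain_def)
  have "aw X X' j p (nat (m + int p)) (nat (n + int (j - p))) (tmap m f x p) (tmap n g y (j - p)) =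
      kmap (map_prod (f j (nat (m + n + int j))) (g j (nat (m + n + int j))))
        (aw Y Y' j p (nat (m + int p)) (nat (n + int (j - p))) (x p) (y (j - p)))" if p: "p \<le> j" for p
  proof (cases "0 \<le> m + int p \<and> 0 \<le> n + int (j - p)")
    case True
    then have N: "nat (m + n + int j) = nat (m + int p) + nat (n + int (j - p))" using p by auto
    show ?thesis
      unfolding N aw_def tmap_def
        kmap_cosimplicial [OF X(1) Y(1) f simplex_op_front [OF p] kx, symmetric]
        kmap_cosimplicial [OF X(2) Y(2) g simplex_op_back [OF p] ky, symmetric]
      by (rule shuffle_natural [OF cosimplicial_mapD(1) [OF f] cosimplicial_mapD(1) [OF g], symmetric])
         (intro keys_kmap_cop [OF Y(1) simplex_op_front [OF p] kx] keys_kmap_cop [OF Y(2) simplex_op_back [OF p] ky])+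
  next
    case False
    then have "x p = 0 \<or> y (j - p) = 0" using x y unfolding tchain_def by (meson not_le)
    then show ?thesis by (auto simp: tmap_def)
  qed
  then show "eprod X X' m n (tmap m f x) (tmap n g y) j = tmap (m + n) (\<lambda>p q. map_prod (f p q) (g p q)) (eprod Y Y' m n x y) j"
    unfolding eprod_def tmap_def [of "m + n"] kmap_sum by (intro sum.cong) auto
qed

lemma kmap_ident [simp]: "kmap (\<lambda>z. z) c = c"
  by (rule kmap_eq_self) simp

lemma simplicial_set_cubes: "simplicial_set (cubes m n k)"
  by (intro simplicial_set_sprod simplicial_set_std)

lemma fbd_cubes:
  assumes "supp c \<subseteq> smp (cubes m n k) (Suc N)"
  shows "fbd (cubes m n k) (Suc N) c = qbd (Suc N) c"
proof -
  have "kmap (sop (cubes m n k) (Suc N) (coface (Suc N) t)) c = kmap (qdel t) c" if "t \<le> Suc N" for t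
  proof (rule kmap_cong)
    fix z assume "z \<in> supp c"
    then obtain a b c' d where z: "z = ((a, b), (c', d))"
      and "simplex_op (Suc N) k a" "simplex_op (Suc N) m b" "simplex_op (Suc N) k c'" "simplex_op (Suc N) n d"
      using assms by (cases z rule: prod.exhaust, rename_tac u w, case_tac u, case_tac w) auto
    then show "sop (cubes m n k) (Suc N) (coface (Suc N) t) z = qdel t z"
      using that by (simp add: qdel_def simplex_op_def map_nth_coface)
  qed
  then show ?thesis by (simp add: fbd_def qbd_def del: sum.atMost_Suc)
qed

lemma dgn_cubes: "dgn (cubes m n k) r = qdgn r \<inter> smp (cubes m n k) r"
proof (intro subset_antisym subsetI)
  fix z assume z: "z \<in> dgn (cubes m n k) r"
  then have "z \<in> smp (cubes m n k) r" using dgn_subset [OF simplicial_set_cubes] by blast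
  moreover have "z \<in> qdgn r"
  proof -
    from z obtain t y where t: "t < r" "z = sop (cubes m n k) (r - 1) (codegen (r - 1) t) y"
      unfolding dgn_def by blast
    obtain a b c d where y: "y = ((a, b), (c, d))" by (metis surj_pair)
    obtain r' where r: "r = Suc r'" using t(1) by (cases r) auto
    have c: "codegen (r - 1) t = map (collapse t) [0..<Suc r]"
      using t(1) by (simp add: r codegen_conv)
    show ?thesis unfolding qdgn_def t(2) y c
      by (simp, intro exI [of _ t]) (use t(1) in \<open>simp add: collapse_def\<close>)
  qed
  ultimately show "z \<in> qdgn r \<inter> smp (cubes m n k) r" by blast
next
  fix z assume z: "z \<in> qdgn r \<inter> smp (cubes m n k) r"
  then obtain a b c d t where z': "z = ((a, b), (c, d))" and t: "t < r"
    "a ! t = a ! Suc t" "b ! t = b ! Suc t" "c ! t = c ! Suc t" "d ! t = d ! Suc t"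
    unfolding qdgn_def by blast
  have so: "simplex_op r k a" "simplex_op r m b" "simplex_op r k c" "simplex_op r n d"
    using z z' by auto
  have e: "z = sop (cubes m n k) (r - 1) (codegen (r - 1) t)
      ((del (Suc t) a, del (Suc t) b), (del (Suc t) c, del (Suc t) d))"
    using degenerate_factor(2) [OF so(1) t(1,2)] degenerate_factor(2) [OF so(2) t(1,3)]
      degenerate_factor(2) [OF so(3) t(1,4)] degenerate_factor(2) [OF so(4) t(1,5)] by (simp add: z')
  show "z \<in> dgn (cubes m n k) r"
    unfolding dgn_def mem_Collect_eq
    by (rule exI [of _ t], rule exI, intro conjI, rule e)
       (use t(1) degenerate_factor(1) [OF so(1) t(1,2)] degenerate_factor(1) [OF so(2) t(1,3)]
      degenerate_factor(1) [OF so(3) t(1,4)] degenerate_factor(1) [OF so(4) t(1,5)] in simp_all)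
qed

definition diag_map :: "nat list \<times> (nat list \<times> nat list) \<Rightarrow> quad" where
  "diag_map = (\<lambda>(a, (b, c)). ((a, b), (a, c)))"

lemma simplicial_map_diag: "simplicial_map (sprod (std k) (sprod (std m) (std n))) (cubes m n k) (\<lambda>_. diag_map)"
  by (auto simp: simplicial_map_def diag_map_def)

text \<open>The value of \<open>\<phi>\<^sub>\<infinity>\<close> on the shuffle product of the universal elements of degrees \<open>m\<close> and \<open>n\<close>.  Of the two simplices
  in \<open>usimp n m\<close> the one of dimension \<open>m\<close> comes first, because \<open>usimp\<close> takes the dimension of the
  cosimplicial direction as its second argument.\<close>

definition ushuf :: qfam where
  "ushuf m n k = kmap diag_map
     (shuffle (std k) (sprod (std m) (std n)) k (m + n) (kgen [0..<Suc k]) (usimp n m))"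

lemma keys_ushuf_aux:
  "supp (shuffle (std k) (sprod (std m) (std n)) k (m + n) (kgen [0..<Suc k]) (usimp n m)) \<subseteq>
   smp (sprod (std k) (sprod (std m) (std n))) (k + (m + n))"
  by (intro shuffle_keys simplicial_set_sprod simplicial_set_std keys_gen_std keys_usimp)

lemma keys_ushuf: "supp (ushuf m n k) \<subseteq> smp (cubes m n k) (m + n + k)"
proof -
  have e: "m + n + k = k + (m + n)" by simp
  show ?thesis
    unfolding ushuf_def e by (rule keys_kmap_simplicial [OF simplicial_map_diag keys_ushuf_aux])
qed

text \<open>The boundary is computed by the chain map property of the two nested shuffle maps, and naturality of shuffles
  identifies the three resulting sums.\<close>

lemma fbd_ushuf: "fbd (cubes m n k) (m + n + k) (ushuf m n k) = qd ushuf m n k"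
proof -
  let ?S = "\<lambda>k m n. shuffle (std k) (sprod (std m) (std n)) k (m + n) (kgen [0..<Suc k]) (usimp n m)"
  have K: "kmap diag_map (shuffle (std k) (sprod (std m) (std n)) (k - 1) (m + n) (fbd (std k) k (kgen [0..<Suc k])) (usimp n m)) =
      qdK ushuf m n k"
  proof (cases k)
    case (Suc k')
    have "shuffle (std k) (sprod (std m) (std n)) k' (m + n) (kmap (map (skip j)) (kgen [0..<Suc k'])) (kmap (\<lambda>z. z) (usimp n m)) =
        kmap (map_prod (map (skip j)) (\<lambda>z. z)) (?S k' m n)" for j
      unfolding Suc
      by (rule shuffle_natural [OF simplicial_map_std [OF mono_skip skip_le] simplicial_map_same keys_gen_std keys_usimp, symmetric])
    moreover have "kmap diag_map (kmap (map_prod (map (skip j)) (\<lambda>z. z)) c) = kmap (qmap (skip j) id id) (kmap diag_map c)" for j c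
      unfolding kmap_kmap by (rule kmap_cong) (auto simp: diag_map_def qmap_def)
    ultimately show ?thesis
      unfolding fbd_std_gen using Suc
      by (simp add: shuffle_sum_left kmap_sum qdK_def ushuf_def del: sum.atMost_Suc)
  qed (simp add: fbd_def qdK_def)
  have M: "kmap diag_map (shuffle (std k) (sprod (std m) (std n)) k (m + n - 1) (kgen [0..<Suc k])
      (case m of 0 \<Rightarrow> 0 | Suc m' \<Rightarrow> \<Sum>j\<le>m. kmap (map_prod (map (skip j)) (\<lambda>b. b)) (usimp n m'))) = qdM ushuf m n k"
  proof (cases m)
    case (Suc m')
    have "shuffle (std k) (sprod (std m) (std n)) k (m' + n) (kmap (\<lambda>a. a) (kgen [0..<Suc k])) (kmap (map_prod (map (skip j)) (\<lambda>b. b)) (usimp n m')) =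
        kmap (map_prod (\<lambda>a. a) (map_prod (map (skip j)) (\<lambda>b. b))) (?S k m' n)" for j
      unfolding Suc
      by (rule shuffle_natural [OF simplicial_map_same simplicial_map_prod [OF simplicial_map_std [OF mono_skip skip_le] simplicial_map_same]
            keys_gen_std keys_usimp, symmetric])
    moreover have "kmap diag_map (kmap (map_prod (\<lambda>a. a) (map_prod (map (skip j)) (\<lambda>b. b))) c) = kmap (qmap id (skip j) id) (kmap diag_map c)" for j c
      unfolding kmap_kmap by (rule kmap_cong) (auto simp: diag_map_def qmap_def)
    ultimately show ?thesis
      using Suc by (simp add: shuffle_sum_right kmap_sum qdM_def ushuf_def del: sum.atMost_Suc)
  qed (simp add: qdM_def)
  have N: "kmap diag_map (shuffle (std k) (sprod (std m) (std n)) k (m + n - 1) (kgen [0..<Suc k])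
      (case n of 0 \<Rightarrow> 0 | Suc n' \<Rightarrow> \<Sum>j\<le>n. kmap (map_prod (\<lambda>a. a) (map (skip j))) (usimp n' m))) = qdN ushuf m n k"
  proof (cases n)
    case (Suc n')
    have "shuffle (std k) (sprod (std m) (std n)) k (m + n') (kmap (\<lambda>a. a) (kgen [0..<Suc k])) (kmap (map_prod (\<lambda>a. a) (map (skip j))) (usimp n' m)) =
        kmap (map_prod (\<lambda>a. a) (map_prod (\<lambda>a. a) (map (skip j)))) (?S k m n')" for j
      unfolding Suc
      by (rule shuffle_natural [OF simplicial_map_same simplicial_map_prod [OF simplicial_map_same simplicial_map_std [OF mono_skip skip_le]]
            keys_gen_std keys_usimp, symmetric])
    moreover have "kmap diag_map (kmap (map_prod (\<lambda>a. a) (map_prod (\<lambda>a. a) (map (skip j)))) c) = kmap (qmap id id (skip j)) (kmap diag_map c)" for j c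
      unfolding kmap_kmap by (rule kmap_cong) (auto simp: diag_map_def qmap_def)
    ultimately show ?thesis
      using Suc by (simp add: shuffle_sum_right kmap_sum qdN_def ushuf_def del: sum.atMost_Suc)
  qed (simp add: qdN_def)
  have "fbd (cubes m n k) (k + (m + n)) (ushuf m n k) = kmap diag_map (fbd (sprod (std k) (sprod (std m) (std n))) (k + (m + n)) (?S k m n))"
    unfolding ushuf_def by (rule kmap_fbd [OF simplicial_map_diag keys_ushuf_aux, symmetric])
  also have "\<dots> = qd ushuf m n k"
    unfolding fbd_shuffle [OF simplicial_set_std simplicial_set_sprod [OF simplicial_set_std simplicial_set_std] keys_gen_std keys_usimp]
      fbd_usimp shuffle_add_right kmap_add K M N qd_def by (simp only: add.assoc)
  finally show ?thesis by (simp only: add.commute [of k])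
qed

definition uaw :: qfam where
  "uaw m n = eprod (cube m) (cube n) (int m) (int n) (usimp m) (usimp n)"

lemma cbd_cubes:
  assumes "supp c \<subseteq> smp (cubes m n k) q"
  shows "cbd (csprod (cube m) (cube n)) k q c = (\<Sum>j\<le>Suc k. kmap (qmap (skip j) id id) c)"
  unfolding cbd_def cop_cube cop_csprod
proof (intro sum.cong refl kmap_cong)
  fix j z assume "z \<in> supp c"
  then obtain a b c' d where z: "z = ((a, b), (c', d))" and "simplex_op q k a" "simplex_op q k c'"
    using assms by (cases z rule: prod.exhaust, rename_tac u w, case_tac u, case_tac w) auto
  then have "map ((!) (map (skip j) [0..<Suc k])) a = map (skip j) a" "map ((!) (map (skip j) [0..<Suc k])) c' = map (skip j) c'"
    by (auto simp: simplex_op_def intro!: map_nth_upt)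
  then show "map_prod (map_prod (map ((!) (map (skip j) [0..<Suc k]))) (\<lambda>b. b))
      (map_prod (map ((!) (map (skip j) [0..<Suc k]))) (\<lambda>b. b)) z = qmap (skip j) id id z"
    by (simp add: z qmap_def)
qed

lemma tchain_uaw: "tchain (csprod (cube m) (cube n)) (int m + int n) (uaw m n)"
  unfolding uaw_def by (intro tchain_eprod cosimplicial_space_cube tchain_usimp)

lemma keys_uaw: "supp (uaw m n k) \<subseteq> smp (cubes m n k) (m + n + k)"
proof -
  have "nat (int m + int n + int k) = m + n + k" by simp
  then show ?thesis using tchain_uaw unfolding tchain_def lev_csprod lev_cube by metis
qed

lemma tmap_quad:
  "tmap m (\<lambda>_ _. map_prod (map_prod (\<lambda>a. a) (map f)) (map_prod (\<lambda>a. a) (map g))) x k = kmap (qmap id f g) (x k)"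
  unfolding tmap_def by (rule kmap_cong) (auto simp: qmap_def)

lemma cosimplicial_map_cube_same: "cosimplicial_map (cube m) (cube m) (\<lambda>_ _. map_prod (\<lambda>a. a) (map (\<lambda>b. b)))"
  by (rule cosimplicial_map_cube) (simp_all add: mono_self)

lemma tmap_same: "tmap m (\<lambda>_ _. map_prod (\<lambda>a. a) (map (\<lambda>b. b))) x = x"
  by (rule ext) (simp add: tmap_def kmap_eq_self prod.map_ident)

lemma eprod_cube_left:
  assumes f: "mono f" "\<And>x. x \<le> m \<Longrightarrow> f x \<le> m'" and x: "tchain (cube m) (int m) x"
  shows "eprod (cube m') (cube n) (int m) (int n) (tmap (int m) (\<lambda>_ _. map_prod (\<lambda>a. a) (map f)) x) (usimp n) k =
     kmap (qmap id f id) (eprod (cube m) (cube n) (int m) (int n) x (usimp n) k)"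
  using fun_cong [OF eprod_natural [OF cosimplicial_space_cube cosimplicial_space_cube cosimplicial_space_cube
      cosimplicial_space_cube cosimplicial_map_cube [OF f] cosimplicial_map_cube_same x tchain_usimp, of n], of k]
  unfolding tmap_same tmap_quad id_def .

lemma eprod_cube_right:
  assumes f: "mono f" "\<And>x. x \<le> n \<Longrightarrow> f x \<le> n'" and x: "tchain (cube n) (int n) x"
  shows "eprod (cube m) (cube n') (int m) (int n) (usimp m) (tmap (int n) (\<lambda>_ _. map_prod (\<lambda>a. a) (map f)) x) k =
     kmap (qmap id id f) (eprod (cube m) (cube n) (int m) (int n) (usimp m) x k)"
  using fun_cong [OF eprod_natural [OF cosimplicial_space_cube cosimplicial_space_cube cosimplicial_space_cube
      cosimplicial_space_cube cosimplicial_map_cube_same cosimplicial_map_cube [OF f] tchain_usimp [of m] x], of k]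
  unfolding tmap_same tmap_quad id_def .

text \<open>In \<open>tbd_eprod\<close> the horizontal differential of \<open>uaw\<close> gives the cofaces in direction \<open>k\<close>, and the
  differentials of the universal elements give those in the directions \<open>m\<close> and \<open>n\<close>.\<close>

lemma fbd_uaw: "fbd (cubes m n k) (m + n + k) (uaw m n k) = qd uaw m n k"
proof -
  have n: "nat (int m + int n + int k) = m + n + k" for k by simp
  have K: "(case k of 0 \<Rightarrow> 0 | Suc k' \<Rightarrow> cbd (csprod (cube m) (cube n)) k' (m + n + k') (uaw m n k')) = qdK uaw m n k"
    using cbd_cubes [OF keys_uaw] by (cases k) (simp_all add: qdK_def del: sum.atMost_Suc)
  have M: "eprod (cube m) (cube n) (int m - 1) (int n) (tbd (cube m) (int m) (usimp m)) (usimp n) k = qdM uaw m n k"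
  proof (cases m)
    case 0
    then show ?thesis unfolding tbd_usimp by (simp add: qdM_def eprod_def)
  next
    case (Suc m')
    have "eprod (cube m) (cube n) (int m') (int n) (tmap (int m') (\<lambda>_ _. map_prod (\<lambda>a. a) (map (skip j))) (usimp m')) (usimp n) k =
        kmap (qmap id (skip j) id) (uaw m' n k)" for j
      unfolding uaw_def Suc by (rule eprod_cube_left [OF mono_skip skip_le tchain_usimp])
    then show ?thesis unfolding tbd_usimp using Suc
      by (simp add: eprod_sum_left eprod_sum_right fun_sum_apply qdM_def del: sum.atMost_Suc)
  qed
  have N: "eprod (cube m) (cube n) (int m) (int n - 1) (usimp m) (tbd (cube n) (int n) (usimp n)) k = qdN uaw m n k"
  proof (cases n)
    case 0
    then show ?thesis unfolding tbd_usimp by (simp add: qdN_def eprod_def)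
  next
    case (Suc n')
    have "eprod (cube m) (cube n) (int m) (int n') (usimp m) (tmap (int n') (\<lambda>_ _. map_prod (\<lambda>a. a) (map (skip j))) (usimp n')) k =
        kmap (qmap id id (skip j)) (uaw m n' k)" for j
      unfolding uaw_def Suc by (rule eprod_cube_right [OF mono_skip skip_le tchain_usimp])
    then show ?thesis unfolding tbd_usimp using Suc
      by (simp add: eprod_sum_left eprod_sum_right fun_sum_apply qdN_def del: sum.atMost_Suc)
  qed
  have "tbd (csprod (cube m) (cube n)) (int m + int n) (uaw m n) k = qdM uaw m n k + qdN uaw m n k"
    unfolding uaw_def tbd_eprod [OF cosimplicial_space_cube cosimplicial_space_cube tchain_usimp tchain_usimp] plus_fun_apply
    unfolding M N uaw_def [symmetric] ..
  then have "fbd (cubes m n k) (m + n + k) (uaw m n k) + qdK uaw m n k = qdM uaw m n k + qdN uaw m n k"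
    unfolding tbd_def n lev_csprod lev_cube K .
  moreover have "fbd (cubes m n k) (m + n + k) (uaw m n k) =
      qdK uaw m n k + (fbd (cubes m n k) (m + n + k) (uaw m n k) + qdK uaw m n k)"
    by (simp add: add.left_commute)
  ultimately show ?thesis unfolding qd_def by (simp only: add.assoc)
qed

lemma ushuf_codegeneracy_M:
  assumes "i < m"
  shows "supp (kmap (qmap id (collapse i) id) (ushuf m n k)) \<subseteq> qdgn (m + n + k)"
proof -
  obtain m' where m: "m = Suc m'" "i \<le> m'" using assms by (cases m) auto
  note sm = simplicial_map_prod [OF simplicial_map_std [OF mono_collapse collapse_le [OF m(2)]] simplicial_map_same]
  have "kmap (qmap id (collapse i) id) (ushuf m n k) = kmap diag_map (kmap (map_prod (\<lambda>a. a) (map_prod (map (collapse i)) (\<lambda>b. b)))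
      (shuffle (std k) (sprod (std m) (std n)) k (m + n) (kgen [0..<Suc k]) (usimp n m)))"
    unfolding ushuf_def kmap_kmap by (rule kmap_cong) (auto simp: diag_map_def qmap_def)
  also have "kmap (map_prod (\<lambda>a. a) (map_prod (map (collapse i)) (\<lambda>b. b)))
      (shuffle (std k) (sprod (std m) (std n)) k (m + n) (kgen [0..<Suc k]) (usimp n m)) =
      shuffle (std k) (sprod (std m') (std n)) k (m + n) (kmap (\<lambda>a. a) (kgen [0..<Suc k])) (kmap (map_prod (map (collapse i)) (\<lambda>b. b)) (usimp n m))"
    unfolding m by (rule shuffle_natural [OF simplicial_map_same sm keys_gen_std keys_usimp])
  finally have e: "kmap (qmap id (collapse i) id) (ushuf m n k) = kmap diag_map \<dots>" .
  have "supp (kmap (qmap id (collapse i) id) (ushuf m n k)) \<subseteq> dgn (cubes m' n k) (k + (m + n))"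
    unfolding e
    by (rule keys_kmap_dgn [OF simplicial_map_diag], rule shuffle_dgn_right)
       (use usimp_codegeneracy_left [OF m(2), of n] keys_gen_std m(1) in \<open>simp_all add: simplicial_set_sprod simplicial_set_std simplex_op_id\<close>)
  then show ?thesis unfolding dgn_cubes by (simp only: add.commute [of k] le_inf_iff)
qed

lemma ushuf_codegeneracy_N:
  assumes "i < n"
  shows "supp (kmap (qmap id id (collapse i)) (ushuf m n k)) \<subseteq> qdgn (m + n + k)"
proof -
  obtain n' where n: "n = Suc n'" "i \<le> n'" using assms by (cases n) auto
  note sm = simplicial_map_prod [OF simplicial_map_same simplicial_map_std [OF mono_collapse collapse_le [OF n(2)]]]
  have "kmap (qmap id id (collapse i)) (ushuf m n k) = kmap diag_map (kmap (map_prod (\<lambda>a. a) (map_prod (\<lambda>b. b) (map (collapse i))))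
      (shuffle (std k) (sprod (std m) (std n)) k (m + n) (kgen [0..<Suc k]) (usimp n m)))"
    unfolding ushuf_def kmap_kmap by (rule kmap_cong) (auto simp: diag_map_def qmap_def)
  also have "kmap (map_prod (\<lambda>a. a) (map_prod (\<lambda>b. b) (map (collapse i))))
      (shuffle (std k) (sprod (std m) (std n)) k (m + n) (kgen [0..<Suc k]) (usimp n m)) =
      shuffle (std k) (sprod (std m) (std n')) k (m + n) (kmap (\<lambda>a. a) (kgen [0..<Suc k])) (kmap (map_prod (\<lambda>b. b) (map (collapse i))) (usimp n m))"
    unfolding n by (rule shuffle_natural [OF simplicial_map_same sm keys_gen_std keys_usimp])
  finally have e: "kmap (qmap id id (collapse i)) (ushuf m n k) = kmap diag_map \<dots>" .
  have "supp (kmap (qmap id id (collapse i)) (ushuf m n k)) \<subseteq> dgn (cubes m n' k) (k + (m + n))"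
    unfolding e
    by (rule keys_kmap_dgn [OF simplicial_map_diag], rule shuffle_dgn_right)
       (use usimp_codegeneracy_right [OF n(2), of m] keys_gen_std n(1) in \<open>simp_all add: simplicial_set_sprod simplicial_set_std simplex_op_id\<close>)
  then show ?thesis unfolding dgn_cubes by (simp only: add.commute [of k] le_inf_iff)
qed

lemma uaw_codegeneracy_M:
  assumes "i < m"
  shows "supp (kmap (qmap id (collapse i) id) (uaw m n k)) \<subseteq> qdgn (m + n + k)"
proof -
  obtain m' where m: "m = Suc m'" "i \<le> m'" using assms by (cases m) auto
  note cm = cosimplicial_map_cube [OF mono_collapse collapse_le [OF m(2)]]
  define x where "x = tmap (int m) (\<lambda>_ _. map_prod (\<lambda>a. a) (map (collapse i))) (usimp m)"
  have e: "kmap (qmap id (collapse i) id) (uaw m n k) = eprod (cube m') (cube n) (int m) (int n) x (usimp n) k"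
    unfolding uaw_def x_def m(1) by (rule eprod_cube_left [OF mono_collapse collapse_le [OF m(2)] tchain_usimp, symmetric])
  have t: "tchain (cube m') (int m) x"
    unfolding x_def m(1) by (rule tchain_tmap [OF cosimplicial_space_cube cosimplicial_space_cube cm tchain_usimp])
  have N: "nat (int m + int n + int k) = m + n + k" "nat (int m + int p) = p + m" for p by auto
  have "supp (x p) \<subseteq> dgn (lev (cube m') p) (nat (int m + int p))" for p
    using usimp_codegeneracy_right [OF m(2), of p] unfolding x_def tmap_def N(2) lev_cube unfolding m(1) .
  then have "supp (eprod (cube m') (cube n) (int m) (int n) x (usimp n) k) \<subseteq> dgn (cubes m' n k) (m + n + k)"
    using eprod_dgn [OF cosimplicial_space_cube cosimplicial_space_cube t tchain_usimp [of n], of k]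
    unfolding N(1) lev_csprod lev_cube by blast
  then show ?thesis unfolding e dgn_cubes by blast
qed

lemma uaw_codegeneracy_N:
  assumes "i < n"
  shows "supp (kmap (qmap id id (collapse i)) (uaw m n k)) \<subseteq> qdgn (m + n + k)"
proof -
  obtain n' where n: "n = Suc n'" "i \<le> n'" using assms by (cases n) auto
  note cm = cosimplicial_map_cube [OF mono_collapse collapse_le [OF n(2)]]
  define x where "x = tmap (int n) (\<lambda>_ _. map_prod (\<lambda>a. a) (map (collapse i))) (usimp n)"
  have e: "kmap (qmap id id (collapse i)) (uaw m n k) = eprod (cube m) (cube n') (int m) (int n) (usimp m) x k"
    unfolding uaw_def x_def n(1) by (rule eprod_cube_right [OF mono_collapse collapse_le [OF n(2)] tchain_usimp, symmetric])
  have t: "tchain (cube n') (int n) x"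
    unfolding x_def n(1) by (rule tchain_tmap [OF cosimplicial_space_cube cosimplicial_space_cube cm tchain_usimp])
  have N: "nat (int m + int n + int k) = m + n + k" "nat (int n + int p) = p + n" for p by auto
  have "supp (x p) \<subseteq> dgn (lev (cube n') p) (nat (int n + int p))" for p
    using usimp_codegeneracy_right [OF n(2), of p] unfolding x_def tmap_def N(2) lev_cube unfolding n(1) .
  then have "supp (eprod (cube m) (cube n') (int m) (int n) (usimp m) x k) \<subseteq> dgn (cubes m n' k) (m + n + k)"
    using eprod_dgn [OF cosimplicial_space_cube cosimplicial_space_cube tchain_usimp [of m] t, of k]
    unfolding N(1) lev_csprod lev_cube by blast
  then show ?thesis unfolding e dgn_cubes by blast
qed

definition udiff :: qfam where
  "udiff m n k = ushuf m n k + uaw m n k"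

text \<open>The only possible obstruction to the recursion for the homotopy: a cycle of degree \<open>0\<close> need not bound.\<close>

lemma udiff_0: "udiff 0 0 0 = 0"
proof -
  have "usimp 0 0 = kgen ([0], [0])" unfolding usimp_def shuffle_std_gen by simp
  then show ?thesis
    by (simp add: udiff_def ushuf_def uaw_def eprod_def aw_def shuffle_gen diag_map_def cop_cube upt_Suc)
qed

lemma qbd_udiff: "qbd (m + n + k) (udiff m n k) = qd udiff m n k"
proof (cases "m + n + k")
  case 0
  then show ?thesis using udiff_0 by (simp add: qd_def qdK_def qdM_def qdN_def)
next
  case (Suc N)
  have e: "udiff = (\<lambda>m n k. ushuf m n k + uaw m n k)" by (intro ext) (simp add: udiff_def)
  have "supp (udiff m n k) \<subseteq> smp (cubes m n k) (Suc N)"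
    unfolding udiff_def Suc [symmetric] by (intro keys_plus_subset keys_ushuf keys_uaw)
  then have "qbd (m + n + k) (udiff m n k) = fbd (cubes m n k) (m + n + k) (udiff m n k)"
    unfolding Suc by (rule fbd_cubes [symmetric])
  also have "\<dots> = qd udiff m n k"
    by (simp add: e fbd_add fbd_ushuf fbd_uaw qd_add)
  finally show ?thesis .
qed

definition uhty :: qfam where
  "uhty = hty udiff"

lemma keys_uhty: "supp (uhty m n k) \<subseteq> smp (cubes m n k) (Suc (m + n + k))"
proof -
  have "supp (udiff m n k) \<subseteq> smp (cubes m n k) (m + n + k)" for m n k
    unfolding udiff_def by (rule keys_plus_subset [OF keys_ushuf keys_uaw])
  then show ?thesis unfolding uhty_def by (rule keys_hty)
qed

lemma qbd_uhty: "qbd (Suc (m + n + k)) (uhty m n k) = udiff m n k + qd uhty m n k"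
  unfolding uhty_def by (rule qbd_hty [OF qbd_udiff])

lemma uhty_codegeneracy_M:
  assumes "i < m"
  shows "supp (kmap (qmap id (collapse i) id) (uhty m n k)) \<subseteq> qdgn (Suc (m + n + k))"
proof -
  have "supp (kmap (qmap id (collapse i) id) (udiff m n k)) \<subseteq> qdgn (m + n + k)" if "i < m" for m n k i
    unfolding udiff_def kmap_add
    by (rule keys_plus_subset [OF ushuf_codegeneracy_M [OF that] uaw_codegeneracy_M [OF that]])
  then show ?thesis unfolding uhty_def using assms by (rule hty_codegeneracy_M)
qed

lemma uhty_codegeneracy_N:
  assumes "i < n"
  shows "supp (kmap (qmap id id (collapse i)) (uhty m n k)) \<subseteq> qdgn (Suc (m + n + k))"
proof -
  have "supp (kmap (qmap id id (collapse i)) (udiff m n k)) \<subseteq> qdgn (m + n + k)" if "i < n" for m n k i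
    unfolding udiff_def kmap_add
    by (rule keys_plus_subset [OF ushuf_codegeneracy_N [OF that] uaw_codegeneracy_N [OF that]])
  then show ?thesis unfolding uhty_def using assms by (rule hty_codegeneracy_N)
qed

section \<open>Products in the totalization\<close>

text \<open>A pair of elements \<open>f\<close>, \<open>g\<close> of \<open>Tot X\<close> maps the universal chains to chains on \<open>X \<times> X\<close>.\<close>

definition pushq :: "qfam \<Rightarrow> nat \<Rightarrow> nat \<Rightarrow> ('a tot \<Rightarrow>\<^sub>0 bit) \<Rightarrow> ('a tot \<Rightarrow>\<^sub>0 bit) \<Rightarrow> nat \<Rightarrow> 'a \<times> 'a \<Rightarrow>\<^sub>0 bit" where
  "pushq A m n a b = (\<lambda>k. kext (\<lambda>f. kext (\<lambda>g. kmap (map_prod (f k) (g k)) (A m n k)) b) a)"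

lemma pushq_add: "pushq (\<lambda>m n k. A m n k + B m n k) m n a b = pushq A m n a b + pushq B m n a b"
  by (rule ext) (simp add: pushq_def kmap_add kext_plus)

lemma simplex_op_collapse_map: "simplex_op r (Suc m) a \<Longrightarrow> i \<le> m \<Longrightarrow> simplex_op r m (map (collapse i) a)"
  by (rule simplex_op_map [OF _ mono_collapse collapse_le])

context
  fixes X :: "'a csset"
  assumes X: "cosimplicial_space X"
begin

lemma simplicial_map_Tot_pair:
  "f \<in> smp (Tot X) m \<Longrightarrow> g \<in> smp (Tot X) n \<Longrightarrow>
   simplicial_map (cubes m n k) (sprod (lev X k) (lev X k)) (\<lambda>_. map_prod (f k) (g k))"
  by (intro simplicial_map_prod Tot_simplicial_map)

lemma cosimplicial_map_Tot_pair:
  "f \<in> smp (Tot X) m \<Longrightarrow> g \<in> smp (Tot X) n \<Longrightarrow>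
   cosimplicial_map (csprod (cube m) (cube n)) (csprod X X) (\<lambda>k _. map_prod (f k) (g k))"
  by (intro cosimplicial_map_prod Tot_map)

lemma space_csprod_same: "cosimplicial_space (csprod X X)"
  by (intro cosimplicial_space_csprod X)

lemma cosimplicial_space_cubes: "cosimplicial_space (csprod (cube m) (cube n))"
  by (intro cosimplicial_space_csprod cosimplicial_space_cube)

lemma keys_pushq:
  assumes "supp a \<subseteq> smp (Tot X) m" "supp b \<subseteq> smp (Tot X) n"
    and A: "supp (A m n k) \<subseteq> smp (cubes m n k) N"
  shows "supp (pushq A m n a b k) \<subseteq> smp (sprod (lev X k) (lev X k)) N"
  unfolding pushq_def
  by (intro keys_kext_subset keys_kmap_simplicial [OF simplicial_map_Tot_pair A]) (use assms in auto)

lemma fbd_pushq: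
  assumes a: "supp a \<subseteq> smp (Tot X) m" and b: "supp b \<subseteq> smp (Tot X) n"
    and A: "supp (A m n k) \<subseteq> smp (cubes m n k) (Suc (m + n + k))"
  shows "fbd (sprod (lev X k) (lev X k)) (Suc (m + n + k)) (pushq A m n a b k) =
     pushq (\<lambda>m n k. qbd (Suc (m + n + k)) (A m n k)) m n a b k"
  unfolding pushq_def fbd_kext
proof (intro kext_cong)
  fix f g assume "f \<in> supp a" "g \<in> supp b"
  then have "f \<in> smp (Tot X) m" "g \<in> smp (Tot X) n" using a b by auto
  then show "fbd (sprod (lev X k) (lev X k)) (Suc (m + n + k)) (kmap (map_prod (f k) (g k)) (A m n k)) =
      kmap (map_prod (f k) (g k)) (qbd (Suc (m + n + k)) (A m n k))"
    using kmap_fbd [OF simplicial_map_Tot_pair A, of f g] fbd_cubes [OF A] by simp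
qed

lemma pushq_qdK:
  assumes a: "supp a \<subseteq> smp (Tot X) m" and b: "supp b \<subseteq> smp (Tot X) n"
    and A: "supp (A m n k) \<subseteq> smp (cubes m n k) q"
  shows "pushq (qdK A) m n a b (Suc k) = cbd (csprod X X) k q (pushq A m n a b k)"
proof -
  have l: "cbd (csprod X X) k q (kext F c) = kext (\<lambda>z. cbd (csprod X X) k q (F z)) c" for F c
    by (simp add: cbd_def kmap_kext kext_Sum del: sum.atMost_Suc)
  show ?thesis
    unfolding pushq_def l
  proof (intro kext_cong)
    fix f g assume "f \<in> supp a" "g \<in> supp b"
    then have fg: "f \<in> smp (Tot X) m" "g \<in> smp (Tot X) n" using a b by auto
    have "kmap (map_prod (f (Suc k)) (g (Suc k))) (cbd (csprod (cube m) (cube n)) k q (A m n k)) =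
        cbd (csprod X X) k q (kmap (map_prod (f k) (g k)) (A m n k))"
      by (rule kmap_cbd [OF space_csprod_same cosimplicial_space_cubes cosimplicial_map_Tot_pair [OF fg]]) (simp only: A lev_csprod lev_cube)
    then show "kmap (map_prod (f (Suc k)) (g (Suc k))) (qdK A m n (Suc k)) =
        cbd (csprod X X) k q (kmap (map_prod (f k) (g k)) (A m n k))"
      by (simp add: cbd_cubes [OF A] qdK_def del: sum.atMost_Suc)
  qed
qed

lemma pushq_qdM:
  assumes A: "\<And>m'. m = Suc m' \<Longrightarrow> supp (A m' n k) \<subseteq> smp (cubes m' n k) q"
  shows "pushq (qdM A) m n a b k = (case m of 0 \<Rightarrow> 0 | Suc m' \<Rightarrow> pushq A m' n (fbd (Tot X) m a) b k)"
proof (cases m)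
  case (Suc m')
  have e: "kmap (map_prod (f k) (g k)) (kmap (qmap id (skip j) id) (A m' n k)) =
      kmap (map_prod (sop (Tot X) m (coface m j) f k) (g k)) (A m' n k)" if "j \<le> m" for f g j
    unfolding kmap_kmap
  proof (rule kmap_cong)
    fix z assume "z \<in> supp (A m' n k)"
    then obtain x y c d where z: "z = ((x, y), (c, d))" and "simplex_op q k x" "simplex_op q m' y"
      using A [OF Suc] by (cases z rule: prod.exhaust, rename_tac u w, case_tac u, case_tac w) auto
    then show "map_prod (f k) (g k) (qmap id (skip j) id z) = map_prod (sop (Tot X) m (coface m j) f k) (g k) z"
      using Tot_face [of q k x m' y j X f] that Suc by (simp add: qmap_def)
  qed
  have "pushq (qdM A) m n a b k =
      (\<Sum>j\<le>m. kext (\<lambda>f. kext (\<lambda>g. kmap (map_prod (f k) (g k)) (kmap (qmap id (skip j) id) (A m' n k))) b) a)"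
    unfolding pushq_def qdM_def Suc by (simp add: kmap_sum kext_Sum del: sum.atMost_Suc)
  also have "\<dots> = (\<Sum>j\<le>m. kext (\<lambda>f. kext (\<lambda>g. kmap (map_prod (sop (Tot X) m (coface m j) f k) (g k)) (A m' n k)) b) a)"
    by (rule sum.cong) (simp_all add: e)
  also have "\<dots> = pushq A m' n (fbd (Tot X) m a) b k"
    unfolding pushq_def fbd_def Suc by (simp add: kext_sum kext_kmap del: sum.atMost_Suc)
  finally show ?thesis using Suc by simp
qed (simp add: qdM_def pushq_def)

lemma pushq_qdN:
  assumes A: "\<And>n'. n = Suc n' \<Longrightarrow> supp (A m n' k) \<subseteq> smp (cubes m n' k) q"
  shows "pushq (qdN A) m n a b k = (case n of 0 \<Rightarrow> 0 | Suc n' \<Rightarrow> pushq A m n' a (fbd (Tot X) n b) k)"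
proof (cases n)
  case (Suc n')
  have e: "kmap (map_prod (f k) (g k)) (kmap (qmap id id (skip j)) (A m n' k)) =
      kmap (map_prod (f k) (sop (Tot X) n (coface n j) g k)) (A m n' k)" if "j \<le> n" for f g j
    unfolding kmap_kmap
  proof (rule kmap_cong)
    fix z assume "z \<in> supp (A m n' k)"
    then obtain x y c d where z: "z = ((x, y), (c, d))" and "simplex_op q k c" "simplex_op q n' d"
      using A [OF Suc] by (cases z rule: prod.exhaust, rename_tac u w, case_tac u, case_tac w) auto
    then show "map_prod (f k) (g k) (qmap id id (skip j) z) = map_prod (f k) (sop (Tot X) n (coface n j) g k) z"
      using Tot_face [of q k c n' d j X g] that Suc by (simp add: qmap_def)
  qed
  have "pushq (qdN A) m n a b k =
      (\<Sum>j\<le>n. kext (\<lambda>f. kext (\<lambda>g. kmap (map_prod (f k) (g k)) (kmap (qmap id id (skip j)) (A m n' k))) b) a)"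
    unfolding pushq_def qdN_def Suc by (simp add: kmap_sum kext_Sum del: sum.atMost_Suc)
  also have "\<dots> = (\<Sum>j\<le>n. kext (\<lambda>f. kext (\<lambda>g. kmap (map_prod (f k) (sop (Tot X) n (coface n j) g k)) (A m n' k)) b) a)"
    by (rule sum.cong) (simp_all add: e)
  also have "\<dots> = pushq A m n' a (fbd (Tot X) n b) k"
    unfolding pushq_def fbd_def Suc by (simp add: kext_sum kext_kmap kext_Sum del: sum.atMost_Suc)
  finally show ?thesis using Suc by simp
qed (simp add: qdN_def pushq_def)

lemma tchain_pushq_uhty:
  assumes a: "supp a \<subseteq> smp (Tot X) m" and b: "supp b \<subseteq> smp (Tot X) n"
  shows "tchain (csprod X X) (int m + int n + 1) (pushq uhty m n a b)"
proof -
  have "nat (int m + int n + 1 + int k) = Suc (m + n + k)" for k by simp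
  then show ?thesis
    unfolding tchain_def lev_csprod using keys_pushq [where A = uhty, OF a b keys_uhty] by simp
qed

text \<open>The cofaces of \<open>uhty\<close> in direction \<open>k\<close> become the horizontal differential; those in the directions \<open>m\<close> and
  \<open>n\<close> become the boundaries of \<open>a\<close> and \<open>b\<close>.\<close>

lemma tbd_pushq_uhty:
  assumes a: "supp a \<subseteq> smp (Tot X) m" and b: "supp b \<subseteq> smp (Tot X) n"
  shows "tbd (csprod X X) (int m + int n + 1) (pushq uhty m n a b) =
     pushq ushuf m n a b + pushq uaw m n a b +
     ((case m of 0 \<Rightarrow> 0 | Suc m' \<Rightarrow> pushq uhty m' n (fbd (Tot X) m a) b) +
      (case n of 0 \<Rightarrow> 0 | Suc n' \<Rightarrow> pushq uhty m n' a (fbd (Tot X) n b)))"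
proof
  fix k
  have N: "nat (int m + int n + 1 + int k) = Suc (m + n + k)" for k by simp
  have "fbd (sprod (lev X k) (lev X k)) (Suc (m + n + k)) (pushq uhty m n a b k) =
      pushq (\<lambda>m n k. ushuf m n k + uaw m n k + (qdK uhty m n k + (qdM uhty m n k + qdN uhty m n k))) m n a b k"
    unfolding fbd_pushq [where A = uhty, OF a b keys_uhty]
    unfolding qbd_uhty udiff_def qd_def by (simp only: add.assoc)
  also have "\<dots> = pushq ushuf m n a b k + pushq uaw m n a b k +
      (pushq (qdK uhty) m n a b k + (pushq (qdM uhty) m n a b k + pushq (qdN uhty) m n a b k))"
    unfolding pushq_add plus_fun_apply ..
  finally have f: "fbd (sprod (lev X k) (lev X k)) (Suc (m + n + k)) (pushq uhty m n a b k) = \<dots>" .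
  have K: "(case k of 0 \<Rightarrow> 0 | Suc k' \<Rightarrow> cbd (csprod X X) k' (Suc (m + n + k')) (pushq uhty m n a b k')) =
      pushq (qdK uhty) m n a b k"
    using pushq_qdK [where A = uhty, OF a b keys_uhty] by (cases k) (simp_all add: pushq_def qdK_def)
  have M: "pushq (qdM uhty) m n a b k = (case m of 0 \<Rightarrow> 0 | Suc m' \<Rightarrow> pushq uhty m' n (fbd (Tot X) m a) b) k"
    by (subst pushq_qdM [where q = "m + n + k"])
       (use keys_uhty [of _ n k] in \<open>auto split: nat.split simp del: smp_sprod\<close>)
  have N': "pushq (qdN uhty) m n a b k = (case n of 0 \<Rightarrow> 0 | Suc n' \<Rightarrow> pushq uhty m n' a (fbd (Tot X) n b)) k"
    by (subst pushq_qdN [where q = "m + n + k"])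
       (use keys_uhty [of m _ k] in \<open>auto split: nat.split simp del: smp_sprod\<close>)
  show "tbd (csprod X X) (int m + int n + 1) (pushq uhty m n a b) k =
     (pushq ushuf m n a b + pushq uaw m n a b +
     ((case m of 0 \<Rightarrow> 0 | Suc m' \<Rightarrow> pushq uhty m' n (fbd (Tot X) m a) b) +
      (case n of 0 \<Rightarrow> 0 | Suc n' \<Rightarrow> pushq uhty m n' a (fbd (Tot X) n b)))) k"
    unfolding tbd_def N lev_csprod f K plus_fun_apply M [symmetric] N' [symmetric]
    by (simp add: add.assoc add.left_commute [of "pushq (qdK uhty) m n a b k"])
qed

text \<open>If \<open>f = s\<^sub>i h\<close>, then \<open>f\<close> is \<open>h\<close> composed with a codegeneracy in direction \<open>m\<close>, and this codegeneracy maps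
  \<open>uhty\<close> to degenerate chains.\<close>

lemma tdgn_pushq_left:
  assumes a: "supp a \<subseteq> dgn (Tot X) m" and b: "supp b \<subseteq> smp (Tot X) n"
  shows "tdgn (csprod X X) (int m + int n + 1) (pushq uhty m n a b)"
  unfolding tdgn_def
proof
  fix k
  have N: "nat (int m + int n + 1 + int k) = Suc (m + n + k)" by simp
  show "supp (pushq uhty m n a b k) \<subseteq> dgn (lev (csprod X X) k) (nat (int m + int n + 1 + int k))"
    unfolding N pushq_def lev_csprod
  proof (intro keys_kext_subset)
    fix f g assume "f \<in> supp a" "g \<in> supp b"
    then obtain i h where g: "g \<in> smp (Tot X) n" and i: "i < m" "h \<in> smp (Tot X) (m - 1)"
      "f = sop (Tot X) (m - 1) (codegen (m - 1) i) h"
      using a b unfolding dgn_def by blast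
    obtain m' where m: "m = Suc m'" using i(1) by (cases m) auto
    let ?c = "kmap (qmap id (collapse i) id) (uhty m n k)"
    have e: "kmap (map_prod (f k) (g k)) (uhty m n k) = kmap (map_prod (h k) (g k)) ?c"
      unfolding kmap_kmap
    proof (rule kmap_cong)
      fix z assume "z \<in> supp (uhty m n k)"
      then obtain x y c d where z: "z = ((x, y), (c, d))" and
        "simplex_op (Suc (m + n + k)) k x" "simplex_op (Suc (m + n + k)) m y"
        using keys_uhty [of m n k] by (cases z rule: prod.exhaust, rename_tac u w, case_tac u, case_tac w) auto
      then show "map_prod (f k) (g k) z = map_prod (h k) (g k) (qmap id (collapse i) id z)"
        using Tot_degeneracy [of "Suc (m + n + k)" k x m' y i X h] i m by (simp add: qmap_def)
    qed
    have "supp ?c \<subseteq> smp (cubes m' n k) (Suc (m + n + k))"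
    proof (rule keys_kmap_subset, rule subsetI)
      fix z assume "z \<in> qmap id (collapse i) id ` supp (uhty m n k)"
      then obtain x y c d where "z = qmap id (collapse i) id ((x, y), (c, d))" "((x, y), (c, d)) \<in> smp (cubes m n k) (Suc (m + n + k))"
        using keys_uhty [of m n k] by fastforce
      then show "z \<in> smp (cubes m' n k) (Suc (m + n + k))"
        using i(1) m by (simp add: qmap_def simplex_op_collapse_map)
    qed
    then have "supp ?c \<subseteq> dgn (cubes m' n k) (Suc (m + n + k))"
      unfolding dgn_cubes using uhty_codegeneracy_M [OF i(1)] by blast
    then show "supp (kmap (map_prod (f k) (g k)) (uhty m n k)) \<subseteq>
        dgn (sprod (lev X k) (lev X k)) (Suc (m + n + k))"
      unfolding e using keys_kmap_dgn [OF simplicial_map_Tot_pair [OF _ g]] i(2) m by simp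
  qed
qed

lemma tdgn_pushq_right:
  assumes a: "supp a \<subseteq> smp (Tot X) m" and b: "supp b \<subseteq> dgn (Tot X) n"
  shows "tdgn (csprod X X) (int m + int n + 1) (pushq uhty m n a b)"
  unfolding tdgn_def
proof
  fix k
  have N: "nat (int m + int n + 1 + int k) = Suc (m + n + k)" by simp
  show "supp (pushq uhty m n a b k) \<subseteq> dgn (lev (csprod X X) k) (nat (int m + int n + 1 + int k))"
    unfolding N pushq_def lev_csprod
  proof (intro keys_kext_subset)
    fix f g assume "f \<in> supp a" "g \<in> supp b"
    then obtain i h where f: "f \<in> smp (Tot X) m" and i: "i < n" "h \<in> smp (Tot X) (n - 1)"
      "g = sop (Tot X) (n - 1) (codegen (n - 1) i) h"
      using a b unfolding dgn_def by blast
    obtain n' where n: "n = Suc n'" using i(1) by (cases n) auto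
    let ?c = "kmap (qmap id id (collapse i)) (uhty m n k)"
    have e: "kmap (map_prod (f k) (g k)) (uhty m n k) = kmap (map_prod (f k) (h k)) ?c"
      unfolding kmap_kmap
    proof (rule kmap_cong)
      fix z assume "z \<in> supp (uhty m n k)"
      then obtain x y c d where z: "z = ((x, y), (c, d))" and
        "simplex_op (Suc (m + n + k)) k c" "simplex_op (Suc (m + n + k)) n d"
        using keys_uhty [of m n k] by (cases z rule: prod.exhaust, rename_tac u w, case_tac u, case_tac w) auto
      then show "map_prod (f k) (g k) z = map_prod (f k) (h k) (qmap id id (collapse i) z)"
        using Tot_degeneracy [of "Suc (m + n + k)" k c n' d i X h] i n by (simp add: qmap_def)
    qed
    have "supp ?c \<subseteq> smp (cubes m n' k) (Suc (m + n + k))"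
    proof (rule keys_kmap_subset, rule subsetI)
      fix z assume "z \<in> qmap id id (collapse i) ` supp (uhty m n k)"
      then obtain x y c d where "z = qmap id id (collapse i) ((x, y), (c, d))" "((x, y), (c, d)) \<in> smp (cubes m n k) (Suc (m + n + k))"
        using keys_uhty [of m n k] by fastforce
      then show "z \<in> smp (cubes m n' k) (Suc (m + n + k))"
        using i(1) n by (simp add: qmap_def simplex_op_collapse_map)
    qed
    then have "supp ?c \<subseteq> dgn (cubes m n' k) (Suc (m + n + k))"
      unfolding dgn_cubes using uhty_codegeneracy_N [OF i(1)] by blast
    then show "supp (kmap (map_prod (f k) (g k)) (uhty m n k)) \<subseteq>
        dgn (sprod (lev X k) (lev X k)) (Suc (m + n + k))"
      unfolding e using keys_kmap_dgn [OF simplicial_map_Tot_pair [OF f]] i(2) n by simp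
  qed
qed

lemma pushq_uaw:
  assumes a: "supp a \<subseteq> smp (Tot X) m" and b: "supp b \<subseteq> smp (Tot X) n"
  shows "pushq uaw m n a b = eprod X X (int m) (int n) (comparison (int m) a) (comparison (int n) b)"
proof -
  have c: "comparison (int m) c = (\<Sum>f\<in>supp c. tmap (int m) (\<lambda>k _. f k) (usimp m))"
    for m and c :: "'a tot \<Rightarrow>\<^sub>0 bit"
    by (rule ext) (simp add: comparison_eq fun_sum_apply kext_def tmap_def)
  have "eprod X X (int m) (int n) (tmap (int m) (\<lambda>k _. f k) (usimp m)) (tmap (int n) (\<lambda>k _. g k) (usimp n)) k =
      kmap (map_prod (f k) (g k)) (uaw m n k)"
    if "f \<in> supp a" "g \<in> supp b" for f g k
  proof -
    have fg: "f \<in> smp (Tot X) m" "g \<in> smp (Tot X) n" using that a b by auto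
    show ?thesis
      using eprod_natural [OF X X cosimplicial_space_cube cosimplicial_space_cube Tot_map [OF fg(1)] Tot_map [OF fg(2)] tchain_usimp tchain_usimp]
      by (simp add: tmap_def uaw_def)
  qed
  then show ?thesis
    by (intro ext) (simp add: c eprod_sum_left eprod_sum_right fun_sum_apply pushq_def kext_def, rule sum.swap)
qed

end

section \<open>The multiplications on a cosimplicial algebra\<close>

locale cosimplicial_algebra =
  fixes C :: "'o operad" and X :: "'a csset" and A :: "nat \<Rightarrow> nat \<Rightarrow> 'o \<Rightarrow> 'a list \<Rightarrow> 'a" and v :: 'o
  assumes C: "simplicial_operad C" and CX: "cosimplicial_operad_space C X A" and v: "v \<in> smp (osp C 2) 0"
begin

lemma space_X: "cosimplicial_space X"
  using CX by (simp add: cosimplicial_operad_space_def)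

lemma algebra_X: "operad_algebra C (lev X p) (A p)"
  using CX by (simp add: cosimplicial_operad_space_def)

lemma operad_sset: "simplicial_set (osp C n)"
  using C by (simp add: simplicial_operad_def)

lemma simplex_op_0: "simplex_op q 0 (replicate (Suc q) 0)"
  by (auto simp: simplex_op_def)

lemma degen_vertex_in: "degen_vertex (osp C 2) q v \<in> smp (osp C 2) q"
  unfolding degen_vertex_def by (rule sop_in [OF operad_sset simplex_op_0 v])

lemma sop_degen_vertex:
  assumes "simplex_op r q \<phi>"
  shows "sop (osp C 2) q \<phi> (degen_vertex (osp C 2) q v) = degen_vertex (osp C 2) r v"
proof -
  have "map ((!) (replicate (Suc q) 0)) \<phi> = replicate (Suc r) (0::nat)"
  proof (rule nth_equalityI)
    fix i assume i: "i < length (map ((!) (replicate (Suc q) 0)) \<phi> :: nat list)"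
    then have "\<phi> ! i \<in> set \<phi>" by simp
    then have "\<phi> ! i < Suc q" using assms by (auto simp: simplex_op_def)
    then show "map ((!) (replicate (Suc q) 0)) \<phi> ! i = replicate (Suc r) (0::nat) ! i"
      using i assms by (simp add: simplex_op_def del: replicate_Suc)
  qed (use assms in \<open>simp add: simplex_op_def\<close>)
  then show ?thesis
    unfolding degen_vertex_def using sop_comp [OF operad_sset simplex_op_0 assms v] by simp
qed

lemma binary_map: "cosimplicial_map (csprod X X) X (binary C A v)"
proof -
  have in2: "c \<in> smp (osp C (length [x, y])) q \<longleftrightarrow> c \<in> smp (osp C 2) q" for c q and x y :: 'a
    by (simp add: numeral_2_eq_2)
  show ?thesis
    unfolding cosimplicial_map_def
  proof (intro conjI allI impI ballI)
    fix p q
    show "binary C A v p q ` smp (lev (csprod X X) p) q \<subseteq> smp (lev X p) q"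
    proof (rule image_subsetI)
      fix z assume "z \<in> smp (lev (csprod X X) p) q"
      then obtain x y where z: "z = (x, y)" and xy: "[x, y] \<in> lists (smp (lev X p) q)" by (cases z) auto
      have "\<forall>q. \<forall>xs\<in>lists (smp (lev X p) q). \<forall>c\<in>smp (osp C (length xs)) q. A p q c xs \<in> smp (lev X p) q"
        using algebra_X [of p] unfolding operad_algebra_def by blast
      then show "binary C A v p q z \<in> smp (lev X p) q"
        using xy degen_vertex_in in2 by (simp add: binary_def z del: list.size)
    qed
  next
    fix p q r \<phi> z assume so: "simplex_op r q \<phi>" and "z \<in> smp (lev (csprod X X) p) q"
    then obtain x y where z: "z = (x, y)" and xy: "[x, y] \<in> lists (smp (lev X p) q)" by (cases z) auto
    have "\<forall>q r \<phi>. simplex_op r q \<phi> \<longrightarrow> (\<forall>xs\<in>lists (smp (lev X p) q). \<forall>c\<in>smp (osp C (length xs)) q.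
        sop (lev X p) q \<phi> (A p q c xs) = A p r (sop (osp C (length xs)) q \<phi> c) (map (sop (lev X p) q \<phi>) xs))"
      using algebra_X [of p] unfolding operad_algebra_def by blast
    then have "sop (lev X p) q \<phi> (A p q (degen_vertex (osp C 2) q v) [x, y]) =
        A p r (sop (osp C (length [x, y])) q \<phi> (degen_vertex (osp C 2) q v)) (map (sop (lev X p) q \<phi>) [x, y])"
      using so xy degen_vertex_in in2 by blast
    then show "binary C A v p r (sop (lev (csprod X X) p) q \<phi> z) = sop (lev X p) q \<phi> (binary C A v p q z)"
      using sop_degen_vertex [OF so] by (simp add: binary_def z numeral_2_eq_2)
  next
    fix m n q \<theta> z assume so: "simplex_op m n \<theta>" and "z \<in> smp (lev (csprod X X) m) q"
    then obtain x y where z: "z = (x, y)" and xy: "[x, y] \<in> lists (smp (lev X m) q)" by (cases z) auto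
    have "\<forall>xs\<in>lists (smp (lev X m) q). \<forall>c\<in>smp (osp C (length xs)) q.
        cop X n \<theta> q (A m q c xs) = A n q c (map (cop X n \<theta> q) xs)"
      using CX so unfolding cosimplicial_operad_space_def by blast
    then have "cop X n \<theta> q (A m q (degen_vertex (osp C 2) q v) [x, y]) =
        A n q (degen_vertex (osp C 2) q v) (map (cop X n \<theta> q) [x, y])"
      using xy degen_vertex_in in2 by blast
    then show "binary C A v n q (cop (csprod X X) n \<theta> q z) = cop X n \<theta> q (binary C A v m q z)"
      by (simp add: binary_def z)
  qed
qed

lemma Tot_binary_apply:
  assumes "simplex_op r k a" "simplex_op r q b"
  shows "Tot_binary C A v q (f, g) k (a, b) = binary C A v k r (f k (a, b), g k (a, b))"
proof -
  have "(a, b) \<in> prism k q" using assms by (auto simp: prism_iff)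
  moreover have "length a - 1 = r" using assms by (simp add: simplex_op_def)
  ultimately show ?thesis
    using sop_degen_vertex [OF assms(2)] by (simp add: Tot_binary_def Tot_act_def binary_def numeral_2_eq_2)
qed

lemma Tot_binary_in:
  assumes f: "f \<in> smp (Tot X) q" and g: "g \<in> smp (Tot X) q"
  shows "Tot_binary C A v q (f, g) \<in> smp (Tot X) q"
  unfolding Tot_iff
proof
  show "cosimplicial_map (cube q) X (\<lambda>k _. Tot_binary C A v q (f, g) k)"
  proof (rule cosimplicial_map_cong [OF cosimplicial_map_comp [OF cosimplicial_map_pair [OF Tot_map [OF f] Tot_map [OF g]] binary_map] cosimplicial_space_cube])
    fix k r y assume "y \<in> smp (lev (cube q) k) r"
    then show "binary C A v k r (f k y, g k y) = Tot_binary C A v q (f, g) k y"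
      by (cases y) (auto simp: Tot_binary_apply)
  qed
  show "\<forall>k z. z \<notin> prism k q \<longrightarrow> Tot_binary C A v q (f, g) k z = undefined"
    by (simp add: Tot_binary_def Tot_act_def)
qed

lemma simplicial_map_Tot_binary: "simplicial_map (sprod (Tot X) (Tot X)) (Tot X) (Tot_binary C A v)"
  unfolding simplicial_map_def
proof (intro conjI allI ballI impI)
  fix q z assume "z \<in> smp (sprod (Tot X) (Tot X)) q"
  then show "Tot_binary C A v q z \<in> smp (Tot X) q" using Tot_binary_in by (cases z) auto
next
  fix q r \<phi> z assume so: "simplex_op r q \<phi>" and "z \<in> smp (sprod (Tot X) (Tot X)) q"
  then obtain f g where z: "z = (f, g)" and fg: "f \<in> smp (Tot X) q" "g \<in> smp (Tot X) q" by (cases z) auto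
  have in1: "Tot_binary C A v r (sop (sprod (Tot X) (Tot X)) q \<phi> z) \<in> smp (Tot X) r"
    unfolding z using Tot_binary_in [OF sop_Tot_in [OF so fg(1)] sop_Tot_in [OF so fg(2)]] by simp
  have in2: "sop (Tot X) q \<phi> (Tot_binary C A v q z) \<in> smp (Tot X) r"
    unfolding z by (rule sop_Tot_in [OF so Tot_binary_in [OF fg]])
  from in1 in2 show "Tot_binary C A v r (sop (sprod (Tot X) (Tot X)) q \<phi> z) = sop (Tot X) q \<phi> (Tot_binary C A v q z)"
  proof (rule Tot_eqI)
    fix k s a b assume ab: "simplex_op s k a" "simplex_op s r b"
    have l: "length \<phi> = Suc r" using so by (simp add: simplex_op_def)
    have b': "simplex_op s q (map ((!) \<phi>) b)" using simplex_op_comp [OF so ab(2)] .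
    show "Tot_binary C A v r (sop (sprod (Tot X) (Tot X)) q \<phi> z) k (a, b) = sop (Tot X) q \<phi> (Tot_binary C A v q z) k (a, b)"
      by (simp add: z Tot_binary_apply [OF ab] sop_Tot [OF ab l] Tot_binary_apply [OF ab(1) b'])
  qed
qed

definition tot_mult :: "nat \<Rightarrow> nat \<Rightarrow> ('a tot \<Rightarrow>\<^sub>0 bit) \<Rightarrow> ('a tot \<Rightarrow>\<^sub>0 bit) \<Rightarrow> 'a tot \<Rightarrow>\<^sub>0 bit" where
  "tot_mult m n a b = kmap (Tot_binary C A v (m + n)) (shuffle (Tot X) (Tot X) m n a b)"

lemma tot_mult_add:
  "tot_mult m n (a + a') b = tot_mult m n a b + tot_mult m n a' b"
  "tot_mult m n a (b + b') = tot_mult m n a b + tot_mult m n a b'"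
  by (simp_all add: tot_mult_def shuffle_add_left shuffle_add_right kmap_add)

lemma keys_tot_mult:
  assumes "supp a \<subseteq> smp (Tot X) m" "supp b \<subseteq> smp (Tot X) n"
  shows "supp (tot_mult m n a b) \<subseteq> smp (Tot X) (m + n)"
  unfolding tot_mult_def
  by (rule keys_kmap_simplicial [OF simplicial_map_Tot_binary shuffle_keys [OF simplicial_set_Tot simplicial_set_Tot assms]])

lemma tot_mult_dgn:
  assumes "supp a \<subseteq> smp (Tot X) m" "supp b \<subseteq> smp (Tot X) n"
    and "supp a \<subseteq> dgn (Tot X) m \<or> supp b \<subseteq> dgn (Tot X) n"
  shows "supp (tot_mult m n a b) \<subseteq> dgn (Tot X) (m + n)"
  unfolding tot_mult_def
  by (rule keys_kmap_dgn [OF simplicial_map_Tot_binary])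
     (use assms shuffle_dgn_left shuffle_dgn_right simplicial_set_Tot in metis)

lemma fbd_tot_mult:
  assumes a: "supp a \<subseteq> smp (Tot X) m" and b: "supp b \<subseteq> smp (Tot X) n"
  shows "fbd (Tot X) (m + n) (tot_mult m n a b) =
    (if m = 0 then 0 else tot_mult (m - 1) n (fbd (Tot X) m a) b) +
    (if n = 0 then 0 else tot_mult m (n - 1) a (fbd (Tot X) n b))"
proof -
  have "fbd (Tot X) (m + n) (tot_mult m n a b) =
      kmap (Tot_binary C A v (m + n - 1)) (fbd (sprod (Tot X) (Tot X)) (m + n) (shuffle (Tot X) (Tot X) m n a b))"
    unfolding tot_mult_def
    by (rule kmap_fbd [OF simplicial_map_Tot_binary shuffle_keys [OF simplicial_set_Tot simplicial_set_Tot a b], symmetric])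
  then show ?thesis
    unfolding fbd_shuffle [OF simplicial_set_Tot simplicial_set_Tot a b] kmap_add tot_mult_def
    by (cases m; cases n) (simp_all add: fbd_def [of _ 0])
qed

text \<open>The product in \<open>Tot X\<close> is pointwise.  Hence evaluating the product of \<open>f\<close> and \<open>g\<close> on the shuffles of
  \<open>\<Delta>\<^sup>k\<close> and \<open>\<Delta>\<^bsup>m+n\<^esup>\<close> amounts to evaluating \<open>(f, g)\<close> on the shuffles of \<open>\<Delta>\<^sup>k\<close> and \<open>\<Delta>\<^sup>m \<times> \<Delta>\<^sup>n\<close>, with
  \<open>\<Delta>\<^sup>k\<close> put diagonally into both factors.\<close>

lemma comparison_tot_mult:
  assumes a: "supp a \<subseteq> smp (Tot X) m" and b: "supp b \<subseteq> smp (Tot X) n"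
  shows "comparison (int (m + n)) (tot_mult m n a b) = tmap (int (m + n)) (binary C A v) (pushq ushuf m n a b)"
proof
  fix k
  have N: "nat (int (m + n) + int k) = m + n + k" by simp
  have us: "usimp q p = shuf p q" for p q unfolding usimp_def shuffle_std_gen ..
  \<comment> \<open>The contribution of one shuffle \<open>(\<alpha>, \<beta>)\<close> of \<open>m\<close>, \<open>n\<close> and one shuffle \<open>(x, y)\<close> of \<open>k\<close>, \<open>m + n\<close>, in which
    both sides can be expressed.\<close>
  let ?F = "\<lambda>f g (\<alpha>, \<beta>) (x, y). binary C A v k (m + n + k) (f k (x, map ((!) \<alpha>) y), g k (x, map ((!) \<beta>) y))"
  have L: "kext (\<lambda>(\<alpha>, \<beta>). kmap (Tot_binary C A v (m + n) (sop (Tot X) m \<alpha> f, sop (Tot X) n \<beta> g) k) (usimp (m + n) k)) (shuf m n) =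
      kext (\<lambda>w. kmap (?F f g w) (shuf k (m + n))) (shuf m n)" for f g
    unfolding us
  proof (rule kext_cong)
    fix w assume "w \<in> supp (shuf m n)"
    then obtain \<alpha> \<beta> where w: "w = (\<alpha>, \<beta>)" "simplex_op (m + n) m \<alpha>" "simplex_op (m + n) n \<beta>" by (rule shuf_keys)
    then have l: "length \<alpha> = Suc (m + n)" "length \<beta> = Suc (m + n)" by (auto simp: simplex_op_def)
    have "kmap (Tot_binary C A v (m + n) (sop (Tot X) m \<alpha> f, sop (Tot X) n \<beta> g) k) (shuf k (m + n)) =
        kmap (?F f g w) (shuf k (m + n))"
    proof (rule kmap_cong)
      fix z assume "z \<in> supp (shuf k (m + n))"
      then obtain x y where z: "z = (x, y)" "simplex_op (k + (m + n)) k x" "simplex_op (k + (m + n)) (m + n) y"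
        by (rule shuf_keys)
      have e: "k + (m + n) = m + n + k" by simp
      note xy = z(2,3) [unfolded e]
      show "Tot_binary C A v (m + n) (sop (Tot X) m \<alpha> f, sop (Tot X) n \<beta> g) k z = ?F f g w z"
        by (simp add: z(1) w(1) Tot_binary_apply [OF xy] sop_Tot [OF xy l(1)] sop_Tot [OF xy l(2)])
    qed
    then show "(case w of (\<alpha>, \<beta>) \<Rightarrow> kmap (Tot_binary C A v (m + n) (sop (Tot X) m \<alpha> f, sop (Tot X) n \<beta> g) k) (shuf k (m + n))) =
        kmap (?F f g w) (shuf k (m + n))"
      by (simp only: w(1) prod.case)
  qed
  have R: "kmap (binary C A v k (m + n + k)) (kmap (map_prod (f k) (g k)) (ushuf m n k)) =
      kext (\<lambda>w. kmap (?F f g w) (shuf k (m + n))) (shuf m n)" for f g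
  proof -
    have "ushuf m n k = kext (\<lambda>w. kmap (\<lambda>(x, y). ((x, map ((!) (fst w)) y), (x, map ((!) (snd w)) y))) (shuf k (m + n))) (shuf m n)"
    proof -
      have "shuffle (std k) (sprod (std m) (std n)) k (m + n) (kgen [0..<Suc k]) (shuf m n) =
          kext (\<lambda>w. kmap (\<lambda>(x, y). (x, (map ((!) (fst w)) y, map ((!) (snd w)) y))) (shuf k (m + n))) (shuf m n)"
        unfolding shuffle_alt kext_kgen
      proof (intro kext_cong kmap_cong)
        fix w z assume "z \<in> supp (shuf k (m + n))"
        then obtain x y where z: "z = (x, y)" "simplex_op (k + (m + n)) k x" by (rule shuf_keys)
        then have "map ((!) [0..<Suc k]) x = x" by (intro map_idI) (auto simp: simplex_op_def)
        then show "(case z of (\<alpha>, \<beta>) \<Rightarrow> (sop (std k) k \<alpha> [0..<Suc k], sop (sprod (std m) (std n)) (m + n) \<beta> w)) =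
            (case z of (x, y) \<Rightarrow> (x, (map ((!) (fst w)) y, map ((!) (snd w)) y)))"
          by (simp add: z(1) map_prod_def case_prod_unfold)
      qed
      then show ?thesis
        by (simp add: ushuf_def us kmap_kext kmap_kmap diag_map_def case_prod_unfold)
    qed
    then show ?thesis
      by (simp add: kmap_kext kmap_kmap case_prod_unfold)
  qed
  have "comparison (int (m + n)) (tot_mult m n a b) k =
      kext (\<lambda>f. kext (\<lambda>g. kext (\<lambda>(\<alpha>, \<beta>). kmap (Tot_binary C A v (m + n) (sop (Tot X) m \<alpha> f, sop (Tot X) n \<beta> g) k) (usimp (m + n) k)) (shuf m n)) b) a"
    unfolding comparison_eq tot_mult_def shuffle_alt
    by (simp add: kmap_kext kext_kext kmap_kmap kext_kmap case_prod_unfold)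
  also have "\<dots> = tmap (int (m + n)) (binary C A v) (pushq ushuf m n a b) k"
    unfolding L tmap_def N pushq_def kmap_kext R ..
  finally show "comparison (int (m + n)) (tot_mult m n a b) k = tmap (int (m + n)) (binary C A v) (pushq ushuf m n a b) k" .
qed

end

section \<open>Quotients\<close>

definition subgrp :: "'a::ab_group_add set \<Rightarrow> bool" where
  "subgrp W \<longleftrightarrow> 0 \<in> W \<and> (\<forall>x\<in>W. \<forall>y\<in>W. x - y \<in> W)"

lemma subgrp_0: "subgrp W \<Longrightarrow> 0 \<in> W"
  by (simp add: subgrp_def)

lemma subgrp_diff: "subgrp W \<Longrightarrow> x \<in> W \<Longrightarrow> y \<in> W \<Longrightarrow> x - y \<in> W"
  by (simp add: subgrp_def)

lemma subgrp_add: "subgrp W \<Longrightarrow> x \<in> W \<Longrightarrow> y \<in> W \<Longrightarrow> x + y \<in> W"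
  using subgrp_diff [of W x "0 - y"] subgrp_diff [of W 0 y] subgrp_0 [of W] by simp

lemma subgrp_Int: "subgrp V \<Longrightarrow> subgrp W \<Longrightarrow> subgrp (V \<inter> W)"
  by (simp add: subgrp_def)

lemma subgrp_plus:
  assumes "subgrp V" "subgrp W" shows "subgrp (V + W)"
  unfolding subgrp_def
proof (intro conjI ballI)
  show "0 \<in> V + W" using set_plus_intro [OF subgrp_0 subgrp_0] assms by fastforce
  fix x y assume "x \<in> V + W" "y \<in> V + W"
  then obtain a b c d where "a \<in> V" "b \<in> W" "c \<in> V" "d \<in> W" "x = a + b" "y = c + d"
    by (auto simp: set_plus_def)
  moreover from this have "(a - c) + (b - d) \<in> V + W"
    using assms subgrp_diff set_plus_intro by blast
  moreover have "(a - c) + (b - d) = (a + b) - (c + d)"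
    by (simp add: algebra_simps)
  ultimately show "x - y \<in> V + W" by metis
qed

lemma coset_mem: "y \<in> x +o W \<longleftrightarrow> y - x \<in> (W :: 'a::ab_group_add set)"
  by (force simp: elt_set_plus_def)

lemma coset_eq_iff:
  assumes "subgrp W" shows "x +o W = y +o W \<longleftrightarrow> x - y \<in> W"
proof
  assume "x +o W = y +o W"
  moreover have "x \<in> x +o W" using subgrp_0 [OF assms] by (simp add: coset_mem)
  ultimately show "x - y \<in> W" using coset_mem by blast
next
  assume xy: "x - y \<in> W"
  have "z - x \<in> W \<longleftrightarrow> z - y \<in> W" for z
    using subgrp_add [OF assms _ xy, of "z - x"] subgrp_diff [OF assms _ xy, of "z - y"] by auto
  then show "x +o W = y +o W" by (auto simp: coset_mem)
qed

lemma coset_plus: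
  assumes "subgrp W" shows "(x +o W) + (y +o W) = (x + y) +o W"
proof (rule subset_antisym; rule subsetI)
  fix z assume "z \<in> (x +o W) + (y +o W)"
  then obtain a b where ab: "a - x \<in> W" "b - y \<in> W" and z: "z = a + b" by (auto simp: set_plus_def coset_mem)
  have "z - (x + y) = (a - x) + (b - y)" by (simp add: z algebra_simps)
  then show "z \<in> (x + y) +o W" unfolding coset_mem using subgrp_add [OF assms ab] by (simp only:)
next
  fix z assume "z \<in> (x + y) +o W"
  then have "z - (x + y) \<in> W" by (simp only: coset_mem)
  moreover have "(z - x) - y = z - (x + y)" by (simp add: algebra_simps)
  ultimately have "z - x \<in> y +o W" by (simp only: coset_mem)
  moreover have "x \<in> x +o W" using subgrp_0 [OF assms] by (simp add: coset_mem)
  ultimately have "x + (z - x) \<in> (x +o W) + (y +o W)" by (rule set_plus_intro [rotated])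
  then show "z \<in> (x +o W) + (y +o W)" by simp
qed

text \<open>The elements of the filtration quotients of homology are cosets of a set of cosets.  Since sets of cosets
  do not form a group under addition, they are described by representatives in the ambient group.\<close>

lemma coset_quot:
  assumes "subgrp B" shows "(x +o B) +o quot K B = (\<lambda>k. (x + k) +o B) ` K"
proof -
  have "(x +o B) +o quot K B = (\<lambda>c. (x +o B) + c) ` quot K B"
    by (auto simp: elt_set_plus_def)
  also have "\<dots> = (\<lambda>k. (x +o B) + (k +o B)) ` K"
    by (simp add: quot_def image_image)
  finally show ?thesis by (simp only: coset_plus [OF assms])
qed

lemma coset_quot_eq_iff:
  assumes B: "subgrp B" and K: "subgrp K" and BK: "B \<subseteq> K"
  shows "(x +o B) +o quot K B = (y +o B) +o quot K B \<longleftrightarrow> x - y \<in> K"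
proof
  assume e: "(x +o B) +o quot K B = (y +o B) +o quot K B"
  have "(x + 0) +o B \<in> (x +o B) +o quot K B"
    unfolding coset_quot [OF B] by (rule image_eqI [where x = 0, OF refl subgrp_0 [OF K]])
  then have "(x + 0) +o B \<in> (\<lambda>k. (y + k) +o B) ` K"
    unfolding e unfolding coset_quot [OF B] .
  then obtain k where k: "(x + 0) +o B = (y + k) +o B" "k \<in> K" by (rule imageE)
  then have "(x + 0) - (y + k) \<in> K" using BK by (auto simp: coset_eq_iff [OF B])
  then have "(x + 0) - (y + k) + k \<in> K" using k(2) by (rule subgrp_add [OF K])
  then show "x - y \<in> K" by simp
next
  assume xy: "x - y \<in> K"
  have e: "x + k = y + ((x - y) + k)" "y + k = x + (k - (x - y))" for k by simp_all
  show "(x +o B) +o quot K B = (y +o B) +o quot K B"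
    unfolding coset_quot [OF B]
  proof (rule subset_antisym; rule subsetI)
    fix z assume "z \<in> (\<lambda>k. (x + k) +o B) ` K"
    then obtain k where k: "k \<in> K" "z = (x + k) +o B" by blast
    show "z \<in> (\<lambda>k. (y + k) +o B) ` K"
      unfolding k(2) e(1) [of k] by (rule image_eqI [where x = "(x - y) + k", OF refl subgrp_add [OF K xy k(1)]])
  next
    fix z assume "z \<in> (\<lambda>k. (y + k) +o B) ` K"
    then obtain k where k: "k \<in> K" "z = (y + k) +o B" by blast
    show "z \<in> (\<lambda>k. (x + k) +o B) ` K"
      unfolding k(2) e(2) [of k] by (rule image_eqI [where x = "k - (x - y)", OF refl subgrp_diff [OF K k(1) xy]])
  qed
qed

lemma UN_coset_const:
  assumes "S \<noteq> {}" "\<And>s. s \<in> S \<Longrightarrow> F s = c" shows "(\<Union>s\<in>S. F s) = c"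
  using assms by auto

lemma induced_coset:
  assumes W: "subgrp W" and V: "0 \<in> V" and f: "\<And>u. u \<in> V \<Longrightarrow> f (x + u) - f x \<in> W"
  shows "induced W f (x +o V) = f x +o W"
  unfolding induced_def
proof (rule UN_coset_const)
  show "x +o V \<noteq> {}" using V by (auto simp: elt_set_plus_def)
  fix z assume "z \<in> x +o V"
  then obtain u where "u \<in> V" "z = x + u" by (auto simp: elt_set_plus_def)
  then show "f z +o W = f x +o W" using f by (simp add: coset_eq_iff [OF W])
qed

text \<open>The sets \<open>S\<close> and \<open>T\<close> need not be cosets: in the external product they are the intersections of cosets with
  the conormal representatives.\<close>

lemma induced2_coset:
  assumes W: "subgrp W" and "x \<in> S" "y \<in> T"
    and f: "\<And>x' y'. x' \<in> S \<Longrightarrow> y' \<in> T \<Longrightarrow> f x' y' - c \<in> W"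
  shows "induced2 W f S T = c +o W"
  unfolding induced2_def
  by (rule UN_coset_const, use assms in blast, rule UN_coset_const, use assms in blast)
     (use f in \<open>simp add: coset_eq_iff [OF W]\<close>)

text \<open>Both multiplications are an external product followed by an induced map; this composes the two on
  representatives.\<close>

lemma induced_induced2:
  assumes W: "subgrp W" and f: "\<And>x y. f (x + y) = f x + f y" and V: "0 \<in> V" "\<And>u. u \<in> V \<Longrightarrow> f u \<in> W"
  shows "induced W f (induced2 V g S T) = induced2 W (\<lambda>x y. f (g x y)) S T"
proof -
  have "induced W f (induced2 V g S T) = (\<Union>x\<in>S. \<Union>y\<in>T. induced W f (g x y +o V))"
    unfolding induced_def induced2_def by blast
  moreover have "induced W f (g x y +o V) = f (g x y) +o W" for x y
    by (rule induced_coset [OF W V(1)]) (simp add: f V(2))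
  ultimately show ?thesis by (simp add: induced2_def)
qed

section \<open>Cycles and boundaries\<close>

lemma subgrp_chainI:
  fixes W :: "('a \<Rightarrow>\<^sub>0 bit) set"
  shows "0 \<in> W \<Longrightarrow> (\<And>x y. x \<in> W \<Longrightarrow> y \<in> W \<Longrightarrow> x + y \<in> W) \<Longrightarrow> subgrp W"
  by (simp add: subgrp_def)

lemma subgrp_famI:
  fixes W :: "(nat \<Rightarrow> 'a \<Rightarrow>\<^sub>0 bit) set"
  shows "0 \<in> W \<Longrightarrow> (\<And>x y. x \<in> W \<Longrightarrow> y \<in> W \<Longrightarrow> x + y \<in> W) \<Longrightarrow> subgrp W"
  by (simp only: subgrp_def fun_diff) blast

lemma cycles_S_chains:
  "a \<in> cycles (S_chains Z) m \<longleftrightarrow> supp a \<subseteq> smp Z (nat m) \<and> (m < 0 \<longrightarrow> a = 0) \<and>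
     supp (fbd Z (nat m) a) \<subseteq> dgn Z (nat m - 1)"
proof -
  have "nat (m - 1) = nat m - 1" by simp
  then show ?thesis
    unfolding cycles_def nulls_S_chains bdry_S_chains by (auto simp: chains_S_chains)
qed

lemma bounds_S_chains:
  "a \<in> bounds (S_chains Z) m \<longleftrightarrow> (\<exists>c \<nu>. supp c \<subseteq> smp Z (nat (m + 1)) \<and> (m + 1 < 0 \<longrightarrow> c = 0) \<and>
     supp \<nu> \<subseteq> dgn Z (nat m) \<and> a = fbd Z (nat (m + 1)) c + \<nu>)"
proof -
  have "a \<in> bounds (S_chains Z) m \<longleftrightarrow> (\<exists>c\<in>chains (S_chains Z) (m + 1). \<exists>\<nu>\<in>nulls (S_chains Z) m. a = fbd Z (nat (m + 1)) c + \<nu>)"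
    unfolding bounds_def set_plus_def bdry_S_chains by blast
  then show ?thesis unfolding Bex_def chains_S_chains nulls_S_chains mem_Collect_eq by blast
qed

lemma nat_pred: "nat (m + 1) - 1 = nat m"
  by simp

lemma subgrp_bounds_S: "subgrp (bounds (S_chains Z) m)"
proof (rule subgrp_chainI)
  show "0 \<in> bounds (S_chains Z) m"
    unfolding bounds_S_chains by (rule exI [of _ 0], rule exI [of _ 0]) simp
  fix x y assume "x \<in> bounds (S_chains Z) m" "y \<in> bounds (S_chains Z) m"
  then obtain c \<nu> d \<rho> where "supp c \<subseteq> smp Z (nat (m + 1))" "m + 1 < 0 \<longrightarrow> c = 0"
      "supp \<nu> \<subseteq> dgn Z (nat m)" "x = fbd Z (nat (m + 1)) c + \<nu>"
      "supp d \<subseteq> smp Z (nat (m + 1))" "m + 1 < 0 \<longrightarrow> d = 0"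
      "supp \<rho> \<subseteq> dgn Z (nat m)" "y = fbd Z (nat (m + 1)) d + \<rho>"
    unfolding bounds_S_chains by blast
  then show "x + y \<in> bounds (S_chains Z) m"
    unfolding bounds_S_chains
    by (intro exI [of _ "c + d"] exI [of _ "\<nu> + \<rho>"]) (simp add: keys_plus_subset fbd_add ac_simps)
qed

lemma subgrp_cycles_S: "subgrp (cycles (S_chains Z) m)"
  by (rule subgrp_chainI) (simp_all add: cycles_S_chains fbd_add keys_plus_subset)

lemma bounds_subset_cycles_S:
  assumes Z: "simplicial_set Z" shows "bounds (S_chains Z) m \<subseteq> cycles (S_chains Z) m"
proof
  fix a assume "a \<in> bounds (S_chains Z) m"
  then obtain c \<nu> where c: "supp c \<subseteq> smp Z (nat (m + 1))"
      and \<nu>: "supp \<nu> \<subseteq> dgn Z (nat m)" and a: "a = fbd Z (nat (m + 1)) c + \<nu>"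
    unfolding bounds_S_chains by blast
  have "supp \<nu> \<subseteq> smp Z (nat m)" using \<nu> dgn_subset [OF Z] by blast
  then have "supp a \<subseteq> smp Z (nat m)"
    unfolding a using keys_fbd [OF Z c] unfolding nat_pred by (rule keys_plus_subset [rotated])
  moreover have "a = 0" if "m < 0" using that \<nu> by (simp add: a fbd_def)
  moreover have "fbd Z (nat m) a = fbd Z (nat m) \<nu>"
    unfolding a fbd_add using fbd_fbd [OF Z c] by (simp add: nat_pred)
  ultimately show "a \<in> cycles (S_chains Z) m"
    using fbd_dgn [OF Z \<nu>] by (simp add: cycles_S_chains)
qed

lemma kmap_bounds_S:
  assumes f: "simplicial_map Z Z' f" and a: "a \<in> bounds (S_chains Z) m"
  shows "kmap (f (nat m)) a \<in> bounds (S_chains Z') m"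
proof -
  obtain c \<nu> where c: "supp c \<subseteq> smp Z (nat (m + 1))" "m + 1 < 0 \<longrightarrow> c = 0"
      and \<nu>: "supp \<nu> \<subseteq> dgn Z (nat m)" and a: "a = fbd Z (nat (m + 1)) c + \<nu>"
    using a unfolding bounds_S_chains by blast
  have "kmap (f (nat m)) (fbd Z (nat (m + 1)) c) = fbd Z' (nat (m + 1)) (kmap (f (nat (m + 1))) c)"
    using kmap_fbd [OF f c(1)] unfolding nat_pred .
  then show ?thesis
    unfolding bounds_S_chains a kmap_add
    using keys_kmap_simplicial [OF f c(1)] keys_kmap_dgn [OF f \<nu>] c(2)
    by (intro exI [of _ "kmap (f (nat (m + 1))) c"] exI [of _ "kmap (f (nat m)) \<nu>"]) auto
qed

lemma cycles_TC: "x \<in> cycles (TC X) m \<longleftrightarrow> tchain X m x \<and> bdry (TC X) m x \<in> nulls (TC X) (m - 1)"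
  by (simp add: cycles_def chains_TC)

lemma bounds_TC:
  "x \<in> bounds (TC X) m \<longleftrightarrow> (\<exists>w \<nu>. tchain X (m + 1) w \<and> \<nu> \<in> nulls (TC X) m \<and> x = bdry (TC X) (m + 1) w + \<nu>)"
proof -
  have "x \<in> bounds (TC X) m \<longleftrightarrow> (\<exists>w\<in>chains (TC X) (m + 1). \<exists>\<nu>\<in>nulls (TC X) m. x = bdry (TC X) (m + 1) w + \<nu>)"
    unfolding bounds_def set_plus_def by blast
  then show ?thesis by (simp add: Bex_def chains_TC)
qed

lemma tproj_0 [simp]: "tproj X m 0 = 0"
  by (rule ext) (simp add: tproj_def)

lemma bdry_TC_0 [simp]: "bdry (TC X) m 0 = 0"
  by (rule ext) (simp add: bdry_TC split: nat.split)

context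
  fixes X :: "'a csset"
  assumes X: "cosimplicial_space X"
begin

lemma nulls_of_tdgn: "tdgn X m x \<Longrightarrow> x \<in> nulls (TC X) m"
  by (simp add: nulls_TC [OF X] tchain_of_tdgn [OF X] tdgn_tproj [OF X])

lemma nulls_of_tproj_0: "tchain X m x \<Longrightarrow> tproj X m x = 0 \<Longrightarrow> x \<in> nulls (TC X) m"
  by (simp add: nulls_TC [OF X] tdgn_0)

lemma subgrp_nulls: "subgrp (nulls (TC X) m)"
  by (rule subgrp_famI)
     (simp_all only: nulls_TC [OF X] tchain_0 tchain_add tproj_add tdgn_add tproj_0 tdgn_0 simp_thms)

text \<open>The difference of \<open>d\<^sup>0\<close> and the sum of all cofaces lies in the image of \<open>d\<^sup>1, \<dots>, d\<^bsup>p+1\<^esup>\<close>.  So \<open>tbd\<close> represents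
  the differential of the total complex.\<close>

lemma bdry_tbd:
  assumes x: "tchain X m x" shows "bdry (TC X) m x + tbd X m x \<in> nulls (TC X) (m - 1)"
proof (rule nulls_of_tproj_0)
  show "tchain X (m - 1) (bdry (TC X) m x + tbd X m x)"
    by (intro tchain_add tchain_bdry tchain_tbd X x)
  show "tproj X (m - 1) (bdry (TC X) m x + tbd X m x) = 0"
  proof
    fix p
    show "tproj X (m - 1) (bdry (TC X) m x + tbd X m x) p = 0 p"
    proof (cases p)
      case 0
      then show ?thesis by (simp add: tproj_def bdry_TC tbd_def)
    next
      case (Suc p')
      let ?q = "nat (m + int p')"
      have q: "nat (m - 1 + int p) = ?q" by (simp add: Suc)
      have k: "supp (x p') \<subseteq> smp (lev X p') ?q" using x by (simp add: tchain_def)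
      have "cbd X p' ?q (x p') = dco X p' ?q 0 (x p') + (\<Sum>k=1..Suc p'. dco X p' ?q k (x p'))"
        unfolding cbd_def by (simp add: atMost_atLeast0 sum.atLeast_Suc_atMost [of 0] One_nat_def del: sum.cl_ivl_Suc)
      then have "(bdry (TC X) m x + tbd X m x) p = (\<Sum>k=1..Suc p'. dco X p' ?q k (x p'))"
        by (simp add: bdry_TC tbd_def Suc add.assoc add.left_commute [of "dco X p' ?q 0 (x p')"])
      moreover have "(\<Sum>k=1..Suc p'. dco X p' ?q k (x p')) \<in> cospan X p ?q"
        unfolding cospan_def Suc using k by (intro CollectI exI [of _ "\<lambda>_. x p'"]) simp
      ultimately show ?thesis
        using proj_cospan [OF X] q by (simp add: tproj_def)
    qed
  qed
qed

lemma bdry_bdry: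
  assumes x: "tchain X m x" shows "bdry (TC X) (m - 1) (bdry (TC X) m x) \<in> nulls (TC X) (m - 1 - 1)"
proof (rule nulls_of_tproj_0)
  show "tchain X (m - 1 - 1) (bdry (TC X) (m - 1) (bdry (TC X) m x))"
    by (intro tchain_bdry X x)
  show "tproj X (m - 1 - 1) (bdry (TC X) (m - 1) (bdry (TC X) m x)) = 0"
    unfolding tproj_bdry [OF X tchain_bdry [OF X x]] tproj_bdry [OF X x]
    by (rule tbd_tbd [OF X tchain_tproj [OF X x]])
qed

lemma bdry_nulls:
  assumes "x \<in> nulls (TC X) m" shows "bdry (TC X) m x \<in> nulls (TC X) (m - 1)"
  using assms by (simp add: nulls_TC [OF X] tchain_bdry [OF X] tproj_bdry [OF X] tdgn_tbd [OF X])

lemma subgrp_bounds: "subgrp (bounds (TC X) m)"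
proof (rule subgrp_famI)
  show "0 \<in> bounds (TC X) m"
    unfolding bounds_TC using subgrp_0 [OF subgrp_nulls] tchain_0 by (intro exI [of _ 0]) simp
  fix x y assume "x \<in> bounds (TC X) m" "y \<in> bounds (TC X) m"
  then obtain w \<nu> z \<rho> where "tchain X (m + 1) w" "\<nu> \<in> nulls (TC X) m" "x = bdry (TC X) (m + 1) w + \<nu>"
      "tchain X (m + 1) z" "\<rho> \<in> nulls (TC X) m" "y = bdry (TC X) (m + 1) z + \<rho>"
    unfolding bounds_TC by blast
  then show "x + y \<in> bounds (TC X) m"
    unfolding bounds_TC
    by (intro exI [of _ "w + z"] exI [of _ "\<nu> + \<rho>"] conjI tchain_add subgrp_add [OF subgrp_nulls])
       (simp_all only: bdry_TC_add ac_simps)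
qed

lemma nulls_subset_bounds: "nulls (TC X) m \<subseteq> bounds (TC X) m"
proof
  fix x assume "x \<in> nulls (TC X) m"
  then show "x \<in> bounds (TC X) m"
    unfolding bounds_TC using tchain_0 by (intro exI [of _ 0] exI [of _ x]) simp
qed

lemma bdry_in_bounds: "tchain X (m + 1) w \<Longrightarrow> bdry (TC X) (m + 1) w \<in> bounds (TC X) m"
  unfolding bounds_TC using subgrp_0 [OF subgrp_nulls] by (intro exI [of _ w] exI [of _ 0]) simp

lemma tchain_nulls: "x \<in> nulls (TC X) m \<Longrightarrow> tchain X m x"
  by (simp add: nulls_TC [OF X])

lemma subgrp_cycles: "subgrp (cycles (TC X) m)"
  by (rule subgrp_famI)
     (simp_all only: cycles_TC tchain_0 tchain_add bdry_TC_0 bdry_TC_add subgrp_0 [OF subgrp_nulls] subgrp_add [OF subgrp_nulls] simp_thms)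

lemma bounds_subset_cycles: "bounds (TC X) m \<subseteq> cycles (TC X) m"
proof
  fix x assume "x \<in> bounds (TC X) m"
  then obtain w \<nu> where w: "tchain X (m + 1) w" and \<nu>: "\<nu> \<in> nulls (TC X) m" and x: "x = bdry (TC X) (m + 1) w + \<nu>"
    unfolding bounds_TC by blast
  have "bdry (TC X) m (bdry (TC X) (m + 1) w) \<in> nulls (TC X) (m - 1)"
    using bdry_bdry [OF w] by simp
  then have "bdry (TC X) m x \<in> nulls (TC X) (m - 1)"
    unfolding x bdry_TC_add by (rule subgrp_add [OF subgrp_nulls _ bdry_nulls [OF \<nu>]])
  moreover have "tchain X m x"
    unfolding x using tchain_bdry [OF X w] tchain_nulls [OF \<nu>] by (simp add: tchain_add)
  ultimately show "x \<in> cycles (TC X) m" by (simp add: cycles_TC)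
qed

lemma subgrp_fil: "subgrp (fil (CN X) (- int s) m)"
  by (rule subgrp_famI) (simp_all add: fil_TC [OF X] tchain_0 tchain_add tproj_add keys_plus_subset)

lemma nulls_subset_fil: "nulls (TC X) m \<subseteq> fil (CN X) (- int s) m"
  by (auto simp: nulls_TC [OF X] fil_TC [OF X] tdgn_def)

lemma fil_antimono: "s \<le> s' \<Longrightarrow> fil (CN X) (- int s') m \<subseteq> fil (CN X) (- int s) m"
  by (auto simp: fil_TC [OF X])

lemma tchain_fil: "x \<in> fil (CN X) (- int s) m \<Longrightarrow> tchain X m x"
  by (simp add: fil_TC [OF X])

end

text \<open>The denominator of \<open>E\<^sup>\<infinity>\<^bsub>-s,t\<^esub>\<close>, indexed by the total degree \<open>m = t - s\<close> as all other modules here.\<close>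

definition Enull :: "'a csset \<Rightarrow> nat \<Rightarrow> int \<Rightarrow> (nat \<Rightarrow> 'a \<Rightarrow>\<^sub>0 bit) set" where
  "Enull X s m = cycles (TC X) m \<inter> fil (CN X) (- int (Suc s)) m + bounds (TC X) m \<inter> fil (CN X) (- int s) m"

lemma E_nulls_Enull: "E_nulls (csS_chains X) s t = Enull X s (t - int s)"
proof -
  have "- int (Suc s) = - int s - 1" by simp
  then show ?thesis by (simp only: E_nulls_def Enull_def Let_def)
qed

lemma subgrp_Enull: "cosimplicial_space X \<Longrightarrow> subgrp (Enull X s m)"
  unfolding Enull_def by (intro subgrp_plus subgrp_Int subgrp_cycles subgrp_fil subgrp_bounds)

lemma Enull_cycle:
  assumes "cosimplicial_space X" "x \<in> cycles (TC X) m" "x \<in> fil (CN X) (- int (Suc s)) m"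
  shows "x \<in> Enull X s m"
  using set_plus_intro [of x "cycles (TC X) m \<inter> fil (CN X) (- int (Suc s)) m" 0 "bounds (TC X) m \<inter> fil (CN X) (- int s) m"]
    assms subgrp_0 [OF subgrp_bounds [OF assms(1)]] subgrp_0 [OF subgrp_fil [OF assms(1)]]
  unfolding Enull_def by (simp del: of_nat_Suc)

lemma Enull_bound:
  assumes "cosimplicial_space X" "x \<in> bounds (TC X) m" "x \<in> fil (CN X) (- int s) m"
  shows "x \<in> Enull X s m"
  using set_plus_intro [of 0 "cycles (TC X) m \<inter> fil (CN X) (- int (Suc s)) m" x "bounds (TC X) m \<inter> fil (CN X) (- int s) m"]
    assms subgrp_0 [OF subgrp_cycles [OF assms(1)]] subgrp_0 [OF subgrp_fil [OF assms(1)]]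
  unfolding Enull_def by (simp del: of_nat_Suc)

lemma EnullE:
  assumes "x \<in> Enull X s m"
  obtains y z where "x = y + z" "y \<in> cycles (TC X) m" "y \<in> fil (CN X) (- int (Suc s)) m"
    "z \<in> bounds (TC X) m" "z \<in> fil (CN X) (- int s) m"
  using assms unfolding Enull_def set_plus_def by blast

lemma nulls_subset_Enull:
  assumes "cosimplicial_space X" shows "nulls (TC X) m \<subseteq> Enull X s m"
  using Enull_bound [OF assms] nulls_subset_bounds [OF assms] nulls_subset_fil [OF assms] by blast

lemma tmap_bounds:
  assumes X: "cosimplicial_space X" and Y: "cosimplicial_space Y" and f: "cosimplicial_map Y X f"
    and x: "x \<in> bounds (TC Y) m"
  shows "tmap m f x \<in> bounds (TC X) m"
proof -
  obtain w \<nu> where w: "tchain Y (m + 1) w" and \<nu>: "\<nu> \<in> nulls (TC Y) m" and x: "x = bdry (TC Y) (m + 1) w + \<nu>"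
    using x unfolding bounds_TC by blast
  have "tmap m f (bdry (TC Y) (m + 1) w) = bdry (TC X) (m + 1) (tmap (m + 1) f w)"
    using tmap_bdry [OF X Y f w] by simp
  then show ?thesis
    unfolding bounds_TC x tmap_add using tchain_tmap [OF X Y f w] nulls_tmap [OF X Y f \<nu>]
    by (intro exI [of _ "tmap (m + 1) f w"] exI [of _ "tmap m f \<nu>"]) simp
qed

lemma tmap_cycles:
  assumes X: "cosimplicial_space X" and Y: "cosimplicial_space Y" and f: "cosimplicial_map Y X f"
    and x: "x \<in> cycles (TC Y) m"
  shows "tmap m f x \<in> cycles (TC X) m"
  using x tmap_bdry [OF X Y f, of m x] nulls_tmap [OF X Y f, of "bdry (TC Y) m x" "m - 1"] tchain_tmap [OF X Y f, of m x]
  by (simp add: cycles_TC)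

lemma tmap_Enull:
  assumes X: "cosimplicial_space X" and Y: "cosimplicial_space Y" and f: "cosimplicial_map Y X f"
    and x: "x \<in> Enull Y s m"
  shows "tmap m f x \<in> Enull X s m"
  using x
proof (rule EnullE)
  fix y z assume "x = y + z" "y \<in> cycles (TC Y) m" "y \<in> fil (CN Y) (- int (Suc s)) m"
    "z \<in> bounds (TC Y) m" "z \<in> fil (CN Y) (- int s) m"
  then show ?thesis
    using subgrp_add [OF subgrp_Enull [OF X] Enull_cycle [OF X tmap_cycles [OF X Y f] fil_tmap [OF X Y f]]
        Enull_bound [OF X tmap_bounds [OF X Y f] fil_tmap [OF X Y f]]] by (simp only: tmap_add)
qed

lemma conormal_iff:
  "x \<in> conormal (csS_chains X) m \<longleftrightarrow>
     (\<forall>p i. i \<le> p \<longrightarrow> supp (sco X p (nat (m + int (Suc p))) i (x (Suc p))) \<subseteq> dgn (lev X p) (nat (m + int (Suc p))))"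
  (is "_ \<longleftrightarrow> ?R")
proof -
  have "x \<in> conormal (csS_chains X) m \<longleftrightarrow> (\<forall>p. \<forall>i<p.
      supp (kmap (cop X (p - 1) (codegen (p - 1) i) (nat (m + int p))) (x p)) \<subseteq> dgn (lev X (p - 1)) (nat (m + int p)))"
    by (simp add: conormal_def nulls_S_chains)
  also have "\<dots> \<longleftrightarrow> ?R"
  proof (intro iffI allI impI)
    fix p i :: nat
    assume a: "\<forall>p. \<forall>i<p. supp (kmap (cop X (p - 1) (codegen (p - 1) i) (nat (m + int p))) (x p)) \<subseteq> dgn (lev X (p - 1)) (nat (m + int p))"
      and i: "i \<le> p"
    show "supp (sco X p (nat (m + int (Suc p))) i (x (Suc p))) \<subseteq> dgn (lev X p) (nat (m + int (Suc p)))"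
      using a [rule_format, of i "Suc p"] i by (simp add: codegen_conv)
  next
    fix p i :: nat assume R: ?R and i: "i < p"
    then obtain p' where p: "p = Suc p'" by (cases p) auto
    show "supp (kmap (cop X (p - 1) (codegen (p - 1) i) (nat (m + int p))) (x p)) \<subseteq> dgn (lev X (p - 1)) (nat (m + int p))"
      using R [rule_format, of i p'] i by (simp add: p codegen_conv)
  qed
  finally show ?thesis .
qed

lemma conormal_tproj:
  assumes X: "cosimplicial_space X" and x: "tchain X m x"
  shows "tproj X m x \<in> conormal (csS_chains X) m"
  unfolding conormal_iff tproj_def
proof (intro allI impI)
  fix p i :: nat assume "i \<le> p"
  moreover have "supp (x (Suc p)) \<subseteq> smp (lev X (Suc p)) (nat (m + int (Suc p)))"
    using x unfolding tchain_def by blast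
  ultimately show "supp (sco X p (nat (m + int (Suc p))) i (proj X (Suc p) (nat (m + int (Suc p))) (Suc p) (x (Suc p))))
      \<subseteq> dgn (lev X p) (nat (m + int (Suc p)))"
    using sco_proj [OF X] by (simp del: proj.simps of_nat_Suc)
qed

text \<open>On conormal families \<open>P\<close> is the identity up to degenerate chains.\<close>

lemma tdgn_conormal:
  assumes X: "cosimplicial_space X" and x: "tchain X m x" and c: "x \<in> conormal (csS_chains X) m"
  shows "tdgn X m (x + tproj X m x)"
  unfolding tdgn_def
proof
  fix p
  show "supp ((x + tproj X m x) p) \<subseteq> dgn (lev X p) (nat (m + int p))"
  proof (cases p)
    case (Suc k)
    have "supp (x (Suc k)) \<subseteq> smp (lev X (Suc k)) (nat (m + int (Suc k)))"
      using x unfolding tchain_def by blast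
    then have "supp (x (Suc k) + proj X (Suc k) (nat (m + int (Suc k))) (Suc k) (x (Suc k))) \<subseteq> dgn (lev X (Suc k)) (nat (m + int (Suc k)))"
      by (rule proj_conormal_dgn [OF X]) (use c in \<open>unfold conormal_iff, blast\<close>)
    then show ?thesis unfolding Suc plus_fun_apply tproj_def .
  qed (simp add: tproj_def)
qed

text \<open>With \<open>conormal_tproj\<close> this says that every class has a conormal representative.\<close>

lemma tproj_diff_nulls:
  assumes X: "cosimplicial_space X" and x: "tchain X m x"
  shows "x + tproj X m x \<in> nulls (TC X) m"
proof (rule nulls_of_tproj_0 [OF X])
  show "tchain X m (x + tproj X m x)" using tchain_add [OF x tchain_tproj [OF X x]] .
  show "tproj X m (x + tproj X m x) = 0"
  proof
    fix p
    have "supp (x p) \<subseteq> smp (lev X p) (nat (m + int p))" using x unfolding tchain_def by blast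
    from proj_cospan [OF X proj_cospan_diff [OF X this]]
    show "tproj X m (x + tproj X m x) p = 0 p" by (simp add: tproj_def)
  qed
qed

section \<open>Compatibility of the multiplications\<close>

lemma comparison_nat: "comparison m = comparison (int (nat m))"
  by (rule ext) (simp add: comparison_def)

context cosimplicial_algebra
begin

abbreviation bin :: "nat \<Rightarrow> nat \<Rightarrow> 'a \<times> 'a \<Rightarrow> 'a" where
  "bin \<equiv> binary C A v"

lemma space_XX: "cosimplicial_space (csprod X X)"
  by (intro cosimplicial_space_csprod space_X)

text \<open>In negative degrees there are no nonzero cycles, so that the truncation by \<open>nat\<close> is harmless.\<close>

definition tot_prod :: "int \<Rightarrow> int \<Rightarrow> ('a tot \<Rightarrow>\<^sub>0 bit) \<Rightarrow> ('a tot \<Rightarrow>\<^sub>0 bit) \<Rightarrow> 'a tot \<Rightarrow>\<^sub>0 bit" where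
  "tot_prod m n a b = kmap (Tot_binary C A v (nat (m + n))) (shuffle (Tot X) (Tot X) (nat m) (nat n) a b)"

lemma tot_prod_add: "tot_prod m n (a + a') b = tot_prod m n a b + tot_prod m n a' b" "tot_prod m n a (b + b') = tot_prod m n a b + tot_prod m n a b'"
  by (simp_all add: tot_prod_def shuffle_add_left shuffle_add_right kmap_add)

lemma tot_prod_0 [simp]: "tot_prod m n 0 b = 0" "tot_prod m n a 0 = 0"
  by (simp_all add: tot_prod_def)

lemma tot_prod_int: "tot_prod (int m) (int n) a b = tot_mult m n a b"
  by (simp add: tot_prod_def tot_mult_def nat_int_add)

lemma tot_prod_cycles:
  assumes a: "a \<in> cycles (S_chains (Tot X)) m" and b: "b \<in> cycles (S_chains (Tot X)) n"
  shows "tot_prod m n a b \<in> cycles (S_chains (Tot X)) (m + n)"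
proof (cases "m < 0 \<or> n < 0")
  case True
  then have "tot_prod m n a b = 0" using a b by (auto simp: cycles_S_chains)
  then show ?thesis using subgrp_0 [OF subgrp_cycles_S] by simp
next
  case False
  then obtain m' n' where mn: "m = int m'" "n = int n'" by (metis not_less nonneg_int_cases)
  have a': "supp a \<subseteq> smp (Tot X) m'" "supp (fbd (Tot X) m' a) \<subseteq> dgn (Tot X) (m' - 1)"
    and b': "supp b \<subseteq> smp (Tot X) n'" "supp (fbd (Tot X) n' b) \<subseteq> dgn (Tot X) (n' - 1)"
    using a b by (auto simp: cycles_S_chains mn)
  have l: "supp (if m' = 0 then 0 else tot_mult (m' - 1) n' (fbd (Tot X) m' a) b) \<subseteq> dgn (Tot X) (m' + n' - 1)"
    using tot_mult_dgn [OF keys_fbd [OF simplicial_set_Tot a'(1)] b'(1)] a'(2) by (cases m') simp_all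
  have r: "supp (if n' = 0 then 0 else tot_mult m' (n' - 1) a (fbd (Tot X) n' b)) \<subseteq> dgn (Tot X) (m' + n' - 1)"
    using tot_mult_dgn [OF a'(1) keys_fbd [OF simplicial_set_Tot b'(1)]] b'(2) by (cases n') simp_all
  have "supp (fbd (Tot X) (m' + n') (tot_mult m' n' a b)) \<subseteq> dgn (Tot X) (m' + n' - 1)"
    unfolding fbd_tot_mult [OF a'(1) b'(1)] by (rule keys_plus_subset [OF l r])
  then show ?thesis
    using keys_tot_mult [OF a'(1) b'(1)] by (simp add: mn tot_prod_int cycles_S_chains nat_int_add)
qed

lemma tot_prod_bounds_left:
  assumes a: "a \<in> bounds (S_chains (Tot X)) m" and b: "b \<in> cycles (S_chains (Tot X)) n"
  shows "tot_prod m n a b \<in> bounds (S_chains (Tot X)) (m + n)"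
proof (cases "m < 0 \<or> n < 0")
  case True
  moreover have "a \<in> cycles (S_chains (Tot X)) m"
    using a bounds_subset_cycles_S [OF simplicial_set_Tot] by blast
  ultimately have "tot_prod m n a b = 0"
    using b by (auto simp: cycles_S_chains)
  then show ?thesis using subgrp_0 [OF subgrp_bounds_S] by simp
next
  case False
  then obtain m' n' where mn: "m = int m'" "n = int n'" by (metis not_less nonneg_int_cases)
  obtain c \<nu> where "supp c \<subseteq> smp (Tot X) (nat (m + 1))"
    and \<nu>: "supp \<nu> \<subseteq> dgn (Tot X) m'" and ae: "a = fbd (Tot X) (nat (m + 1)) c + \<nu>"
    using a unfolding bounds_S_chains by (auto simp: mn)
  moreover have "nat (m + 1) = Suc m'" by (simp add: mn)
  ultimately have c: "supp c \<subseteq> smp (Tot X) (Suc m')" and ae: "a = fbd (Tot X) (Suc m') c + \<nu>" by simp_all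
  have b': "supp b \<subseteq> smp (Tot X) n'" "supp (fbd (Tot X) n' b) \<subseteq> dgn (Tot X) (n' - 1)"
    using b by (auto simp: cycles_S_chains mn)
  define \<rho> where "\<rho> = (if n' = 0 then 0 else tot_mult (Suc m') (n' - 1) c (fbd (Tot X) n' b))"
  have "fbd (Tot X) (Suc (m' + n')) (tot_mult (Suc m') n' c b) = tot_mult m' n' (fbd (Tot X) (Suc m') c) b + \<rho>"
    using fbd_tot_mult [OF c b'(1)] by (simp add: \<rho>_def)
  then have "tot_mult m' n' (fbd (Tot X) (Suc m') c) b = fbd (Tot X) (Suc (m' + n')) (tot_mult (Suc m') n' c b) + \<rho>"
    by (simp add: add.assoc)
  then have e: "tot_prod m n a b = fbd (Tot X) (Suc (m' + n')) (tot_mult (Suc m') n' c b) + (\<rho> + tot_mult m' n' \<nu> b)"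
    by (simp add: mn tot_prod_int ae tot_mult_add add.assoc)
  have "supp \<rho> \<subseteq> dgn (Tot X) (m' + n')"
    using tot_mult_dgn [OF c keys_fbd [OF simplicial_set_Tot b'(1)]] b'(2) by (cases n') (simp_all add: \<rho>_def)
  moreover have "supp (tot_mult m' n' \<nu> b) \<subseteq> dgn (Tot X) (m' + n')"
    using tot_mult_dgn [OF _ b'(1)] \<nu> dgn_subset [OF simplicial_set_Tot] by blast
  ultimately have "supp (\<rho> + tot_mult m' n' \<nu> b) \<subseteq> dgn (Tot X) (m' + n')"
    by (rule keys_plus_subset)
  moreover have "nat (m + n + 1) = Suc (m' + n')" "nat (m + n) = m' + n'" by (simp_all add: mn)
  ultimately show ?thesis
    unfolding bounds_S_chains e using keys_tot_mult [OF c b'(1)] mn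
    by (intro exI [of _ "tot_mult (Suc m') n' c b"] exI [of _ "\<rho> + tot_mult m' n' \<nu> b"]) simp
qed

lemma tot_prod_bounds_right:
  assumes a: "a \<in> cycles (S_chains (Tot X)) m" and b: "b \<in> bounds (S_chains (Tot X)) n"
  shows "tot_prod m n a b \<in> bounds (S_chains (Tot X)) (m + n)"
proof (cases "m < 0 \<or> n < 0")
  case True
  moreover have "b \<in> cycles (S_chains (Tot X)) n"
    using b bounds_subset_cycles_S [OF simplicial_set_Tot] by blast
  ultimately have "tot_prod m n a b = 0"
    using a by (auto simp: cycles_S_chains)
  then show ?thesis using subgrp_0 [OF subgrp_bounds_S] by simp
next
  case False
  then obtain m' n' where mn: "m = int m'" "n = int n'" by (metis not_less nonneg_int_cases)
  obtain c \<nu> where "supp c \<subseteq> smp (Tot X) (nat (n + 1))"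
    and \<nu>: "supp \<nu> \<subseteq> dgn (Tot X) n'" and be: "b = fbd (Tot X) (nat (n + 1)) c + \<nu>"
    using b unfolding bounds_S_chains by (auto simp: mn)
  moreover have "nat (n + 1) = Suc n'" by (simp add: mn)
  ultimately have c: "supp c \<subseteq> smp (Tot X) (Suc n')" and be: "b = fbd (Tot X) (Suc n') c + \<nu>" by simp_all
  have a': "supp a \<subseteq> smp (Tot X) m'" "supp (fbd (Tot X) m' a) \<subseteq> dgn (Tot X) (m' - 1)"
    using a by (auto simp: cycles_S_chains mn)
  define \<rho> where "\<rho> = (if m' = 0 then 0 else tot_mult (m' - 1) (Suc n') (fbd (Tot X) m' a) c)"
  have "fbd (Tot X) (Suc (m' + n')) (tot_mult m' (Suc n') a c) = \<rho> + tot_mult m' n' a (fbd (Tot X) (Suc n') c)"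
    using fbd_tot_mult [OF a'(1) c] by (simp add: \<rho>_def)
  then have "tot_mult m' n' a (fbd (Tot X) (Suc n') c) = fbd (Tot X) (Suc (m' + n')) (tot_mult m' (Suc n') a c) + \<rho>"
    by (simp add: add.assoc add.commute [of \<rho>])
  then have e: "tot_prod m n a b = fbd (Tot X) (Suc (m' + n')) (tot_mult m' (Suc n') a c) + (\<rho> + tot_mult m' n' a \<nu>)"
    by (simp add: mn tot_prod_int be tot_mult_add add.assoc)
  have "supp \<rho> \<subseteq> dgn (Tot X) (m' + n')"
    using tot_mult_dgn [OF keys_fbd [OF simplicial_set_Tot a'(1)] c] a'(2) by (cases m') (simp_all add: \<rho>_def)
  moreover have "supp (tot_mult m' n' a \<nu>) \<subseteq> dgn (Tot X) (m' + n')"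
    using tot_mult_dgn [OF a'(1)] \<nu> dgn_subset [OF simplicial_set_Tot] by blast
  ultimately have "supp (\<rho> + tot_mult m' n' a \<nu>) \<subseteq> dgn (Tot X) (m' + n')"
    by (rule keys_plus_subset)
  moreover have "nat (m + n + 1) = Suc (m' + n')" "nat (m + n) = m' + n'" by (simp_all add: mn)
  ultimately show ?thesis
    unfolding bounds_S_chains e using keys_tot_mult [OF a'(1) c] mn
    by (intro exI [of _ "tot_mult m' (Suc n') a c"] exI [of _ "\<rho> + tot_mult m' n' a \<nu>"]) simp
qed

lemma comparison_plus: "comparison m (a + b) = comparison m a + comparison m b"
  by (subst (1 2 3) comparison_nat) (rule comparison_add)

lemma comparison_cycles:
  assumes "a \<in> cycles (S_chains (Tot X)) m" shows "comparison m a \<in> cycles (TC X) m"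
proof (cases "m < 0")
  case True
  then have "a = 0" using assms by (simp add: cycles_S_chains)
  then show ?thesis using subgrp_0 [OF subgrp_cycles [OF space_X]] by simp
next
  case False
  then obtain m' where m: "m = int m'" by (metis not_less nonneg_int_cases)
  have a: "supp a \<subseteq> smp (Tot X) m'" "supp (fbd (Tot X) m' a) \<subseteq> dgn (Tot X) (m' - 1)"
    using assms by (auto simp: cycles_S_chains m)
  note t = tchain_comparison [OF space_X a(1)]
  have "tdgn X (int m' - 1) (comparison (int m' - 1) (fbd (Tot X) m' a))"
  proof (cases m')
    case 0
    then show ?thesis by (simp add: fbd_def tdgn_0)
  next
    case (Suc k)
    then show ?thesis using tdgn_comparison [OF space_X a(2)] by simp
  qed
  then have "tbd X (int m') (comparison (int m') a) \<in> nulls (TC X) (int m' - 1)"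
    unfolding tbd_comparison [OF space_X a(1)] by (rule nulls_of_tdgn [OF space_X])
  from subgrp_add [OF subgrp_nulls [OF space_X] bdry_tbd [OF space_X t] this]
  have "bdry (TC X) (int m') (comparison (int m') a) \<in> nulls (TC X) (int m' - 1)"
    by (simp add: add.assoc)
  then show ?thesis using t by (simp add: cycles_TC m)
qed

lemma comparison_bounds:
  assumes "a \<in> bounds (S_chains (Tot X)) m" shows "comparison m a \<in> bounds (TC X) m"
proof (cases "m < 0")
  case True
  moreover have "a \<in> cycles (S_chains (Tot X)) m"
    using assms bounds_subset_cycles_S [OF simplicial_set_Tot] by blast
  ultimately have "a = 0" by (simp add: cycles_S_chains)
  then show ?thesis using subgrp_0 [OF subgrp_bounds [OF space_X]] by simp
next
  case False
  then obtain m' where m: "m = int m'" by (metis not_less nonneg_int_cases)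
  obtain c \<nu> where "supp c \<subseteq> smp (Tot X) (nat (m + 1))"
    and \<nu>: "supp \<nu> \<subseteq> dgn (Tot X) m'" and "a = fbd (Tot X) (nat (m + 1)) c + \<nu>"
    using assms unfolding bounds_S_chains by (auto simp: m)
  moreover have "nat (m + 1) = Suc m'" by (simp add: m)
  ultimately have c: "supp c \<subseteq> smp (Tot X) (Suc m')" and ae: "a = fbd (Tot X) (Suc m') c + \<nu>" by simp_all
  note t = tchain_comparison [OF space_X c]
  have e: "int (Suc m') = m + 1" "m + 1 - 1 = m" by (simp_all add: m)
  have "bdry (TC X) (m + 1) (comparison (m + 1) c) + tbd X (m + 1) (comparison (m + 1) c) \<in> nulls (TC X) m"
    using bdry_tbd [OF space_X t] unfolding e .
  moreover have "tbd X (m + 1) (comparison (m + 1) c) = comparison m (fbd (Tot X) (Suc m') c)"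
    using tbd_comparison [OF space_X c] unfolding e .
  moreover have "comparison m \<nu> \<in> nulls (TC X) m"
    using nulls_of_tdgn [OF space_X tdgn_comparison [OF space_X \<nu>]] by (simp add: m)
  ultimately have "(bdry (TC X) (m + 1) (comparison (m + 1) c) + comparison m (fbd (Tot X) (Suc m') c)) + comparison m \<nu> \<in> nulls (TC X) m"
    using subgrp_add [OF subgrp_nulls [OF space_X]] by metis
  moreover have "bdry (TC X) (m + 1) (comparison (m + 1) c) \<in> bounds (TC X) m"
    using bdry_in_bounds [OF space_X] t unfolding e by blast
  ultimately have "bdry (TC X) (m + 1) (comparison (m + 1) c) +
      ((bdry (TC X) (m + 1) (comparison (m + 1) c) + comparison m (fbd (Tot X) (Suc m') c)) + comparison m \<nu>) \<in> bounds (TC X) m"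
    using subgrp_add [OF subgrp_bounds [OF space_X]] nulls_subset_bounds [OF space_X] by blast
  then show ?thesis by (simp add: ae comparison_plus add.assoc)
qed

text \<open>The product in the total complex, made to factor through the cokernel by applying \<open>P\<close> to both arguments.\<close>

definition bil :: "int \<Rightarrow> int \<Rightarrow> (nat \<Rightarrow> 'a \<Rightarrow>\<^sub>0 bit) \<Rightarrow> (nat \<Rightarrow> 'a \<Rightarrow>\<^sub>0 bit) \<Rightarrow> nat \<Rightarrow> 'a \<Rightarrow>\<^sub>0 bit" where
  "bil m n x y = tmap (m + n) bin (eprod X X m n (tproj X m x) (tproj X n y))"

lemma bil_add: "bil m n (x + x') y = bil m n x y + bil m n x' y" "bil m n x (y + y') = bil m n x y + bil m n x y'"
  by (simp_all only: bil_def tproj_add eprod_add tmap_add)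

lemma tchain_bil:
  assumes "tchain X m x" "tchain X n y" shows "tchain X (m + n) (bil m n x y)"
  unfolding bil_def
  by (intro tchain_tmap [OF space_X space_XX binary_map] tchain_eprod space_X tchain_tproj assms)

lemma bil_nulls:
  assumes x: "tchain X m x" and y: "tchain X n y" and d: "x \<in> nulls (TC X) m \<or> y \<in> nulls (TC X) n"
  shows "bil m n x y \<in> nulls (TC X) (m + n)"
proof -
  have "tdgn X m (tproj X m x) \<or> tdgn X n (tproj X n y)"
    using d nulls_TC [OF space_X] by blast
  then have "tdgn (csprod X X) (m + n) (eprod X X m n (tproj X m x) (tproj X n y))"
    unfolding tdgn_def [of "csprod X X"]
    by (intro allI eprod_dgn [OF space_X space_X tchain_tproj [OF space_X x] tchain_tproj [OF space_X y]])
       (unfold tdgn_def, blast)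
  then show ?thesis
    unfolding bil_def by (intro nulls_of_tdgn [OF space_X] tdgn_tmap [OF space_X space_XX binary_map])
qed

text \<open>A summand in cosimplicial degree less than \<open>s + s'\<close> has a first factor in degree less than \<open>s\<close> or a second one
  in degree less than \<open>s'\<close>.\<close>

lemma bil_fil:
  assumes x: "x \<in> fil (CN X) (- int s) m" and y: "y \<in> fil (CN X) (- int s') n"
  shows "bil m n x y \<in> fil (CN X) (- int (s + s')) (m + n)"
proof -
  note tx = tchain_tproj [OF space_X tchain_fil [OF space_X x]] and ty = tchain_tproj [OF space_X tchain_fil [OF space_X y]]
  let ?E = "eprod X X m n (tproj X m x) (tproj X n y)"
  have "?E \<in> fil (CN (csprod X X)) (- int (s + s')) (m + n)"
    unfolding fil_TC [OF space_XX]
  proof (intro conjI allI impI)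
    show "tchain (csprod X X) (m + n) ?E" by (intro tchain_eprod space_X tx ty)
    fix j assume j: "j < s + s'"
    have "supp (?E j) \<subseteq> dgn (lev (csprod X X) j) (nat (m + n + int j))"
    proof (rule eprod_dgn [OF space_X space_X tx ty])
      fix p assume "p \<le> j"
      then have "p < s \<or> j - p < s'" using j by linarith
      then show "supp (tproj X m x p) \<subseteq> dgn (lev X p) (nat (m + int p)) \<or>
          supp (tproj X n y (j - p)) \<subseteq> dgn (lev X (j - p)) (nat (n + int (j - p)))"
        using x y unfolding fil_TC [OF space_X] by blast
    qed
    then show "supp (tproj (csprod X X) (m + n) ?E j) \<subseteq> dgn (lev (csprod X X) j) (nat (m + n + int j))"
      unfolding tproj_def by (rule keys_proj_dgn [OF space_XX order_refl])
  qed
  then show ?thesis unfolding bil_def by (rule fil_tmap [OF space_X space_XX binary_map])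
qed

text \<open>\<open>P\<close> turns the differential of the total complex into \<open>tbd\<close>, for which the external product is a chain map.\<close>

lemma bil_bdry:
  assumes x: "tchain X m x" and y: "tchain X n y"
  shows "bdry (TC X) (m + n) (bil m n x y) + (bil (m - 1) n (bdry (TC X) m x) y + bil m (n - 1) x (bdry (TC X) n y))
    \<in> nulls (TC X) (m + n - 1)"
proof -
  let ?E = "eprod X X m n (tproj X m x) (tproj X n y)"
  note tx = tchain_tproj [OF space_X x] and ty = tchain_tproj [OF space_X y]
  have E: "tchain (csprod X X) (m + n) ?E" by (intro tchain_eprod space_X tx ty)
  have d: "m - 1 + n = m + n - 1" "m + (n - 1) = m + n - 1" by simp_all
  have "tbd X (m + n) (bil m n x y) = tmap (m + n - 1) bin (tbd (csprod X X) (m + n) ?E)"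
    unfolding bil_def by (rule tmap_tbd [OF space_X space_XX binary_map E, symmetric])
  also have "\<dots> = bil (m - 1) n (bdry (TC X) m x) y + bil m (n - 1) x (bdry (TC X) n y)"
    unfolding tbd_eprod [OF space_X space_X tx ty] tmap_add bil_def tproj_bdry [OF space_X x] tproj_bdry [OF space_X y] d ..
  finally show ?thesis using bdry_tbd [OF space_X tchain_bil [OF x y]] by simp
qed

lemma bil_cycles:
  assumes x: "x \<in> cycles (TC X) m" and y: "y \<in> cycles (TC X) n"
  shows "bil m n x y \<in> cycles (TC X) (m + n)"
proof -
  have tx: "tchain X m x" "bdry (TC X) m x \<in> nulls (TC X) (m - 1)"
    and ty: "tchain X n y" "bdry (TC X) n y \<in> nulls (TC X) (n - 1)" using x y by (auto simp: cycles_TC)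
  have d: "m - 1 + n = m + n - 1" "m + (n - 1) = m + n - 1" by simp_all
  have "bil (m - 1) n (bdry (TC X) m x) y \<in> nulls (TC X) (m + n - 1)"
    using bil_nulls [OF tchain_bdry [OF space_X tx(1)] ty(1)] tx(2) unfolding d by blast
  moreover have "bil m (n - 1) x (bdry (TC X) n y) \<in> nulls (TC X) (m + n - 1)"
    using bil_nulls [OF tx(1) tchain_bdry [OF space_X ty(1)]] ty(2) unfolding d by blast
  ultimately have "bil (m - 1) n (bdry (TC X) m x) y + bil m (n - 1) x (bdry (TC X) n y) \<in> nulls (TC X) (m + n - 1)"
    by (rule subgrp_add [OF subgrp_nulls [OF space_X]])
  from subgrp_add [OF subgrp_nulls [OF space_X] bil_bdry [OF tx(1) ty(1)] this]
  have "bdry (TC X) (m + n) (bil m n x y) \<in> nulls (TC X) (m + n - 1)" by (simp add: add.assoc)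
  then show ?thesis using tchain_bil [OF tx(1) ty(1)] by (simp add: cycles_TC)
qed

lemma bil_bounds_left:
  assumes x: "x \<in> bounds (TC X) m" and y: "y \<in> cycles (TC X) n"
  shows "bil m n x y \<in> bounds (TC X) (m + n)"
proof -
  obtain w \<nu> where w: "tchain X (m + 1) w" and \<nu>: "\<nu> \<in> nulls (TC X) m" and x: "x = bdry (TC X) (m + 1) w + \<nu>"
    using x unfolding bounds_TC by blast
  have ty: "tchain X n y" "bdry (TC X) n y \<in> nulls (TC X) (n - 1)" using y by (auto simp: cycles_TC)
  have d: "m + 1 - 1 = m" "m + 1 + n - 1 = m + n" "m + n + 1 - 1 = m + n" "m + 1 + n = m + n + 1" "m + 1 + (n - 1) = m + n" by simp_all
  have "bil (m + 1) (n - 1) w (bdry (TC X) n y) \<in> nulls (TC X) (m + n)"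
    using bil_nulls [OF w tchain_bdry [OF space_X ty(1)]] ty(2) unfolding d by blast
  from subgrp_add [OF subgrp_nulls [OF space_X] bil_bdry [OF w ty(1), unfolded d] this]
  have n1: "bdry (TC X) (m + n + 1) (bil (m + 1) n w y) + bil m n (bdry (TC X) (m + 1) w) y \<in> nulls (TC X) (m + n)"
    by (simp add: add.assoc)
  have n2: "bil m n \<nu> y \<in> nulls (TC X) (m + n)"
    using bil_nulls [OF tchain_nulls [OF space_X \<nu>] ty(1)] \<nu> by blast
  have t: "tchain X (m + n + 1) (bil (m + 1) n w y)" using tchain_bil [OF w ty(1)] unfolding d .
  have "bil m n x y = bdry (TC X) (m + n + 1) (bil (m + 1) n w y) +
      ((bdry (TC X) (m + n + 1) (bil (m + 1) n w y) + bil m n (bdry (TC X) (m + 1) w) y) + bil m n \<nu> y)"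
    by (simp add: x bil_add add.assoc)
  then show ?thesis
    unfolding bounds_TC using t subgrp_add [OF subgrp_nulls [OF space_X] n1 n2] by blast
qed

lemma bil_bounds_right:
  assumes x: "x \<in> cycles (TC X) m" and y: "y \<in> bounds (TC X) n"
  shows "bil m n x y \<in> bounds (TC X) (m + n)"
proof -
  obtain w \<nu> where w: "tchain X (n + 1) w" and \<nu>: "\<nu> \<in> nulls (TC X) n" and y: "y = bdry (TC X) (n + 1) w + \<nu>"
    using y unfolding bounds_TC by blast
  have tx: "tchain X m x" "bdry (TC X) m x \<in> nulls (TC X) (m - 1)" using x by (auto simp: cycles_TC)
  have d: "n + 1 - 1 = n" "m + (n + 1) - 1 = m + n" "m + n + 1 - 1 = m + n" "m + (n + 1) = m + n + 1" "m - 1 + (n + 1) = m + n" by simp_all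
  have "bil (m - 1) (n + 1) (bdry (TC X) m x) w \<in> nulls (TC X) (m + n)"
    using bil_nulls [OF tchain_bdry [OF space_X tx(1)] w] tx(2) unfolding d by blast
  from subgrp_add [OF subgrp_nulls [OF space_X] bil_bdry [OF tx(1) w, unfolded d] this]
  have n1: "bdry (TC X) (m + n + 1) (bil m (n + 1) x w) + bil m n x (bdry (TC X) (n + 1) w) \<in> nulls (TC X) (m + n)"
    by (simp add: add.assoc add.left_commute add.commute)
  have n2: "bil m n x \<nu> \<in> nulls (TC X) (m + n)"
    using bil_nulls [OF tx(1) tchain_nulls [OF space_X \<nu>]] \<nu> by blast
  have t: "tchain X (m + n + 1) (bil m (n + 1) x w)" using tchain_bil [OF tx(1) w] unfolding d .
  have "bil m n x y = bdry (TC X) (m + n + 1) (bil m (n + 1) x w) +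
      ((bdry (TC X) (m + n + 1) (bil m (n + 1) x w) + bil m n x (bdry (TC X) (n + 1) w)) + bil m n x \<nu>)"
    by (simp add: y bil_add add.assoc)
  then show ?thesis
    unfolding bounds_TC using t subgrp_add [OF subgrp_nulls [OF space_X] n1 n2] by blast
qed

text \<open>On conormal representatives the external product can be computed with or without \<open>P\<close>.\<close>

lemma bil_conormal:
  assumes x: "tchain X m x" and dx: "tdgn X m (x + tproj X m x)"
    and y: "tchain X n y" and dy: "tdgn X n (y + tproj X n y)"
  shows "tmap (m + n) bin (eprod X X m n x y) + bil m n x y \<in> nulls (TC X) (m + n)"
proof -
  have "eprod X X m n x y + eprod X X m n (tproj X m x) (tproj X n y) =
      eprod X X m n (x + tproj X m x) y + eprod X X m n (tproj X m x) (y + tproj X n y)"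
    by (simp add: eprod_add add.assoc)
  moreover have "tdgn (csprod X X) (m + n) (eprod X X m n (x + tproj X m x) y)"
    unfolding tdgn_def [of "csprod X X"]
    by (intro allI eprod_dgn [OF space_X space_X tchain_of_tdgn [OF space_X dx] y]) (use dx in \<open>unfold tdgn_def, blast\<close>)
  moreover have "tdgn (csprod X X) (m + n) (eprod X X m n (tproj X m x) (y + tproj X n y))"
    unfolding tdgn_def [of "csprod X X"]
    by (intro allI eprod_dgn [OF space_X space_X tchain_tproj [OF space_X x] tchain_of_tdgn [OF space_X dy]]) (use dy in \<open>unfold tdgn_def, blast\<close>)
  ultimately have "tdgn (csprod X X) (m + n) (eprod X X m n x y + eprod X X m n (tproj X m x) (tproj X n y))"
    using tdgn_add by metis
  then show ?thesis
    unfolding bil_def tmap_add [symmetric]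
    by (intro nulls_of_tdgn [OF space_X] tdgn_tmap [OF space_X space_XX binary_map])
qed

text \<open>The homotopy \<open>uhty\<close>, evaluated on the two cycles, has the difference of the two products as its boundary; what
  remains involves the boundaries of \<open>a\<close> and \<open>b\<close>, which are degenerate.\<close>

lemma comparison_eprod:
  assumes a: "a \<in> cycles (S_chains (Tot X)) (int m)" and b: "b \<in> cycles (S_chains (Tot X)) (int n)"
  shows "comparison (int m + int n) (tot_prod (int m) (int n) a b) +
     tmap (int m + int n) bin (eprod X X (int m) (int n) (comparison (int m) a) (comparison (int n) b))
     \<in> bounds (TC X) (int m + int n)"
proof -
  have a': "supp a \<subseteq> smp (Tot X) m" "supp (fbd (Tot X) m a) \<subseteq> dgn (Tot X) (m - 1)"
    and b': "supp b \<subseteq> smp (Tot X) n" "supp (fbd (Tot X) n b) \<subseteq> dgn (Tot X) (n - 1)"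
    using a b by (auto simp: cycles_S_chains)
  let ?N = "int m + int n"
  let ?W = "tmap (?N + 1) bin (pushq uhty m n a b)"
  note t = tchain_pushq_uhty [OF space_X a'(1) b'(1)]
  have W: "tchain X (?N + 1) ?W" by (rule tchain_tmap [OF space_X space_XX binary_map t])
  define R where "R = (case m of 0 \<Rightarrow> 0 | Suc m' \<Rightarrow> pushq uhty m' n (fbd (Tot X) m a) b) +
      (case n of 0 \<Rightarrow> 0 | Suc n' \<Rightarrow> pushq uhty m n' a (fbd (Tot X) n b))"
  have "tdgn (csprod X X) ?N (case m of 0 \<Rightarrow> 0 | Suc m' \<Rightarrow> pushq uhty m' n (fbd (Tot X) m a) b)"
  proof (cases m)
    case (Suc m')
    then have "tdgn (csprod X X) (int m' + int n + 1) (pushq uhty m' n (fbd (Tot X) m a) b)"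
      using tdgn_pushq_left [OF space_X _ b'(1), of "fbd (Tot X) m a" m'] a'(2) by simp
    then show ?thesis using Suc by (simp add: ac_simps)
  qed (simp add: tdgn_0)
  moreover have "tdgn (csprod X X) ?N (case n of 0 \<Rightarrow> 0 | Suc n' \<Rightarrow> pushq uhty m n' a (fbd (Tot X) n b))"
  proof (cases n)
    case (Suc n')
    then have "tdgn (csprod X X) (int m + int n' + 1) (pushq uhty m n' a (fbd (Tot X) n b))"
      using tdgn_pushq_right [OF space_X a'(1), of "fbd (Tot X) n b" n'] b'(2) by simp
    then show ?thesis using Suc by (simp add: ac_simps)
  qed (simp add: tdgn_0)
  ultimately have "tdgn (csprod X X) ?N R" unfolding R_def by (rule tdgn_add)
  then have R: "tmap ?N bin R \<in> nulls (TC X) ?N"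
    by (intro nulls_of_tdgn [OF space_X] tdgn_tmap [OF space_X space_XX binary_map])
  have d: "?N + 1 - 1 = ?N" "int (m + n) = ?N" by simp_all
  have "tbd X (?N + 1) ?W = tmap ?N bin (tbd (csprod X X) (?N + 1) (pushq uhty m n a b))"
    using tmap_tbd [OF space_X space_XX binary_map t] unfolding d by (rule sym)
  also have "\<dots> = comparison ?N (tot_prod (int m) (int n) a b) +
      tmap ?N bin (eprod X X (int m) (int n) (comparison (int m) a) (comparison (int n) b)) + tmap ?N bin R"
    unfolding tbd_pushq_uhty [OF space_X a'(1) b'(1)] R_def [symmetric] tmap_add pushq_uaw [OF space_X a'(1) b'(1)]
      comparison_tot_mult [OF a'(1) b'(1), unfolded d, symmetric] tot_prod_int ..
  finally have e: "tbd X (?N + 1) ?W = \<dots>" .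
  let ?Z = "comparison ?N (tot_prod (int m) (int n) a b) +
      tmap ?N bin (eprod X X (int m) (int n) (comparison (int m) a) (comparison (int n) b))"
  have "bdry (TC X) (?N + 1) ?W + (?Z + tmap ?N bin R) \<in> nulls (TC X) ?N"
    using bdry_tbd [OF space_X W] unfolding e d .
  from subgrp_add [OF subgrp_nulls [OF space_X] this R]
  have "bdry (TC X) (?N + 1) ?W + ?Z \<in> nulls (TC X) ?N" by (simp add: add.assoc)
  then have "bdry (TC X) (?N + 1) ?W + (bdry (TC X) (?N + 1) ?W + ?Z) \<in> bounds (TC X) ?N"
    using subgrp_add [OF subgrp_bounds [OF space_X] bdry_in_bounds [OF space_X W]] nulls_subset_bounds [OF space_X] by blast
  then show ?thesis by (simp add: add.assoc)
qed

lemma comparison_mult: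
  assumes a: "a \<in> cycles (S_chains (Tot X)) m" and b: "b \<in> cycles (S_chains (Tot X)) n"
  shows "comparison (m + n) (tot_prod m n a b) + bil m n (comparison m a) (comparison n b) \<in> bounds (TC X) (m + n)"
proof (cases "m < 0 \<or> n < 0")
  case True
  then have "a = 0 \<or> b = 0" using a b by (auto simp: cycles_S_chains)
  moreover have "bil m n 0 y = 0" "bil m n y 0 = 0" for y
    by (simp_all add: bil_def) (simp_all add: tmap_def fun_eq_iff)
  ultimately show ?thesis using subgrp_0 [OF subgrp_bounds [OF space_X]] by auto
next
  case False
  then obtain m' n' where mn: "m = int m'" "n = int n'" by (metis not_less nonneg_int_cases)
  have a': "supp a \<subseteq> smp (Tot X) m'" and b': "supp b \<subseteq> smp (Tot X) n'"
    using a b by (auto simp: cycles_S_chains mn)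
  have "tmap (m + n) bin (eprod X X m n (comparison m a) (comparison n b)) + bil m n (comparison m a) (comparison n b) \<in> nulls (TC X) (m + n)"
    unfolding mn by (intro bil_conormal tchain_comparison comparison_conormal space_X a' b')
  from subgrp_add [OF subgrp_bounds [OF space_X] comparison_eprod [OF a [unfolded mn] b [unfolded mn], folded mn]
      subsetD [OF nulls_subset_bounds [OF space_X] this]]
  show ?thesis by (simp add: add.assoc)
qed

end

section \<open>Filtration quotients and the column of the spectral sequence\<close>

lemma bounds_trunc:
  "x \<in> bounds (total_trunc (int s - 1) (CN X)) m \<longleftrightarrow>
     (\<exists>w z. tchain X (m + 1) w \<and> z \<in> fil (CN X) (- int s) m \<and> x = bdry (TC X) (m + 1) w + z)"
proof -
  have "bounds (total_trunc (int s - 1) (CN X)) m = bdry (TC X) (m + 1) ` chains (TC X) (m + 1) + fil (CN X) (- int s) m"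
    by (simp add: bounds_def total_trunc_def)
  also have "\<dots> = {bdry (TC X) (m + 1) w + z | w z. tchain X (m + 1) w \<and> z \<in> fil (CN X) (- int s) m}"
    by (auto simp: set_plus_def chains_TC) blast
  finally show ?thesis by blast
qed

lemma Enull_subset:
  assumes X: "cosimplicial_space X" and x: "x \<in> Enull X s m"
  shows "x \<in> cycles (TC X) m" "x \<in> fil (CN X) (- int s) m"
proof -
  obtain y z where e: "x = y + z" and y: "y \<in> cycles (TC X) m" "y \<in> fil (CN X) (- int (Suc s)) m"
    and z: "z \<in> bounds (TC X) m" "z \<in> fil (CN X) (- int s) m"
    by (rule EnullE [OF x])
  show "x \<in> cycles (TC X) m"
    unfolding e using subgrp_add [OF subgrp_cycles [OF X] y(1)] subsetD [OF bounds_subset_cycles [OF X] z(1)] by blast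
  have "y \<in> fil (CN X) (- int s) m" using subsetD [OF fil_antimono [OF X] y(2), of s] by simp
  then show "x \<in> fil (CN X) (- int s) m"
    unfolding e using subgrp_add [OF subgrp_fil [OF X] _ z(2)] by blast
qed

context cosimplicial_algebra
begin

abbreviation tot_bounds :: "int \<Rightarrow> ('a tot \<Rightarrow>\<^sub>0 bit) set" where
  "tot_bounds m \<equiv> bounds (S_chains (Tot X)) m"

text \<open>The cycles that represent the classes in filtration \<open>-s\<close> (\<open>H_fil_quot\<close>).\<close>

definition fil_cycles :: "nat \<Rightarrow> int \<Rightarrow> ('a tot \<Rightarrow>\<^sub>0 bit) set" where
  "fil_cycles s m = {a \<in> cycles (S_chains (Tot X)) m.
     \<exists>w. tchain X (m + 1) w \<and> comparison m a + bdry (TC X) (m + 1) w \<in> fil (CN X) (- int s) m}"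

lemma fil_cyclesE:
  assumes "a \<in> fil_cycles s m"
  obtains w where "a \<in> cycles (S_chains (Tot X)) m" "tchain X (m + 1) w"
    "comparison m a + bdry (TC X) (m + 1) w \<in> fil (CN X) (- int s) m"
    "comparison m a + bdry (TC X) (m + 1) w \<in> cycles (TC X) m"
proof -
  obtain w where a: "a \<in> cycles (S_chains (Tot X)) m" and w: "tchain X (m + 1) w"
    and f: "comparison m a + bdry (TC X) (m + 1) w \<in> fil (CN X) (- int s) m"
    using assms unfolding fil_cycles_def by blast
  have "comparison m a + bdry (TC X) (m + 1) w \<in> cycles (TC X) m"
    using subgrp_add [OF subgrp_cycles [OF space_X] comparison_cycles [OF a]]
      subsetD [OF bounds_subset_cycles [OF space_X] bdry_in_bounds [OF space_X w]] by blast
  then show thesis using that a w f by blast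
qed

lemma tot_bounds_subset_fil_cycles: "tot_bounds m \<subseteq> fil_cycles s m"
proof
  fix a assume a: "a \<in> tot_bounds m"
  then obtain w \<nu> where w: "tchain X (m + 1) w" "\<nu> \<in> nulls (TC X) m" "comparison m a = bdry (TC X) (m + 1) w + \<nu>"
    using comparison_bounds unfolding bounds_TC by blast
  then have "comparison m a + bdry (TC X) (m + 1) w = \<nu>" by (simp add: ac_simps)
  then show "a \<in> fil_cycles s m"
    unfolding fil_cycles_def using w nulls_subset_fil [OF space_X] a bounds_subset_cycles_S [OF simplicial_set_Tot] by blast
qed

lemma subgrp_fil_cycles: "subgrp (fil_cycles s m)"
proof (rule subgrp_chainI)
  show "0 \<in> fil_cycles s m"
    using subsetD [OF tot_bounds_subset_fil_cycles] subgrp_0 [OF subgrp_bounds_S] by blast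
  fix a b assume "a \<in> fil_cycles s m" "b \<in> fil_cycles s m"
  then obtain w z where a: "a \<in> cycles (S_chains (Tot X)) m" and w: "tchain X (m + 1) w"
    and fa: "comparison m a + bdry (TC X) (m + 1) w \<in> fil (CN X) (- int s) m"
    and b: "b \<in> cycles (S_chains (Tot X)) m" and z: "tchain X (m + 1) z"
    and fb: "comparison m b + bdry (TC X) (m + 1) z \<in> fil (CN X) (- int s) m"
    by (auto elim!: fil_cyclesE)
  have "comparison m (a + b) + bdry (TC X) (m + 1) (w + z) =
      (comparison m a + bdry (TC X) (m + 1) w) + (comparison m b + bdry (TC X) (m + 1) z)"
    by (simp only: comparison_plus bdry_TC_add ac_simps)
  then have "comparison m (a + b) + bdry (TC X) (m + 1) (w + z) \<in> fil (CN X) (- int s) m"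
    using subgrp_add [OF subgrp_fil [OF space_X] fa fb] by (simp only:)
  then show "a + b \<in> fil_cycles s m"
    unfolding fil_cycles_def using subgrp_add [OF subgrp_cycles_S a b] tchain_add [OF w z] by blast
qed

lemma fil_cycles_Suc: "fil_cycles (Suc s) m \<subseteq> fil_cycles s m"
  unfolding fil_cycles_def using fil_antimono [OF space_X, of s "Suc s" m] by auto

lemma H_comparison_coset: "H_comparison X m (a +o tot_bounds m) = comparison m a +o bounds (TC X) m"
  unfolding H_comparison_def
  by (rule induced_coset [OF subgrp_bounds [OF space_X] subgrp_0 [OF subgrp_bounds_S]])
     (simp add: comparison_plus comparison_bounds ac_simps)

lemma H_fil_quot: "H_fil X s m = quot (fil_cycles s m) (tot_bounds m)"
proof -
  let ?T = "bounds (total_trunc (int s - 1) (CN X)) m"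
  have T: "subgrp ?T"
  proof (rule subgrp_famI)
    show "0 \<in> ?T"
      unfolding bounds_trunc using subgrp_0 [OF subgrp_fil [OF space_X]] tchain_0 by (intro exI [of _ 0]) simp
    fix x y assume "x \<in> ?T" "y \<in> ?T"
    then obtain w z w' z' where "tchain X (m + 1) w" "z \<in> fil (CN X) (- int s) m" "x = bdry (TC X) (m + 1) w + z"
      "tchain X (m + 1) w'" "z' \<in> fil (CN X) (- int s) m" "y = bdry (TC X) (m + 1) w' + z'"
      unfolding bounds_trunc by blast
    then show "x + y \<in> ?T"
      unfolding bounds_trunc
      by (intro exI [of _ "w + w'"] exI [of _ "z + z'"] conjI tchain_add subgrp_add [OF subgrp_fil [OF space_X]])
         (simp_all only: bdry_TC_add ac_simps)
  qed
  have BT: "bounds (TC X) m \<subseteq> ?T"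
    unfolding subset_iff bounds_trunc bounds_TC using nulls_subset_fil [OF space_X] by blast
  have T_iff: "comparison m a \<in> ?T \<longleftrightarrow> (\<exists>w. tchain X (m + 1) w \<and> comparison m a + bdry (TC X) (m + 1) w \<in> fil (CN X) (- int s) m)" for a
  proof
    assume "comparison m a \<in> ?T"
    then obtain w z where "tchain X (m + 1) w" "z \<in> fil (CN X) (- int s) m" "comparison m a = bdry (TC X) (m + 1) w + z"
      unfolding bounds_trunc by blast
    moreover from this have "comparison m a + bdry (TC X) (m + 1) w = z" by (simp add: ac_simps)
    ultimately show "\<exists>w. tchain X (m + 1) w \<and> comparison m a + bdry (TC X) (m + 1) w \<in> fil (CN X) (- int s) m" by metis
  next
    assume "\<exists>w. tchain X (m + 1) w \<and> comparison m a + bdry (TC X) (m + 1) w \<in> fil (CN X) (- int s) m"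
    then obtain w where "tchain X (m + 1) w" "comparison m a + bdry (TC X) (m + 1) w \<in> fil (CN X) (- int s) m" by blast
    then show "comparison m a \<in> ?T"
      unfolding bounds_trunc
      by (intro exI [of _ w] exI [of _ "comparison m a + bdry (TC X) (m + 1) w"]) (simp add: ac_simps)
  qed
  have "induced ?T (\<lambda>z. z) (H_comparison X m (a +o tot_bounds m)) = ?T \<longleftrightarrow> comparison m a \<in> ?T" for a
  proof -
    have "induced ?T (\<lambda>z. z) (comparison m a +o bounds (TC X) m) = comparison m a +o ?T"
      by (rule induced_coset [OF T subgrp_0 [OF subgrp_bounds [OF space_X]]]) (use BT in \<open>auto simp: ac_simps\<close>)
    moreover have "comparison m a +o ?T = 0 +o ?T \<longleftrightarrow> comparison m a \<in> ?T"
      unfolding coset_eq_iff [OF T] by simp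
    ultimately show ?thesis by (simp add: H_comparison_coset)
  qed
  then show ?thesis
    unfolding H_fil_def Let_def homology_def quot_def T_iff fil_cycles_def by auto
qed

lemma H_filE:
  assumes "g \<in> H_fil X s m" obtains a where "a \<in> fil_cycles s m" "g = a +o tot_bounds m"
  using assms unfolding H_fil_quot quot_def by blast

lemma H_filI: "a \<in> fil_cycles s m \<Longrightarrow> a +o tot_bounds m \<in> H_fil X s m"
  unfolding H_fil_quot quot_def by (rule imageI)

lemma H_grE:
  assumes "\<xi> \<in> H_gr X s m"
  obtains a where "a \<in> fil_cycles s m" "\<xi> = (a +o tot_bounds m) +o H_fil X (Suc s) m"
  using assms unfolding H_gr_def quot_def by (auto elim: H_filE)

lemma H_fil_coset_eq_iff:
  "(a +o tot_bounds m) +o H_fil X s m = (b +o tot_bounds m) +o H_fil X s m \<longleftrightarrow> a - b \<in> fil_cycles s m"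
  unfolding H_fil_quot by (rule coset_quot_eq_iff [OF subgrp_bounds_S subgrp_fil_cycles tot_bounds_subset_fil_cycles])

lemma fil_cycles_cycles: "a \<in> fil_cycles s m \<Longrightarrow> a \<in> cycles (S_chains (Tot X)) m"
  by (simp add: fil_cycles_def)

text \<open>The chain \<open>w''\<close> corrects \<open>\<phi>\<^sub>\<infinity> (a b)\<close> to the product of the two corrected factors, up to a null element, and this
  product lies in filtration \<open>-s - s'\<close>.\<close>

lemma tot_prod_fil:
  assumes a: "a \<in> cycles (S_chains (Tot X)) m" "tchain X (m + 1) w"
      "comparison m a + bdry (TC X) (m + 1) w \<in> fil (CN X) (- int s) m"
    and b: "b \<in> cycles (S_chains (Tot X)) n" "tchain X (n + 1) w'"
      "comparison n b + bdry (TC X) (n + 1) w' \<in> fil (CN X) (- int s') n"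
  obtains w'' where "tchain X (m + n + 1) w''"
    "comparison (m + n) (tot_prod m n a b) + bdry (TC X) (m + n + 1) w'' \<in> fil (CN X) (- int (s + s')) (m + n)"
    "(comparison (m + n) (tot_prod m n a b) + bdry (TC X) (m + n + 1) w'') +
       bil m n (comparison m a + bdry (TC X) (m + 1) w) (comparison n b + bdry (TC X) (n + 1) w') \<in> nulls (TC X) (m + n)"
proof -
  let ?a = "comparison m a" and ?b = "comparison n b" and ?w = "bdry (TC X) (m + 1) w" and ?w' = "bdry (TC X) (n + 1) w'"
  let ?c = "comparison (m + n) (tot_prod m n a b)"
  note B = subgrp_add [OF subgrp_bounds [OF space_X]]
  have w: "?w \<in> bounds (TC X) m" and w': "?w' \<in> bounds (TC X) n"
    using bdry_in_bounds [OF space_X] a(2) b(2) by blast+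
  have "?b + ?w' \<in> cycles (TC X) n"
    using subgrp_add [OF subgrp_cycles [OF space_X] comparison_cycles [OF b(1)]]
      subsetD [OF bounds_subset_cycles [OF space_X] w'] by blast
  note 1 = B [OF bil_bounds_left [OF w this] bil_bounds_right [OF comparison_cycles [OF a(1)] w']]
  have "?c + bil m n (?a + ?w) (?b + ?w') = (?c + bil m n ?a ?b) + (bil m n ?w (?b + ?w') + bil m n ?a ?w')"
    by (simp add: bil_add ac_simps)
  then have "?c + bil m n (?a + ?w) (?b + ?w') \<in> bounds (TC X) (m + n)"
    using B [OF comparison_mult [OF a(1) b(1)] 1] by (simp only:)
  then obtain w'' \<nu> where w'': "tchain X (m + n + 1) w''" and \<nu>: "\<nu> \<in> nulls (TC X) (m + n)"
    and e: "?c + bil m n (?a + ?w) (?b + ?w') = bdry (TC X) (m + n + 1) w'' + \<nu>"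
    unfolding bounds_TC by blast
  have n: "?c + bdry (TC X) (m + n + 1) w'' + bil m n (?a + ?w) (?b + ?w') = \<nu>"
  proof -
    have "?c + bdry (TC X) (m + n + 1) w'' + bil m n (?a + ?w) (?b + ?w') =
        bdry (TC X) (m + n + 1) w'' + (?c + bil m n (?a + ?w) (?b + ?w'))" by (simp only: ac_simps)
    then show ?thesis unfolding e by simp
  qed
  have "?c + bdry (TC X) (m + n + 1) w'' = \<nu> + bil m n (?a + ?w) (?b + ?w')"
    unfolding n [symmetric] by (simp add: add.assoc)
  then have "?c + bdry (TC X) (m + n + 1) w'' \<in> fil (CN X) (- int (s + s')) (m + n)"
    using subgrp_add [OF subgrp_fil [OF space_X] subsetD [OF nulls_subset_fil [OF space_X] \<nu>] bil_fil [OF a(3) b(3)]] by (simp only:)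
  then show thesis using that w'' \<nu> n by blast
qed

lemma tot_prod_fil_cycles:
  assumes a: "a \<in> fil_cycles s m" and b: "b \<in> fil_cycles s' n"
  shows "tot_prod m n a b \<in> fil_cycles (s + s') (m + n)"
proof -
  obtain w where a': "a \<in> cycles (S_chains (Tot X)) m" "tchain X (m + 1) w"
      "comparison m a + bdry (TC X) (m + 1) w \<in> fil (CN X) (- int s) m" by (rule fil_cyclesE [OF a])
  obtain w' where b': "b \<in> cycles (S_chains (Tot X)) n" "tchain X (n + 1) w'"
      "comparison n b + bdry (TC X) (n + 1) w' \<in> fil (CN X) (- int s') n" by (rule fil_cyclesE [OF b])
  show ?thesis
    by (rule tot_prod_fil [OF a' b']) (use tot_prod_cycles [OF a'(1) b'(1)] in \<open>unfold fil_cycles_def, blast\<close>)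
qed

lemma mu_H_coset:
  assumes a: "a \<in> cycles (S_chains (Tot X)) m" and b: "b \<in> cycles (S_chains (Tot X)) n"
  shows "mu_H C X A v m n (a +o tot_bounds m) (b +o tot_bounds n) = tot_prod m n a b +o tot_bounds (m + n)"
proof -
  have "mu_H C X A v m n (a +o tot_bounds m) (b +o tot_bounds n) =
      induced2 (tot_bounds (m + n)) (tot_prod m n) (a +o tot_bounds m) (b +o tot_bounds n)"
    unfolding mu_H_def cross_def tot_prod_def
    by (rule induced_induced2 [OF subgrp_bounds_S])
       (simp_all add: kmap_add subgrp_0 [OF subgrp_bounds_S] kmap_bounds_S [OF simplicial_map_Tot_binary])
  also have "\<dots> = tot_prod m n a b +o tot_bounds (m + n)"
  proof (rule induced2_coset [OF subgrp_bounds_S])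
    show "a \<in> a +o tot_bounds m" "b \<in> b +o tot_bounds n"
      using subgrp_0 [OF subgrp_bounds_S] by (auto simp: coset_mem)
    fix a' b' assume "a' \<in> a +o tot_bounds m" "b' \<in> b +o tot_bounds n"
    then obtain c d where c: "c \<in> tot_bounds m" "a' = a + c" and d: "d \<in> tot_bounds n" "b' = b + d"
      by (auto simp: elt_set_plus_def)
    have "b + d \<in> cycles (S_chains (Tot X)) n"
      using subgrp_add [OF subgrp_cycles_S b] subsetD [OF bounds_subset_cycles_S [OF simplicial_set_Tot] d(1)] by blast
    from subgrp_add [OF subgrp_bounds_S tot_prod_bounds_left [OF c(1) this] tot_prod_bounds_right [OF a d(1)]]
    show "tot_prod m n a' b' - tot_prod m n a b \<in> tot_bounds (m + n)"
      by (simp add: c(2) d(2) tot_prod_add ac_simps)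
  qed
  finally show ?thesis .
qed

lemma mu_H_coset_fil:
  assumes a: "a \<in> fil_cycles s m" and b: "b \<in> fil_cycles s' n"
    and a': "a' - a \<in> fil_cycles (Suc s) m" and b': "b' - b \<in> fil_cycles (Suc s') n"
  shows "mu_H C X A v m n (a' +o tot_bounds m) (b' +o tot_bounds n) +o H_fil X (Suc (s + s')) (m + n) =
    (tot_prod m n a b +o tot_bounds (m + n)) +o H_fil X (Suc (s + s')) (m + n)"
proof -
  define c d where "c = a + a'" and "d = b + b'"
  have c: "c \<in> fil_cycles (Suc s) m" and d: "d \<in> fil_cycles (Suc s') n"
    using a' b' by (simp_all add: c_def d_def ac_simps)
  have e: "a' = a + c" "b' = b + d" by (simp_all add: c_def d_def)
  have bd: "b + d \<in> fil_cycles s' n" and ac: "a + c \<in> fil_cycles s m"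
    using subgrp_add [OF subgrp_fil_cycles b] subgrp_add [OF subgrp_fil_cycles a] fil_cycles_Suc c d by blast+
  have "tot_prod m n c (b + d) \<in> fil_cycles (Suc (s + s')) (m + n)" "tot_prod m n a d \<in> fil_cycles (Suc (s + s')) (m + n)"
    using tot_prod_fil_cycles [OF c bd] tot_prod_fil_cycles [OF a d] by simp_all
  from subgrp_add [OF subgrp_fil_cycles this]
  have "tot_prod m n (a + c) (b + d) - tot_prod m n a b \<in> fil_cycles (Suc (s + s')) (m + n)"
    by (simp add: tot_prod_add ac_simps)
  then show ?thesis
    unfolding e mu_H_coset [OF fil_cycles_cycles [OF ac] fil_cycles_cycles [OF bd]] H_fil_coset_eq_iff .
qed

lemma mu_gr_coset:
  assumes a: "a \<in> fil_cycles s m" and b: "b \<in> fil_cycles s' n"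
  shows "mu_gr C X A v s m s' n ((a +o tot_bounds m) +o H_fil X (Suc s) m) ((b +o tot_bounds n) +o H_fil X (Suc s') n) =
    (tot_prod m n a b +o tot_bounds (m + n)) +o H_fil X (Suc (s + s')) (m + n)" (is "_ = ?R")
proof -
  have e: "(c +o tot_bounds k) +o H_fil X (Suc r) k = (\<lambda>z. (c + z) +o tot_bounds k) ` fil_cycles (Suc r) k" for c k r
    unfolding H_fil_quot by (rule coset_quot [OF subgrp_bounds_S])
  have ne: "fil_cycles (Suc r) k \<noteq> {}" for r k using subgrp_0 [OF subgrp_fil_cycles] by blast
  show ?thesis
    unfolding mu_gr_def induced2_def e [of a] e [of b] UN_simps
  proof (intro UN_coset_const ne)
    fix c d assume "c \<in> fil_cycles (Suc s) m" "d \<in> fil_cycles (Suc s') n"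
    then show "mu_H C X A v m n ((a + c) +o tot_bounds m) ((b + d) +o tot_bounds n) +o H_fil X (Suc (s + s')) (m + n) = ?R"
      by (intro mu_H_coset_fil a b) (simp_all add: ac_simps)
  qed
qed

text \<open>The class is independent of all choices: another representative differs by an element of
  \<open>fil_cycles (Suc s)\<close>, whose image is a cycle of filtration \<open>-s - 1\<close> up to a boundary, and another
  correction differs by a boundary that lies in filtration \<open>-s\<close>.\<close>

lemma iota_coset:
  assumes a: "a \<in> cycles (S_chains (Tot X)) m" and w: "tchain X (m + 1) w"
    and x: "comparison m a + bdry (TC X) (m + 1) w \<in> fil (CN X) (- int s) m"
  shows "iota X s m ((a +o tot_bounds m) +o H_fil X (Suc s) m) = (comparison m a + bdry (TC X) (m + 1) w) +o Enull X s m"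
    (is "_ = ?x +o _")
proof -
  have e: "(a +o tot_bounds m) +o H_fil X (Suc s) m = (\<lambda>z. (a + z) +o tot_bounds m) ` fil_cycles (Suc s) m"
    unfolding H_fil_quot by (rule coset_quot [OF subgrp_bounds_S])
  let ?F = "\<lambda>k. (comparison m (a + k) +o bounds (TC X) m) \<inter> fil (CN X) (- int s) m"
  have step: "z +o Enull X s m = ?x +o Enull X s m" if k: "k \<in> fil_cycles (Suc s) m" and z: "z \<in> ?F k" for k z
  proof -
    obtain w' where w': "tchain X (m + 1) w'"
      and y: "comparison m k + bdry (TC X) (m + 1) w' \<in> fil (CN X) (- int (Suc s)) m"
        "comparison m k + bdry (TC X) (m + 1) w' \<in> cycles (TC X) m"
      by (rule fil_cyclesE [OF k])
    let ?y = "comparison m k + bdry (TC X) (m + 1) w'"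
    have ys: "?y \<in> fil (CN X) (- int s) m" using subsetD [OF fil_antimono [OF space_X] y(1), of s] by simp
    let ?d = "(z + ?x) + ?y"
    have "z + comparison m (a + k) \<in> bounds (TC X) m" using z by (simp add: coset_mem)
    from subgrp_add [OF subgrp_bounds [OF space_X] this
        subgrp_add [OF subgrp_bounds [OF space_X] bdry_in_bounds [OF space_X w] bdry_in_bounds [OF space_X w']]]
    have "?d \<in> bounds (TC X) m"
      by (simp only: comparison_plus ac_simps)
    moreover have "?d \<in> fil (CN X) (- int s) m"
      by (rule subgrp_add [OF subgrp_fil [OF space_X] subgrp_add [OF subgrp_fil [OF space_X] _ x] ys]) (use z in simp)
    ultimately have "?d \<in> Enull X s m" by (rule Enull_bound [OF space_X])
    from subgrp_add [OF subgrp_Enull [OF space_X] this Enull_cycle [OF space_X y(2,1)]]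
    have "z + ?x \<in> Enull X s m" by (simp only: add.assoc fun_double add_0_right)
    then show ?thesis by (simp only: coset_eq_iff [OF subgrp_Enull [OF space_X]] fun_diff)
  qed
  have x0: "?x \<in> ?F 0"
    using x bdry_in_bounds [OF space_X w] by (auto simp: elt_set_plus_def)
  have "iota X s m ((a +o tot_bounds m) +o H_fil X (Suc s) m) = (\<Union>k\<in>fil_cycles (Suc s) m. \<Union>z\<in>?F k. z +o Enull X s m)"
    unfolding iota_def e E_nulls_Enull by (simp add: H_comparison_coset)
  also have "\<dots> = ?x +o Enull X s m"
  proof (rule subset_antisym; rule subsetI)
    fix u assume "u \<in> (\<Union>k\<in>fil_cycles (Suc s) m. \<Union>z\<in>?F k. z +o Enull X s m)"
    then obtain k z where kz: "k \<in> fil_cycles (Suc s) m" "z \<in> ?F k" and u: "u \<in> z +o Enull X s m" by (elim UN_E)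
    show "u \<in> ?x +o Enull X s m" using u unfolding step [OF kz] .
  next
    fix u assume u: "u \<in> ?x +o Enull X s m"
    have 0: "0 \<in> fil_cycles (Suc s) m" by (rule subgrp_0 [OF subgrp_fil_cycles])
    show "u \<in> (\<Union>k\<in>fil_cycles (Suc s) m. \<Union>z\<in>?F k. z +o Enull X s m)"
      by (rule UN_I [OF 0], rule UN_I [OF x0], rule u)
  qed
  finally show ?thesis .
qed

lemma bil_Enull_left:
  assumes x: "x \<in> Enull X s m" and y: "y \<in> cycles (TC X) n" "y \<in> fil (CN X) (- int s') n"
  shows "bil m n x y \<in> Enull X (s + s') (m + n)"
proof (rule EnullE [OF x])
  fix u z assume xe: "x = u + z" and u: "u \<in> cycles (TC X) m" "u \<in> fil (CN X) (- int (Suc s)) m"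
    and z: "z \<in> bounds (TC X) m" "z \<in> fil (CN X) (- int s) m"
  have "bil m n u y \<in> fil (CN X) (- int (Suc (s + s'))) (m + n)"
    using bil_fil [OF u(2) y(2)] unfolding add_Suc .
  from subgrp_add [OF subgrp_Enull [OF space_X] Enull_cycle [OF space_X bil_cycles [OF u(1) y(1)] this]
      Enull_bound [OF space_X bil_bounds_left [OF z(1) y(1)] bil_fil [OF z(2) y(2)]]]
  show ?thesis unfolding xe bil_add .
qed

lemma bil_Enull_right:
  assumes x: "x \<in> cycles (TC X) m" "x \<in> fil (CN X) (- int s) m" and y: "y \<in> Enull X s' n"
  shows "bil m n x y \<in> Enull X (s + s') (m + n)"
proof (rule EnullE [OF y])
  fix u z assume ye: "y = u + z" and u: "u \<in> cycles (TC X) n" "u \<in> fil (CN X) (- int (Suc s')) n"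
    and z: "z \<in> bounds (TC X) n" "z \<in> fil (CN X) (- int s') n"
  have "bil m n x u \<in> fil (CN X) (- int (Suc (s + s'))) (m + n)"
    using bil_fil [OF x(2) u(2)] unfolding add_Suc_right .
  from subgrp_add [OF subgrp_Enull [OF space_X] Enull_cycle [OF space_X bil_cycles [OF x(1) u(1)] this]
      Enull_bound [OF space_X bil_bounds_right [OF x(1) z(1)] bil_fil [OF x(2) z(2)]]]
  show ?thesis unfolding ye bil_add .
qed

text \<open>The external product uses only the conormal elements of the two classes.  On these it agrees with
  \<open>bil\<close> up to null elements, and \<open>bil\<close> is well defined on all representatives.\<close>

lemma mu_E_coset:
  assumes x: "x \<in> cycles (TC X) m" "x \<in> fil (CN X) (- int s) m"
    and y: "y \<in> cycles (TC X) n" "y \<in> fil (CN X) (- int s') n"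
  shows "mu_E C X A v s (m + int s) s' (n + int s') (x +o Enull X s m) (y +o Enull X s' n) =
    bil m n x y +o Enull X (s + s') (m + n)"
proof -
  let ?S = "(x +o Enull X s m) \<inter> conormal (csS_chains X) m" and ?T = "(y +o Enull X s' n) \<inter> conormal (csS_chains X) n"
  have d: "m + int s + (n + int s') - int (s + s') = m + n" "m + int s - int s = m" "n + int s' - int s' = n" by simp_all
  have rep: "tproj X k z \<in> (z +o Enull X r k) \<inter> conormal (csS_chains X) k" if "tchain X k z" for k r z
    using conormal_tproj [OF space_X that] subsetD [OF nulls_subset_Enull [OF space_X] tproj_diff_nulls [OF space_X that]]
    by (simp add: coset_mem ac_simps)
  have "mu_E C X A v s (m + int s) s' (n + int s') (x +o Enull X s m) (y +o Enull X s' n) =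
      induced2 (Enull X (s + s') (m + n)) (\<lambda>x y. tmap (m + n) bin (ext_prod X m n x y)) ?S ?T"
    unfolding mu_E_def E_ext_def E_nulls_Enull d tmap_def [symmetric]
    using subgrp_0 [OF subgrp_Enull [OF space_XX]] tmap_Enull [OF space_X space_XX binary_map]
    by (intro induced_induced2 [where f = "tmap (m + n) bin"] subgrp_Enull [OF space_X] tmap_add)
  also have "\<dots> = bil m n x y +o Enull X (s + s') (m + n)"
  proof (rule induced2_coset [OF subgrp_Enull [OF space_X]])
    show "tproj X m x \<in> ?S" "tproj X n y \<in> ?T" using rep tchain_fil [OF space_X] x(2) y(2) by blast+
    fix x' y' assume x': "x' \<in> ?S" and y': "y' \<in> ?T"
    obtain u where u: "u \<in> Enull X s m" "x' = x + u" using x' by (auto simp: elt_set_plus_def)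
    obtain z where z: "z \<in> Enull X s' n" "y' = y + z" using y' by (auto simp: elt_set_plus_def)
    have cx: "x' \<in> cycles (TC X) m" "x' \<in> fil (CN X) (- int s) m"
      unfolding u(2) using subgrp_add [OF subgrp_cycles [OF space_X] x(1)] subgrp_add [OF subgrp_fil [OF space_X] x(2)]
        Enull_subset [OF space_X u(1)] by blast+
    have cy: "y' \<in> cycles (TC X) n" "y' \<in> fil (CN X) (- int s') n"
      unfolding z(2) using subgrp_add [OF subgrp_cycles [OF space_X] y(1)] subgrp_add [OF subgrp_fil [OF space_X] y(2)]
        Enull_subset [OF space_X z(1)] by blast+
    have tx: "tchain X m x'" and ty: "tchain X n y'" using tchain_fil [OF space_X] cx cy by blast+
    have "tmap (m + n) bin (ext_prod X m n x' y') + bil m n x' y' \<in> nulls (TC X) (m + n)"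
      unfolding ext_prod_eprod [OF space_X tx ty]
      by (rule bil_conormal [OF tx tdgn_conormal [OF space_X tx] ty tdgn_conormal [OF space_X ty]]) (use x' y' in blast)+
    note 1 = subsetD [OF nulls_subset_Enull [OF space_X] this]
    have "bil m n x' y' + bil m n x y = bil m n u y' + bil m n x z"
      by (simp add: u(2) z(2) bil_add ac_simps)
    then have "bil m n x' y' + bil m n x y \<in> Enull X (s + s') (m + n)"
      using subgrp_add [OF subgrp_Enull [OF space_X] bil_Enull_left [OF u(1) cy] bil_Enull_right [OF x z(1)]] by (simp only:)
    from subgrp_add [OF subgrp_Enull [OF space_X] 1 this]
    show "tmap (m + n) bin (ext_prod X m n x' y') - bil m n x y \<in> Enull X (s + s') (m + n)"
      by (simp add: add.assoc)
  qed
  finally show ?thesis .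
qed

lemma mu_H_fil:
  assumes "g \<in> H_fil X s m" "h \<in> H_fil X s' n"
  shows "mu_H C X A v m n g h \<in> H_fil X (s + s') (m + n)"
  using assms by (auto elim!: H_filE simp: mu_H_coset fil_cycles_cycles intro!: H_filI tot_prod_fil_cycles)

lemma mu_H_gr:
  assumes g: "g \<in> H_fil X s m" "g' \<in> H_fil X s m" "g +o H_fil X (Suc s) m = g' +o H_fil X (Suc s) m"
    and h: "h \<in> H_fil X s' n" "h' \<in> H_fil X s' n" "h +o H_fil X (Suc s') n = h' +o H_fil X (Suc s') n"
  shows "mu_H C X A v m n g h +o H_fil X (Suc (s + s')) (m + n) = mu_H C X A v m n g' h' +o H_fil X (Suc (s + s')) (m + n)"
proof -
  obtain a a' where a: "a \<in> fil_cycles s m" "g = a +o tot_bounds m" "a' \<in> fil_cycles s m" "g' = a' +o tot_bounds m"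
    using g by (auto elim!: H_filE)
  obtain b b' where b: "b \<in> fil_cycles s' n" "h = b +o tot_bounds n" "b' \<in> fil_cycles s' n" "h' = b' +o tot_bounds n"
    using h by (auto elim!: H_filE)
  have "a - a' \<in> fil_cycles (Suc s) m" "b - b' \<in> fil_cycles (Suc s') n"
    using g(3) h(3) unfolding a b H_fil_coset_eq_iff .
  then have "mu_H C X A v m n g h +o H_fil X (Suc (s + s')) (m + n) =
      (tot_prod m n a' b' +o tot_bounds (m + n)) +o H_fil X (Suc (s + s')) (m + n)"
    unfolding a b by (rule mu_H_coset_fil [OF a(3) b(3)])
  then show ?thesis
    using mu_H_coset [OF fil_cycles_cycles [OF a(3)] fil_cycles_cycles [OF b(3)]] by (simp only: a b)
qed

lemma iota_mu_gr:
  assumes \<xi>: "\<xi> \<in> H_gr X s m" and \<eta>: "\<eta> \<in> H_gr X s' n"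
  shows "mu_gr C X A v s m s' n \<xi> \<eta> \<in> H_gr X (s + s') (m + n)"
    and "iota X (s + s') (m + n) (mu_gr C X A v s m s' n \<xi> \<eta>) \<in> E_infinity (csS_chains X) (s + s') (m + n + int (s + s'))"
    and "iota X (s + s') (m + n) (mu_gr C X A v s m s' n \<xi> \<eta>) =
      mu_E C X A v s (m + int s) s' (n + int s') (iota X s m \<xi>) (iota X s' n \<eta>)"
proof -
  obtain a where fa: "a \<in> fil_cycles s m" and \<xi>': "\<xi> = (a +o tot_bounds m) +o H_fil X (Suc s) m" by (rule H_grE [OF \<xi>])
  obtain b where fb: "b \<in> fil_cycles s' n" and \<eta>': "\<eta> = (b +o tot_bounds n) +o H_fil X (Suc s') n" by (rule H_grE [OF \<eta>])
  note e = mu_gr_coset [OF fa fb, folded \<xi>' \<eta>']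
  note fab = tot_prod_fil_cycles [OF fa fb]
  show "mu_gr C X A v s m s' n \<xi> \<eta> \<in> H_gr X (s + s') (m + n)"
    unfolding e H_gr_def quot_def by (intro imageI H_filI fab)
  obtain w where a: "a \<in> cycles (S_chains (Tot X)) m" "tchain X (m + 1) w"
      "comparison m a + bdry (TC X) (m + 1) w \<in> fil (CN X) (- int s) m"
    and ca: "comparison m a + bdry (TC X) (m + 1) w \<in> cycles (TC X) m" by (rule fil_cyclesE [OF fa])
  obtain w' where b: "b \<in> cycles (S_chains (Tot X)) n" "tchain X (n + 1) w'"
      "comparison n b + bdry (TC X) (n + 1) w' \<in> fil (CN X) (- int s') n"
    and cb: "comparison n b + bdry (TC X) (n + 1) w' \<in> cycles (TC X) n" by (rule fil_cyclesE [OF fb])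
  obtain w'' where w'': "tchain X (m + n + 1) w''"
    and f: "comparison (m + n) (tot_prod m n a b) + bdry (TC X) (m + n + 1) w'' \<in> fil (CN X) (- int (s + s')) (m + n)"
    and \<nu>: "comparison (m + n) (tot_prod m n a b) + bdry (TC X) (m + n + 1) w'' + bil m n (comparison m a + bdry (TC X) (m + 1) w) (comparison n b + bdry (TC X) (n + 1) w') \<in> nulls (TC X) (m + n)"
    by (rule tot_prod_fil [OF a b])
  let ?z = "comparison (m + n) (tot_prod m n a b) + bdry (TC X) (m + n + 1) w''"
  note ie = iota_coset [OF tot_prod_cycles [OF a(1) b(1)] w'' f, folded e]
  have "?z \<in> cycles (TC X) (m + n)"
    using subgrp_add [OF subgrp_cycles [OF space_X] comparison_cycles [OF tot_prod_cycles [OF a(1) b(1)]]]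
      subsetD [OF bounds_subset_cycles [OF space_X] bdry_in_bounds [OF space_X w'']] by blast
  moreover have "m + n + int (s + s') - int (s + s') = m + n" by simp
  ultimately show "iota X (s + s') (m + n) (mu_gr C X A v s m s' n \<xi> \<eta>) \<in> E_infinity (csS_chains X) (s + s') (m + n + int (s + s'))"
    unfolding ie E_infinity_def quot_def E_cycles_def E_nulls_Enull Let_def using f by (simp only:) blast
  have "?z +o Enull X (s + s') (m + n) =
      bil m n (comparison m a + bdry (TC X) (m + 1) w) (comparison n b + bdry (TC X) (n + 1) w') +o Enull X (s + s') (m + n)"
    unfolding coset_eq_iff [OF subgrp_Enull [OF space_X]] using \<nu> nulls_subset_Enull [OF space_X] by auto
  then show "iota X (s + s') (m + n) (mu_gr C X A v s m s' n \<xi> \<eta>) =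
      mu_E C X A v s (m + int s) s' (n + int s') (iota X s m \<xi>) (iota X s' n \<eta>)"
    unfolding ie by (simp only: \<xi>' \<eta>' iota_coset [OF a] iota_coset [OF b] mu_E_coset [OF ca a(3) cb b(3)])
qed

end

theorem corollary4p9:
  fixes \<C> :: "'o operad"
    and X :: "'a csset"
    and A :: "nat \<Rightarrow> nat \<Rightarrow> 'o \<Rightarrow> 'a list \<Rightarrow> 'a"
    and v :: 'o
  assumes "E_infinity_operad \<C>"
    and "cosimplicial_operad_space \<C> X A"
    and "v \<in> smp (osp \<C> 2) 0"
  shows
    "\<forall>s s' :: nat. \<forall>m n :: int.
       (\<forall>g\<in>H_fil X s m. \<forall>h\<in>H_fil X s' n.
          mu_H \<C> X A v m n g h \<in> H_fil X (s + s') (m + n)) \<and>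
       (\<forall>g\<in>H_fil X s m. \<forall>g'\<in>H_fil X s m. \<forall>h\<in>H_fil X s' n. \<forall>h'\<in>H_fil X s' n.
          g +o H_fil X (Suc s) m = g' +o H_fil X (Suc s) m \<and>
          h +o H_fil X (Suc s') n = h' +o H_fil X (Suc s') n \<longrightarrow>
          mu_H \<C> X A v m n g h +o H_fil X (Suc (s + s')) (m + n) =
          mu_H \<C> X A v m n g' h' +o H_fil X (Suc (s + s')) (m + n)) \<and>
       (\<forall>\<xi>\<in>H_gr X s m. \<forall>\<eta>\<in>H_gr X s' n.
          mu_gr \<C> X A v s m s' n \<xi> \<eta> \<in> H_gr X (s + s') (m + n) \<and>
          iota X (s + s') (m + n) (mu_gr \<C> X A v s m s' n \<xi> \<eta>)
            \<in> E_infinity (csS_chains X) (s + s') (m + n + int (s + s')) \<and>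
          iota X (s + s') (m + n) (mu_gr \<C> X A v s m s' n \<xi> \<eta>) =
          mu_E \<C> X A v s (m + int s) s' (n + int s') (iota X s m \<xi>) (iota X s' n \<eta>))"
proof -
  interpret cosimplicial_algebra \<C> X A v
    using assms by unfold_locales (simp_all add: E_infinity_operad_def)
  show ?thesis
    by (intro allI conjI ballI impI; (elim conjE)?)
       (fact mu_H_fil, rule mu_H_gr, assumption+, (fact iota_mu_gr)+)
qed

end
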